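(* Let $\mathcal{O}$ be the ring of integers of a number field and let $L$ be a solvable $\mathcal{O}$-Lie algebra of dimension at most $4$. Then $k^{\leq}(L,\mathbb{F}_q)=k^{\triangleleft}(L,\mathbb{F}_q)$.
   Context: An $\mathcal{O}$-Lie algebra is always assumed to be free and finitely generated as an $\mathcal{O}$-module; its dimension is its rank. For a nonzero prime ideal $\mathfrak{p}$ of $\mathcal{O}$ put $q=|\mathcal{O}/\mathfrak{p}|$ and $L(\mathcal{O}/\mathfrak{p})=L\otimes_{\mathcal{O}}\mathcal{O}/\mathfrak{p}$, a finite-dimensional Lie algebra over $\mathbb{F}_q$. For $*\in\{\leq,\triangleleft\}$ let $\zeta^{*}_{L(\mathcal{O}/\mathfrak{p})}(s)=\sum_{i\ge 0}a^{*}_{q^i}(L(\mathcal{O}/\mathfrak{p}))\,q^{-is}$, where $a^{\leq}_{q^i}$ (respectively $a^{\triangleleft}_{q^i}$) is the number of Lie subalgebras (respectively ideals) of codimension $i$ over $\mathbb{F}_q$. The $\mathbb{F}_q$-period $k^{*}(L,\mathbb{F}_q)$ is the smallest $k\in\mathbb{N}=\{1,2,\dots\}$ for which there exist polynomials $P_1,\dots,P_k\in\mathbb{Q}[X,Y]$ such that, for all but finitely many nonzero prime ideals $\mathfrak{p}$ of $\mathcal{O}$, one has $\zeta^{*}_{L(\mathcal{O}/\mathfrak{p})}(s)=P_i(q,q^{-s})$ for some $i\in\{1,\dots,k\}$, where $q=|\mathcal{O}/\mathfrak{p}|$ (and $k^{*}(L,\mathbb{F}_q)=\infty$ if no such $k$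 exists). The symbol $\mathbb{F}_q$ in $k^{*}(L,\mathbb{F}_q)$ is purely notational: the period depends only on $L$ and $*$. *)

theory Defs
  imports
    "HOL-Algebra.Algebra"
    "HOL-Algebra.Algebraic_Closure_Type"
    "HOL-Library.Extended_Nat"
    "HOL-Analysis.Complex_Transcendental"
    "Jordan_Normal_Form.Missing_VectorSpace"
begin

section \<open>Number fields and rings of integers\<close>

text \<open>
  A number field is a subfield of some field of characteristic 0 (for instance of the complex
  numbers, or that field itself) that has finite degree over the rationals.
\<close>

definition number_field :: "'k::field_char_0 set \<Rightarrow> bool" where
  "number_field K \<longleftrightarrow>
     subfield K ring_of_type_algebra \<and> ring.finite_dimension ring_of_type_algebra \<rat> K"

definition ring_of_integers :: "'k::field_char_0 set \<Rightarrow> 'k ring" where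
  "ring_of_integers K = ring_of_type_algebra \<lparr>carrier := {x \<in> K. algebraic_int x}\<rparr>"

section \<open>Lie algebras over a commutative ring\<close>

text \<open>
  The fields for multiplication and unit that the record inherits from the type of modules play no
  role, as for modules themselves.
\<close>

record ('a, 'b) lie_alg = "('a, 'b) module" +
  bracket :: "'b \<Rightarrow> 'b \<Rightarrow> 'b" (\<open>\<lbrakk>_,_\<rbrakk>\<index>\<close>)

locale lie_algebra = module R L
  for R (structure) and L :: "('a, 'b, 'm) lie_alg_scheme" (structure) +
  assumes bracket_closed [simp, intro]:
      "x \<in> carrier L \<Longrightarrow> y \<in> carrier L \<Longrightarrow> \<lbrakk>x,y\<rbrakk>\<^bsub>L\<^esub> \<in> carrier L"
    and bracket_add_left:
      "x \<in> carrier L \<Longrightarrow> y \<in> carrier L \<Longrightarrow> z \<in> carrier L \<Longrightarrow>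
        \<lbrakk>x \<oplus>\<^bsub>L\<^esub> y,z\<rbrakk>\<^bsub>L\<^esub> = \<lbrakk>x,z\<rbrakk>\<^bsub>L\<^esub> \<oplus>\<^bsub>L\<^esub> \<lbrakk>y,z\<rbrakk>\<^bsub>L\<^esub>"
    and bracket_add_right:
      "x \<in> carrier L \<Longrightarrow> y \<in> carrier L \<Longrightarrow> z \<in> carrier L \<Longrightarrow>
        \<lbrakk>x,y \<oplus>\<^bsub>L\<^esub> z\<rbrakk>\<^bsub>L\<^esub> = \<lbrakk>x,y\<rbrakk>\<^bsub>L\<^esub> \<oplus>\<^bsub>L\<^esub> \<lbrakk>x,z\<rbrakk>\<^bsub>L\<^esub>"
    and bracket_smult_left:
      "a \<in> carrier R \<Longrightarrow> x \<in> carrier L \<Longrightarrow> y \<in> carrier L \<Longrightarrow>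
        \<lbrakk>a \<odot>\<^bsub>L\<^esub> x,y\<rbrakk>\<^bsub>L\<^esub> = a \<odot>\<^bsub>L\<^esub> \<lbrakk>x,y\<rbrakk>\<^bsub>L\<^esub>"
    and bracket_smult_right:
      "a \<in> carrier R \<Longrightarrow> x \<in> carrier L \<Longrightarrow> y \<in> carrier L \<Longrightarrow>
        \<lbrakk>x,a \<odot>\<^bsub>L\<^esub> y\<rbrakk>\<^bsub>L\<^esub> = a \<odot>\<^bsub>L\<^esub> \<lbrakk>x,y\<rbrakk>\<^bsub>L\<^esub>"
    and bracket_self: "x \<in> carrier L \<Longrightarrow> \<lbrakk>x,x\<rbrakk>\<^bsub>L\<^esub> = \<zero>\<^bsub>L\<^esub>"
    and jacobi:
      "x \<in> carrier L \<Longrightarrow> y \<in> carrier L \<Longrightarrow> z \<in> carrier L \<Longrightarrow>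
        \<lbrakk>x,\<lbrakk>y,z\<rbrakk>\<^bsub>L\<^esub>\<rbrakk>\<^bsub>L\<^esub> \<oplus>\<^bsub>L\<^esub> \<lbrakk>y,\<lbrakk>z,x\<rbrakk>\<^bsub>L\<^esub>\<rbrakk>\<^bsub>L\<^esub> \<oplus>\<^bsub>L\<^esub> \<lbrakk>z,\<lbrakk>x,y\<rbrakk>\<^bsub>L\<^esub>\<rbrakk>\<^bsub>L\<^esub> = \<zero>\<^bsub>L\<^esub>"

definition free_of_rank :: "('a, 'r) ring_scheme \<Rightarrow> ('a, 'b, 'm) module_scheme \<Rightarrow> nat \<Rightarrow> bool" where
  "free_of_rank R M n \<longleftrightarrow>
     (\<exists>B \<subseteq> carrier M. finite B \<and> card B = n \<and>
        module.lin_indpt R M B \<and> module.span R M B = carrier M)"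

definition lie_subalgebra :: "('a, 'r) ring_scheme \<Rightarrow> ('a, 'b, 'm) lie_alg_scheme \<Rightarrow> 'b set \<Rightarrow> bool" where
  "lie_subalgebra R L H \<longleftrightarrow>
     LinearCombinations.submodule R H L \<and> (\<forall>x\<in>H. \<forall>y\<in>H. \<lbrakk>x,y\<rbrakk>\<^bsub>L\<^esub> \<in> H)"

definition lie_ideal :: "('a, 'r) ring_scheme \<Rightarrow> ('a, 'b, 'm) lie_alg_scheme \<Rightarrow> 'b set \<Rightarrow> bool" where
  "lie_ideal R L H \<longleftrightarrow>
     LinearCombinations.submodule R H L \<and> (\<forall>x\<in>carrier L. \<forall>y\<in>H. \<lbrakk>x,y\<rbrakk>\<^bsub>L\<^esub> \<in> H)"

primrec derived_series ::
    "('a, 'r) ring_scheme \<Rightarrow> ('a, 'b, 'm) lie_alg_scheme \<Rightarrow> nat \<Rightarrow> 'b set" where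
  "derived_series R L 0 = carrier L"
| "derived_series R L (Suc n) =
     module.span R L {\<lbrakk>x,y\<rbrakk>\<^bsub>L\<^esub> | x y. x \<in> derived_series R L n \<and> y \<in> derived_series R L n}"

definition solvable_lie :: "('a, 'r) ring_scheme \<Rightarrow> ('a, 'b, 'm) lie_alg_scheme \<Rightarrow> bool" where
  "solvable_lie R L \<longleftrightarrow> (\<exists>n. derived_series R L n = {\<zero>\<^bsub>L\<^esub>})"

section \<open>Reduction modulo an ideal\<close>

definition ideal_smult ::
    "('a, 'r) ring_scheme \<Rightarrow> ('a, 'b, 'm) module_scheme \<Rightarrow> 'a set \<Rightarrow> 'b set" where
  "ideal_smult R L I = module.span R L {a \<odot>\<^bsub>L\<^esub> x | a x. a \<in> I \<and> x \<in> carrier L}"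

text \<open>
  The base change of \<open>L\<close> along \<open>R \<rightarrow> R/I\<close>, that is, the tensor product of \<open>L\<close> with \<open>R/I\<close> over \<open>R\<close>,
  is realised as the Lie algebra \<open>L/IL\<close> over \<open>R/I\<close>. The lemmas below verify that this is a Lie
  algebra with the evident operations and that it has the universal property of the tensor product.
\<close>

definition reduction ::
    "('a, 'r) ring_scheme \<Rightarrow> ('a, 'b, 'm) lie_alg_scheme \<Rightarrow> 'a set \<Rightarrow> ('a set, 'b set) lie_alg" where
  "reduction R L I =
     \<lparr>carrier = a_rcosets\<^bsub>L\<^esub> (ideal_smult R L I),
      monoid.mult = undefined,
      monoid.one = undefined,
      ring.zero = ideal_smult R L I,
      ring.add = set_add L,
      module.smult = (\<lambda>A U. \<Union>a\<in>A. \<Union>x\<in>U. ideal_smult R L I +>\<^bsub>L\<^esub> (a \<odot>\<^bsub>L\<^esub> x)),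
      bracket = (\<lambda>U V. \<Union>x\<in>U. \<Union>y\<in>V. ideal_smult R L I +>\<^bsub>L\<^esub> \<lbrakk>x,y\<rbrakk>\<^bsub>L\<^esub>)\<rparr>"

context lie_algebra
begin

lemma bracket_zero_left [simp]: "x \<in> carrier L \<Longrightarrow> \<lbrakk>\<zero>\<^bsub>L\<^esub>,x\<rbrakk>\<^bsub>L\<^esub> = \<zero>\<^bsub>L\<^esub>"
  using bracket_smult_left[of "\<zero>\<^bsub>R\<^esub>" "\<zero>\<^bsub>L\<^esub>" x] by simp

lemma bracket_zero_right [simp]: "x \<in> carrier L \<Longrightarrow> \<lbrakk>x,\<zero>\<^bsub>L\<^esub>\<rbrakk>\<^bsub>L\<^esub> = \<zero>\<^bsub>L\<^esub>"
  using bracket_smult_right[of "\<zero>\<^bsub>R\<^esub>" x "\<zero>\<^bsub>L\<^esub>"] by simp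

end

locale lie_algebra_ideal = lie_algebra R L + ideal I R
  for R (structure) and L :: "('a, 'b, 'm) lie_alg_scheme" (structure) and I
begin

abbreviation N where "N \<equiv> ideal_smult R L I"

abbreviation cls where "cls x \<equiv> N +>\<^bsub>L\<^esub> x"

lemma gens_carrier: "{a \<odot>\<^bsub>L\<^esub> x | a x. a \<in> I \<and> x \<in> carrier L} \<subseteq> carrier L"
  using a_subset by blast

lemma N_submodule: "LinearCombinations.submodule R N L"
  unfolding ideal_smult_def by (rule span_is_submodule[OF gens_carrier])

lemma N_subset: "N \<subseteq> carrier L"
  using N_submodule by (rule LinearCombinations.submodule.subset)

lemma N_closed [simp]: "x \<in> N \<Longrightarrow> x \<in> carrier L"
  using N_subset by blast

lemma N_gen: "a \<in> I \<Longrightarrow> x \<in> carrier L \<Longrightarrow> a \<odot>\<^bsub>L\<^esub> x \<in> N"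
  unfolding ideal_smult_def using in_own_span[OF gens_carrier] by blast

lemma N_smult: "a \<in> carrier R \<Longrightarrow> x \<in> N \<Longrightarrow> a \<odot>\<^bsub>L\<^esub> x \<in> N"
  using N_submodule by (rule LinearCombinations.submodule.smult_closed)

lemma N_add: "x \<in> N \<Longrightarrow> y \<in> N \<Longrightarrow> x \<oplus>\<^bsub>L\<^esub> y \<in> N"
  using N_submodule by (rule LinearCombinations.submodule.m_closed)

lemma N_zero: "\<zero>\<^bsub>L\<^esub> \<in> N"
  using N_submodule by (rule LinearCombinations.submodule.zero_closed)

lemma N_minus: "x \<in> N \<Longrightarrow> \<ominus>\<^bsub>L\<^esub> x \<in> N"
  using N_smult[of "\<ominus>\<^bsub>R\<^esub> \<one>\<^bsub>R\<^esub>" x] smult_l_minus[of "\<one>\<^bsub>R\<^esub>" x] by simp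

lemma N_induct:
  assumes "x \<in> N" and "P \<zero>\<^bsub>L\<^esub>"
    and "\<And>y z. y \<in> carrier L \<Longrightarrow> z \<in> carrier L \<Longrightarrow> P y \<Longrightarrow> P z \<Longrightarrow> P (y \<oplus>\<^bsub>L\<^esub> z)"
    and "\<And>a y. a \<in> carrier R \<Longrightarrow> y \<in> carrier L \<Longrightarrow> P y \<Longrightarrow> P (a \<odot>\<^bsub>L\<^esub> y)"
    and "\<And>a y. a \<in> I \<Longrightarrow> y \<in> carrier L \<Longrightarrow> P (a \<odot>\<^bsub>L\<^esub> y)"
  shows "P x"
proof -
  have "LinearCombinations.submodule R {x \<in> carrier L. P x} L"
    by (rule submodule.intro) (use assms(2-4) in \<open>auto intro: module_axioms\<close>)
  moreover have "{a \<odot>\<^bsub>L\<^esub> x | a x. a \<in> I \<and> x \<in> carrier L} \<subseteq> {x \<in> carrier L. P x}"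
    using gens_carrier assms(5) by blast
  ultimately have "N \<subseteq> {x \<in> carrier L. P x}"
    unfolding ideal_smult_def by (intro span_is_subset)
  with assms(1) show ?thesis by blast
qed

lemma N_bracket:
  assumes "x \<in> N" "y \<in> carrier L"
  shows "\<lbrakk>x,y\<rbrakk>\<^bsub>L\<^esub> \<in> N" "\<lbrakk>y,x\<rbrakk>\<^bsub>L\<^esub> \<in> N"
proof -
  show "\<lbrakk>x,y\<rbrakk>\<^bsub>L\<^esub> \<in> N" using assms(1)
    by (rule N_induct)
       (use assms(2) a_subset in
        \<open>auto simp: bracket_add_left bracket_smult_left N_zero N_add N_smult N_gen\<close>)
  show "\<lbrakk>y,x\<rbrakk>\<^bsub>L\<^esub> \<in> N" using assms(1)
    by (rule N_induct)
       (use assms(2) a_subset in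
        \<open>auto simp: bracket_add_right bracket_smult_right N_zero N_add N_smult N_gen\<close>)
qed

sublocale Nsub: abelian_subgroup N L
proof (rule abelian_subgroupI3)
  show "additive_subgroup N L"
    by (rule additive_subgroup.intro, rule M.add.subgroupI)
       (use N_zero in \<open>auto intro: N_add simp: a_inv_def[symmetric] N_minus\<close>)
qed (rule M.abelian_group_axioms)

lemma cls_eq: "x \<in> carrier L \<Longrightarrow> y \<in> carrier L \<Longrightarrow> cls x = cls y \<longleftrightarrow> x \<ominus>\<^bsub>L\<^esub> y \<in> N"
proof -
  assume x: "x \<in> carrier L" and y: "y \<in> carrier L"
  have "cls x = cls y \<longleftrightarrow> x \<in> cls y"
    using x y Nsub.a_repr_independence'[of x y] Nsub.a_rcos_self[of x] by auto
  also have "\<dots> \<longleftrightarrow> x \<ominus>\<^bsub>L\<^esub> y \<in> N"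
    using Nsub.a_rcos_module[OF y x] by (simp add: a_minus_def)
  finally show ?thesis .
qed

lemma cls_in [simp]: "x \<in> carrier L \<Longrightarrow> cls x \<in> a_rcosets\<^bsub>L\<^esub> N"
  by (rule M.a_rcosetsI[OF N_subset])

lemma cls_cases:
  assumes "U \<in> a_rcosets\<^bsub>L\<^esub> N"
  obtains x where "x \<in> carrier L" "U = cls x"
  using assms by (auto simp: A_RCOSETS_def')

lemma cls_mem: "x \<in> carrier L \<Longrightarrow> y \<in> cls x \<Longrightarrow> y \<in> carrier L \<and> cls y = cls x"
  by (metis Nsub.a_elemrcos_carrier Nsub.a_repr_independence')

lemma cls_memD: "x \<in> carrier L \<Longrightarrow> y \<in> cls x \<Longrightarrow> y \<ominus>\<^bsub>L\<^esub> x \<in> N"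
  by (metis cls_eq cls_mem)

abbreviation Q where "Q \<equiv> R Quot I"

lemma Q_cases:
  assumes "A \<in> carrier Q"
  obtains a where "a \<in> carrier R" "A = I +>\<^bsub>R\<^esub> a"
  using assms by (auto simp: FactRing_def A_RCOSETS_def')

lemma reduction_carrier: "carrier (reduction R L I) = a_rcosets\<^bsub>L\<^esub> N"
  by (simp add: reduction_def)

lemma reduction_cls: "x \<in> carrier L \<Longrightarrow> cls x \<in> carrier (reduction R L I)"
  by (simp add: reduction_carrier)

lemma reduction_cases:
  assumes "U \<in> carrier (reduction R L I)"
  obtains x where "x \<in> carrier L" "U = cls x"
  using assms by (auto simp: reduction_carrier elim: cls_cases)

lemma reduction_zero: "\<zero>\<^bsub>reduction R L I\<^esub> = cls \<zero>\<^bsub>L\<^esub>"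
  using Nsub.a_rcos_const[OF N_zero] by (simp add: reduction_def)

lemma reduction_add:
  assumes "x \<in> carrier L" "y \<in> carrier L"
  shows "cls x \<oplus>\<^bsub>reduction R L I\<^esub> cls y = cls (x \<oplus>\<^bsub>L\<^esub> y)"
  using Nsub.a_rcos_sum[OF assms] by (simp add: reduction_def)

lemma reduction_smult:
  assumes a: "a \<in> carrier R" and x: "x \<in> carrier L"
  shows "(I +>\<^bsub>R\<^esub> a) \<odot>\<^bsub>reduction R L I\<^esub> cls x = cls (a \<odot>\<^bsub>L\<^esub> x)"
proof -
  have *: "cls (b \<odot>\<^bsub>L\<^esub> y) = cls (a \<odot>\<^bsub>L\<^esub> x)" if b: "b \<in> I +>\<^bsub>R\<^esub> a" and y: "y \<in> cls x" for b y
  proof -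
    have [simp]: "b \<in> carrier R" "y \<in> carrier L"
      using a_elemrcos_carrier[OF a b] cls_mem[OF x y] by simp_all
    have 1: "b \<ominus>\<^bsub>R\<^esub> a \<in> I" using b a a_rcos_module_imp[OF a b] by (simp add: a_minus_def)
    have 2: "y \<ominus>\<^bsub>L\<^esub> x \<in> N" using cls_memD[OF x y] .
    have b': "b = (b \<ominus>\<^bsub>R\<^esub> a) \<oplus>\<^bsub>R\<^esub> a" and y': "y = (y \<ominus>\<^bsub>L\<^esub> x) \<oplus>\<^bsub>L\<^esub> x"
      using a x by (simp_all add: a_minus_def M.a_assoc M.l_neg R.a_assoc R.l_neg)
    have "b \<odot>\<^bsub>L\<^esub> y = b \<odot>\<^bsub>L\<^esub> (y \<ominus>\<^bsub>L\<^esub> x) \<oplus>\<^bsub>L\<^esub> b \<odot>\<^bsub>L\<^esub> x"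
      using x by (subst y', subst smult_r_distr) auto
    also have "b \<odot>\<^bsub>L\<^esub> x = (b \<ominus>\<^bsub>R\<^esub> a) \<odot>\<^bsub>L\<^esub> x \<oplus>\<^bsub>L\<^esub> a \<odot>\<^bsub>L\<^esub> x"
      using a x by (subst b', subst smult_l_distr) auto
    finally have "b \<odot>\<^bsub>L\<^esub> y \<ominus>\<^bsub>L\<^esub> a \<odot>\<^bsub>L\<^esub> x =
        b \<odot>\<^bsub>L\<^esub> (y \<ominus>\<^bsub>L\<^esub> x) \<oplus>\<^bsub>L\<^esub> (b \<ominus>\<^bsub>R\<^esub> a) \<odot>\<^bsub>L\<^esub> x"
      using a x by (simp add: a_minus_def M.a_assoc M.r_neg)
    also have "\<dots> \<in> N" using 1 2 x by (intro N_add N_smult N_gen) auto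
    finally show ?thesis using a x by (subst cls_eq) auto
  qed
  have ne: "a \<in> I +>\<^bsub>R\<^esub> a" "x \<in> cls x" using a x a_rcos_self Nsub.a_rcos_self by auto
  have "(I +>\<^bsub>R\<^esub> a) \<odot>\<^bsub>reduction R L I\<^esub> cls x = (\<Union>b\<in>I +>\<^bsub>R\<^esub> a. \<Union>y\<in>cls x. cls (b \<odot>\<^bsub>L\<^esub> y))"
    by (simp add: reduction_def)
  also have "\<dots> = (\<Union>b\<in>I +>\<^bsub>R\<^esub> a. \<Union>y\<in>cls x. cls (a \<odot>\<^bsub>L\<^esub> x))"
    by (intro SUP_cong refl *)
  also have "\<dots> = cls (a \<odot>\<^bsub>L\<^esub> x)" using ne by auto
  finally show ?thesis .
qed

lemma reduction_bracket:
  assumes x: "x \<in> carrier L" and y: "y \<in> carrier L"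
  shows "\<lbrakk>cls x,cls y\<rbrakk>\<^bsub>reduction R L I\<^esub> = cls \<lbrakk>x,y\<rbrakk>\<^bsub>L\<^esub>"
proof -
  have *: "cls \<lbrakk>u,v\<rbrakk>\<^bsub>L\<^esub> = cls \<lbrakk>x,y\<rbrakk>\<^bsub>L\<^esub>" if u: "u \<in> cls x" and v: "v \<in> cls y" for u v
  proof -
    have [simp]: "u \<in> carrier L" "v \<in> carrier L"
      using cls_mem[OF x u] cls_mem[OF y v] by simp_all
    have 1: "u \<ominus>\<^bsub>L\<^esub> x \<in> N" "v \<ominus>\<^bsub>L\<^esub> y \<in> N"
      using cls_memD[OF x u] cls_memD[OF y v] .
    have u': "u = (u \<ominus>\<^bsub>L\<^esub> x) \<oplus>\<^bsub>L\<^esub> x" and v': "v = (v \<ominus>\<^bsub>L\<^esub> y) \<oplus>\<^bsub>L\<^esub> y"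
      using x y by (simp_all add: a_minus_def M.a_assoc M.l_neg)
    have "\<lbrakk>u,v\<rbrakk>\<^bsub>L\<^esub> = \<lbrakk>u \<ominus>\<^bsub>L\<^esub> x,v\<rbrakk>\<^bsub>L\<^esub> \<oplus>\<^bsub>L\<^esub> \<lbrakk>x,v\<rbrakk>\<^bsub>L\<^esub>"
      using x by (subst u', subst bracket_add_left) auto
    also have "\<lbrakk>x,v\<rbrakk>\<^bsub>L\<^esub> = \<lbrakk>x,v \<ominus>\<^bsub>L\<^esub> y\<rbrakk>\<^bsub>L\<^esub> \<oplus>\<^bsub>L\<^esub> \<lbrakk>x,y\<rbrakk>\<^bsub>L\<^esub>"
      using x y by (subst v', subst bracket_add_right) auto
    finally have "\<lbrakk>u,v\<rbrakk>\<^bsub>L\<^esub> \<ominus>\<^bsub>L\<^esub> \<lbrakk>x,y\<rbrakk>\<^bsub>L\<^esub> = \<lbrakk>u \<ominus>\<^bsub>L\<^esub> x,v\<rbrakk>\<^bsub>L\<^esub> \<oplus>\<^bsub>L\<^esub> \<lbrakk>x,v \<ominus>\<^bsub>L\<^esub> y\<rbrakk>\<^bsub>L\<^esub>"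
      using x y by (simp add: a_minus_def M.a_assoc M.r_neg)
    also have "\<dots> \<in> N" using 1 x by (intro N_add N_bracket) auto
    finally show ?thesis using x y by (subst cls_eq) auto
  qed
  have ne: "x \<in> cls x" "y \<in> cls y" using x y Nsub.a_rcos_self by auto
  have "\<lbrakk>cls x,cls y\<rbrakk>\<^bsub>reduction R L I\<^esub> = (\<Union>u\<in>cls x. \<Union>v\<in>cls y. cls \<lbrakk>u,v\<rbrakk>\<^bsub>L\<^esub>)"
    by (simp add: reduction_def)
  also have "\<dots> = (\<Union>u\<in>cls x. \<Union>v\<in>cls y. cls \<lbrakk>x,y\<rbrakk>\<^bsub>L\<^esub>)"
    by (intro SUP_cong refl *)
  also have "\<dots> = cls \<lbrakk>x,y\<rbrakk>\<^bsub>L\<^esub>" using ne by auto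
  finally show ?thesis .
qed

lemma Q_add: "a \<in> carrier R \<Longrightarrow> b \<in> carrier R \<Longrightarrow> (I +>\<^bsub>R\<^esub> a) \<oplus>\<^bsub>Q\<^esub> (I +>\<^bsub>R\<^esub> b) = I +>\<^bsub>R\<^esub> (a \<oplus>\<^bsub>R\<^esub> b)"
  using a_rcos_sum by (simp add: FactRing_def)

lemma Q_mult: "a \<in> carrier R \<Longrightarrow> b \<in> carrier R \<Longrightarrow> (I +>\<^bsub>R\<^esub> a) \<otimes>\<^bsub>Q\<^esub> (I +>\<^bsub>R\<^esub> b) = I +>\<^bsub>R\<^esub> (a \<otimes>\<^bsub>R\<^esub> b)"
  using rcoset_mult_add by (simp add: FactRing_def)

lemma Q_one: "\<one>\<^bsub>Q\<^esub> = I +>\<^bsub>R\<^esub> \<one>\<^bsub>R\<^esub>"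
  by (simp add: FactRing_def)

lemmas reduction_ops = reduction_zero reduction_add reduction_smult reduction_bracket reduction_cls
  Q_add Q_mult Q_one

theorem reduction_lie_algebra: "lie_algebra Q (reduction R L I)"
proof (intro lie_algebra.intro lie_algebra_axioms.intro moduleI abelian_groupI)
  show "cring Q" by (rule quotient_is_cring[OF R.is_cring])
next
  fix U assume "U \<in> carrier (reduction R L I)"
  then obtain x where x: "x \<in> carrier L" "U = cls x" by (rule reduction_cases)
  have "cls (\<ominus>\<^bsub>L\<^esub> x) \<oplus>\<^bsub>reduction R L I\<^esub> U = \<zero>\<^bsub>reduction R L I\<^esub>"
    using x by (simp add: reduction_ops M.l_neg)
  then show "\<exists>V\<in>carrier (reduction R L I). V \<oplus>\<^bsub>reduction R L I\<^esub> U = \<zero>\<^bsub>reduction R L I\<^esub>"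
    using x by (intro bexI[of _ "cls (\<ominus>\<^bsub>L\<^esub> x)"]) (auto simp: reduction_cls)
next
  fix U V W
  assume "U \<in> carrier (reduction R L I)" "V \<in> carrier (reduction R L I)"
    "W \<in> carrier (reduction R L I)"
  then obtain x y z where "x \<in> carrier L" "y \<in> carrier L" "z \<in> carrier L"
    "U = cls x" "V = cls y" "W = cls z"
    by (elim reduction_cases) blast
  then show "\<lbrakk>U,\<lbrakk>V,W\<rbrakk>\<^bsub>reduction R L I\<^esub>\<rbrakk>\<^bsub>reduction R L I\<^esub> \<oplus>\<^bsub>reduction R L I\<^esub>
      \<lbrakk>V,\<lbrakk>W,U\<rbrakk>\<^bsub>reduction R L I\<^esub>\<rbrakk>\<^bsub>reduction R L I\<^esub> \<oplus>\<^bsub>reduction R L I\<^esub>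
      \<lbrakk>W,\<lbrakk>U,V\<rbrakk>\<^bsub>reduction R L I\<^esub>\<rbrakk>\<^bsub>reduction R L I\<^esub> = \<zero>\<^bsub>reduction R L I\<^esub>"
    by (simp add: reduction_ops jacobi)
qed (auto elim!: reduction_cases Q_cases
    simp: reduction_ops M.a_ac smult_l_distr smult_r_distr smult_assoc1
      bracket_add_left bracket_add_right bracket_smult_left bracket_smult_right bracket_self)

theorem reduction_universal:
  assumes S: "module Q S"
    and f: "f \<in> carrier L \<rightarrow> carrier S"
      "\<And>x y. x \<in> carrier L \<Longrightarrow> y \<in> carrier L \<Longrightarrow> f (x \<oplus>\<^bsub>L\<^esub> y) = f x \<oplus>\<^bsub>S\<^esub> f y"
      "\<And>a x. a \<in> carrier R \<Longrightarrow> x \<in> carrier L \<Longrightarrow> f (a \<odot>\<^bsub>L\<^esub> x) = (I +>\<^bsub>R\<^esub> a) \<odot>\<^bsub>S\<^esub> f x"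
  shows "\<exists>!g. g \<in> extensional (carrier (reduction R L I)) \<and> g \<in> module_hom Q (reduction R L I) S \<and>
    (\<forall>x\<in>carrier L. g (cls x) = f x)"
proof -
  interpret S: module Q S by fact
  have fc [simp]: "f x \<in> carrier S" if "x \<in> carrier L" for x using f(1) that by auto
  have Qc [simp]: "I +>\<^bsub>R\<^esub> a \<in> carrier Q" if "a \<in> carrier R" for a
    using that R.a_rcosetsI[OF a_subset] by (simp add: FactRing_def)
  have fI: "f (a \<odot>\<^bsub>L\<^esub> x) = \<zero>\<^bsub>S\<^esub>" if "a \<in> I" "x \<in> carrier L" for a x
  proof -
    have "I +>\<^bsub>R\<^esub> a = \<zero>\<^bsub>Q\<^esub>" using that a_rcos_const by (simp add: FactRing_def)
    moreover have "a \<in> carrier R" using that a_subset by auto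
    ultimately show ?thesis using that f(3)[of a x] by simp
  qed
  have f0: "f \<zero>\<^bsub>L\<^esub> = \<zero>\<^bsub>S\<^esub>" using fI[of "\<zero>\<^bsub>R\<^esub>" "\<zero>\<^bsub>L\<^esub>"] by simp
  have fN: "f x = \<zero>\<^bsub>S\<^esub>" if "x \<in> N" for x using that
    by (rule N_induct) (simp_all add: f0 f(2) fI, simp add: f(3))
  have fcls: "f x = f y" if x: "x \<in> carrier L" and y: "y \<in> cls x" for x y
  proof -
    have y': "y \<in> carrier L" using cls_mem[OF x y] by simp
    have "f y = f ((y \<ominus>\<^bsub>L\<^esub> x) \<oplus>\<^bsub>L\<^esub> x)" using x y' by (simp add: a_minus_def M.a_assoc M.l_neg)
    also have "\<dots> = f x" using x y' fN[OF cls_memD[OF x y]] by (simp add: f(2))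
    finally show ?thesis by simp
  qed
  define g where "g = restrict (\<lambda>U. f (SOME x. x \<in> U)) (carrier (reduction R L I))"
  have gcls: "g (cls x) = f x" if x: "x \<in> carrier L" for x
  proof -
    have "(SOME y. y \<in> cls x) \<in> cls x" by (rule someI[of _ x]) (rule Nsub.a_rcos_self[OF x])
    from fcls[OF x this] show ?thesis using x by (simp add: g_def reduction_cls)
  qed
  have "g \<in> module_hom Q (reduction R L I) S"
    unfolding module_hom_def
    by (auto elim!: reduction_cases Q_cases simp: reduction_ops gcls f(2,3))
  moreover have "g \<in> extensional (carrier (reduction R L I))" by (simp add: g_def)
  moreover have "h = g" if "h \<in> extensional (carrier (reduction R L I))"
      "\<forall>x\<in>carrier L. h (cls x) = f x" for h
  proof (rule extensionalityI[OF that(1)])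
    fix U assume "U \<in> carrier (reduction R L I)"
    then show "h U = g U" by (rule reduction_cases) (use that(2) gcls in simp)
  qed (simp add: g_def)
  ultimately show ?thesis using gcls by blast
qed

end

section \<open>Zeta functions and periods\<close>

datatype subobject = Subalgebras | Ideals

fun is_subobject ::
    "subobject \<Rightarrow> ('a, 'r) ring_scheme \<Rightarrow> ('a, 'b, 'm) lie_alg_scheme \<Rightarrow> 'b set \<Rightarrow> bool" where
  "is_subobject Subalgebras = lie_subalgebra"
| "is_subobject Ideals = lie_ideal"

definition count_codim ::
    "subobject \<Rightarrow> ('a, 'r) ring_scheme \<Rightarrow> ('a, 'b, 'm) lie_alg_scheme \<Rightarrow> nat \<Rightarrow> nat" where
  "count_codim t F L i =
     card {H. is_subobject t F L H \<and>
              vectorspace.dim F L = vectorspace.dim F (L \<lparr>carrier := H\<rparr>) + i}"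

text \<open>For a finite-dimensional Lie algebra the series has only finitely many nonzero terms.\<close>

definition lie_zeta ::
    "subobject \<Rightarrow> ('a, 'r) ring_scheme \<Rightarrow> ('a, 'b, 'm) lie_alg_scheme \<Rightarrow> complex \<Rightarrow> complex" where
  "lie_zeta t F L s =
     suminf (\<lambda>i. of_nat (count_codim t F L i) *
       of_nat (card (carrier F)) powr (- (of_nat i * s)))"

text \<open>
  A polynomial in two variables \<open>X\<close>, \<open>Y\<close> over the rationals is a polynomial in \<open>Y\<close> whose
  coefficients are polynomials in \<open>X\<close>.
\<close>

definition eval_XY :: "rat poly poly \<Rightarrow> complex \<Rightarrow> complex \<Rightarrow> complex" where
  "eval_XY P x y = poly (map_poly (\<lambda>c. poly (map_poly of_rat c) x) P) y"

definition period_le ::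
    "subobject \<Rightarrow> ('a, 'r) ring_scheme \<Rightarrow> ('a, 'b, 'm) lie_alg_scheme \<Rightarrow> nat \<Rightarrow> bool" where
  "period_le t R L k \<longleftrightarrow>
     (\<exists>P :: nat \<Rightarrow> rat poly poly.
        finite {p. primeideal p R \<and> p \<noteq> {\<zero>\<^bsub>R\<^esub>} \<and>
          \<not> (\<exists>i\<in>{1..k}. \<forall>s. let q = of_nat (card (carrier (R Quot p))) in
               lie_zeta t (R Quot p) (reduction R L p) s = eval_XY (P i) q (q powr (- s)))})"

text \<open>The infimum of the empty set is \<open>\<infinity>\<close>; that of a nonempty set is its least element.\<close>

definition Fq_period :: "subobject \<Rightarrow> ('a, 'r) ring_scheme \<Rightarrow> ('a, 'b, 'm) lie_alg_scheme \<Rightarrow> enat" where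
  "Fq_period t R L = Inf {enat k | k. k \<ge> 1 \<and> period_le t R L k}"

end

theory Submission
  imports Defs
begin

text \<open>
  Over a finite field with \<open>q\<close> elements, \<open>q\<close> odd, and in dimension 3 or 4, the number of subalgebras
  of each codimension is a polynomial in \<open>q\<close> and in one further number \<open>b\<close>, which is (up to a shift
  by 1) the number of invariant lines of a linear operator coming from the bracket: usually the action
  of a vector on an invariant hyperplane on which the bracket vanishes. The same \<open>b\<close> determines the
  numbers of ideals once \<open>d = dim [L,L]\<close>, the vanishing of the centre and the vanishing of
  \<open>[[L,L],[L,L]]\<close> are known. The number \<open>b\<close> has the form \<open>c0 + c1 q + c2 q^2\<close> with \<open>c0, c1, c2 \<le> 4\<close>, and
  it can be recovered from the number of maximal subalgebras as well as from the numbers of ideals. For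
  an integral \<open>L\<close> the three data are the same for almost all primes, being statements about linear
  systems. So both periods count the triples \<open>(c0, c1, c2)\<close> that occur for infinitely many primes.
\<close>

section \<open>Finite vector spaces\<close>

text \<open>A case distinction on \<open>d\<close> takes the place of a classification in dimension
  four. If an abelian ideal of codimension one exists, all counts reduce to the invariant subspaces
  of one operator on it. Otherwise, over a field of odd size and for solvable \<open>L\<close>, only
  two shapes remain: [L,L] is a plane containing its own centralizer, or [L,L] is a Heisenberg
  algebra. The operator then acts on [L,L], respectively on [L,L] modulo its centre, and in the
  first shape \<open>b\<close> is one more than the number of its invariant lines. Odd
  \<open>q\<close> serves to rule out that [[L,L],[L,L]] is a plane. An operator in dimension at
  most 3 has at most 3 eigenvalues in the field, and an eigenspace of dimension \<open>k\<close>
  contributes 1 + q + ... + q^(k-1) lines: hence three bounded coefficients. How many eigenvalues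
  lie in the field varies with the prime, so \<open>b\<close> itself is not generic, unlike the
  other data. At each good prime one common triple describes both zeta functions, and for fixed
  generic data each of the two maps from triples to polynomials is injective. So the periods agree
  whatever set of triples occurs.\<close>

definition qn :: "nat \<Rightarrow> nat \<Rightarrow> nat" where
  "qn q k = (\<Sum>j<k. q ^ j)"

lemma qn_simps [simp]: "qn q 0 = 0" "qn q (Suc k) = 1 + q * qn q k"
  unfolding qn_def by (simp, simp only: sum.lessThan_Suc_shift sum_distrib_left power_Suc power_0)

text \<open>So \<open>qn q k\<close> is (q^k - 1)/(q - 1), the number of lines, and also of
  hyperplanes, of a space of dimension \<open>k\<close>; the sum form keeps division out of the
  natural numbers.\<close>

lemma qn_mult: "1 \<le> q \<Longrightarrow> (q - 1) * qn q k = q ^ k - 1"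
proof (induction k)
  case (Suc k)
  obtain r where r: "q = Suc r" using Suc.prems by (cases q) auto
  obtain p where p: "q ^ k = Suc p" using r by (cases "q ^ k") auto
  show ?case using Suc.IH Suc.prems p by (simp add: r algebra_simps)
qed simp

text \<open>
  A finite vector space over a field with \<open>q\<close> elements, presented as a finite submodule \<open>V\<close> of a
  module over a commutative ring type whose scalars act on \<open>V\<close> through such a field.
\<close>

locale finite_space = Modules.module scale
  for scale :: "'r::comm_ring_1 \<Rightarrow> 'v::ab_group_add \<Rightarrow> 'v" (infixr \<open>\<star>\<close> 75) +
  fixes V :: "'v set" and q :: nat
  assumes finV: "finite V" and subV: "subspace V" and q2: "2 \<le> q"
    and kill: "a \<star> v = 0 \<Longrightarrow> v \<in> V \<Longrightarrow> v \<noteq> 0 \<Longrightarrow> u \<in> V \<Longrightarrow> a \<star> u = 0"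
    and card_line: "v \<in> V \<Longrightarrow> v \<noteq> 0 \<Longrightarrow> card (span {v}) = q"
begin

definition sub :: "'v set \<Rightarrow> bool" where
  "sub W \<longleftrightarrow> subspace W \<and> W \<subseteq> V"

lemma sub_finite [simp]: "sub W \<Longrightarrow> finite W"
  using finV finite_subset by (auto simp: sub_def)

lemma sub_mem: "sub W \<Longrightarrow> x \<in> W \<Longrightarrow> x \<in> V"
  by (auto simp: sub_def)

lemma sub_0 [simp]: "sub W \<Longrightarrow> 0 \<in> W"
  by (auto simp: sub_def subspace_0)

lemma sub_add: "sub W \<Longrightarrow> x \<in> W \<Longrightarrow> y \<in> W \<Longrightarrow> x + y \<in> W"
  by (auto simp: sub_def subspace_add)

lemma sub_diff: "sub W \<Longrightarrow> x \<in> W \<Longrightarrow> y \<in> W \<Longrightarrow> x - y \<in> W"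
  by (auto simp: sub_def subspace_diff)

lemma sub_neg: "sub W \<Longrightarrow> x \<in> W \<Longrightarrow> - x \<in> W"
  by (auto simp: sub_def subspace_neg)

lemma sub_scale: "sub W \<Longrightarrow> x \<in> W \<Longrightarrow> a \<star> x \<in> W"
  by (auto simp: sub_def subspace_scale)

lemmas sub_closed = sub_add sub_diff sub_neg sub_scale

lemma sub_V [simp]: "sub V"
  by (simp add: sub_def subV)

lemma sub_zero [simp]: "sub {0}"
  using sub_0[OF sub_V] by (simp add: sub_def)

lemma sub_inter: "sub W \<Longrightarrow> sub U \<Longrightarrow> sub (W \<inter> U)"
  by (auto simp: sub_def subspace_inter)

lemma sub_card_pos: "sub W \<Longrightarrow> 0 < card W"
  by (metis card_gt_0_iff empty_iff sub_0 sub_finite)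

lemma sub_card_1: "sub W \<Longrightarrow> card W = 1 \<longleftrightarrow> W = {0}"
  by (metis card_1_singletonE is_singletonI is_singleton_altdef singletonD sub_0)

lemma sub_span: "S \<subseteq> V \<Longrightarrow> sub (span S)"
  by (simp add: sub_def span_minimal subV)

lemma sub_card_eq: "sub U \<Longrightarrow> W \<subseteq> U \<Longrightarrow> card W = card U \<Longrightarrow> W = U"
  by (simp add: card_subset_eq)

lemma sub_card_mono: "sub U \<Longrightarrow> W \<subseteq> U \<Longrightarrow> card W \<le> card U"
  by (simp add: card_mono)

text \<open>Inverses come from counting: the line of \<open>a \<star> v\<close> lies in the line of
  \<open>v\<close> and both have \<open>q\<close> elements, so they agree and \<open>v\<close> is a
  multiple of \<open>a \<star> v\<close>. By \<open>kill\<close> the same multiplier undoes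
  \<open>a\<close> on all of \<open>V\<close>.\<close>

lemma inverse_ex:
  assumes v: "v \<in> V" and av: "a \<star> v \<noteq> 0"
  obtains b where "\<And>u. u \<in> V \<Longrightarrow> b \<star> a \<star> u = u"
proof -
  have aV: "a \<star> v \<in> V" using v by (simp add: sub_scale[OF sub_V])
  have v0: "v \<noteq> 0" using av by auto
  have s: "sub (span {v})" using v by (intro sub_span) auto
  have "span {a \<star> v} \<subseteq> span {v}"
    by (intro span_minimal) (auto intro: span_scale span_base)
  then have "span {a \<star> v} = span {v}"
    using card_line[OF v v0] card_line[OF aV av] s by (metis sub_card_eq)
  then have "v \<in> span {a \<star> v}" by (simp add: span_base)
  then obtain k where "v = k \<star> a \<star> v" by (auto simp: span_singleton)
  then have "(k * a - 1) \<star> v = 0" by (simp add: scale_left_diff_distrib)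
  then have "(k * a - 1) \<star> u = 0" if "u \<in> V" for u using kill v v0 that by blast
  then have "k \<star> a \<star> u = u" if "u \<in> V" for u using that by (simp add: scale_left_diff_distrib)
  then show ?thesis by (rule that)
qed

lemma scale_mem:
  assumes "sub W" "u \<in> V" "a \<star> u \<in> W" "a \<star> u \<noteq> 0"
  shows "u \<in> W"
  by (metis assms inverse_ex sub_scale)

abbreviation adj :: "'v \<Rightarrow> 'v set \<Rightarrow> 'v set" where
  "adj u W \<equiv> span (insert u W)"

lemma sub_adj: "sub W \<Longrightarrow> u \<in> V \<Longrightarrow> sub (adj u W)"
  by (intro sub_span) (auto simp: sub_def)

lemma adj_iff: "sub W \<Longrightarrow> x \<in> adj u W \<longleftrightarrow> (\<exists>k. x - k \<star> u \<in> W)"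
  by (metis span_breakdown_eq span_eq_iff sub_def)

lemma adj_least: "sub U \<Longrightarrow> W \<subseteq> U \<Longrightarrow> u \<in> U \<Longrightarrow> adj u W \<subseteq> U"
  by (intro span_minimal) (auto simp: sub_def)

lemma adj_self [simp]: "u \<in> adj u W"
  by (simp add: span_base)

lemma adj_superset: "W \<subseteq> adj u W"
  by (auto intro: span_base)

lemma adjE:
  assumes "sub W" "x \<in> adj u W"
  obtains w k where "w \<in> W" "x = w + k \<star> u"
  using assms by (metis adj_iff diff_add_cancel)

lemma card_adj:
  assumes W: "sub W" and u: "u \<in> V" "u \<notin> W"
  shows "card (adj u W) = q * card W"
proof -
  have u0: "u \<noteq> 0" using u W by auto
  have "bij_betw (\<lambda>(w, y). w + y) (W \<times> span {u}) (adj u W)"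
  proof (rule bij_betwI')
    fix a b assume "a \<in> W \<times> span {u}" "b \<in> W \<times> span {u}"
    then obtain w k w' l where a: "a = (w, k \<star> u)" "w \<in> W" and b: "b = (w', l \<star> u)" "w' \<in> W"
      by (auto simp: span_singleton)
    show "((\<lambda>(w, y). w + y) a = (\<lambda>(w, y). w + y) b) = (a = b)"
    proof
      assume "(\<lambda>(w, y). w + y) a = (\<lambda>(w, y). w + y) b"
      then have e: "w + k \<star> u = w' + l \<star> u" using a b by simp
      then have "(k - l) \<star> u = w' - w" by (simp add: scale_left_diff_distrib algebra_simps)
      then have "(k - l) \<star> u \<in> W" using a b W by (simp add: sub_diff)
      then have "(k - l) \<star> u = 0" using scale_mem[OF W] u by blast
      then have "k \<star> u = l \<star> u" by (simp add: scale_left_diff_distrib)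
      then show "a = b" using a b e by simp
    qed simp
  next
    fix a assume "a \<in> W \<times> span {u}"
    then show "(\<lambda>(w, y). w + y) a \<in> adj u W"
      by (auto intro!: span_add intro: span_base span_mono[THEN subsetD, rotated])
  next
    fix y assume "y \<in> adj u W"
    then obtain w k where "w \<in> W" "y = w + k \<star> u" by (rule adjE[OF W])
    then show "\<exists>x\<in>W \<times> span {u}. y = (\<lambda>(w, y). w + y) x"
      by (intro bexI[of _ "(w, k \<star> u)"]) (auto simp: span_singleton)
  qed
  then have "card (adj u W) = card W * card (span {u})"
    by (simp add: bij_betw_same_card[symmetric] card_cartesian_product)
  then show ?thesis using card_line[OF u(1) u0] by simp
qed

lemma adj_eqI:
  assumes "sub W" "sub H" "W \<subseteq> H" "card H = q * card W" "u \<in> H" "u \<notin> W"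
  shows "H = adj u W"
  using assms adj_least card_adj sub_card_eq sub_mem by metis

text \<open>Each vector adjoined outside \<open>W\<close> multiplies the size by \<open>q\<close>.
  From here on cardinalities play the part of dimensions.\<close>

lemma card_pow:
  assumes "sub W" "sub U" "W \<subseteq> U"
  obtains k where "card U = q ^ k * card W"
proof -
  have "\<exists>k. card U = q ^ k * card W"
    using assms
  proof (induction "card U - card W" arbitrary: W rule: less_induct)
    case less
    show ?case
    proof (cases "W = U")
      case True
      then show ?thesis by (intro exI[of _ 0]) simp
    next
      case False
      then obtain u where u: "u \<in> U" "u \<notin> W" using less.prems by blast
      have uV: "u \<in> V" using u less.prems sub_mem by blast
      let ?W = "adj u W"
      have W: "sub ?W" "?W \<subseteq> U" "card ?W = q * card W"
        using less.prems u uV sub_adj adj_least card_adj by auto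
      have "card W < card ?W" using W(3) sub_card_pos[OF less.prems(1)] q2 by simp
      moreover have "card ?W \<le> card U" using W less.prems sub_card_mono by blast
      ultimately have "card U - card ?W < card U - card W" by linarith
      with less.hyps W less.prems obtain k where "card U = q ^ k * card ?W" by blast
      then show ?thesis using W by (intro exI[of _ "Suc k"]) simp
    qed
  qed
  then show ?thesis using that by blast
qed

lemma q_pow_inj: "q ^ j = q ^ k \<longleftrightarrow> j = k"
  using q2 by (intro power_inject_exp) auto

lemma q_pow_le: "q ^ j \<le> q ^ k \<longleftrightarrow> j \<le> k"
  using q2 by (intro power_increasing_iff) auto

lemma card_pow_sub:
  assumes "sub W" "sub U" "W \<subseteq> U" "card U = q ^ k"
  obtains j where "j \<le> k" "card W = q ^ j" "card U = q ^ (k - j) * card W"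
proof -
  obtain j where j: "card W = q ^ j * card {0::'v}" by (rule card_pow[of "{0}" W]) (use assms in auto)
  have "j \<le> k" using sub_card_mono[OF assms(2,3)] assms(4) j by (simp add: q_pow_le)
  then show ?thesis using that[of j] j assms(4) by (simp add: power_add[symmetric])
qed

lemma ex_between:
  assumes "sub W" "sub U" "W \<subseteq> U" "card U = q ^ k * card W" "j \<le> k"
  obtains T where "sub T" "W \<subseteq> T" "T \<subseteq> U" "card T = q ^ j * card W"
proof -
  have "\<exists>T. sub T \<and> W \<subseteq> T \<and> T \<subseteq> U \<and> card T = q ^ j * card W"
    using \<open>j \<le> k\<close>
  proof (induction j)
    case 0
    then show ?case using assms by auto
  next
    case (Suc j)
    then obtain T where T: "sub T" "W \<subseteq> T" "T \<subseteq> U" "card T = q ^ j * card W" by auto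
    have "q ^ j < q ^ k" using Suc.prems q2 by (intro power_strict_increasing) auto
    then have "card T < card U" using T assms sub_card_pos by simp
    then obtain u where u: "u \<in> U" "u \<notin> T"
      by (metis T(3) less_irrefl subsetI subset_antisym)
    have "u \<in> V" using u assms sub_mem by blast
    then have "sub (adj u T) \<and> W \<subseteq> adj u T \<and> adj u T \<subseteq> U \<and> card (adj u T) = q ^ Suc j * card W"
      using u T assms sub_adj adj_least card_adj adj_superset[of T u] by auto
    then show ?case by blast
  qed
  then show ?thesis using that by blast
qed

text \<open>The points and the hyperplanes of the projective space of \<open>U/W\<close>, expressed
  by subspaces between \<open>W\<close> and \<open>U\<close> so that no quotient has to be
  formed.\<close>

definition atoms :: "'v set \<Rightarrow> 'v set \<Rightarrow> 'v set set" where
  "atoms W U = {H. sub H \<and> W \<subseteq> H \<and> H \<subseteq> U \<and> card H = q * card W}"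

definition coatoms :: "'v set \<Rightarrow> 'v set \<Rightarrow> 'v set set" where
  "coatoms W U = {H. sub H \<and> W \<subseteq> H \<and> H \<subseteq> U \<and> card U = q * card H}"

lemma finite_subs [simp]: "finite {H. sub H \<and> P H}"
  by (rule finite_subset[of _ "Pow V"]) (auto simp: sub_def finV)

lemma finite_atoms [simp]: "finite (atoms W U)" "finite (coatoms W U)"
  by (simp_all add: atoms_def coatoms_def)

lemma atoms_adj: "sub W \<Longrightarrow> H \<in> atoms W U \<Longrightarrow> u \<in> H \<Longrightarrow> u \<notin> W \<Longrightarrow> H = adj u W"
  unfolding atoms_def using adj_eqI[of W H u] by simp

lemma adj_atoms: "sub W \<Longrightarrow> sub U \<Longrightarrow> W \<subseteq> U \<Longrightarrow> u \<in> U \<Longrightarrow> u \<notin> W \<Longrightarrow> adj u W \<in> atoms W U"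
  using sub_adj card_adj adj_least adj_superset[of W u] sub_mem by (simp add: atoms_def)

lemma atoms_ex:
  assumes "sub W" "H \<in> atoms W U"
  obtains u where "u \<in> H" "u \<in> U" "u \<notin> W" "u \<in> V"
proof -
  have "card W < card H" using assms q2 sub_card_pos[OF assms(1)] by (auto simp: atoms_def)
  then have "\<exists>u. u \<in> H \<and> u \<notin> W" 
    by (metis assms(1) card_mono not_less sub_finite subsetI)
  then show ?thesis using that assms(2) by (auto simp: atoms_def sub_def)
qed

lemma atoms_inter:
  assumes W: "sub W" and U: "sub U" "W \<subseteq> U" and H: "H \<in> atoms W T" "\<not> H \<subseteq> U"
  shows "H \<inter> U = W"
proof
  obtain h where h: "h \<in> H" "h \<notin> U" using H by auto
  then have hW: "h \<notin> W" using U by auto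
  have hV: "h \<in> V" using h H by (auto simp: atoms_def sub_def)
  have e: "H = adj h W" using atoms_adj[OF W H(1)] h hW by auto
  show "H \<inter> U \<subseteq> W"
  proof
    fix y assume y: "y \<in> H \<inter> U"
    then obtain w k where w: "w \<in> W" "y = w + k \<star> h" using e adjE[OF W] by blast
    have "y - w \<in> U" using y w U by (intro sub_diff) auto
    then have "k \<star> h \<in> U" using w by simp
    then have "k \<star> h = 0" using scale_mem[OF U(1) hV] h by blast
    then show "y \<in> W" using w by simp
  qed
qed (use H U in \<open>auto simp: atoms_def\<close>)

text \<open>An atom outside \<open>U0\<close> meets it in \<open>W\<close> only, and two different
  atoms share only \<open>W\<close>. So the sets \<open>H - W\<close>, with
  \<open>(q - 1) * card W\<close> elements each, partition \<open>U - U0\<close>. Most counts of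
  subalgebras below rest on this partition.\<close>

lemma card_atoms_outside_mult:
  assumes W: "sub W" and U0: "sub U0" "W \<subseteq> U0" and U: "sub U" "U0 \<subseteq> U"
  shows "card {H \<in> atoms W U. \<not> H \<subseteq> U0} * ((q - 1) * card W) = card U - card U0"
proof -
  let ?S = "{H \<in> atoms W U. \<not> H \<subseteq> U0}"
  have WU: "W \<subseteq> U" using U0 U by auto
  have 1: "U - U0 = (\<Union>H\<in>?S. H - W)"
  proof (intro equalityI subsetI)
    fix u assume u: "u \<in> U - U0"
    then have "adj u W \<in> ?S" using adj_atoms[OF W U(1) WU] U0 adj_self[of u W] by blast
    then show "u \<in> (\<Union>H\<in>?S. H - W)" using u U0 adj_self[of u W] by blast
  next
    fix u assume "u \<in> (\<Union>H\<in>?S. H - W)"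
    then obtain H where H: "H \<in> ?S" "u \<in> H" "u \<notin> W" by blast
    then have "H \<inter> U0 = W" using atoms_inter[OF W U0] by blast
    then show "u \<in> U - U0" using H by (auto simp: atoms_def)
  qed
  have 2: "card (H - W) = (q - 1) * card W" if "H \<in> ?S" for H
    using that W by (auto simp: atoms_def card_Diff_subset diff_mult_distrib)
  have "card (U - U0) = (\<Sum>H\<in>?S. card (H - W))"
    unfolding 1
  proof (rule card_UN_disjoint)
    show "\<forall>A\<in>?S. \<forall>B\<in>?S. A \<noteq> B \<longrightarrow> (A - W) \<inter> (B - W) = {}"
    proof (intro ballI impI)
      fix A B assume AB: "A \<in> ?S" "B \<in> ?S" "A \<noteq> B"
      then have "\<And>u. u \<in> A \<Longrightarrow> u \<in> B \<Longrightarrow> u \<notin> W \<Longrightarrow> A = B"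
        using atoms_adj[OF W] by (metis (no_types, lifting) mem_Collect_eq)
      then show "(A - W) \<inter> (B - W) = {}" using AB by blast
    qed
  qed (auto simp: atoms_def)
  also have "\<dots> = card ?S * ((q - 1) * card W)" using 2 by simp
  finally show ?thesis using U U0 by (simp add: card_Diff_subset)
qed

lemma card_atoms_outside:
  assumes "sub W" "sub U0" "W \<subseteq> U0" "sub U" "U0 \<subseteq> U"
    and "card U - card U0 = m * ((q - 1) * card W)"
  shows "card {H \<in> atoms W U. \<not> H \<subseteq> U0} = m"
proof -
  have "0 < (q - 1) * card W" using q2 sub_card_pos[OF assms(1)] by simp
  then show ?thesis using card_atoms_outside_mult[OF assms(1-5)] assms(6) by auto
qed

lemma card_atoms:
  assumes "sub W" "sub U" "W \<subseteq> U" "card U = q ^ k * card W"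
  shows "card (atoms W U) = qn q k"
proof -
  have "{H \<in> atoms W U. \<not> H \<subseteq> W} = atoms W U"
    using atoms_ex[OF assms(1)] by blast
  moreover have "card U - card W = qn q k * ((q - 1) * card W)"
  proof -
    have "card U - card W = (q ^ k - 1) * card W" using assms(4) by (simp add: diff_mult_distrib)
    also have "q ^ k - 1 = (q - 1) * qn q k" using qn_mult[of q k] q2 by simp
    finally show ?thesis by (simp only: mult_ac)
  qed
  ultimately show ?thesis using card_atoms_outside[of W W U] assms by simp
qed

lemma coatom_adj:
  assumes "sub U" "H \<in> coatoms W U" "h \<in> U" "h \<notin> H"
  shows "adj h H = U"
  using assms adj_eqI[of H U h] by (auto simp: coatoms_def)

lemma coatom_inter:
  assumes U: "sub U" and H0: "H0 \<in> coatoms W U" and H: "sub H" "H \<subseteq> U" "\<not> H \<subseteq> H0"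
  shows "card H = q * card (H \<inter> H0)"
proof -
  obtain h where h: "h \<in> H" "h \<notin> H0" using H by auto
  have hV: "h \<in> V" using h H sub_mem by blast
  have H0s: "sub H0" using H0 by (simp add: coatoms_def)
  have s: "sub (H \<inter> H0)" using H(1) H0s by (rule sub_inter)
  have "H = adj h (H \<inter> H0)"
  proof
    show "H \<subseteq> adj h (H \<inter> H0)"
    proof
      fix y assume y: "y \<in> H"
      then have "y \<in> adj h H0" using coatom_adj[OF U H0, of h] h H by blast
      then obtain k where "y - k \<star> h \<in> H0" using adj_iff[OF H0s] by blast
      moreover have "y - k \<star> h \<in> H" using y h H by (simp add: sub_closed)
      ultimately show "y \<in> adj h (H \<inter> H0)" using adj_iff[OF s] by blast
    qed
    show "adj h (H \<inter> H0) \<subseteq> H" using adj_least[OF H(1)] h by blast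
  qed
  then show ?thesis using card_adj[OF s hV] h by simp
qed

text \<open>The recursion of \<open>qn\<close>, without dual spaces: fix a coatom \<open>H0\<close>.
  Any other coatom meets \<open>H0\<close> in a coatom \<open>T\<close> of the interval from
  \<open>W\<close> to \<open>H0\<close>, and each such \<open>T\<close> is the trace of exactly
  \<open>q\<close> coatoms other than \<open>H0\<close>.\<close>

lemma card_coatoms:
  assumes "sub W" "sub U" "W \<subseteq> U" "card U = q ^ k * card W"
  shows "card (coatoms W U) = qn q k"
  using assms
proof (induction k arbitrary: U)
  case 0
  then have "W = U" using sub_card_eq by auto
  have "H \<notin> coatoms W U" for H
  proof
    assume H: "H \<in> coatoms W U"
    then have "card U \<le> card H" using \<open>W = U\<close> by (auto simp: coatoms_def intro!: sub_card_mono)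
    then show False using H q2 sub_card_pos[OF \<open>sub U\<close>] by (auto simp: coatoms_def)
  qed
  then have "coatoms W U = {}" by blast
  then show ?case by simp
next
  case (Suc k)
  obtain H0 where H0: "sub H0" "W \<subseteq> H0" "H0 \<subseteq> U" "card H0 = q ^ k * card W"
    using ex_between[of W U "Suc k" k] Suc.prems by auto
  have H0c: "H0 \<in> coatoms W U" using H0 Suc.prems by (simp add: coatoms_def)
  have IH: "card (coatoms W H0) = qn q k" using Suc.IH[of H0] Suc.prems H0 by simp
  have eq: "coatoms W U = insert H0 (\<Union>T\<in>coatoms W H0. {H \<in> atoms T U. \<not> H \<subseteq> H0})"
  proof (intro equalityI subsetI)
    fix H assume H: "H \<in> coatoms W U"
    then have Hs: "sub H" "H \<subseteq> U" "W \<subseteq> H" by (auto simp: coatoms_def)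
    have cH: "card H = card H0" using H H0c q2 by (auto simp: coatoms_def)
    show "H \<in> insert H0 (\<Union>T\<in>coatoms W H0. {H \<in> atoms T U. \<not> H \<subseteq> H0})"
    proof (cases "H \<subseteq> H0")
      case True
      then have "H = H0" using sub_card_eq[OF H0(1)] cH by simp
      then show ?thesis by simp
    next
      case False
      have c: "card H = q * card (H \<inter> H0)"
        using coatom_inter[OF Suc.prems(2) H0c Hs(1,2) False] .
      then have "H \<inter> H0 \<in> coatoms W H0" using Hs H0 cH by (auto simp: coatoms_def sub_inter)
      moreover have "H \<in> atoms (H \<inter> H0) U" using c Hs by (auto simp: atoms_def)
      ultimately show ?thesis using False by blast
    qed
  next
    fix H assume "H \<in> insert H0 (\<Union>T\<in>coatoms W H0. {H \<in> atoms T U. \<not> H \<subseteq> H0})"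
    then show "H \<in> coatoms W U"
    proof
      assume "H \<in> (\<Union>T\<in>coatoms W H0. {H \<in> atoms T U. \<not> H \<subseteq> H0})"
      then obtain T where "T \<in> coatoms W H0" "H \<in> atoms T U" by blast
      then show ?thesis using H0c by (auto simp: coatoms_def atoms_def)
    qed (use H0c in simp)
  qed
  have T: "card {H \<in> atoms T U. \<not> H \<subseteq> H0} = q" if T: "T \<in> coatoms W H0" for T
  proof (rule card_atoms_outside)
    have "card U = q * card H0" "card H0 = q * card T" using T H0c by (auto simp: coatoms_def)
    then show "card U - card H0 = q * ((q - 1) * card T)" by (simp add: diff_mult_distrib algebra_simps)
  qed (use T H0 Suc.prems in \<open>auto simp: coatoms_def\<close>)
  have "card (\<Union>T\<in>coatoms W H0. {H \<in> atoms T U. \<not> H \<subseteq> H0})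
      = (\<Sum>T\<in>coatoms W H0. card {H \<in> atoms T U. \<not> H \<subseteq> H0})"
  proof (rule card_UN_disjoint)
    show "\<forall>A\<in>coatoms W H0. \<forall>B\<in>coatoms W H0. A \<noteq> B \<longrightarrow>
        {H \<in> atoms A U. \<not> H \<subseteq> H0} \<inter> {H \<in> atoms B U. \<not> H \<subseteq> H0} = {}"
    proof (intro ballI impI)
      fix A B assume AB: "A \<in> coatoms W H0" "B \<in> coatoms W H0" "A \<noteq> B"
      have "A = H \<inter> H0" if "H \<in> atoms A U" "\<not> H \<subseteq> H0" for H
        using atoms_inter[of A H0 H U] AB H0 that by (auto simp: coatoms_def)
      moreover have "B = H \<inter> H0" if "H \<in> atoms B U" "\<not> H \<subseteq> H0" for H
        using atoms_inter[of B H0 H U] AB H0 that by (auto simp: coatoms_def)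
      ultimately show "{H \<in> atoms A U. \<not> H \<subseteq> H0} \<inter> {H \<in> atoms B U. \<not> H \<subseteq> H0} = {}"
        using AB by blast
    qed
  qed auto
  also have "\<dots> = q * qn q k" using T IH by simp
  finally show ?case unfolding eq by (subst card_insert_disjoint) auto
qed

subsection \<open>Eigenvectors\<close>

abbreviation linear where "linear D \<equiv> Modules.module_hom scale scale D"

lemma linear_add: "linear D \<Longrightarrow> D (x + y) = D x + D y"
  by (rule module_hom.add)

lemma linear_scale: "linear D \<Longrightarrow> D (a \<star> x) = a \<star> D x"
  by (rule module_hom.scale)

lemma linear_diff: "linear D \<Longrightarrow> D (x - y) = D x - D y"
  by (rule module_hom.diff)

lemma linear_0: "linear D \<Longrightarrow> D 0 = 0"
  by (rule module_hom.zero)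

lemma linear_image_sub: "linear D \<Longrightarrow> sub U \<Longrightarrow> D ` U \<subseteq> V \<Longrightarrow> sub (D ` U)"
  by (auto simp: sub_def module_hom.subspace_image)

lemma linear_shift: "linear D \<Longrightarrow> linear (\<lambda>x. D x - a \<star> x)"
  by (auto simp: module_hom_iff mult.commute scale_right_distrib scale_right_diff_distrib)

lemma linear_vimage_sub: "linear D \<Longrightarrow> sub U \<Longrightarrow> sub W \<Longrightarrow> sub {u \<in> U. D u \<in> W}"
  using subspace_inter[of U "D -` W"] module_hom.subspace_vimage[of scale scale D W]
  by (auto simp: sub_def vimage_def Int_def)

lemma rank_nullity:
  assumes D: "linear D" and U: "sub U"
  shows "card U = card (D ` U) * card {u \<in> U. D u = 0}"
proof -
  have "card U = (\<Sum>y\<in>D ` U. card {u \<in> U. D u = y})"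
    using card_eq_sum sum.image_gen[of U "\<lambda>_. 1::nat" D] U by simp
  also have "\<dots> = (\<Sum>y\<in>D ` U. card {u \<in> U. D u = 0})"
  proof (rule sum.cong[OF refl])
    fix y assume "y \<in> D ` U"
    then obtain v where v: "v \<in> U" "y = D v" by blast
    have "bij_betw (\<lambda>u. u - v) {u \<in> U. D u = y} {u \<in> U. D u = 0}"
      by (rule bij_betw_byWitness[where f' = "\<lambda>u. u + v"])
        (use v U D in \<open>auto simp: linear_add linear_diff sub_closed\<close>)
    then show "card {u \<in> U. D u = y} = card {u \<in> U. D u = 0}" by (rule bij_betw_same_card)
  qed
  finally show ?thesis by simp
qed

text \<open>The invariant lines of the operator induced on \<open>U/W\<close>. The case
  \<open>W = {0}\<close> serves all algebras except those with a Heisenberg derived algebra, where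
  \<open>W\<close> is the centre of the latter.\<close>

definition eig :: "('v \<Rightarrow> 'v) \<Rightarrow> 'v set \<Rightarrow> 'v set \<Rightarrow> 'v set set" where
  "eig D W U = {H \<in> atoms W U. D ` H \<subseteq> H}"

definition eigspace :: "('v \<Rightarrow> 'v) \<Rightarrow> 'v set \<Rightarrow> 'v set \<Rightarrow> 'r \<Rightarrow> 'v set" where
  "eigspace D W U a = {u \<in> U. D u - a \<star> u \<in> W}"

lemma sub_eigspace: "linear D \<Longrightarrow> sub W \<Longrightarrow> sub U \<Longrightarrow> sub (eigspace D W U a)"
  unfolding eigspace_def by (intro linear_vimage_sub linear_shift)

lemma eigspace_superset:
  "sub W \<Longrightarrow> W \<subseteq> U \<Longrightarrow> D ` W \<subseteq> W \<Longrightarrow> W \<subseteq> eigspace D W U a"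
  by (auto simp: eigspace_def intro!: sub_closed)

text \<open>The elements of the finite field, given by representatives in the type of scalars.\<close>

definition is_scalars :: "'r set \<Rightarrow> bool" where
  "is_scalars A \<longleftrightarrow> finite A \<and> (\<forall>a. \<exists>b\<in>A. \<forall>v\<in>V. a \<star> v = b \<star> v) \<and>
     (\<forall>a\<in>A. \<forall>b\<in>A. \<forall>v\<in>V. v \<noteq> 0 \<longrightarrow> a \<star> v = b \<star> v \<longrightarrow> a = b)"

text \<open>By \<open>kill\<close>, two scalars that agree on one nonzero \<open>v\<close> agree on
  all of \<open>V\<close>. So choosing one multiplier for each point of the line of \<open>v\<close>
  gives a system of representatives.\<close>

lemma scalars_ex:
  assumes "V \<noteq> {0}"
  obtains A where "is_scalars A"
proof -
  obtain v where v: "v \<in> V" "v \<noteq> 0" using assms sub_0[OF sub_V] by blast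
  define f where "f y = (SOME a. a \<star> v = y)" for y
  have f: "f (a \<star> v) \<star> v = a \<star> v" for a unfolding f_def by (rule someI[of _ a]) simp
  have eq: "a \<star> u = b \<star> u" if "a \<star> v = b \<star> v" "u \<in> V" for a b u
    using kill[of "a - b" v u] v that by (simp add: scale_left_diff_distrib)
  have "is_scalars (f ` span {v})"
    unfolding is_scalars_def
  proof (intro conjI allI ballI impI)
    show "finite (f ` span {v})" using sub_finite[OF sub_span[of "{v}"]] v by simp
    show "\<exists>b\<in>f ` span {v}. \<forall>u\<in>V. a \<star> u = b \<star> u" for a
    proof (intro bexI ballI)
      show "f (a \<star> v) \<in> f ` span {v}" by (auto simp: span_singleton)
      show "a \<star> u = f (a \<star> v) \<star> u" if "u \<in> V" for u
        using eq[OF _ that, of a "f (a \<star> v)"] f by simp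
    qed
  next
    fix a b u assume "a \<in> f ` span {v}" "b \<in> f ` span {v}" and u: "u \<in> V" "u \<noteq> 0" "a \<star> u = b \<star> u"
    then obtain k l where kl: "a = f (k \<star> v)" "b = f (l \<star> v)" by (auto simp: span_singleton)
    have "a \<star> v = b \<star> v" using kill[of "a - b" u v] v u by (simp add: scale_left_diff_distrib)
    then show "a = b" using kl f by metis
  qed
  then show ?thesis by (rule that)
qed

lemma scalars_rep:
  assumes "is_scalars A"
  obtains b where "b \<in> A" "\<forall>v\<in>V. a \<star> v = b \<star> v"
  using assms unfolding is_scalars_def by meson

lemma eigspace_inter:
  assumes A: "is_scalars A" and W: "sub W" and U: "sub U" and ab: "a \<in> A" "b \<in> A" "a \<noteq> b"
    and u: "u \<in> eigspace D W U a" "u \<in> eigspace D W U b"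
  shows "u \<in> W"
proof (rule ccontr)
  assume n: "u \<notin> W"
  have uV: "u \<in> V" using u U sub_mem by (auto simp: eigspace_def)
  have u0: "u \<noteq> 0" using n W by auto
  have "(D u - b \<star> u) - (D u - a \<star> u) \<in> W" using u by (intro sub_diff[OF W, of "D u - b \<star> u" "D u - a \<star> u"]) (auto simp: eigspace_def)
  then have "(a - b) \<star> u \<in> W" by (simp add: scale_left_diff_distrib)
  then have "(a - b) \<star> u = 0" using scale_mem[OF W uV] n by blast
  then show False using A ab uV u0 by (auto simp: is_scalars_def scale_left_diff_distrib)
qed

text \<open>An invariant line of \<open>U/W\<close> has one eigenvalue, and every line inside an
  eigenspace is invariant; eigenspaces for different eigenvalues meet in \<open>W\<close>, so the
  sum counts no line twice.\<close>

lemma card_eig_sum: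
  assumes D: "linear D" and W: "sub W" "D ` W \<subseteq> W" and U: "sub U" "W \<subseteq> U" and A: "is_scalars A"
  shows "card (eig D W U) = (\<Sum>a\<in>A. card (atoms W (eigspace D W U a)))"
proof -
  have "eig D W U = (\<Union>a\<in>A. atoms W (eigspace D W U a))"
  proof (intro equalityI subsetI)
    fix H assume H: "H \<in> eig D W U"
    then have Ha: "H \<in> atoms W U" "D ` H \<subseteq> H" by (auto simp: eig_def)
    obtain h where h: "h \<in> H" "h \<in> U" "h \<notin> W" "h \<in> V" using atoms_ex[OF W(1) Ha(1)] .
    have e: "H = adj h W" using atoms_adj[OF W(1) Ha(1)] h by blast
    obtain a' where a': "D h - a' \<star> h \<in> W" using Ha h e adj_iff[OF W(1)] by blast
    obtain a where a: "a \<in> A" "\<forall>v\<in>V. a' \<star> v = a \<star> v" using scalars_rep[OF A] .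
    have ah: "D h - a \<star> h \<in> W" using a' a h by simp
    have "D y - a \<star> y \<in> W" if y: "y \<in> H" for y
    proof -
      obtain w k where w: "w \<in> W" "y = w + k \<star> h"
        by (rule adjE[OF W(1), of y h]) (use y e in auto)
      have "D y - a \<star> y = (D w - a \<star> w) + k \<star> (D h - a \<star> h)"
        using w D by (simp add: linear_add linear_scale scale_right_distrib scale_right_diff_distrib
          mult.commute)
      then show ?thesis using w W ah by (auto intro!: sub_closed)
    qed
    then have "H \<in> atoms W (eigspace D W U a)" using Ha by (auto simp: atoms_def eigspace_def)
    then show "H \<in> (\<Union>a\<in>A. atoms W (eigspace D W U a))" using a by blast
  next
    fix H assume "H \<in> (\<Union>a\<in>A. atoms W (eigspace D W U a))"
    then obtain a where H: "H \<in> atoms W (eigspace D W U a)" by blast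
    then have Hs: "sub H" "W \<subseteq> H" by (auto simp: atoms_def)
    have "D y \<in> H" if "y \<in> H" for y
    proof -
      have "D y - a \<star> y \<in> H" using that H Hs by (auto simp: atoms_def eigspace_def)
      then have "(D y - a \<star> y) + a \<star> y \<in> H"
        using that by (intro sub_add[OF Hs(1)] sub_scale[OF Hs(1)])
      then show ?thesis by simp
    qed
    then show "H \<in> eig D W U" using H by (auto simp: eig_def atoms_def eigspace_def)
  qed
  moreover have "card (\<Union>a\<in>A. atoms W (eigspace D W U a)) = (\<Sum>a\<in>A. card (atoms W (eigspace D W U a)))"
  proof (rule card_UN_disjoint)
    show "\<forall>a\<in>A. \<forall>b\<in>A. a \<noteq> b \<longrightarrow> atoms W (eigspace D W U a) \<inter> atoms W (eigspace D W U b) = {}"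
    proof (intro ballI impI equals0I)
      fix a b H assume ab: "a \<in> A" "b \<in> A" "a \<noteq> b"
        and H: "H \<in> atoms W (eigspace D W U a) \<inter> atoms W (eigspace D W U b)"
      obtain h where "h \<in> H" "h \<notin> W" using atoms_ex[OF W(1), of H] H by blast
      then show False using eigspace_inter[OF A W(1) U(1) ab, of h D] H by (auto simp: atoms_def)
    qed
  qed (use A in \<open>auto simp: is_scalars_def\<close>)
  ultimately show ?thesis by simp
qed

text \<open>Eigenvalues are removed one at a time: the eigenspace of \<open>a\<close> becomes the
  new \<open>W\<close>. Any other eigenvalue survives modulo it, because eigenspaces meet only in
  \<open>W\<close>, and the codimension drops.\<close>

lemma card_eigenvalues:
  assumes D: "linear D" and U: "sub U" "D ` U \<subseteq> U" and A: "is_scalars A"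
    and W: "sub W" "D ` W \<subseteq> W" "W \<subseteq> U" and m: "card U = q ^ m * card W"
  shows "card {a \<in> A. eigspace D W U a \<noteq> W} \<le> m"
  using W m
proof (induction m arbitrary: W rule: less_induct)
  case (less m)
  note W = less.prems(1-3)
  have finA: "finite A" using A by (simp add: is_scalars_def)
  show ?case
  proof (cases "\<exists>a\<in>A. eigspace D W U a \<noteq> W")
    case True
    then obtain a where a: "a \<in> A" "eigspace D W U a \<noteq> W" by blast
    let ?E = "eigspace D W U a"
    have E: "sub ?E" "W \<subseteq> ?E" "?E \<subseteq> U"
      using sub_eigspace[OF D W(1) U(1)] eigspace_superset[OF W(1,3,2)] by (auto simp: eigspace_def)
    have ED: "D ` ?E \<subseteq> ?E"
    proof
      fix y assume "y \<in> D ` ?E"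
      then obtain u where u: "u \<in> U" "D u - a \<star> u \<in> W" "y = D u" by (auto simp: eigspace_def)
      have "D (D u) - a \<star> D u = D (D u - a \<star> u)" using D by (simp add: linear_diff linear_scale)
      then show "y \<in> ?E" using u U W by (auto simp: eigspace_def)
    qed
    obtain j where j: "card ?E = q ^ j * card W" using card_pow[OF W(1) E(1,2)] .
    have "j \<noteq> 0" using j a E sub_card_eq[OF E(1,2)] by auto
    obtain i where i: "card U = q ^ i * card ?E" using card_pow[OF E(1) U(1) E(3)] .
    have "q ^ m * card W = q ^ (i + j) * card W" using i j less.prems(4) by (simp add: power_add mult.assoc)
    then have "q ^ m = q ^ (i + j)" using sub_card_pos[OF W(1)] by (metis mult_right_cancel less_irrefl)
    then have mij: "m = i + j" using q_pow_inj by blast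
    have IH: "card {b \<in> A. eigspace D ?E U b \<noteq> ?E} \<le> i"
      using less.IH[of i ?E] mij \<open>j \<noteq> 0\<close> E ED i by simp
    have "{b \<in> A. eigspace D W U b \<noteq> W} \<subseteq> insert a {b \<in> A. eigspace D ?E U b \<noteq> ?E}"
    proof
      fix b assume b: "b \<in> {b \<in> A. eigspace D W U b \<noteq> W}"
      show "b \<in> insert a {b \<in> A. eigspace D ?E U b \<noteq> ?E}"
      proof (cases "b = a")
        case False
        obtain u where u: "u \<in> eigspace D W U b" "u \<notin> W"
          using b eigspace_superset[OF W(1,3,2), of b] by blast
        then have "u \<notin> ?E" using eigspace_inter[OF A W(1) U(1), of a b u] a b False by blast
        moreover have "u \<in> eigspace D ?E U b" using u E by (auto simp: eigspace_def)
        ultimately show ?thesis using b by blast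
      qed simp
    qed
    then have "card {b \<in> A. eigspace D W U b \<noteq> W} \<le> card (insert a {b \<in> A. eigspace D ?E U b \<noteq> ?E})"
      using finA by (intro card_mono) auto
    also have "\<dots> \<le> 1 + i" using IH finA by (simp add: card_insert_if)
    finally show ?thesis using mij \<open>j \<noteq> 0\<close> by simp
  next
    case False
    then have "{a \<in> A. eigspace D W U a \<noteq> W} = {}" by blast
    then show ?thesis by (metis card.empty le0)
  qed
qed

text \<open>An eigenspace of dimension \<open>k\<close> over \<open>W\<close> holds 1 + q + ... +
  q^(k-1) lines, and there are at most three eigenvalues. Sorting the sum by powers of
  \<open>q\<close> gives the coefficients.\<close>

lemma card_eig:
  assumes D: "linear D" and U: "sub U" "D ` U \<subseteq> U"
    and W: "sub W" "D ` W \<subseteq> W" "W \<subseteq> U" and m: "card U = q ^ m * card W" "m \<le> 3"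
  obtains c0 c1 c2 where "c0 \<le> 3" "c1 \<le> 3" "c2 \<le> 3" "card (eig D W U) = c0 + c1 * q + c2 * q\<^sup>2"
proof (cases "V = {0}")
  case True
  have "eig D W U = {}"
  proof (rule equals0I)
    fix H assume "H \<in> eig D W U"
    then obtain h where "h \<notin> W" "h \<in> V" using atoms_ex[OF W(1), of H U] by (auto simp: eig_def)
    then show False using True W by auto
  qed
  then show ?thesis using that[of 0 0 0] by simp
next
  case False
  then obtain A where A: "is_scalars A" by (rule scalars_ex)
  then have finA: "finite A" by (simp add: is_scalars_def)
  have "\<forall>a. \<exists>k\<le>m. card (eigspace D W U a) = q ^ k * card W"
  proof
    fix a
    let ?E = "eigspace D W U a"
    have E: "sub ?E" "W \<subseteq> ?E" "?E \<subseteq> U"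
      using sub_eigspace[OF D W(1) U(1)] eigspace_superset[OF W(1,3,2)] by (auto simp: eigspace_def)
    obtain k where k: "card ?E = q ^ k * card W" using card_pow[OF W(1) E(1,2)] .
    have "q ^ k * card W \<le> q ^ m * card W" using sub_card_mono[OF U(1) E(3)] k m by simp
    then have "k \<le> m" using sub_card_pos[OF W(1)] q_pow_le by simp
    then show "\<exists>k\<le>m. card ?E = q ^ k * card W" using k by blast
  qed
  then obtain k where k: "\<And>a. k a \<le> m" "\<And>a. card (eigspace D W U a) = q ^ k a * card W" by metis
  define \<Lambda> where "\<Lambda> = {a \<in> A. eigspace D W U a \<noteq> W}"
  have fin\<Lambda>: "finite \<Lambda>" and \<Lambda>3: "card \<Lambda> \<le> 3"
    using finA card_eigenvalues[OF D U A W m(1)] m(2) by (auto simp: \<Lambda>_def)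
  \<comment> \<open>The number of eigenvalues whose eigenspace has dimension greater than
    \<open>j\<close> over \<open>W\<close>: each of these contributes one summand
    \<open>q ^ j\<close>.\<close>
  define c where "c j = card {a \<in> \<Lambda>. j < k a}" for j
  have c3: "c j \<le> 3" for j
    using card_mono[OF fin\<Lambda>, of "{a \<in> \<Lambda>. j < k a}"] \<Lambda>3 by (auto simp: c_def)
  have at: "card (atoms W (eigspace D W U a)) = qn q (k a)" for a
    using card_atoms[OF W(1) sub_eigspace[OF D W(1) U(1)] eigspace_superset[OF W(1,3,2)] k(2)] .
  have "card (eig D W U) = (\<Sum>a\<in>A. qn q (k a))"
    using card_eig_sum[OF D W(1,2) U(1) W(3) A] at by simp
  also have "\<dots> = (\<Sum>a\<in>\<Lambda>. qn q (k a))"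
  proof (rule sum.mono_neutral_right[OF finA])
    show "\<forall>i\<in>A - \<Lambda>. qn q (k i) = 0"
    proof
      fix i assume "i \<in> A - \<Lambda>"
      then have "card W = q ^ k i * card W" using k(2)[of i] by (simp add: \<Lambda>_def)
      then have "q ^ k i = q ^ 0" using sub_card_pos[OF W(1)] by simp
      then have "k i = 0" by (simp only: q_pow_inj)
      then show "qn q (k i) = 0" by simp
    qed
  qed (auto simp: \<Lambda>_def)
  also have "\<dots> = (\<Sum>a\<in>\<Lambda>. \<Sum>j<3. if j < k a then q ^ j else 0)"
  proof (rule sum.cong[OF refl])
    fix a
    have "{..<k a} = {j. j < 3 \<and> j < k a}" using k(1)[of a] m(2) by auto
    then show "qn q (k a) = (\<Sum>j<3. if j < k a then q ^ j else 0)"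
      unfolding qn_def by (auto simp: sum.If_cases Int_def intro!: sum.cong)
  qed
  also have "\<dots> = (\<Sum>j<3. \<Sum>a\<in>\<Lambda>. if j < k a then q ^ j else 0)" by (rule sum.swap)
  also have "\<dots> = (\<Sum>j<3. c j * q ^ j)"
    by (rule sum.cong[OF refl]) (simp add: sum.If_cases fin\<Lambda> c_def Int_def)
  also have "\<dots> = c 0 + c 1 * q + c 2 * q\<^sup>2" by (simp add: numeral_3_eq_3 numeral_2_eq_2)
  finally show ?thesis using that c3 by blast
qed

text \<open>
  The number of invariant hyperplanes with eigenvalue \<open>a\<close> on the quotient is governed by the corank
  of \<open>D - a\<close>, the number of invariant lines with eigenvalue \<open>a\<close> by its nullity.
\<close>

lemma card_invariant_hyperplanes:
  assumes D: "linear D" and U: "sub U" "D ` U \<subseteq> U"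
  shows "card {P \<in> coatoms {0} U. D ` P \<subseteq> P} = card (eig D {0} U)"
proof (cases "V = {0}")
  case True
  then have U0: "U = {0}" using sub_0[OF U(1)] sub_mem[OF U(1)] by auto
  have "coatoms {0} U = {}" "atoms {0} U = {}"
    using card_coatoms[of "{0}" U 0] card_atoms[of "{0}" U 0] U0 finite_atoms by auto
  then show ?thesis by (simp add: eig_def)
next
  case False
  then obtain A where A: "is_scalars A" by (rule scalars_ex)
  let ?I = "\<lambda>a. (\<lambda>u. D u - a \<star> u) ` U"
  have I: "sub (?I a)" "?I a \<subseteq> U" for a
  proof -
    show s: "?I a \<subseteq> U" using U by (auto intro!: sub_closed)
    show "sub (?I a)" using linear_image_sub[OF linear_shift[OF D] U(1)] s U(1) by (auto simp: sub_def)
  qed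
  \<comment> \<open>A hyperplane is invariant with eigenvalue \<open>a\<close> on the quotient
    exactly if it contains the image of \<open>D - a\<close>.\<close>
  have eq: "{P \<in> coatoms {0} U. D ` P \<subseteq> P} = (\<Union>a\<in>A. coatoms (?I a) U)"
  proof (intro equalityI subsetI)
    fix P assume P: "P \<in> {P \<in> coatoms {0} U. D ` P \<subseteq> P}"
    then have Ps: "sub P" "P \<subseteq> U" "card U = q * card P" "D ` P \<subseteq> P" by (auto simp: coatoms_def)
    have "card P < card U" using Ps sub_card_pos[OF Ps(1)] q2 by simp
    then obtain u where u: "u \<in> U" "u \<notin> P" using Ps by (metis less_irrefl subsetI subset_antisym)
    have uV: "u \<in> V" using u U sub_mem by blast
    have e: "U = adj u P" using adj_eqI[OF Ps(1) U(1) Ps(2,3) u] .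
    obtain a' where a': "D u - a' \<star> u \<in> P" using u U e adj_iff[OF Ps(1)] by blast
    obtain a where a: "a \<in> A" "\<forall>v\<in>V. a' \<star> v = a \<star> v" using scalars_rep[OF A] .
    have au: "D u - a \<star> u \<in> P" using a' a uV by simp
    have "D y - a \<star> y \<in> P" if y: "y \<in> U" for y
    proof -
      obtain w k where w: "w \<in> P" "y = w + k \<star> u" by (rule adjE[OF Ps(1), of y u]) (use y e in auto)
      have "D y - a \<star> y = (D w - a \<star> w) + k \<star> (D u - a \<star> u)"
        using w D by (simp add: linear_add linear_scale scale_right_distrib scale_right_diff_distrib
          mult.commute)
      then show ?thesis using w Ps au by (auto intro!: sub_closed)
    qed
    then show "P \<in> (\<Union>a\<in>A. coatoms (?I a) U)" using a Ps by (auto simp: coatoms_def)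
  next
    fix P assume "P \<in> (\<Union>a\<in>A. coatoms (?I a) U)"
    then obtain a where P: "P \<in> coatoms (?I a) U" by blast
    then have Ps: "sub P" "P \<subseteq> U" "?I a \<subseteq> P" by (auto simp: coatoms_def)
    have "D y \<in> P" if "y \<in> P" for y
    proof -
      have "D y - a \<star> y \<in> P" using that Ps by blast
      then have "(D y - a \<star> y) + a \<star> y \<in> P"
        using that by (intro sub_add[OF Ps(1)] sub_scale[OF Ps(1)])
      then show ?thesis by simp
    qed
    then show "P \<in> {P \<in> coatoms {0} U. D ` P \<subseteq> P}" using P by (auto simp: coatoms_def)
  qed
  have "card (\<Union>a\<in>A. coatoms (?I a) U) = (\<Sum>a\<in>A. card (coatoms (?I a) U))"
  proof (rule card_UN_disjoint)
    show "\<forall>a\<in>A. \<forall>b\<in>A. a \<noteq> b \<longrightarrow> coatoms (?I a) U \<inter> coatoms (?I b) U = {}"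
    proof (intro ballI impI equals0I)
      fix a b P assume ab: "a \<in> A" "b \<in> A" "a \<noteq> b" and "P \<in> coatoms (?I a) U \<inter> coatoms (?I b) U"
      then have Ps: "sub P" "P \<subseteq> U" "card U = q * card P" "?I a \<subseteq> P" "?I b \<subseteq> P"
        by (auto simp: coatoms_def)
      have "card P < card U" using Ps sub_card_pos[OF Ps(1)] q2 by simp
      then obtain u where u: "u \<in> U" "u \<notin> P" using Ps by (metis less_irrefl subsetI subset_antisym)
      then have "u \<in> eigspace D P U a" "u \<in> eigspace D P U b" using Ps by (auto simp: eigspace_def)
      then show False using eigspace_inter[OF A Ps(1) U(1) ab] u by blast
    qed
  qed (use A in \<open>auto simp: is_scalars_def\<close>)
  also have "\<dots> = (\<Sum>a\<in>A. card (atoms {0} (eigspace D {0} U a)))"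
  proof (rule sum.cong[OF refl])
    fix a
    have E: "eigspace D {0} U a = {u \<in> U. D u - a \<star> u = 0}" by (auto simp: eigspace_def)
    have Es: "sub (eigspace D {0} U a)" using sub_eigspace[OF D sub_zero U(1)] .
    obtain k where k: "card (eigspace D {0} U a) = q ^ k * card {0::'v}"
      using card_pow[OF sub_zero Es] Es by auto
    have "card U = card (?I a) * card (eigspace D {0} U a)"
      using rank_nullity[OF linear_shift[OF D] U(1)] E by simp
    then have "card U = q ^ k * card (?I a)" using k by simp
    then have "card (coatoms (?I a) U) = qn q k" using card_coatoms I U(1) by blast
    moreover have "card (atoms {0} (eigspace D {0} U a)) = qn q k"
      using card_atoms[OF sub_zero Es _ k] Es by simp
    ultimately show "card (coatoms (?I a) U) = card (atoms {0} (eigspace D {0} U a))" by simp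
  qed
  also have "\<dots> = card (eig D {0} U)"
    using card_eig_sum[OF D sub_zero _ U(1) _ A] linear_0[OF D] U(1) by simp
  finally show ?thesis using eq by simp
qed

end

section \<open>Finite Lie algebras\<close>

text \<open>The laws are asked of the whole type, and only closure is asked of \<open>V\<close>.
  Hence a closed subspace is again an instance with the same bracket, and results about
  \<open>V\<close> become available for \<open>der V\<close>.\<close>

locale finite_lie = finite_space scale V q
  for scale :: "'r::comm_ring_1 \<Rightarrow> 'v::ab_group_add \<Rightarrow> 'v" (infixr \<open>\<star>\<close> 75) and V q +
  fixes br :: "'v \<Rightarrow> 'v \<Rightarrow> 'v"
  assumes br_add_left: "br (x + y) z = br x z + br y z"
    and br_add_right: "br x (y + z) = br x y + br x z"
    and br_scale_left: "br (a \<star> x) y = a \<star> br x y"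
    and br_scale_right: "br x (a \<star> y) = a \<star> br x y"
    and br_self [simp]: "br x x = 0"
    and br_jacobi: "br x (br y z) + br y (br z x) + br z (br x y) = 0"
    and br_V: "x \<in> V \<Longrightarrow> y \<in> V \<Longrightarrow> br x y \<in> V"
begin

lemma br_anti: "br y x = - br x y"
proof -
  have "br (x + y) (x + y) = (br x x + br x y) + (br y x + br y y)"
    by (simp only: br_add_left br_add_right) (simp add: algebra_simps)
  then have "br x y + br y x = 0" by simp
  then show ?thesis by (simp add: add_eq_0_iff)
qed

lemma linear_br: "linear (br x)"
  by (simp add: module_hom_iff br_add_right br_scale_right module_axioms)

lemma br_0 [simp]: "br x 0 = 0" "br 0 x = 0"
  using linear_0[OF linear_br] br_anti[of 0 x] by simp_all

lemma br_neg: "br x (- y) = - br x y" "br (- x) y = - br x y"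
  using br_add_right[of x y "- y"] br_add_left[of x "- x" y] by (simp_all add: add_eq_0_iff)

lemma br_diff_right: "br x (y - z) = br x y - br x z"
  using linear_diff[OF linear_br] .

lemma br_diff_left: "br (x - y) z = br x z - br y z"
  using br_add_left[of x "- y" z] by (simp add: br_neg)

lemmas br_lin = br_add_left br_add_right br_scale_left br_scale_right br_diff_left br_diff_right br_neg

lemma br_derivation: "br x (br y z) = br (br x y) z + br y (br x z)"
  using br_jacobi[of x y z] br_anti[of z x] br_anti[of z "br x y"] by (simp add: br_neg algebra_simps)

definition closed :: "'v set \<Rightarrow> bool" where
  "closed H \<longleftrightarrow> (\<forall>x\<in>H. \<forall>y\<in>H. br x y \<in> H)"

definition ideal :: "'v set \<Rightarrow> bool" where
  "ideal H \<longleftrightarrow> (\<forall>x\<in>V. \<forall>y\<in>H. br x y \<in> H)"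

definition der :: "'v set \<Rightarrow> 'v set" where
  "der H = span {br x y | x y. x \<in> H \<and> y \<in> H}"

definition center :: "'v set" where
  "center = {z \<in> V. \<forall>v\<in>V. br v z = 0}"

definition subalgs :: "nat \<Rightarrow> 'v set set" where
  "subalgs k = {H. sub H \<and> closed H \<and> card H = q ^ k}"

definition ideals :: "nat \<Rightarrow> 'v set set" where
  "ideals k = {H. sub H \<and> ideal H \<and> card H = q ^ k}"

lemma finite_ideals [simp]: "finite (ideals k)"
  by (simp add: ideals_def)

lemma closed_V: "closed V" and ideal_V: "ideal V"
  by (auto simp: closed_def ideal_def br_V)

lemma der_gen: "x \<in> H \<Longrightarrow> y \<in> H \<Longrightarrow> br x y \<in> der H"
  unfolding der_def by (auto intro!: span_base)

lemma der_least: "sub W \<Longrightarrow> (\<And>x y. x \<in> H \<Longrightarrow> y \<in> H \<Longrightarrow> br x y \<in> W) \<Longrightarrow> der H \<subseteq> W"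
  unfolding der_def sub_def by (intro span_minimal) auto

lemma sub_der: "sub H \<Longrightarrow> sub (der H)"
  unfolding der_def by (rule sub_span) (auto simp: sub_mem br_V)

lemma der_mono: "H \<subseteq> K \<Longrightarrow> der H \<subseteq> der K"
  unfolding der_def by (intro span_mono) auto

lemma ideal_der: "der V \<subseteq> H \<Longrightarrow> sub H \<Longrightarrow> ideal H"
  unfolding ideal_def by (auto intro!: der_gen dest: sub_mem)

lemma ideal_closed: "sub H \<Longrightarrow> ideal H \<Longrightarrow> closed H"
  by (auto simp: ideal_def closed_def sub_mem)

lemma ideal_rev: "ideal H \<Longrightarrow> sub H \<Longrightarrow> x \<in> H \<Longrightarrow> y \<in> V \<Longrightarrow> br x y \<in> H"
  using br_anti[of x y] by (simp add: ideal_def sub_neg)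

lemma finite_lie_sub:
  assumes "sub U" "closed U"
  shows "finite_lie scale U q br"
proof -
  have "U \<subseteq> V" using assms by (simp add: sub_def)
  then show ?thesis
    using assms finite_subset[OF _ finV] kill card_line q2
    by unfold_locales
      (auto simp: sub_def br_add_left br_add_right br_scale_left br_scale_right br_jacobi closed_def
        subset_iff)
qed

lemma closed_adj:
  assumes W: "sub W" "closed W" and h: "h \<in> V" and n: "\<And>w. w \<in> W \<Longrightarrow> br h w \<in> adj h W"
  shows "closed (adj h W)"
  unfolding closed_def
proof (intro ballI)
  fix x y assume "x \<in> adj h W" "y \<in> adj h W"
  then obtain w k w' k' where w: "w \<in> W" "x = w + k \<star> h" "w' \<in> W" "y = w' + k' \<star> h"
    by (elim adjE[OF W(1)]) blast
  have a: "sub (adj h W)" using sub_adj[OF W(1) h] .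
  have 1: "br x y = br w w' + (k \<star> br h w' - k' \<star> br h w)"
    using w br_anti[of h w] by (simp add: br_lin algebra_simps)
  have "br w w' \<in> adj h W" using w W adj_superset[of W h] by (auto simp: closed_def)
  then show "br x y \<in> adj h W" unfolding 1 using w n a by (auto intro!: sub_closed)
qed

lemma subalgs_0: "card (subalgs 0) = 1" and ideals_0: "card (ideals 0) = 1"
proof -
  have "subalgs 0 = {{0}}" "ideals 0 = {{0}}"
    by (auto simp: subalgs_def ideals_def sub_card_1[simplified] closed_def ideal_def)
  then show "card (subalgs 0) = 1" "card (ideals 0) = 1" by simp_all
qed

lemma subalgs_top: "card V = q ^ n \<Longrightarrow> card (subalgs n) = 1"
  and ideals_top: "card V = q ^ n \<Longrightarrow> card (ideals n) = 1"
proof -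
  assume n: "card V = q ^ n"
  have "subalgs n = {V}" "ideals n = {V}"
    using n sub_card_eq[OF sub_V] closed_V ideal_V by (auto simp: subalgs_def ideals_def sub_def subV)
  then show "card (subalgs n) = 1" "card (ideals n) = 1" by simp_all
qed

lemma subalgs_1:
  assumes "card V = q ^ n"
  shows "card (subalgs 1) = qn q n"
proof -
  have "subalgs 1 = atoms {0} V"
  proof (intro equalityI subsetI)
    fix H assume H: "H \<in> atoms {0} V"
    obtain u where u: "u \<in> H" "u \<in> V" "u \<notin> {0}" "u \<in> V" using atoms_ex[OF sub_zero H] .
    have "closed (adj u {0})" by (rule closed_adj) (use u in \<open>auto simp: closed_def intro: span_zero\<close>)
    moreover have "H = adj u {0}" using atoms_adj[OF sub_zero H] u by auto
    ultimately show "H \<in> subalgs 1" using H by (auto simp: subalgs_def atoms_def)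
  qed (auto simp: subalgs_def atoms_def sub_mem)
  then show ?thesis using card_atoms[of "{0}" V n] assms by simp
qed

text \<open>The quotient by an ideal hyperplane is a line, on which any bracket vanishes.\<close>

lemma coatom_ideal:
  assumes H: "H \<in> coatoms {0} V" "ideal H"
  shows "der V \<subseteq> H"
proof -
  have Hs: "sub H" "card V = q * card H" using H by (auto simp: coatoms_def)
  have "card H < card V" using Hs sub_card_pos q2 by simp
  then obtain h where h: "h \<in> V" "h \<notin> H" 
    by (metis Hs(1) less_irrefl sub_def subsetI subset_antisym)
  have V: "V = adj h H" using coatom_adj[OF sub_V H(1) h] by simp
  show ?thesis
  proof (rule der_least[OF Hs(1)])
    fix x y assume xy: "x \<in> V" "y \<in> V"
    obtain w k where w: "w \<in> H" "x = w + k \<star> h" by (rule adjE[OF Hs(1), of x h]) (use xy V in auto)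
    obtain w' k' where w': "w' \<in> H" "y = w' + k' \<star> h" by (rule adjE[OF Hs(1), of y h]) (use xy V in auto)
    have "br x y = br x w' + k' \<star> br w h" using w w' by (simp add: br_lin)
    then show "br x y \<in> H"
      using w w' xy h H(2) Hs(1) ideal_rev[OF H(2) Hs(1)] by (auto simp: ideal_def intro!: sub_closed)
  qed
qed

lemma ideals_coatoms:
  assumes n: "card V = q ^ Suc n" and d: "card (der V) = q ^ d"
  shows "card (ideals n) = qn q (Suc n - d)"
proof -
  have sd: "sub (der V)" "der V \<subseteq> V" using sub_der[OF sub_V] by (auto simp: sub_def)
  have "ideals n = coatoms (der V) V"
  proof (intro equalityI subsetI)
    fix H assume H: "H \<in> ideals n"
    then have "H \<in> coatoms {0} V" using n by (auto simp: ideals_def coatoms_def sub_mem)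
    then show "H \<in> coatoms (der V) V" using coatom_ideal H by (auto simp: ideals_def coatoms_def)
  next
    fix H assume "H \<in> coatoms (der V) V"
    then show "H \<in> ideals n" using n q2 by (auto simp: ideals_def coatoms_def ideal_der)
  qed
  moreover obtain j where j: "j \<le> Suc n" "card (der V) = q ^ j"
      "card V = q ^ (Suc n - j) * card (der V)"
    using card_pow_sub[OF sd(1) sub_V sd(2) n] .
  moreover have "j = d" using j d q_pow_inj by simp
  ultimately show ?thesis using card_coatoms[OF sd(1) sub_V sd(2)] by simp
qed

text \<open>A subspace outside \<open>V0\<close> is an atom over its trace on \<open>V0\<close>, and
  over a trace of dimension \<open>k\<close> there are (q^(n+1) - q^n)/((q - 1) q^k) = q^(n-k) such
  atoms.\<close>

lemma card_over_hyperplane: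
  assumes V0: "V0 \<in> coatoms {0} V" and n: "card V = q ^ Suc n" and k: "k \<le> n"
  shows "card {H. sub H \<and> card H = q ^ Suc k \<and> \<not> H \<subseteq> V0 \<and> P (H \<inter> V0)}
    = q ^ (n - k) * card {W. sub W \<and> W \<subseteq> V0 \<and> card W = q ^ k \<and> P W}"
proof -
  let ?S = "{W. sub W \<and> W \<subseteq> V0 \<and> card W = q ^ k \<and> P W}"
  let ?F = "\<lambda>W. {H \<in> atoms W V. \<not> H \<subseteq> V0}"
  have V0s: "sub V0" "card V0 = q ^ n" using V0 n q2 by (auto simp: coatoms_def)
  have c: "card (?F W) = q ^ (n - k)" if "W \<in> ?S" for W
  proof (rule card_atoms_outside)
    have "q ^ n = q ^ (n - k) * q ^ k" using k by (simp add: power_add[symmetric])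
    then show "card V - card V0 = q ^ (n - k) * ((q - 1) * card W)"
      using V0s n that by (simp add: diff_mult_distrib algebra_simps)
  qed (use that V0s in \<open>auto simp: sub_mem\<close>)
  have i: "H \<inter> V0 = W" if "W \<in> ?S" "H \<in> ?F W" for H W
    using atoms_inter[of W V0 H V] that V0s by auto
  have eq: "{H. sub H \<and> card H = q ^ Suc k \<and> \<not> H \<subseteq> V0 \<and> P (H \<inter> V0)} = (\<Union>W\<in>?S. ?F W)"
  proof (intro equalityI subsetI)
    fix H assume H: "H \<in> {H. sub H \<and> card H = q ^ Suc k \<and> \<not> H \<subseteq> V0 \<and> P (H \<inter> V0)}"
    then have "H \<subseteq> V" by (simp add: sub_def)
    then have "card H = q * card (H \<inter> V0)" using coatom_inter[OF sub_V V0] H by blast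
    then have "H \<inter> V0 \<in> ?S" "H \<in> ?F (H \<inter> V0)"
      using H V0s q2 by (auto simp: sub_inter atoms_def sub_mem)
    then show "H \<in> (\<Union>W\<in>?S. ?F W)" by blast
  next
    fix H assume "H \<in> (\<Union>W\<in>?S. ?F W)"
    then obtain W where W: "W \<in> ?S" "H \<in> ?F W" by blast
    then show "H \<in> {H. sub H \<and> card H = q ^ Suc k \<and> \<not> H \<subseteq> V0 \<and> P (H \<inter> V0)}"
      using i[OF W] by (auto simp: atoms_def)
  qed
  have "card (\<Union>W\<in>?S. ?F W) = (\<Sum>W\<in>?S. card (?F W))"
  proof (rule card_UN_disjoint)
    show "\<forall>A\<in>?S. \<forall>B\<in>?S. A \<noteq> B \<longrightarrow> ?F A \<inter> ?F B = {}" using i by blast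
    show "finite ?S" by (rule finite_subs)
  qed simp
  also have "\<dots> = card ?S * q ^ (n - k)" using c by simp
  finally show ?thesis unfolding eq by simp
qed

subsection \<open>Abelian ideals of codimension one\<close>

text \<open>\<open>V\<close> is then an extension of a line by the abelian ideal \<open>V0\<close>,
  so its whole structure is the single operator \<open>br x\<close> on \<open>V0\<close>, for any
  \<open>x\<close> outside \<open>V0\<close>.\<close>

definition abelian_hyperplane :: "'v set \<Rightarrow> bool" where
  "abelian_hyperplane V0 \<longleftrightarrow> V0 \<in> coatoms {0} V \<and> der V \<subseteq> V0 \<and> (\<forall>x\<in>V0. \<forall>y\<in>V0. br x y = 0)"

text \<open>
  Coefficients up to 3 suffice for the number of invariant lines in dimension at most 3; the bound 4
  leaves room for a shift by 1.
\<close>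

definition eig_number :: "nat \<Rightarrow> bool" where
  "eig_number b \<longleftrightarrow> (\<exists>c0\<le>4. \<exists>c1\<le>4. \<exists>c2\<le>4. b = c0 + c1 * q + c2 * q\<^sup>2)"

lemma card_eig_number:
  assumes "linear D" "sub U" "D ` U \<subseteq> U" "sub W" "D ` W \<subseteq> W" "W \<subseteq> U" "card U = q ^ m * card W" "m \<le> 3"
  shows "eig_number (card (eig D W U))" "eig_number (Suc (card (eig D W U)))"
proof -
  obtain c0 c1 c2 where c: "c0 \<le> 3" "c1 \<le> 3" "c2 \<le> 3" "card (eig D W U) = c0 + c1 * q + c2 * q\<^sup>2"
    using card_eig[OF assms] .
  then have "c0 \<le> 4" "c1 \<le> 4" "c2 \<le> 4" by auto
  with c(4) show "eig_number (card (eig D W U))" unfolding eig_number_def by blast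
  have "Suc c0 \<le> 4" "c1 \<le> 4" "c2 \<le> 4" "Suc (card (eig D W U)) = Suc c0 + c1 * q + c2 * q\<^sup>2"
    using c by auto
  then show "eig_number (Suc (card (eig D W U)))" unfolding eig_number_def by blast
qed

context
  fixes V0 x n
  assumes ah: "abelian_hyperplane V0" and x: "x \<in> V" "x \<notin> V0" and n: "card V = q ^ Suc n"
begin

private lemma V0: "sub V0" "V0 \<subseteq> V" "card V0 = q ^ n" "V0 \<in> coatoms {0} V" "der V \<subseteq> V0"
  "y \<in> V0 \<Longrightarrow> z \<in> V0 \<Longrightarrow> br y z = 0"
  using ah n q2 by (auto simp: abelian_hyperplane_def coatoms_def)

private lemma V_eq: "adj x V0 = V"
  using coatom_adj[OF sub_V V0(4) x] .

private lemma V_E: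
  assumes "h \<in> V"
  obtains w k where "w \<in> V0" "h = w + k \<star> x"
  using adjE[OF V0(1)] assms V_eq by blast

private lemma D_V0: "y \<in> V \<Longrightarrow> br x y \<in> V0"
  using der_gen[of x V y] x V0 by auto

text \<open>Modulo \<open>V0\<close> the vector \<open>h\<close> is a multiple of \<open>x\<close>
  by an invertible scalar, and \<open>V0\<close> acts on itself as zero. So \<open>br h\<close> and
  \<open>br x\<close> agree on \<open>V0\<close> up to that scalar.\<close>

private lemma D_mem:
  assumes H: "sub H" and h: "h \<in> H" "h \<notin> V0" and y: "y \<in> V0" "br h y \<in> H"
  shows "br x y \<in> H"
proof -
  have hV: "h \<in> V" using h H sub_mem by blast
  obtain w k where w: "w \<in> V0" "h = w + k \<star> x" using V_E[OF hV] .
  have "k \<star> x \<noteq> 0" using w h by auto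
  then obtain b where b: "\<And>u. u \<in> V \<Longrightarrow> b \<star> k \<star> u = u" using inverse_ex[OF x(1)] by blast
  have yV: "y \<in> V" using y V0 by blast
  have "br h y = k \<star> br x y" using w y V0(6) by (simp add: br_lin)
  then have "b \<star> br h y = br x y" using b[OF br_V[OF x(1) yV]] by simp
  then show ?thesis using y H sub_scale by metis
qed

private lemma closed_iff:
  assumes H: "sub H" "\<not> H \<subseteq> V0"
  shows "closed H \<longleftrightarrow> br x ` (H \<inter> V0) \<subseteq> H \<inter> V0"
proof
  assume c: "closed H"
  obtain h where h: "h \<in> H" "h \<notin> V0" using H by blast
  show "br x ` (H \<inter> V0) \<subseteq> H \<inter> V0"
    using D_mem[OF H(1) h] c h D_V0 V0(2) by (auto simp: closed_def)
next
  assume D: "br x ` (H \<inter> V0) \<subseteq> H \<inter> V0"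
  obtain h where h: "h \<in> H" "h \<notin> V0" using H by blast
  have hV: "h \<in> V" using h H sub_mem by blast
  obtain w k where w: "w \<in> V0" "h = w + k \<star> x" using V_E[OF hV] .
  have s: "sub (H \<inter> V0)" using H V0 by (simp add: sub_inter)
  have "card H = q * card (H \<inter> V0)" using coatom_inter[OF sub_V V0(4) H(1) _ H(2)] H by (auto simp: sub_def)
  then have e: "H = adj h (H \<inter> V0)" using adj_eqI[OF s H(1)] h by simp
  have "closed (adj h (H \<inter> V0))"
  proof (rule closed_adj[OF s _ hV])
    show "closed (H \<inter> V0)" using V0(6) sub_0[OF s] by (auto simp: closed_def)
    fix v assume v: "v \<in> H \<inter> V0"
    then have "br h v = k \<star> br x v" using w V0(6) by (simp add: br_lin)
    moreover have "br x v \<in> adj h (H \<inter> V0)" using v D adj_superset[of "H \<inter> V0" h] by blast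
    ultimately show "br h v \<in> adj h (H \<inter> V0)" by (simp add: span_scale)
  qed
  then show "closed H" using e by simp
qed

text \<open>An element of \<open>H\<close> outside \<open>V0\<close>, bracketed with all of
  \<open>V0\<close>, produces the image of \<open>br x\<close>; this image is \<open>der V\<close>,
  and whatever contains it is an ideal.\<close>

private lemma ideal_iff:
  assumes H: "sub H" "\<not> H \<subseteq> V0"
  shows "ideal H \<longleftrightarrow> br x ` V0 \<subseteq> H \<inter> V0"
proof
  assume c: "ideal H"
  obtain h where h: "h \<in> H" "h \<notin> V0" using H by blast
  show "br x ` V0 \<subseteq> H \<inter> V0"
    using D_mem[OF H(1) h] D_V0 V0(2) h ideal_rev[OF c H(1)] by blast
next
  assume D: "br x ` V0 \<subseteq> H \<inter> V0"
  show "ideal H" unfolding ideal_def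
  proof (intro ballI)
    fix z y assume z: "z \<in> V" and y: "y \<in> H"
    obtain w k where w: "w \<in> V0" "z = w + k \<star> x" using V_E[OF z] .
    have "y \<in> V" using y H sub_mem by blast
    then obtain w' k' where w': "w' \<in> V0" "y = w' + k' \<star> x" using V_E by blast
    have "br z y = k \<star> br x w' - k' \<star> br x w"
      using w w' V0(6) br_anti[of x w] by (simp add: br_lin)
    then show "br z y \<in> H" using D w w' H by (auto intro!: sub_closed)
  qed
qed

private lemma ideal_inside_iff:
  assumes H: "sub H" "H \<subseteq> V0"
  shows "ideal H \<longleftrightarrow> br x ` H \<subseteq> H"
proof
  assume D: "br x ` H \<subseteq> H"
  show "ideal H" unfolding ideal_def
  proof (intro ballI)
    fix z y assume z: "z \<in> V" and y: "y \<in> H"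
    obtain w k where w: "w \<in> V0" "z = w + k \<star> x" using V_E[OF z] .
    have "br z y = k \<star> br x y" using w y H V0(6)[of w y] by (auto simp add: br_lin)
    then show "br z y \<in> H" using D y H by (auto intro!: sub_scale)
  qed
qed (use x in \<open>auto simp: ideal_def\<close>)

lemma der_abelian_hyperplane: "der V = br x ` V0"
proof
  have s: "sub (br x ` V0)" using linear_image_sub[OF linear_br V0(1)] D_V0 V0(2) by blast
  show "der V \<subseteq> br x ` V0"
  proof (rule der_least[OF s])
    fix z y assume z: "z \<in> V" and y: "y \<in> V"
    obtain w k where w: "w \<in> V0" "z = w + k \<star> x" using V_E[OF z] .
    obtain w' k' where w': "w' \<in> V0" "y = w' + k' \<star> x" using V_E[OF y] .
    have "br z y = br x (k \<star> w' - k' \<star> w)"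
      using w w' V0(6) br_anti[of x w] by (simp add: br_lin)
    then show "br z y \<in> br x ` V0" using w w' V0 by (auto intro!: imageI sub_closed)
  qed
  show "br x ` V0 \<subseteq> der V" using x V0(2) by (auto intro!: der_gen)
qed

text \<open>Inside \<open>V0\<close> every subspace is closed. Outside it only the trace on
  \<open>V0\<close> has to be invariant, and each trace arises \<open>q ^ (n - k)\<close>
  times.\<close>

lemma card_subalgs_abelian_hyperplane:
  assumes k: "k \<le> n"
  shows "card (subalgs (Suc k)) = card {W. sub W \<and> W \<subseteq> V0 \<and> card W = q ^ Suc k}
    + q ^ (n - k) * card {W. sub W \<and> W \<subseteq> V0 \<and> card W = q ^ k \<and> br x ` W \<subseteq> W}"
proof -
  have "subalgs (Suc k) = {W. sub W \<and> W \<subseteq> V0 \<and> card W = q ^ Suc k}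
      \<union> {H. sub H \<and> card H = q ^ Suc k \<and> \<not> H \<subseteq> V0 \<and> br x ` (H \<inter> V0) \<subseteq> H \<inter> V0}"
    (is "?I = ?A \<union> ?B")
  proof (intro equalityI subsetI)
    fix H assume "H \<in> ?A \<union> ?B"
    then show "H \<in> subalgs (Suc k)"
    proof
      assume "H \<in> ?A"
      then show ?thesis using V0(6) by (auto simp: subalgs_def closed_def subset_iff)
    qed (use closed_iff in \<open>auto simp: subalgs_def\<close>)
  qed (use closed_iff in \<open>auto simp: subalgs_def\<close>)
  moreover have "card (?A \<union> ?B) = card ?A + card ?B" by (rule card_Un_disjoint) auto
  ultimately show ?thesis
    using card_over_hyperplane[OF V0(4) n k, of "\<lambda>W. br x ` W \<subseteq> W"] by simp
qed

lemma card_ideals_abelian_hyperplane: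
  assumes k: "k \<le> n"
  shows "card (ideals (Suc k)) = card {W. sub W \<and> W \<subseteq> V0 \<and> card W = q ^ Suc k \<and> br x ` W \<subseteq> W}
    + q ^ (n - k) * card {W. sub W \<and> W \<subseteq> V0 \<and> card W = q ^ k \<and> der V \<subseteq> W}"
proof -
  have "ideals (Suc k) = {W. sub W \<and> W \<subseteq> V0 \<and> card W = q ^ Suc k \<and> br x ` W \<subseteq> W}
      \<union> {H. sub H \<and> card H = q ^ Suc k \<and> \<not> H \<subseteq> V0 \<and> der V \<subseteq> H \<inter> V0}"
    (is "?I = ?A \<union> ?B")
  proof (intro Set.set_eqI)
    fix H
    show "H \<in> ideals (Suc k) \<longleftrightarrow> H \<in> ?A \<union> ?B"
      using ideal_iff[of H] ideal_inside_iff[of H] der_abelian_hyperplane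
      by (cases "H \<subseteq> V0") (auto simp only: ideals_def mem_Collect_eq Un_iff)
  qed
  moreover have "card (?A \<union> ?B) = card ?A + card ?B" by (rule card_Un_disjoint) auto
  ultimately show ?thesis using card_over_hyperplane[OF V0(4) n k, of "\<lambda>W. der V \<subseteq> W"] by simp
qed

lemma card_invariant_lines:
  "{W. sub W \<and> W \<subseteq> V0 \<and> card W = q ^ Suc 0 \<and> br x ` W \<subseteq> W} = eig (br x) {0} V0"
  by (auto simp: eig_def atoms_def)

lemma eig_number_abelian_hyperplane: "n \<le> 3 \<Longrightarrow> eig_number (card (eig (br x) {0} V0))"
  using card_eig_number(1)[OF linear_br V0(1) _ sub_zero, of x n] D_V0 V0 by auto

text \<open>The kernel of \<open>br x\<close> on \<open>V0\<close> commutes with \<open>x\<close>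
  and with \<open>V0\<close>, so it is central; it is nonzero if the image \<open>der V\<close> is
  smaller than \<open>V0\<close>. In dimension four with a plane as \<open>der V\<close>, this
  separates the algebras with an abelian hyperplane from the self-centralising ones.\<close>

lemma center_abelian_hyperplane:
  assumes "card (der V) < card V0"
  shows "center \<noteq> {0}"
proof
  assume c: "center = {0}"
  have "card V0 = card (der V) * card {u \<in> V0. br x u = 0}"
    using rank_nullity[OF linear_br V0(1), of x] der_abelian_hyperplane by simp
  moreover have "{u \<in> V0. br x u = 0} \<subseteq> center"
  proof
    fix u assume u: "u \<in> {u \<in> V0. br x u = 0}"
    have "br v u = 0" if v: "v \<in> V" for v
    proof -
      obtain w k where "w \<in> V0" "v = w + k \<star> x" using V_E[OF v] .
      then show ?thesis using u V0(6) by (simp add: br_lin)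
    qed
    then show "u \<in> center" using u V0(2) by (auto simp: center_def)
  qed
  then have "{u \<in> V0. br x u = 0} = {0}" using c V0(1) by auto
  ultimately show False using assms by simp
qed

lemma card_subs_zero:
  "card {W. sub W \<and> W \<subseteq> V0 \<and> card W = q ^ 0 \<and> der V \<subseteq> W} = (if der V = {0} then 1 else 0)"
proof -
  have 1: "sub W \<and> card W = q ^ 0 \<longleftrightarrow> W = {0}" for W
    using sub_card_1[of W] by auto
  have "{W. sub W \<and> W \<subseteq> V0 \<and> card W = q ^ 0 \<and> der V \<subseteq> W} = {W. W = {0} \<and> W \<subseteq> V0 \<and> der V \<subseteq> W}"
  proof (rule Collect_cong)
    fix W
    show "(sub W \<and> W \<subseteq> V0 \<and> card W = q ^ 0 \<and> der V \<subseteq> W) = (W = {0} \<and> W \<subseteq> V0 \<and> der V \<subseteq> W)"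
      using 1[of W] by argo
  qed
  also have "\<dots> = (if der V = {0} then {{0}} else {})"
  proof (cases "der V = {0}")
    case False
    then have "\<not> der V \<subseteq> {0}" using sub_0[OF sub_der[OF sub_V]] by blast
    with False show ?thesis by simp
  qed (use sub_0[OF V0(1)] in auto)
  finally show ?thesis by simp
qed

lemma card_subs_top:
  "{W. sub W \<and> W \<subseteq> V0 \<and> card W = q ^ n} = {V0}"
  proof (intro equalityI subsetI)
  fix W assume "W \<in> {W. sub W \<and> W \<subseteq> V0 \<and> card W = q ^ n}"
  then show "W \<in> {V0}" using sub_card_eq[OF V0(1), of W] V0(3) by simp
qed (use V0(1,3) in simp)

end

lemma counts_3:
  assumes n: "card V = q ^ 3" and ah: "abelian_hyperplane V0" and d: "card (der V) = q ^ d"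
  obtains b where "eig_number b" "card (subalgs 2) = 1 + b * q"
    "card (ideals 1) = b + (if d = 0 then q\<^sup>2 else 0)"
proof -
  have n': "card V = q ^ Suc 2" using n by (simp add: numeral_3_eq_3)
  have V0: "sub V0" "card V = q * card V0" using ah by (auto simp: abelian_hyperplane_def coatoms_def)
  have "card V0 < card V" using V0 sub_card_pos[of V0] q2 by simp
  then obtain x where x: "x \<in> V" "x \<notin> V0" by (metis V0(1) less_irrefl sub_def subsetI subset_antisym)
  let ?b = "card (eig (br x) {0} V0)"
  have d0: "der V = {0} \<longleftrightarrow> d = 0"
    using sub_card_1[OF sub_der[OF sub_V]] d q2 by auto
  show ?thesis
  proof (rule that)
    show "eig_number ?b" using eig_number_abelian_hyperplane[OF ah x n'] by simp
    have "{W. sub W \<and> W \<subseteq> V0 \<and> card W = q ^ Suc 1} = {V0}"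
      using card_subs_top[OF ah x n'] by (simp add: numeral_2_eq_2)
    then show "card (subalgs 2) = 1 + ?b * q"
      using card_subalgs_abelian_hyperplane[OF ah x n', of 1] card_invariant_lines[OF ah x n']
      by (simp add: numeral_2_eq_2)
    show "card (ideals 1) = ?b + (if d = 0 then q\<^sup>2 else 0)"
      using card_ideals_abelian_hyperplane[OF ah x n', of 0] card_invariant_lines[OF ah x n']
        card_subs_zero[OF ah x n'] d0 by simp
  qed
qed

text \<open>Subalgebras of dimension 3 see the invariant planes of \<open>V0\<close>, those of
  dimension 2 its invariant lines. \<open>card_invariant_hyperplanes\<close> makes both numbers the
  same \<open>b\<close>.\<close>

lemma counts_4:
  assumes n: "card V = q ^ 4" and ah: "abelian_hyperplane V0" and d: "card (der V) = q ^ d"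
  obtains b where "eig_number b" "card (subalgs 3) = 1 + b * q" "card (subalgs 2) = qn q 3 + b * q\<^sup>2"
    "card (ideals 2) = b + (if d = 0 then qn q 3 else if d = 1 then 1 else 0) * q\<^sup>2"
    "card (ideals 1) = b + (if d = 0 then q ^ 3 else 0)"
proof -
  have n': "card V = q ^ Suc 3" using n by (simp add: eval_nat_numeral)
  have V0: "sub V0" "card V0 = q ^ 3" "der V \<subseteq> V0" "V0 \<subseteq> V" 
    using ah q2 n' by (auto simp: abelian_hyperplane_def coatoms_def numeral_3_eq_3)
  have "card V0 < card V" using V0 n' sub_card_pos[of V0] q2 by simp
  then obtain x where x: "x \<in> V" "x \<notin> V0" by (metis V0(1) less_irrefl sub_def subsetI subset_antisym)
  let ?b = "card (eig (br x) {0} V0)"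
  have sd: "sub (der V)" by (simp add: sub_der)
  have d0: "der V = {0} \<longleftrightarrow> d = 0"
    using sub_card_1[OF sd] d q2 by auto
  have i1: "card (coatoms {0} V0) = qn q 3" using card_coatoms[of "{0}" V0 3] V0 by simp
  have DV0: "br x ` V0 \<subseteq> V0" using der_abelian_hyperplane[OF ah x n'] V0 by simp
  have 2: "{W. sub W \<and> W \<subseteq> V0 \<and> card W = q\<^sup>2 \<and> br x ` W \<subseteq> W} = {P \<in> coatoms {0} V0. br x ` P \<subseteq> P}"
    using V0 q2 by (auto simp: coatoms_def numeral_3_eq_3 numeral_2_eq_2)
  have 3: "{W. sub W \<and> W \<subseteq> V0 \<and> card W = q\<^sup>2} = coatoms {0} V0"
    using V0 q2 by (auto simp: coatoms_def numeral_3_eq_3 numeral_2_eq_2)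
  have b2: "card {P \<in> coatoms {0} V0. br x ` P \<subseteq> P} = ?b"
    using card_invariant_hyperplanes[OF linear_br V0(1) DV0] .
  \<comment> \<open>The traces on \<open>V0\<close> of the two-dimensional ideals outside
    \<open>V0\<close>: lines that contain \<open>der V\<close>, hence none for \<open>d\<close>
    above 1.\<close>
  have 4: "card {W. sub W \<and> W \<subseteq> V0 \<and> card W = q ^ 1 \<and> der V \<subseteq> W}
      = (if d = 0 then qn q 3 else if d = 1 then 1 else 0)" (is "card ?L = _")
  proof (cases d)
    case 0
    then have "?L = atoms {0} V0" using d0 by (auto simp: atoms_def)
    then show ?thesis using 0 card_atoms[of "{0}" V0 3] V0 by simp
  next
    case (Suc e)
    show ?thesis
    proof (cases e)
      case 0
      then have "?L = {W. sub W \<and> W \<subseteq> V0 \<and> card W = card (der V) \<and> der V \<subseteq> W}"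
        using Suc d by simp
      also have "\<dots> = {der V}"
      proof (intro equalityI subsetI)
        fix W assume "W \<in> {W. sub W \<and> W \<subseteq> V0 \<and> card W = card (der V) \<and> der V \<subseteq> W}"
        then show "W \<in> {der V}" using sub_card_eq[of W "der V"] by simp
      qed (use sd V0(3) in simp)
      finally have "?L = {der V}" .
      then show ?thesis using Suc 0 by simp
    next
      case (Suc e')
      have "W \<notin> ?L" for W
      proof
        assume W: "W \<in> ?L"
        then have "q ^ d \<le> q ^ 1" using sub_card_mono[of W "der V"] d by auto
        then have "d \<le> 1" by (simp only: q_pow_le)
        then show False using Suc \<open>d = Suc e\<close> by simp
      qed
      then have "?L = {}" by blast
      then show ?thesis using Suc \<open>d = Suc e\<close> by (metis card.empty nat.distinct(1) nat.inject One_nat_def)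
    qed
  qed
  show ?thesis
  proof (rule that)
    show "eig_number ?b" using eig_number_abelian_hyperplane[OF ah x n'] by simp
    show "card (subalgs 3) = 1 + ?b * q"
      using card_subalgs_abelian_hyperplane[OF ah x n', of 2] card_subs_top[OF ah x n'] 2 b2
      by (simp add: numeral_3_eq_3 numeral_2_eq_2)
    show "card (subalgs 2) = qn q 3 + ?b * q\<^sup>2"
      using card_subalgs_abelian_hyperplane[OF ah x n', of 1] card_invariant_lines[OF ah x n'] 3 i1
      by (simp add: numeral_2_eq_2)
    show "card (ideals 2) = ?b + (if d = 0 then qn q 3 else if d = 1 then 1 else 0) * q\<^sup>2"
      using card_ideals_abelian_hyperplane[OF ah x n', of 1] 2 b2 4 by (simp add: numeral_2_eq_2)
    show "card (ideals 1) = ?b + (if d = 0 then q ^ 3 else 0)"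
      using card_ideals_abelian_hyperplane[OF ah x n', of 0] card_invariant_lines[OF ah x n']
        card_subs_zero[OF ah x n'] d0 by simp
  qed
qed

end

context finite_lie
begin

subsection \<open>Existence of abelian hyperplanes\<close>

lemma lineE:
  assumes "sub H" "card H = q" "z \<in> H" "z \<noteq> 0" "y \<in> H"
  obtains k where "y = k \<star> z"
proof -
  have "H = adj z {0}" using adj_eqI[of "{0}" H z] assms by auto
  then obtain w k where "w \<in> {0}" "y = w + k \<star> z" using adjE[OF sub_zero, of y z] assms(5) by blast
  then show ?thesis using that by simp
qed

lemma line_span:
  assumes "sub H" "card H = q" "z \<in> H" "z \<noteq> 0" "sub W" "z \<in> W"
  shows "H \<subseteq> W"
proof
  fix y assume "y \<in> H"
  then obtain k where "y = k \<star> z" by (rule lineE[OF assms(1-4)])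
  then show "y \<in> W" using assms by (simp add: sub_scale)
qed

lemma q_less: "q < q\<^sup>2"
  using q2 power_strict_increasing[of 1 2 q] by simp

lemma not_trivial: "2 \<le> card H \<Longrightarrow> H \<noteq> {0::'v}"
  by auto

lemma ex_nonzero:
  assumes "sub H" "H \<noteq> {0}"
  obtains z where "z \<in> H" "z \<noteq> 0"
  using assms sub_0[OF assms(1)] by blast

lemma ex_outside:
  assumes "sub H" "sub U" "card H < card U"
  obtains x where "x \<in> U" "x \<notin> H"
  using assms by (metis card_mono not_less subsetI sub_finite)

lemma coatom_outside:
  assumes "H \<in> coatoms W V"
  obtains x where "x \<in> V" "x \<notin> H"
proof -
  have H: "sub H" "card V = q * card H" using assms by (auto simp: coatoms_def)
  then have "card H < card V" using sub_card_pos[OF H(1)] q2 by simp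
  then show ?thesis using ex_outside[OF H(1) sub_V] that by blast
qed

lemma kernel_card:
  assumes D: "linear D" and U: "sub U" and L: "sub L" "card L = q" "D ` U \<subseteq> L"
    and v: "v \<in> U" "D v \<noteq> 0"
  shows "card U = q * card {u \<in> U. D u = 0}" "D ` U = L"
proof -
  have s: "sub (D ` U)" using linear_image_sub[OF D U] L by (auto simp: sub_def)
  show e: "D ` U = L"
    using line_span[OF L(1,2) _ v(2) s] v L(3) by blast
  show "card U = q * card {u \<in> U. D u = 0}" using rank_nullity[OF D U] e L by simp
qed

lemma der_zero: "der U = {0} \<Longrightarrow> x \<in> U \<Longrightarrow> y \<in> U \<Longrightarrow> br x y = 0"
  using der_gen by blast

lemma der_nonzero:
  assumes "der U \<noteq> {0}" "sub U"
  obtains x y where "x \<in> U" "y \<in> U" "br x y \<noteq> 0"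
proof -
  have "\<not> (\<forall>x\<in>U. \<forall>y\<in>U. br x y = 0)"
  proof
    assume "\<forall>x\<in>U. \<forall>y\<in>U. br x y = 0"
    then have "der U \<subseteq> {0}" by (intro der_least) auto
    then show False using assms sub_0[OF sub_der[OF assms(2)]] by blast
  qed
  then show ?thesis using that by blast
qed

lemma abelian_hyperplane_der_0:
  assumes "card V = q ^ Suc n" "der V = {0}"
  obtains V0 where "abelian_hyperplane V0"
proof -
  obtain T where T: "sub T" "T \<subseteq> V" "card T = q ^ n * card {0::'v}"
    using ex_between[of "{0}" V "Suc n" n] assms by auto
  then have "abelian_hyperplane T"
    using assms der_zero[OF assms(2)] by (auto simp: abelian_hyperplane_def coatoms_def subset_iff)
  then show ?thesis by (rule that)
qed

lemma abelian_adj: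
  assumes P: "sub P" "\<And>x y. x \<in> P \<Longrightarrow> y \<in> P \<Longrightarrow> br x y = 0" and h: "\<And>x. x \<in> P \<Longrightarrow> br h x = 0"
    and xy: "x \<in> adj h P" "y \<in> adj h P"
  shows "br x y = 0"
proof -
  obtain w k where w: "w \<in> P" "x = w + k \<star> h" by (rule adjE[OF P(1) xy(1)])
  obtain w' k' where w': "w' \<in> P" "y = w' + k' \<star> h" by (rule adjE[OF P(1) xy(2)])
  show ?thesis using w w' P(2)[of w w'] h[of w'] h[of w] br_anti[of h w] by (simp add: br_lin)
qed

text \<open>\<open>P\<close> is spanned by \<open>z\<close> and at most one further vector, and
  \<open>z\<close> commutes with both.\<close>

lemma abelian_plane:
  assumes P: "sub P" "card P \<le> q\<^sup>2" and z: "z \<in> P" "z \<noteq> 0" "\<And>v. v \<in> P \<Longrightarrow> br z v = 0"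
    and xy: "x \<in> P" "y \<in> P"
  shows "br x y = 0"
proof -
  let ?L = "adj z {0}"
  have zV: "z \<in> V" using P z sub_mem by blast
  have L: "sub ?L" "card ?L = q" using sub_adj[OF sub_zero zV] card_adj[OF sub_zero zV] z by auto
  have Lab: "br v w = 0" if "v \<in> ?L" "w \<in> ?L" for v w
    by (rule abelian_adj[of "{0}" z]) (use that in auto)
  have Lz: "br v w = 0" if v: "v \<in> ?L" and w: "w \<in> P" for v w
  proof -
    obtain k where "v = k \<star> z" using lineE[OF L, of z v] z v by auto
    then show ?thesis using z w by (simp add: br_lin)
  qed
  show ?thesis
  proof (cases "P \<subseteq> ?L")
    case True
    then show ?thesis using Lab xy by blast
  next
    case False
    then obtain p where p: "p \<in> P" "p \<notin> ?L" by blast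
    have pV: "p \<in> V" using P p sub_mem by blast
    have "adj p ?L \<subseteq> P" using adj_least P z p by (metis empty_subsetI insert_subset sub_0)
    moreover have "card (adj p ?L) = q\<^sup>2" using card_adj[OF L(1) pV p(2)] L by (simp add: power2_eq_square)
    ultimately have "adj p ?L = P" using P sub_card_mono[OF P(1)] sub_card_eq[OF P(1)] by (metis le_antisym)
    moreover have "br p v = 0" if "v \<in> ?L" for v
      using Lz[OF that p(1)] br_anti[of v p] by simp
    ultimately show ?thesis using abelian_adj[OF L(1) Lab] xy by blast
  qed
qed

text \<open>Let \<open>z\<close> span the line \<open>der V\<close>. If \<open>z\<close> is not
  central, its centralizer is the hyperplane. If it is central, take \<open>x\<close> and
  \<open>w\<close> that do not commute: the hyperplane is spanned by \<open>x\<close> and the common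
  centralizer of \<open>x\<close> and \<open>w\<close>.\<close>

lemma abelian_hyperplane_der_1:
  assumes n: "card V = q ^ Suc (Suc n)" "n \<le> 2" and d: "card (der V) = q"
  obtains V0 where "abelian_hyperplane V0"
proof -
  have s: "sub (der V)" by (simp add: sub_der)
  have "der V \<noteq> {0}" using d q2 not_trivial[of "der V"] by simp
  then obtain z where z: "z \<in> der V" "z \<noteq> 0" using ex_nonzero[OF s] by blast
  have zV: "z \<in> V" using z s sub_mem by blast
  have brd: "br x y \<in> der V" if "x \<in> V" "y \<in> V" for x y using that by (rule der_gen)
  obtain V0 where "abelian_hyperplane V0"
  proof (cases "\<exists>x\<in>V. br z x \<noteq> 0")
    case True
    then obtain x where x: "x \<in> V" "br z x \<noteq> 0" by blast
    let ?C = "{v \<in> V. br z v = 0}"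
    have C: "card V = q * card ?C"
      using kernel_card(1)[OF linear_br sub_V s d _ x] brd zV by blast
    have sC: "sub ?C" using linear_vimage_sub[OF linear_br sub_V sub_zero, of z] by simp
    obtain k where k: "br x z = k \<star> z" using lineE[OF s d z] brd[OF x(1) zV] by blast
    have kz: "k \<star> z \<noteq> 0" using x k br_anti[of z x] by simp
    have "abelian_hyperplane ?C"
      unfolding abelian_hyperplane_def
    proof (intro conjI ballI)
      show "?C \<in> coatoms {0} V" using C sC by (auto simp: coatoms_def)
      show "der V \<subseteq> ?C" using line_span[OF s d z sC] zV by simp
    next
      fix a b assume a: "a \<in> ?C" and b: "b \<in> ?C"
      obtain l where l: "br a b = l \<star> z" using lineE[OF s d z] brd a b by blast
      obtain i where i: "br x a = i \<star> z" using lineE[OF s d z] brd[OF x(1)] a by blast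
      obtain j where j: "br x b = j \<star> z" using lineE[OF s d z] brd[OF x(1)] b by blast
      have "br a z = 0" using a br_anti[of z a] by simp
      \<comment> \<open>By the derivation rule, since \<open>br x\<close> maps \<open>a\<close> and
        \<open>b\<close> to multiples of \<open>z\<close>, with which both commute. As
        \<open>x\<close> scales \<open>z\<close> by an invertible \<open>k\<close>, the bracket of
        \<open>a\<close> and \<open>b\<close> must vanish.\<close>
      then have "br x (br a b) = 0" using a b i j by (simp add: br_derivation[of x a b] br_lin)
      then have "l \<star> k \<star> z = 0" using l k by (simp add: br_lin)
      then have "l \<star> z = 0" using kill[of l "k \<star> z" z] kz zV sub_scale[OF sub_V zV] by blast
      then show "br a b = 0" using l by simp
    qed
    then show ?thesis by (rule that)
  next
    case False
    then have zc: "br z x = 0" if "x \<in> V" for x using that by blast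
    obtain x w where xw: "x \<in> V" "w \<in> V" "br x w \<noteq> 0" using der_nonzero[OF \<open>der V \<noteq> {0}\<close> sub_V] by blast
    let ?C = "{v \<in> V. br x v = 0}" and ?P = "{v \<in> {v \<in> V. br x v = 0}. br w v = 0}"
    have C: "card V = q * card ?C"
      using kernel_card(1)[OF linear_br sub_V s d _ xw(2,3)] brd xw by blast
    have sC: "sub ?C" using linear_vimage_sub[OF linear_br sub_V sub_zero, of x] by simp
    have xC: "x \<in> ?C" "br w x \<noteq> 0" using xw br_anti[of x w] by auto
    have P: "card ?C = q * card ?P"
      using kernel_card(1)[OF linear_br sC s d _ xC] brd xw by blast
    have sP: "sub ?P" using linear_vimage_sub[OF linear_br sC sub_zero, of w] by simp
    have zP: "z \<in> ?P" using zV zc[OF xw(1)] zc[OF xw(2)] br_anti[of z x] br_anti[of z w] by simp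
    have "q * (q * q ^ n) = q * (q * card ?P)" using n C P by auto
    moreover have "0 < q" using q2 by simp
    ultimately have "q ^ n = card ?P" by (simp only: nat_mult_eq_cancel1)
    then have "card ?P = q ^ n" by (rule sym)
    \<comment> \<open>The bound on the dimension enters here: \<open>?P\<close> is at most a plane
      and contains the central \<open>z\<close>, so it is abelian.\<close>
    then have "card ?P \<le> q\<^sup>2" using n(2) q_pow_le[of n 2] by simp
    then have abP: "br a b = 0" if "a \<in> ?P" "b \<in> ?P" for a b
      using abelian_plane[OF sP _ zP z(2) _ that] zc by simp
    have "abelian_hyperplane (adj x ?P)"
      unfolding abelian_hyperplane_def
    proof (intro conjI ballI)
      have "sub (adj x ?P)" "card (adj x ?P) = q * card ?P"
        using sub_adj[OF sP xw(1)] card_adj[OF sP xw(1)] xC by auto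
      then show "adj x ?P \<in> coatoms {0} V" using C P by (auto simp: coatoms_def sub_mem)
      show "der V \<subseteq> adj x ?P" using line_span[OF s d z sP zP] adj_superset by blast
    next
      fix a b assume ab: "a \<in> adj x ?P" "b \<in> adj x ?P"
      show "br a b = 0"
      proof (rule abelian_adj[OF sP _ _ ab])
        show "br v v' = 0" if "v \<in> ?P" "v' \<in> ?P" for v v' by (rule abP[OF that])
        show "br x v = 0" if "v \<in> ?P" for v using that by blast
      qed
    qed
    then show ?thesis by (rule that)
  qed
  then show ?thesis by (rule that)
qed

text \<open>On the line of \<open>y\<close> the elements of \<open>V\<close> act by scalars. Scalars
  commute, so brackets act as zero.\<close>

lemma der_kills_line:
  assumes y: "y \<in> V" and l: "\<And>v. v \<in> V \<Longrightarrow> \<exists>k. br v y = k \<star> y" and u: "u \<in> der V"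
  shows "br u y = 0"
proof -
  have "der V \<subseteq> {u \<in> V. br y u \<in> {0}}"
  proof (rule der_least)
    show "sub {u \<in> V. br y u \<in> {0}}" by (rule linear_vimage_sub[OF linear_br sub_V sub_zero])
    fix g h assume gh: "g \<in> V" "h \<in> V"
    obtain i j where ij: "br g y = i \<star> y" "br h y = j \<star> y" using l gh by metis
    have "br (br g h) y = br g (br h y) - br h (br g y)"
      using br_derivation[of g h y] by simp
    also have "\<dots> = 0" using ij by (simp add: br_lin mult.commute)
    finally show "br g h \<in> {u \<in> V. br y u \<in> {0}}" using br_V gh br_anti[of "br g h" y] by simp
  qed
  then have "br y u = 0" using u by auto
  then show ?thesis using br_anti[of y u] by simp
qed

lemma plane_basis:
  assumes "sub U" "card U = q\<^sup>2" "a \<in> U" "a \<noteq> 0" "b \<in> U" "b \<notin> adj a {0}" "y \<in> U"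
  obtains k l where "y = k \<star> a + l \<star> b"
proof -
  have aV: "a \<in> V" using assms sub_mem by blast
  have L: "sub (adj a {0})" "card (adj a {0}) = q" 
    using sub_adj[OF sub_zero aV] card_adj[OF sub_zero aV] assms by auto
  have "adj a {0} \<subseteq> U" using assms by (intro adj_least) auto
  then have "U = adj b (adj a {0})" using assms L by (intro adj_eqI) (auto simp: power2_eq_square)
  then obtain w l where w: "w \<in> adj a {0}" "y = w + l \<star> b" using adjE[OF L(1)] assms(7) by blast
  then obtain k where "w = k \<star> a" using lineE[OF L, of a w] assms by auto
  then show ?thesis using that w by simp
qed

lemma plane_independent:
  assumes "a \<in> V" "b \<in> V" "b \<notin> adj a {0}" "k \<star> a + l \<star> b = 0"
  shows "k \<star> a = 0" "l \<star> b = 0"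
proof -
  have "l \<star> b = (- k) \<star> a" using assms(4) by (simp add: add_eq_0_iff add.commute)
  then have "l \<star> b \<in> adj a {0}" by (metis adj_self span_scale)
  then show "l \<star> b = 0" using scale_mem[OF sub_adj[OF sub_zero assms(1)] assms(2)] assms(3) by blast
  then show "k \<star> a = 0" using assms(4) by simp
qed

lemma plane_ex_basis:
  assumes "sub U" "card U = q\<^sup>2"
  obtains a b where "a \<in> U" "a \<noteq> 0" "b \<in> U" "b \<notin> adj a {0}" "a \<in> V" "b \<in> V"
proof -
  have "1 * 2 \<le> q * q" using q2 by (intro mult_le_mono) auto
  then have "U \<noteq> {0}" using assms(2) not_trivial[of U] by (simp add: power2_eq_square)
  then obtain a where a: "a \<in> U" "a \<noteq> 0" using ex_nonzero[OF assms(1)] by blast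
  have aV: "a \<in> V" using a assms sub_mem by blast
  have L: "sub (adj a {0})" "card (adj a {0}) = q" 
    using sub_adj[OF sub_zero aV] card_adj[OF sub_zero aV] a by auto
  then have "card (adj a {0}) < card U" using assms q2 by (simp add: power2_eq_square)
  then obtain b where "b \<in> U" "b \<notin> adj a {0}" using ex_outside[OF L(1) assms(1)] by blast
  then show ?thesis using that a aV assms sub_mem by blast
qed

text \<open>All brackets inside the plane \<open>der V\<close> are multiples of one bracket
  \<open>y\<close>. By the derivation rule every element of \<open>V\<close> scales
  \<open>y\<close>, so \<open>der V\<close> kills \<open>y\<close>. But the brackets of the basis
  vectors with \<open>y\<close> are, up to sign, the coordinates of \<open>y\<close> times
  \<open>y\<close>; hence \<open>y = 0\<close>.\<close>

lemma der_2_abelian: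
  assumes d: "card (der V) = q\<^sup>2" and uw: "u \<in> der V" "w \<in> der V"
  shows "br u w = 0"
proof -
  let ?U = "der V"
  have s: "sub ?U" by (simp add: sub_der)
  obtain a b where ab: "a \<in> ?U" "a \<noteq> 0" "b \<in> ?U" "b \<notin> adj a {0}" "a \<in> V" "b \<in> V"
    using plane_ex_basis[OF s d] .
  define y where "y = br a b"
  have ba: "br b a = - y" using br_anti[of a b] by (simp add: y_def)
  have U: "\<exists>k. br g h = k \<star> y" if g: "g \<in> ?U" and h: "h \<in> ?U" for g h
  proof -
    obtain k l where kl: "g = k \<star> a + l \<star> b" using plane_basis[OF s d ab(1-4) g] .
    obtain k' l' where kl': "h = k' \<star> a + l' \<star> b" using plane_basis[OF s d ab(1-4) h] .
    have "br g h = (k * l' - l * k') \<star> y"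
      unfolding kl kl' using ba by (simp add: br_lin y_def[symmetric] algebra_simps)
    then show ?thesis by blast
  qed
  have yU: "y \<in> ?U" unfolding y_def using ab by (intro der_gen)
  have "\<exists>k. br v y = k \<star> y" if v: "v \<in> V" for v
  proof -
    obtain k where k: "br (br v a) b = k \<star> y" using U[OF der_gen[OF v ab(5)] ab(3)] by blast
    obtain l where l: "br a (br v b) = l \<star> y" using U[OF ab(1) der_gen[OF v ab(6)]] by blast
    have "br v y = (k + l) \<star> y" unfolding y_def br_derivation[of v a b] k l
      using k l by (simp add: y_def scale_left_distrib)
    then show ?thesis by blast
  qed
  then have ky: "br g y = 0" if "g \<in> ?U" for g using der_kills_line[of y g] yU s sub_mem that by blast
  have "y = 0"
  proof -
    obtain k l where kl: "y = k \<star> a + l \<star> b" using plane_basis[OF s d ab(1-4) yU] .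
    have yV: "y \<in> V" using yU s sub_mem by blast
    have "br a y = l \<star> y" "br b y = - (k \<star> y)"
      by (subst kl, use ba in \<open>simp add: br_lin y_def[symmetric] scale_minus_right\<close>)+
    then have "l \<star> y = 0" "k \<star> y = 0" using ky ab by auto
    then have "y \<noteq> 0 \<Longrightarrow> l \<star> b = 0 \<and> k \<star> a = 0" using kill[of l y b] kill[of k y a] ab yV by blast
    then show ?thesis using kl by (metis add.right_neutral)
  qed
  then show ?thesis using U[OF uw] by auto
qed

subsection \<open>Self-centralising derived algebra of dimension two\<close>

definition self_centralising :: bool where
  "self_centralising \<longleftrightarrow> (\<forall>v\<in>V. (\<forall>u\<in>der V. br v u = 0) \<longrightarrow> v \<in> der V)"

text \<open>A vector outside the abelian plane \<open>der V\<close> that centralizes it spans,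
  together with it, an abelian hyperplane; if there is none, \<open>der V\<close> contains its own
  centralizer.\<close>

lemma der_2_cases:
  assumes n: "card V = q ^ 4" and d: "card (der V) = q\<^sup>2"
  obtains V0 where "abelian_hyperplane V0" | "self_centralising"
proof (cases self_centralising)
  case False
  let ?U = "der V"
  have s: "sub ?U" by (simp add: sub_der)
  have U: "br u w = 0" if "u \<in> ?U" "w \<in> ?U" for u w using der_2_abelian[OF d that] .
  obtain c where c: "c \<in> V" "c \<notin> ?U" "\<And>u. u \<in> ?U \<Longrightarrow> br c u = 0"
    using False by (auto simp: self_centralising_def)
  let ?C = "adj c ?U"
  have C: "sub ?C" "card ?C = q ^ 3"
    using sub_adj[OF s c(1)] card_adj[OF s c(1,2)] d by (auto simp: eval_nat_numeral)
  have "abelian_hyperplane ?C"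
    unfolding abelian_hyperplane_def
  proof (intro conjI ballI)
    show "?C \<in> coatoms {0} V" using C n by (auto simp: coatoms_def sub_mem eval_nat_numeral)
    show "der V \<subseteq> ?C" using adj_superset by blast
    fix x y assume "x \<in> ?C" "y \<in> ?C"
    then show "br x y = 0" using abelian_adj[OF s U c(3)] by blast
  qed
  then show ?thesis using that by blast
qed (use that in blast)

lemma self_centralising_center:
  assumes "self_centralising" "\<And>x y. x \<in> der V \<Longrightarrow> y \<in> der V \<Longrightarrow> br x y = 0"
    and e: "e \<in> V" "\<And>y. y \<in> der V \<Longrightarrow> br e y = y"
  shows "center = {0}"
proof (intro equalityI subsetI)
  fix z assume z: "z \<in> center"
  then have zV: "z \<in> V" by (simp add: center_def)
  moreover have "\<forall>u\<in>der V. br z u = 0"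
  proof
    fix u assume "u \<in> der V"
    then have "br u z = 0" using z sub_mem[OF sub_der[OF sub_V]] by (simp add: center_def)
    then show "br z u = 0" using br_anti[of u z] by simp
  qed
  ultimately have "z \<in> V" "\<forall>u\<in>der V. br z u = 0" by blast+
  then have "z \<in> der V" using assms(1) by (auto simp: self_centralising_def)
  then have "z = br e z" using e by simp
  then show "z \<in> {0}" using z e by (simp add: center_def)
qed (simp add: center_def)

text \<open>The plane \<open>der V\<close> turns out to be a cyclic module under some
  \<open>u\<close>, generated by a vector \<open>v\<close>. Everything in \<open>V\<close> commutes
  with \<open>u\<close> in its action on \<open>v\<close>, so an action is determined by its value
  on \<open>v\<close>, and all values in the plane occur. The one that fixes \<open>v\<close> is the
  identity of the plane.\<close>

lemma self_centralising_basis: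
  assumes n: "card V = q ^ 4" and d: "card (der V) = q\<^sup>2" and sc: self_centralising
  obtains e u where "e \<in> V" "u \<in> V" "\<And>y. y \<in> der V \<Longrightarrow> br e y = y" "br e u = 0"
    "e \<notin> der V" "u \<notin> adj e (der V)"
proof -
  let ?U = "der V"
  have s: "sub ?U" by (simp add: sub_der)
  have ab: "br g h = 0" if "g \<in> ?U" "h \<in> ?U" for g h using der_2_abelian[OF d that] .
  have UV: "y \<in> V" if "y \<in> ?U" for y using that s sub_mem by blast
  \<comment> \<open>Otherwise every element of \<open>V\<close> acts on the plane by a scalar. Then
    the centralizer of \<open>a\<close> has dimension at least 3, so it contains some
    \<open>h\<close> outside the plane; \<open>h\<close> acts as the scalar 0, against
    self-centralisation.\<close>
  have "\<exists>u\<in>V. \<exists>v\<in>?U. br u v \<notin> adj v {0}"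
  proof (rule ccontr)
    assume "\<not> ?thesis"
    then have sca: "br u v \<in> adj v {0}" if "u \<in> V" "v \<in> ?U" for u v using that by blast
    obtain a b where a: "a \<in> ?U" "a \<noteq> 0" "b \<in> ?U" "b \<notin> adj a {0}" "a \<in> V" "b \<in> V"
      using plane_ex_basis[OF s d] .
    have L: "sub (adj a {0})" "card (adj a {0}) = q" 
      using sub_adj[OF sub_zero a(5)] card_adj[OF sub_zero a(5)] a by auto
    let ?K = "{v \<in> V. br a v = 0}"
    have "\<exists>h\<in>?K. h \<notin> ?U"
    proof (cases "\<exists>v\<in>V. br a v \<noteq> 0")
      case True
      have i: "br a ` V \<subseteq> adj a {0}"
      proof
        fix y assume "y \<in> br a ` V"
        then obtain v where "v \<in> V" "y = - br v a" using br_anti by blast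
        then show "y \<in> adj a {0}" using sca[of v a] a L by (simp add: sub_neg)
      qed
      from True have "card V = q * card ?K" using kernel_card(1)[OF linear_br sub_V L i] by blast
      then have "card ?K = q * q\<^sup>2" using n q2 by (simp add: eval_nat_numeral)
      then have "card ?U < card ?K" using d q2 by (simp add: power2_eq_square)
      moreover have "sub ?K" using linear_vimage_sub[OF linear_br sub_V sub_zero, of a] by simp
      ultimately show ?thesis using ex_outside[OF s] by blast
    next
      case False
      have "q\<^sup>2 < q ^ 4" using q2 by (intro power_strict_increasing) auto
      then have "card ?U < card V" using n d by simp
      then show ?thesis using False ex_outside[OF s sub_V] by blast
    qed
    then obtain h where h: "h \<in> V" "br a h = 0" "h \<notin> ?U" by blast
    have ha: "br h a = 0" using h br_anti[of a h] by simp
    \<comment> \<open>With \<open>a\<close>, \<open>b\<close> and \<open>a + b\<close> all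
      eigenvectors of \<open>h\<close>, the eigenvalues agree, and the one on \<open>a\<close> is
      0.\<close>
    have hb: "br h b = 0"
    proof -
      have bV: "a + b \<in> V" using a by (simp add: sub_add)
      have b0: "b \<noteq> 0" using a by (auto simp: span_zero)
      have "br h b \<in> adj b {0}" "br h (a + b) \<in> adj (a + b) {0}"
        using sca[OF h(1) a(3)] sca[OF h(1), of "a + b"] a s by (auto simp: sub_add)
      then obtain k l where k: "br h b = k \<star> b" and l: "br h (a + b) = l \<star> (a + b)"
        using adj_iff[OF sub_zero] by auto
      then have "l \<star> a + (l - k) \<star> b = 0"
        using ha by (simp add: br_lin scale_right_distrib scale_left_diff_distrib)
      then have "l \<star> a = 0" "(l - k) \<star> b = 0" using plane_independent[OF a(5,6,4)] by blast+
      then have "l \<star> b = 0" "l \<star> b = k \<star> b" 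
        using kill[of l a b] a by (auto simp: scale_left_diff_distrib)
      then show ?thesis using k by simp
    qed
    have "br h y = 0" if y: "y \<in> ?U" for y
    proof -
      obtain k l where "y = k \<star> a + l \<star> b" using plane_basis[OF s d a(1-4) y] .
      then show ?thesis using ha hb by (simp add: br_lin)
    qed
    then show False using sc h by (auto simp: self_centralising_def)
  qed
  then obtain u v where u: "u \<in> V" and v: "v \<in> ?U" and nv: "br u v \<notin> adj v {0}" by blast
  have vV: "v \<in> V" using UV[OF v] .
  have v0: "v \<noteq> 0" using nv by (auto simp: span_zero)
  define w where "w = br u v"
  have wU: "w \<in> ?U" using der_gen u vV by (simp add: w_def)
  have nw: "w \<notin> adj v {0}" using nv by (simp add: w_def)
  have basis: "\<exists>k l. y = k \<star> v + l \<star> w" if "y \<in> ?U" for y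
    using plane_basis[OF s d v v0 wU nw that] by blast
  \<comment> \<open>The bracket of \<open>h\<close> and \<open>u\<close> lies in the abelian plane
    and kills \<open>v\<close>, so \<open>h\<close> and \<open>u\<close> commute on
    \<open>v\<close>.\<close>
  have hw: "br h w = br u (br h v)" if h: "h \<in> V" for h
    using ab[OF der_gen[OF h u] v] br_derivation[of h u v] by (simp add: w_def)
  have ker: "{h \<in> V. br v h = 0} = ?U"
  proof (intro equalityI subsetI)
    fix h assume h: "h \<in> {h \<in> V. br v h = 0}"
    then have hv: "br h v = 0" using br_anti[of v h] by simp
    have "br h y = 0" if y: "y \<in> ?U" for y
    proof -
      obtain k l where kl: "y = k \<star> v + l \<star> w" using basis[OF y] by blast
      have "br h w = 0" using h hw hv by simp
      then show ?thesis using kl hv by (simp add: br_lin)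
    qed
    then show "h \<in> ?U" using sc h by (auto simp: self_centralising_def)
  qed (use ab v UV in auto)
  have "br v ` V \<subseteq> ?U" using der_gen vV by auto
  moreover have "card (br v ` V) = card ?U"
  proof -
    have "q ^ 4 = card (br v ` V) * q\<^sup>2" using rank_nullity[OF linear_br sub_V, of v] n d ker by simp
    then have "card (br v ` V) * q\<^sup>2 = q\<^sup>2 * q\<^sup>2" by (simp add: power_add[symmetric])
    moreover have "q\<^sup>2 \<noteq> 0" using q2 by simp
    ultimately show ?thesis using d mult_right_cancel by metis
  qed
  ultimately have im: "br v ` V = ?U" using sub_card_eq[OF s] by blast
  \<comment> \<open>Bracketing with \<open>v\<close> maps \<open>V\<close> onto the plane, so some
    \<open>e\<close> fixes \<open>v\<close>. By \<open>hw\<close> it then fixes \<open>w\<close>,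
    hence every vector of the plane.\<close>
  have "- v \<in> ?U" using v s by (simp add: sub_neg)
  then obtain e where e: "e \<in> V" "br v e = - v" using im by (metis imageE)
  have ev: "br e v = v" using e br_anti[of v e] by simp
  have eU: "br e y = y" if y: "y \<in> ?U" for y
  proof -
    obtain k l where kl: "y = k \<star> v + l \<star> w" using basis[OF y] by blast
    have "br e w = w" using hw[OF e(1)] ev by (simp add: w_def)
    then show ?thesis using kl ev by (simp add: br_lin)
  qed
  \<comment> \<open>As \<open>e\<close> acts as the identity on the plane,
    \<open>br e t = t\<close>; so subtracting \<open>t\<close> from \<open>u\<close> makes its
    bracket with \<open>e\<close> vanish.\<close>
  define t where "t = br e u"
  have tU: "t \<in> ?U" using der_gen e u by (simp add: t_def)
  have tV: "t \<in> V" using UV[OF tU] .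
  show ?thesis
  proof (rule that[of e "u - t"])
    show "e \<in> V" "u - t \<in> V" using e u tV by (auto simp: sub_diff)
    show "br e (u - t) = 0" using eU[OF tU] by (simp add: br_lin t_def)
    show "e \<notin> ?U" using ab[OF _ v] ev v0 by auto
    show "u - t \<notin> adj e ?U"
    proof
      assume "u - t \<in> adj e ?U"
      then obtain y k where y: "y \<in> ?U" "u - t = y + k \<star> e" by (rule adjE[OF s])
      have "w = br (u - t) v" using ab[OF tU v] by (simp add: w_def br_lin)
      also have "\<dots> = k \<star> v" unfolding y(2) using ab[OF y(1) v] ev by (simp add: br_lin)
      finally have "w \<in> adj v {0}" by (simp add: span_scale)
      then show False using nw by simp
    qed
  qed (use eU in auto)
qed

text \<open>\<open>V\<close> is spanned by the plane \<open>U = der V\<close>, by \<open>e\<close>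
  acting on \<open>U\<close> as the identity, and by \<open>u\<close> commuting with
  \<open>e\<close>; \<open>b\<close> is the number of \<open>u\<close>-invariant lines of
  \<open>U\<close>. Subobjects are sorted by their trace on \<open>U\<close>; since \<open>e\<close>
  acts by a scalar, only invariance under \<open>u\<close> matters. The shift \<open>Suc b\<close>
  arises in codimension one from the \<open>q + 1\<close> hyperplanes above \<open>U\<close>: 1 + q
  + b q.\<close>

lemma counts_self_centralising:
  assumes n: "card V = q ^ 4" and d: "card (der V) = q\<^sup>2" and sc: self_centralising
  obtains b where "eig_number (Suc b)" "card (subalgs 3) = 1 + Suc b * q"
    "card (subalgs 2) = qn q 3 + Suc b * q\<^sup>2"
    "card (ideals 2) = Suc b" "card (ideals 1) = b" "center = {0}"
proof -
  define U where "U = der V"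
  have s: "sub U" by (simp add: sub_der U_def)
  have cU: "card U = q\<^sup>2" using d by (simp add: U_def)
  have ab: "br g h = 0" if "g \<in> U" "h \<in> U" for g h using der_2_abelian[OF d] that by (simp add: U_def)
  obtain e u where eu: "e \<in> V" "u \<in> V" "\<And>y. y \<in> U \<Longrightarrow> br e y = y" "br e u = 0" "e \<notin> U" "u \<notin> adj e U"
    using self_centralising_basis[OF n d sc] unfolding U_def by blast
  have UV: "y \<in> V" if "y \<in> U" for y using that s sub_mem by blast
  have brU: "br x y \<in> U" if "x \<in> V" "y \<in> V" for x y using that by (simp add: U_def der_gen)
  define M where "M = adj e U"
  have M: "sub M" "card M = q ^ 3" "U \<subseteq> M" "e \<in> M" "u \<notin> M"
    using sub_adj[OF s eu(1)] card_adj[OF s eu(1,5)] cU eu adj_superset[of U e]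
    by (auto simp: M_def eval_nat_numeral)
  have MV: "M \<subseteq> V" using M by (simp add: sub_def)
  have MC: "M \<in> coatoms {0} V" using M MV n by (auto simp: coatoms_def eval_nat_numeral)
  have VM: "adj u M = V" using coatom_adj[OF sub_V MC eu(2) M(5)] .
  have UM: "U \<in> coatoms {0} M" using M s cU by (auto simp: coatoms_def eval_nat_numeral)
  have ME: "\<exists>y k. y \<in> U \<and> h = y + k \<star> e" if "h \<in> M" for h
    using adjE[OF s that[unfolded M_def]] by metis
  have VE: "\<exists>y k l. y \<in> U \<and> h = y + k \<star> e + l \<star> u" if h: "h \<in> V" for h
  proof -
    obtain m l where "m \<in> M" "h = m + l \<star> u" by (rule adjE[OF M(1), of h u]) (use h VM in simp)
    then show ?thesis using ME by blast
  qed
  have DU: "br u ` U \<subseteq> U" using brU eu UV by blast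
  define E where "E = eig (br u) {0} U"
  have E: "W \<in> E \<longleftrightarrow> sub W \<and> W \<subseteq> U \<and> card W = q \<and> br u ` W \<subseteq> W" for W
    by (auto simp: E_def eig_def atoms_def)
  have finE: "finite E" by (simp add: E_def eig_def)
  have ideal_iff: "ideal W \<longleftrightarrow> br u ` W \<subseteq> W" if W: "sub W" "W \<subseteq> U" for W
  proof
    assume D: "br u ` W \<subseteq> W"
    show "ideal W" unfolding ideal_def
    proof (intro ballI)
      fix h y assume "h \<in> V" and y: "y \<in> W"
      then obtain z k l where z: "z \<in> U" "h = z + k \<star> e + l \<star> u" using VE by blast
      have yU: "y \<in> U" using y W by blast
      have "br h y = k \<star> y + l \<star> br u y" using z ab[OF z(1) yU] eu(3)[OF yU] by (simp add: br_lin)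
      then show "br h y \<in> W" using y D W by (auto intro!: sub_closed)
    qed
  qed (use eu in \<open>auto simp: ideal_def\<close>)
  \<comment> \<open>These subalgebras map onto \<open>V/U\<close> and have trace \<open>W\<close> on
    \<open>U\<close>. Intersecting with \<open>M\<close> gives a bijection to the subspaces
    \<open>P\<close> spanned by \<open>W\<close> and some \<open>e + y\<close>; here
    \<open>y \<in> U\<close> is unique modulo \<open>W\<close>, so there are as many as elements of
    \<open>U/W\<close>. The point is that each \<open>P\<close> extends in exactly one way.\<close>
  have complements: "card {H. sub H \<and> closed H \<and> card H = q\<^sup>2 * card W \<and> H \<inter> U = W} = m"
    if W: "sub W" "W \<subseteq> U" "br u ` W \<subseteq> W" "m * card W = q\<^sup>2" for W m
  proof -
    define S where "S = {P \<in> atoms W M. \<not> P \<subseteq> U}"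
    have Wid: "ideal W" using W ideal_iff by blast
    have cS: "card S = m" unfolding S_def
    proof (rule card_atoms_outside)
      have "card M - card U = (q - 1) * q\<^sup>2"
        using M cU by (simp add: diff_mult_distrib eval_nat_numeral)
      then show "card M - card U = m * ((q - 1) * card W)" using W(4) by (metis mult.left_commute)
    qed (use W s M in auto)
    have Ss: "\<exists>y. y \<in> U \<and> e + y \<in> P \<and> P \<inter> U = W \<and> sub P \<and> P \<subseteq> M \<and> card P = q * card W \<and> W \<subseteq> P"
      if P: "P \<in> S" for P
    proof -
      have Pa: "P \<in> atoms W M" "\<not> P \<subseteq> U" using P by (auto simp: S_def)
      have sP: "sub P" "P \<subseteq> M" "card P = q * card W" "W \<subseteq> P" using Pa by (auto simp: atoms_def)
      obtain p where p: "p \<in> P" "p \<notin> U" using Pa by blast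
      obtain y k where y: "y \<in> U" "p = y + k \<star> e" using ME p sP by blast
      have "k \<star> e \<noteq> 0" using p y by auto
      then obtain b where b: "\<And>v. v \<in> V \<Longrightarrow> b \<star> k \<star> v = v" using inverse_ex[OF eu(1)] by blast
      have "b \<star> p = e + b \<star> y" using y b[OF eu(1)] by (simp add: scale_right_distrib add.commute)
      then have "e + b \<star> y \<in> P" "b \<star> y \<in> U" using p y sP s sub_scale by metis+
      moreover have "P \<inter> U = W" using atoms_inter[OF W(1) s W(2) Pa] .
      ultimately show ?thesis using sP by blast
    qed
    define G where "G P = (THE H. sub H \<and> closed H \<and> card H = q\<^sup>2 * card W \<and> H \<inter> U = W \<and> H \<inter> M = P)" for P
    have ex1: "\<exists>!H. sub H \<and> closed H \<and> card H = q\<^sup>2 * card W \<and> H \<inter> U = W \<and> H \<inter> M = P" if P: "P \<in> S" for P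
    proof -
      obtain y where y: "y \<in> U" "e + y \<in> P" and Pp: "P \<inter> U = W" "sub P" "P \<subseteq> M" "card P = q * card W" "W \<subseteq> P"
        using Ss[OF P] by blast
      \<comment> \<open>Since \<open>br y\<close> maps \<open>V\<close> into the abelian
        \<open>U\<close>, the map \<open>v - br y v\<close> is an automorphism. It sends
        \<open>e\<close> to \<open>e + y\<close> and \<open>u\<close> to \<open>g\<close>, so
        \<open>g\<close> commutes with \<open>e + y\<close> as \<open>u\<close> does with
        \<open>e\<close>.\<close>
      define g where "g = u + br u y"
      have bU: "br u y \<in> U" using brU eu UV y by blast
      have gV: "g \<in> V" using eu UV[OF bU] by (simp add: g_def sub_add)
      have gM: "g \<notin> M"
      proof
        assume "g \<in> M"
        then have "g - br u y \<in> M" using bU M by (auto intro!: sub_diff)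
        then show False using M by (simp add: g_def)
      qed
      have Pe: "P = adj (e + y) W"
      proof -
        have "e + y \<notin> W"
        proof
          assume "e + y \<in> W"
          then show False using sub_diff[OF s, of "e + y" y] W y eu by auto
        qed
        then show ?thesis using adj_eqI[OF W(1) Pp(2,5,4)] y by blast
      qed
      have eyV: "e + y \<in> V" using y UV eu by (auto intro!: sub_add)
      have Wab: "closed W" using W(1) Wid by (rule ideal_closed)
      have Pcl: "closed P" unfolding Pe
        using Wab Wid W(1) eyV by (intro closed_adj) (auto simp: ideal_def intro!: span_base)
      have gey: "br g (e + y) = 0"
      proof -
        have "br g (e + y) = br u e + br u y + br (br u y) e + br (br u y) y"
          by (simp add: g_def br_lin)
        also have "br (br u y) e = - br u y" by (subst br_anti) (simp add: eu(3)[OF bU])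
        also have "br (br u y) y = 0" using ab bU y by blast
        also have "br u e = 0" using eu(4) br_anti[of e u] by simp
        finally show ?thesis by simp
      qed
      have gW: "br g w \<in> W" if "w \<in> W" for w using Wid gV that by (auto simp: ideal_def)
      have gP: "br g p \<in> adj g P" if p: "p \<in> P" for p
      proof -
        obtain w k where w: "w \<in> W" "p = w + k \<star> (e + y)"
          by (rule adjE[OF W(1), of p "e + y"]) (use p Pe in simp)
        have "br g p = br g w + k \<star> br g (e + y)" unfolding w(2) by (simp only: br_add_right br_scale_right)
        then have "br g p \<in> W" using gW[OF w(1)] gey by simp
        then show ?thesis using Pp adj_superset[of P g] by blast
      qed
      let ?H = "adj g P"
      have gP': "g \<notin> P" using gM Pp by blast
      have H: "sub ?H" "closed ?H" "card ?H = q\<^sup>2 * card W"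
        using sub_adj[OF Pp(2) gV] closed_adj[OF Pp(2) Pcl gV gP] card_adj[OF Pp(2) gV gP'] Pp
        by (auto simp: power2_eq_square)
      have HM: "?H \<inter> M = P"
      proof (rule atoms_inter[of P M ?H V])
        show "?H \<in> atoms P V" using adj_atoms[OF Pp(2) sub_V _ gV] gM Pp by (auto simp: sub_def)
        show "\<not> ?H \<subseteq> M" using gM by (meson adj_self subsetD)
      qed (use Pp M in auto)
      have HU: "?H \<inter> U = W" using HM Pp M by blast
      show ?thesis
      proof (rule ex1I[of _ ?H])
        fix K assume K: "sub K \<and> closed K \<and> card K = q\<^sup>2 * card W \<and> K \<inter> U = W \<and> K \<inter> M = P"
        have PK: "P \<subseteq> K" using K by blast
        have "\<not> K \<subseteq> M"
        proof
          assume "K \<subseteq> M"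
          then have "K = P" using K by blast
          then show False using K Pp sub_card_pos[OF W(1)] q2 by (auto simp: power2_eq_square)
        qed
        then obtain h where h: "h \<in> K" "h \<notin> M" by blast
        have "h \<in> V" using h K sub_mem by blast
        then obtain z k l where z: "z \<in> U" "h = z + k \<star> e + l \<star> u" using VE by blast
        have "l \<star> u \<noteq> 0"
        proof
          assume "l \<star> u = 0"
          then have "h \<in> M" using z M by (auto intro!: sub_closed)
          then show False using h by simp
        qed
        then obtain b where b: "\<And>v. v \<in> V \<Longrightarrow> b \<star> l \<star> v = v" using inverse_ex[OF eu(2)] by blast
        \<comment> \<open>Scaling \<open>h\<close> and removing its \<open>e\<close>-part by means
          of \<open>e + y\<close> leaves \<open>u + t\<close> in \<open>K\<close>. The bracket with
          \<open>e + y\<close> is \<open>t - br u y\<close>, and subtracting it from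
          \<open>u + t\<close> leaves \<open>g\<close>.\<close>
        define t where "t = b \<star> z - (b * k) \<star> y"
        have tU: "t \<in> U" using z y s by (simp add: t_def sub_closed)
        have "b \<star> h - (b * k) \<star> (e + y) \<in> K" using h y PK K by (auto intro!: sub_closed)
        moreover have "b \<star> h - (b * k) \<star> (e + y) = u + t"
          using b[OF eu(2)] by (simp add: z(2) t_def scale_right_distrib algebra_simps)
        ultimately have ut: "u + t \<in> K" by simp
        have "br (e + y) (u + t) \<in> K" using K ut y PK by (auto simp: closed_def)
        moreover have "br (e + y) (u + t) = t - br u y"
          using eu(3)[OF tU] eu(4) ab[OF y(1) tU] br_anti[of u y] by (simp add: br_lin)
        ultimately have "t - br u y \<in> K" by simp
        then have "(u + t) - (t - br u y) \<in> K" using sub_diff[of K] ut K by blast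
        then have "g \<in> K" by (simp add: g_def)
        then have "?H \<subseteq> K" using adj_least PK K by blast
        then show "K = ?H" using sub_card_eq[of K ?H] K H by simp
      qed (use H HM HU in simp)
    qed
    have "bij_betw G S {H. sub H \<and> closed H \<and> card H = q\<^sup>2 * card W \<and> H \<inter> U = W}"
    proof (rule bij_betw_byWitness[where f' = "\<lambda>H. H \<inter> M"])
      have G: "sub (G P) \<and> closed (G P) \<and> card (G P) = q\<^sup>2 * card W \<and> G P \<inter> U = W \<and> G P \<inter> M = P"
        if "P \<in> S" for P unfolding G_def by (rule theI'[OF ex1[OF that]])
      show "\<forall>P\<in>S. G P \<inter> M = P" using G by blast
      show "G ` S \<subseteq> {H. sub H \<and> closed H \<and> card H = q\<^sup>2 * card W \<and> H \<inter> U = W}" using G by blast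
      have in_S: "H \<inter> M \<in> S" if H: "sub H" "closed H" "card H = q\<^sup>2 * card W" "H \<inter> U = W" for H
      proof -
        have HV: "H \<subseteq> V" using H by (simp add: sub_def)
        have "\<not> H \<subseteq> M"
        proof
          assume HM: "H \<subseteq> M"
          have "\<not> H \<subseteq> U"
          proof
            assume "H \<subseteq> U"
            then have "H = W" using H by blast
            then show False using H sub_card_pos[OF W(1)] q2 by (auto simp: power2_eq_square)
          qed
          then have "card H = q * card W" using coatom_inter[OF M(1) UM H(1) HM] H by simp
          then show False using H sub_card_pos[OF W(1)] q2 by (auto simp: power2_eq_square)
        qed
        then have "card H = q * card (H \<inter> M)" using coatom_inter[OF sub_V MC H(1) HV] by simp
        then have c: "card (H \<inter> M) = q * card W" using H q2 by (simp add: power2_eq_square)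
        have "\<not> H \<inter> M \<subseteq> U"
        proof
          assume "H \<inter> M \<subseteq> U"
          then have "H \<inter> M \<subseteq> W" using H by blast
          then have "q * card W \<le> card W" using c sub_card_mono[OF W(1)] by metis
          then show False using sub_card_pos[OF W(1)] q2 by simp
        qed
        moreover have "W \<subseteq> H \<inter> M" using H M by blast
        ultimately show ?thesis using c sub_inter[OF H(1) M(1)] by (auto simp: S_def atoms_def)
      qed
      then show "(\<lambda>H. H \<inter> M) ` {H. sub H \<and> closed H \<and> card H = q\<^sup>2 * card W \<and> H \<inter> U = W} \<subseteq> S" by blast
      show "\<forall>H\<in>{H. sub H \<and> closed H \<and> card H = q\<^sup>2 * card W \<and> H \<inter> U = W}. G (H \<inter> M) = H"
      proof
        fix H assume H: "H \<in> {H. sub H \<and> closed H \<and> card H = q\<^sup>2 * card W \<and> H \<inter> U = W}"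
        then have "H \<inter> M \<in> S" using in_S by blast
        then show "G (H \<inter> M) = H" unfolding G_def using H ex1 by (intro the1_equality) auto
      qed
    qed
    then have "card S = card {H. sub H \<and> closed H \<and> card H = q\<^sup>2 * card W \<and> H \<inter> U = W}"
      by (rule bij_betw_same_card)
    then show ?thesis using cS by simp
  qed

  \<comment> \<open>Subalgebras of codimension one\<close>
  have inter_norm: "br u ` (H \<inter> U) \<subseteq> H \<inter> U" if H: "H \<in> coatoms {0} V" "closed H" "\<not> U \<subseteq> H" for H
  proof
    have sH: "sub H" using H by (auto simp: coatoms_def)
    fix z assume "z \<in> br u ` (H \<inter> U)"
    then obtain y where y: "y \<in> H" "y \<in> U" "z = br u y" by blast
    obtain t where t: "t \<in> U" "t \<notin> H" using H by blast
    \<comment> \<open>As \<open>H\<close> is a hyperplane, \<open>u\<close> differs from an element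
      of \<open>H\<close> by a multiple of \<open>t \<in> U\<close>, which acts on \<open>U\<close>
      as zero.\<close>
    have "u \<in> adj t H" using coatom_adj[OF sub_V H(1) UV[OF t(1)] t(2)] eu by simp
    then obtain h k where h: "h \<in> H" "u = h + k \<star> t" by (rule adjE[OF sH])
    have "br u y = br h y" using h ab[OF t(1) y(2)] by (simp add: br_lin)
    then have "z \<in> H" using h y H(2) by (auto simp: closed_def)
    then show "z \<in> H \<inter> U" using brU[OF eu(2) UV[OF y(2)]] y by simp
  qed
  have card_E: "card {H. sub H \<and> closed H \<and> card H = q ^ 3 \<and> H \<inter> U \<in> E} = card E * q"
  proof -
    have 1: "{H. sub H \<and> closed H \<and> card H = q ^ 3 \<and> H \<inter> U \<in> E}
        = (\<Union>W\<in>E. {H. sub H \<and> closed H \<and> card H = q ^ 3 \<and> H \<inter> U = W})" by blast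
    have "card (\<Union>W\<in>E. {H. sub H \<and> closed H \<and> card H = q ^ 3 \<and> H \<inter> U = W})
      = (\<Sum>W\<in>E. card {H. sub H \<and> closed H \<and> card H = q ^ 3 \<and> H \<inter> U = W})"
      by (rule card_UN_disjoint[OF finE]) auto
    also have "\<dots> = (\<Sum>W\<in>E. q)"
    proof (rule sum.cong[OF refl])
      fix W assume "W \<in> E"
      then have W: "sub W" "W \<subseteq> U" "br u ` W \<subseteq> W" "card W = q" by (auto simp: E)
      have "q * card W = q\<^sup>2" "q\<^sup>2 * card W = q ^ 3" using W by (simp_all add: eval_nat_numeral)
      then show "card {H. sub H \<and> closed H \<and> card H = q ^ 3 \<and> H \<inter> U = W} = q"
        using complements[OF W(1-3), of q] by simp
    qed
    finally show ?thesis unfolding 1 by simp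
  qed
  have s3: "card (subalgs 3) = 1 + Suc (card E) * q"
  proof -
    have "subalgs 3 = coatoms U V \<union> {H. sub H \<and> closed H \<and> card H = q ^ 3 \<and> H \<inter> U \<in> E}"
      (is "_ = ?A \<union> ?B")
    proof (intro equalityI subsetI)
      fix H assume H: "H \<in> subalgs 3"
      then have Hs: "sub H" "closed H" "card H = q ^ 3" by (auto simp: subalgs_def)
      have HC: "H \<in> coatoms {0} V" using Hs n by (auto simp: coatoms_def sub_mem eval_nat_numeral)
      show "H \<in> ?A \<union> ?B"
      proof (cases "U \<subseteq> H")
        case True
        then show ?thesis using HC by (auto simp: coatoms_def)
      next
        case False
        have "card U = q * card (U \<inter> H)"
          using coatom_inter[OF sub_V HC s _ False] UV by blast
        then have "card (H \<inter> U) = q" using cU q2 by (simp add: power2_eq_square Int_commute)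
        then have "H \<inter> U \<in> E" using inter_norm[OF HC Hs(2) False] sub_inter[OF Hs(1) s] by (auto simp: E)
        then show ?thesis using Hs by blast
      qed
    next
      fix H assume "H \<in> ?A \<union> ?B"
      then show "H \<in> subalgs 3"
      proof
        assume H: "H \<in> ?A"
        then have "sub H" "U \<subseteq> H" "card H = q ^ 3" using n q2 by (auto simp: coatoms_def eval_nat_numeral)
        then show ?thesis using ideal_closed ideal_der by (auto simp: subalgs_def U_def)
      qed (auto simp: subalgs_def)
    qed
    moreover have "card (?A \<union> ?B) = card ?A + card ?B"
    proof (rule card_Un_disjoint)
      show "?A \<inter> ?B = {}"
      proof (rule equals0I)
        fix H assume "H \<in> ?A \<inter> ?B"
        then have "U \<in> E" by (auto simp: coatoms_def Int_absorb1)
        then show False using cU q_less by (simp add: E)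
      qed
    qed auto
    moreover have "card ?A = qn q 2"
      using card_coatoms[OF s sub_V, of 2] n cU UV by (auto simp: power_add[symmetric])
    ultimately show ?thesis using card_E by (simp add: numeral_2_eq_2)
  qed

  \<comment> \<open>Subalgebras of dimension two, sorted by the dimension of their trace on
    \<open>U\<close>\<close>
  define N where "N W = {h \<in> V. \<forall>w\<in>W. br h w \<in> W}" for W
  have N_E: "N W = V" if "W \<in> E" for W
    using that ideal_iff[of W] by (auto simp: N_def E ideal_def)
  \<comment> \<open>A vector with nonzero \<open>u\<close>-part that normalizes \<open>W\<close>
    would make \<open>W\<close> invariant under \<open>u\<close>, because \<open>e\<close> and
    \<open>U\<close> preserve every line of \<open>U\<close>.\<close>
  have N_not_E: "N W = M" if W: "W \<in> atoms {0} U" "W \<notin> E" for W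
  proof -
    have Ws: "sub W" "W \<subseteq> U" "card W = q" using W by (auto simp: atoms_def)
    show ?thesis
    proof (intro equalityI subsetI)
      fix h assume h: "h \<in> N W"
      then have "h \<in> V" by (simp add: N_def)
      then obtain z k l where z: "z \<in> U" "h = z + k \<star> e + l \<star> u" using VE by blast
      have hy: "br h y = k \<star> y + l \<star> br u y" if "y \<in> W" for y
        using z ab[of z y] eu(3)[of y] Ws that by (auto simp add: br_lin)
      have "l \<star> u = 0"
      proof (rule ccontr)
        assume "l \<star> u \<noteq> 0"
        then obtain b where b: "\<And>v. v \<in> V \<Longrightarrow> b \<star> l \<star> v = v" using inverse_ex[OF eu(2)] by blast
        have "br u y \<in> W" if y: "y \<in> W" for y
        proof -
          have "br h y - k \<star> y \<in> W" using h y Ws by (auto simp: N_def intro!: sub_closed)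
          then have "l \<star> br u y \<in> W" using hy[OF y] by simp
          then have "b \<star> l \<star> br u y \<in> W" by (rule sub_scale[OF Ws(1)])
          moreover have "b \<star> l \<star> br u y = br u y" using y Ws UV eu by (intro b br_V) auto
          ultimately show ?thesis by simp
        qed
        then show False using W Ws by (auto simp: E)
      qed
      then show "h \<in> M" using z M by (auto intro!: sub_closed)
    next
      fix h assume h: "h \<in> M"
      then obtain z k where z: "z \<in> U" "h = z + k \<star> e" using ME by blast
      have "br h y = k \<star> y" if "y \<in> W" for y
        using z ab[of z y] eu(3)[of y] Ws that by (auto simp add: br_lin)
      then show "h \<in> N W" using h MV Ws by (auto simp: N_def intro!: sub_scale)
    qed
  qed
  have sN: "sub (N W) \<and> U \<subseteq> N W" if "W \<in> atoms {0} U" for W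
    using N_E[of W] N_not_E[OF that] M sub_V UV by (cases "W \<in> E") auto
  \<comment> \<open>A plane with trace a line \<open>W\<close> is closed exactly if it lies in the
    normalizer of \<open>W\<close>. So each line contributes \<open>q\<close> planes if the
    normalizer is \<open>M\<close>, and \<open>q + q\<^sup>2\<close> if it is
    \<open>V\<close>.\<close>
  have mid: "{H. sub H \<and> closed H \<and> card H = q\<^sup>2 \<and> card (H \<inter> U) = q}
      = (\<Union>W\<in>atoms {0} U. {H \<in> atoms W (N W). \<not> H \<subseteq> U})"
  proof (intro equalityI subsetI)
    fix H assume H: "H \<in> {H. sub H \<and> closed H \<and> card H = q\<^sup>2 \<and> card (H \<inter> U) = q}"
    let ?W = "H \<inter> U"
    have Ws: "sub ?W" using H s sub_inter by blast
    have W: "?W \<in> atoms {0} U" using H Ws sub_0[OF Ws] by (simp add: atoms_def)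
    have "H \<subseteq> N ?W"
    proof
      fix h assume h: "h \<in> H"
      have hV: "h \<in> V" using h H sub_mem by blast
      then show "h \<in> N ?W" using h H brU[OF hV] UV by (auto simp: N_def closed_def)
    qed
    then have "H \<in> atoms ?W (N ?W)" using H by (auto simp: atoms_def power2_eq_square)
    moreover have "\<not> H \<subseteq> U"
    proof
      assume "H \<subseteq> U"
      then have "H \<inter> U = H" by blast
      then show False using H q_less by simp
    qed
    ultimately show "H \<in> (\<Union>W\<in>atoms {0} U. {H \<in> atoms W (N W). \<not> H \<subseteq> U})" using W by blast
  next
    fix H assume "H \<in> (\<Union>W\<in>atoms {0} U. {H \<in> atoms W (N W). \<not> H \<subseteq> U})"
    then obtain W where W: "W \<in> atoms {0} U" and H: "H \<in> atoms W (N W)" "\<not> H \<subseteq> U" by blast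
    have Ws: "sub W" "W \<subseteq> U" "card W = q" using W by (auto simp: atoms_def)
    obtain h where h: "h \<in> H" "h \<notin> W" "h \<in> N W" "h \<in> V" using atoms_ex[OF Ws(1) H(1)] by blast
    have "H = adj h W" using atoms_adj[OF Ws(1) H(1) h(1,2)] .
    moreover have "closed (adj h W)"
    proof (rule closed_adj[OF Ws(1) _ h(4)])
      show "closed W" using ab Ws sub_0[OF Ws(1)] unfolding closed_def by (metis subsetD)
      show "br h w \<in> adj h W" if "w \<in> W" for w using h that adj_superset[of W h] by (auto simp: N_def)
    qed
    moreover have "H \<inter> U = W" using atoms_inter[OF Ws(1) s Ws(2) H] .
    ultimately show "H \<in> {H. sub H \<and> closed H \<and> card H = q\<^sup>2 \<and> card (H \<inter> U) = q}"
      using H Ws by (auto simp: atoms_def power2_eq_square)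
  qed
  have EA: "E \<subseteq> atoms {0} U" by (auto simp: E_def eig_def)
  have card_A: "card (atoms {0} U) = q + 1" using card_atoms[of "{0}" U 2] s cU by (simp add: numeral_2_eq_2)
  have card_mid: "card {H. sub H \<and> closed H \<and> card H = q\<^sup>2 \<and> card (H \<inter> U) = q} = q + q\<^sup>2 + card E * q\<^sup>2"
  proof -
    have "card (\<Union>W\<in>atoms {0} U. {H \<in> atoms W (N W). \<not> H \<subseteq> U})
        = (\<Sum>W\<in>atoms {0} U. card {H \<in> atoms W (N W). \<not> H \<subseteq> U})"
    proof (rule card_UN_disjoint)
      have "H \<inter> U = W" if "W \<in> atoms {0} U" "H \<in> atoms W (N W)" "\<not> H \<subseteq> U" for H W
        using atoms_inter[of W U H] that s by (auto simp: atoms_def)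
      then show "\<forall>A\<in>atoms {0} U. \<forall>B\<in>atoms {0} U. A \<noteq> B \<longrightarrow>
        {H \<in> atoms A (N A). \<not> H \<subseteq> U} \<inter> {H \<in> atoms B (N B). \<not> H \<subseteq> U} = {}" by blast
    qed auto
    also have "\<dots> = (\<Sum>W\<in>atoms {0} U. q + (if W \<in> E then q\<^sup>2 else 0))"
    proof (rule sum.cong[OF refl])
      fix W assume W: "W \<in> atoms {0} U"
      have Ws: "sub W" "W \<subseteq> U" "card W = q" using W by (auto simp: atoms_def)
      show "card {H \<in> atoms W (N W). \<not> H \<subseteq> U} = q + (if W \<in> E then q\<^sup>2 else 0)"
      proof (rule card_atoms_outside)
        show "card (N W) - card U = (q + (if W \<in> E then q\<^sup>2 else 0)) * ((q - 1) * card W)"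
        proof (cases "W \<in> E")
          case True
          obtain r where "q = Suc r" using q2 by (cases q) auto
          then show ?thesis using True N_E n cU Ws by (simp add: eval_nat_numeral algebra_simps)
        next
          case False
          then show ?thesis using N_not_E[OF W] M cU Ws
            by (simp add: diff_mult_distrib diff_mult_distrib2 eval_nat_numeral)
        qed
      qed (use Ws s sN[OF W] in auto)
    qed
    also have "\<dots> = (q + 1) * q + card E * q\<^sup>2"
      using card_A EA by (simp add: sum.distrib sum.If_cases Int_absorb1)
    finally show ?thesis unfolding mid by (simp add: power2_eq_square algebra_simps)
  qed
  have s2: "card (subalgs 2) = qn q 3 + Suc (card E) * q\<^sup>2"
  proof -
    let ?B = "{H. sub H \<and> closed H \<and> card H = q\<^sup>2 \<and> card (H \<inter> U) = q}"
    let ?C = "{H. sub H \<and> closed H \<and> card H = q\<^sup>2 * card {0::'v} \<and> H \<inter> U = {0}}"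
    have eq: "subalgs 2 = insert U (?B \<union> ?C)"
    proof (intro equalityI subsetI)
      fix H assume "H \<in> subalgs 2"
      then have H: "sub H" "closed H" "card H = q\<^sup>2" by (auto simp: subalgs_def)
      obtain j where j: "j \<le> 2" "card (H \<inter> U) = q ^ j"
        using card_pow_sub[OF sub_inter[OF H(1) s] H(1) _ H(3)] by blast
      consider "j = 0" | "j = 1" | "j = 2" using j by linarith
      then show "H \<in> insert U (?B \<union> ?C)"
      proof cases
        case 1
        then show ?thesis using j H sub_card_1[OF sub_inter[OF H(1) s]] by simp
      next
        case 2
        then show ?thesis using j H by simp
      next
        case 3
        then have "H \<inter> U = H" "H \<inter> U = U" using j H s cU sub_card_eq[OF H(1)] sub_card_eq[OF s] by auto
        then show ?thesis by blast
      qed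
    next
      fix H assume "H \<in> insert U (?B \<union> ?C)"
      moreover have "closed U" unfolding closed_def using ab sub_0[OF s] by metis
      ultimately show "H \<in> subalgs 2" using s cU by (auto simp: subalgs_def)
    qed
    have fin: "finite ?B" "finite ?C" by simp_all
    have "U \<notin> ?B" using cU q_less by simp
    moreover have "U \<notin> ?C"
    proof
      assume "U \<in> ?C"
      then have "card U = 1" by simp
      then show False using cU q_less q2 by simp
    qed
    ultimately have "card (insert U (?B \<union> ?C)) = Suc (card (?B \<union> ?C))"
      using fin by (intro card_insert_disjoint) blast+
    moreover have "card (?B \<union> ?C) = card ?B + card ?C"
    proof (intro card_Un_disjoint fin equals0I)
      fix H assume H: "H \<in> ?B \<inter> ?C"
      then have "H \<inter> U = {0}" "card (H \<inter> U) = q" by blast+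
      then have "card {0::'v} = q" by metis
      then show False using q2 by simp
    qed
    moreover have "card ?C = q\<^sup>2"
      using complements[of "{0}" "q\<^sup>2"] sub_0[OF s] by simp
    ultimately show ?thesis using card_mid eq by (simp add: numeral_3_eq_3 numeral_2_eq_2 algebra_simps)
  qed

  \<comment> \<open>Ideals of dimension one and two\<close>
  have meet: "I \<inter> U \<noteq> {0}" if I: "sub I" "ideal I" "I \<noteq> {0}" for I
  proof
    assume 0: "I \<inter> U = {0}"
    obtain i where i: "i \<in> I" "i \<noteq> 0" using ex_nonzero[OF I(1,3)] .
    then have "i \<notin> U" "i \<in> V" using 0 I sub_mem by blast+
    then obtain y where y: "y \<in> U" "br i y \<noteq> 0" using sc by (auto simp: self_centralising_def U_def)
    have "br i y \<in> I" using ideal_rev[OF I(2,1) i(1) UV[OF y(1)]] .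
    moreover have "br i y \<in> U" using brU \<open>i \<in> V\<close> UV y by blast
    ultimately show False using 0 y by blast
  qed
  have i1: "card (ideals 1) = card E"
  proof -
    have "ideals 1 = E"
    proof (intro equalityI subsetI)
      fix I assume "I \<in> ideals 1"
      then have I: "sub I" "ideal I" "card I = q" by (auto simp: ideals_def)
      then have "I \<noteq> {0}" using q2 by auto
      then obtain i where i: "i \<in> I \<inter> U" "i \<noteq> 0"
        using meet[OF I(1,2)] ex_nonzero[OF sub_inter[OF I(1) s]] by blast
      then have "I \<subseteq> U" using line_span[OF I(1,3) _ i(2) s] by blast
      then show "I \<in> E" using I ideal_iff by (simp add: E)
    qed (use ideal_iff in \<open>auto simp: E ideals_def\<close>)
    then show ?thesis by simp
  qed
  have i2: "card (ideals 2) = Suc (card E)"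
  proof -
    \<comment> \<open>\<open>m\<close> is the eigenvalue of \<open>br u\<close> on the line
      \<open>U/W\<close>. So \<open>u - m \<star> e\<close> maps \<open>U\<close> into
      \<open>W\<close>, and adjoining it to \<open>W\<close> gives an ideal: one for each invariant
      line, besides \<open>U\<close> itself.\<close>
    have "\<exists>m. \<forall>y\<in>U. br u y - m \<star> y \<in> W" if "W \<in> E" for W
    proof -
      have Ws: "sub W" "W \<subseteq> U" "card W = q" "br u ` W \<subseteq> W" using that by (auto simp: E)
      have "card W < card U" using Ws cU q2 by (simp add: power2_eq_square)
      then obtain t where t: "t \<in> U" "t \<notin> W" using ex_outside[OF Ws(1) s] by blast
      have Ut: "U = adj t W" using adj_eqI[OF Ws(1) s Ws(2) _ t] cU Ws by (simp add: power2_eq_square)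
      have "br u t \<in> adj t W" using DU t Ut by blast
      then obtain m where m: "br u t - m \<star> t \<in> W" using adj_iff[OF Ws(1)] by blast
      have "br u y - m \<star> y \<in> W" if y: "y \<in> U" for y
      proof -
        obtain w k where w: "w \<in> W" "y = w + k \<star> t" by (rule adjE[OF Ws(1), of y t]) (use y Ut in simp)
        have "br u y - m \<star> y = (br u w - m \<star> w) + k \<star> (br u t - m \<star> t)"
          using w by (simp add: br_lin scale_right_distrib scale_right_diff_distrib mult.commute)
        then show ?thesis using w Ws m by (auto intro!: sub_closed)
      qed
      then show ?thesis by blast
    qed
    then obtain m where m: "\<And>W y. W \<in> E \<Longrightarrow> y \<in> U \<Longrightarrow> br u y - m W \<star> y \<in> W" by metis
    define G where "G W = adj (u - m W \<star> e) W" for W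
    have gM: "u - k \<star> e \<notin> M" for k
    proof
      assume "u - k \<star> e \<in> M"
      then have "(u - k \<star> e) + k \<star> e \<in> M" using M by (intro sub_add sub_scale) auto
      then show False using M by simp
    qed
    have gV: "u - k \<star> e \<in> V" for k using eu by (auto intro!: sub_closed)
    have G: "sub (G W)" "card (G W) = q\<^sup>2" "ideal (G W)" "G W \<inter> U = W" if W: "W \<in> E" for W
    proof -
      have Ws: "sub W" "W \<subseteq> U" "card W = q" "br u ` W \<subseteq> W" using W by (auto simp: E)
      have gW: "u - m W \<star> e \<notin> W" using gM Ws M by blast
      show G1: "sub (G W)" "card (G W) = q\<^sup>2"
        using sub_adj[OF Ws(1) gV] card_adj[OF Ws(1) gV gW] Ws by (auto simp: G_def power2_eq_square)
      show "G W \<inter> U = W"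
      proof (rule atoms_inter[of W U "G W" V])
        have "W \<subseteq> V" using Ws by (simp add: sub_def)
        then show "G W \<in> atoms W V" unfolding G_def using adj_atoms[OF Ws(1) sub_V _ gV gW] by simp
        show "\<not> G W \<subseteq> U" unfolding G_def using gM M adj_self by (meson subsetD)
      qed (use Ws s in auto)
      have Wid: "ideal W" using ideal_iff Ws by blast
      show "ideal (G W)" unfolding ideal_def
      proof (intro ballI)
        fix h y assume h: "h \<in> V" and y: "y \<in> G W"
        obtain z k l where z: "z \<in> U" "h = z + k \<star> e + l \<star> u" using VE[OF h] by blast
        obtain w j where w: "w \<in> W" "y = w + j \<star> (u - m W \<star> e)"
          using y unfolding G_def by (rule adjE[OF Ws(1)])
        have "br z e = - z" by (subst br_anti) (simp add: eu(3)[OF z(1)])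
        moreover have "br u e = 0" by (subst br_anti) (simp add: eu(4))
        moreover have "br z u = - br u z" by (rule br_anti)
        ultimately have g: "br h (u - m W \<star> e) = - (br u z - m W \<star> z)"
          by (simp add: z(2) br_lin eu(4))
        have "br h (u - m W \<star> e) \<in> W" unfolding g using m[OF W z(1)] Ws by (intro sub_neg)
        moreover have "br h w \<in> W" using Wid h w by (simp add: ideal_def)
        moreover have "br h y = br h w + j \<star> br h (u - m W \<star> e)" 
          unfolding w(2) by (simp only: br_add_right br_scale_right)
        ultimately have "br h y \<in> W" using Ws by (simp add: sub_closed)
        then show "br h y \<in> G W" unfolding G_def using adj_superset by blast
      qed
    qed
    have eq: "ideals 2 = insert U (G ` E)"
    proof (intro equalityI subsetI)
      fix I assume "I \<in> ideals 2"
      then have I: "sub I" "ideal I" "card I = q\<^sup>2" by (auto simp: ideals_def)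
      show "I \<in> insert U (G ` E)"
      proof (cases "I = U")
        case False
        let ?W = "I \<inter> U"
        have sW: "sub ?W" using I s sub_inter by blast
        obtain j where j: "j \<le> 2" "card ?W = q ^ j" using card_pow_sub[OF sW I(1) _ I(3)] by blast
        have "I \<noteq> {0}" using I q2 q_less not_trivial[of I] by simp
        then have "j \<noteq> 0" using meet[OF I(1,2)] j sub_card_1[OF sW] by auto
        moreover have "j \<noteq> 2"
        proof
          assume "j = 2"
          then have "?W = I" "?W = U" using j I cU sub_card_eq[OF I(1)] sub_card_eq[OF s] by auto
          then show False using \<open>I \<noteq> U\<close> by simp
        qed
        ultimately have "j = 1" using j by linarith
        then have cW: "card ?W = q" using j by simp
        have W: "?W \<in> E" using cW sW I(2) DU eu(2) by (auto simp: E ideal_def)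
        have "card ?W < card I" using cW I q2 by (simp add: power2_eq_square)
        then obtain i where i: "i \<in> I" "i \<notin> ?W" using ex_outside[OF sW I(1)] by blast
        have iV: "i \<in> V" using i I sub_mem by blast
        obtain z k l where z: "z \<in> U" "i = z + k \<star> e + l \<star> u" using VE[OF iV] by blast
        \<comment> \<open>\<open>br e\<close> kills \<open>e\<close> and \<open>u\<close> and fixes
          \<open>U\<close>, so it isolates the \<open>U\<close>-part of \<open>i\<close>. The rest
          \<open>k \<star> e + l \<star> u\<close> must map \<open>U\<close> into the trace of
          \<open>I\<close>, which forces \<open>k = - l m\<close> as actions.\<close>
        have "br e i = z" using z eu br_anti[of e u] by (simp add: br_lin)
        then have "z \<in> I" using I(2) eu(1) i(1) by (auto simp: ideal_def)
        then have i': "k \<star> e + l \<star> u \<in> I" using sub_diff[OF I(1) i(1) \<open>z \<in> I\<close>] z by (simp add: add.assoc)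
        have act: "k \<star> y + l \<star> br u y \<in> ?W" if y: "y \<in> U" for y
        proof -
          have "br (k \<star> e + l \<star> u) y \<in> I" using ideal_rev[OF I(2,1) i' UV[OF y]] .
          then show ?thesis using eu(3)[OF y] y brU[OF eu(2) UV[OF y]] s by (simp add: br_lin sub_closed)
        qed
        have act2: "(k + l * m ?W) \<star> y \<in> ?W" if y: "y \<in> U" for y
        proof -
          have "(k \<star> y + l \<star> br u y) - l \<star> (br u y - m ?W \<star> y) \<in> ?W"
            by (rule sub_diff[OF sW act[OF y] sub_scale[OF sW m[OF W y]]])
          then show ?thesis by (simp add: scale_right_diff_distrib scale_left_distrib)
        qed
        have "card ?W < card U" using cW cU q2 by (simp add: power2_eq_square)
        then obtain t where t: "t \<in> U" "t \<notin> ?W" using ex_outside[OF sW s] by blast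
        have "(k + l * m ?W) \<star> t = 0" using scale_mem[OF sW UV[OF t(1)] act2[OF t(1)]] t by blast
        moreover have "t \<noteq> 0" using t sub_0[OF sW] by metis
        ultimately have "(k + l * m ?W) \<star> e = 0" using kill[OF _ UV[OF t(1)] _ eu(1)] by blast
        then have "k \<star> e = - (l \<star> m ?W \<star> e)" by (simp add: scale_left_distrib add_eq_0_iff)
        then have i'': "l \<star> (u - m ?W \<star> e) \<in> I" using i' by (simp add: scale_right_diff_distrib)
        have "l \<star> (u - m ?W \<star> e) \<noteq> 0"
        proof
          assume 0: "l \<star> (u - m ?W \<star> e) = 0"
          then have "l \<star> u = l \<star> m ?W \<star> e" by (simp add: scale_right_diff_distrib)
          then have "i = z" using z \<open>k \<star> e = - (l \<star> m ?W \<star> e)\<close> by simp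
          then show False using i z(1) by blast
        qed
        then have "u - m ?W \<star> e \<in> I" using scale_mem[OF I(1) gV i''] by blast
        then have "G ?W \<subseteq> I" unfolding G_def using adj_least[OF I(1)] by blast
        then have "G ?W = I" using sub_card_eq[OF I(1)] G(2)[OF W] I by simp
        then show ?thesis using W by blast
      qed simp
    next
      fix I assume "I \<in> insert U (G ` E)"
      then show "I \<in> ideals 2"
        using G s cU ideal_der[of U] by (auto simp: ideals_def U_def)
    qed
    have "inj_on G E" using G(4) by (metis inj_onI)
    then have "card (G ` E) = card E" by (rule card_image)
    moreover have "U \<notin> G ` E"
    proof
      assume "U \<in> G ` E"
      then obtain W where W: "W \<in> E" "U = G W" by blast
      then have "W = U" using G(4)[OF W(1)] by simp
      then show False using W(1) cU q_less by (simp add: E)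
    qed
    ultimately show ?thesis unfolding eq using finE by simp
  qed
  have cen: "center = {0}"
    using self_centralising_center[OF sc _ eu(1)] ab eu(3) by (auto simp: U_def)
  have "eig_number (Suc (card E))"
    unfolding E_def using card_eig_number(2)[OF linear_br s DU sub_zero, of 2] s cU by simp
  then show ?thesis using that s3 s2 i1 i2 cen by blast
qed

end

context finite_lie
begin

subsection \<open>Derived algebra of codimension one\<close>

lemma abelian_hyperplane_der_abelian:
  assumes "card V = q ^ Suc n" "card (der V) = q ^ n" "der (der V) = {0}"
  shows "abelian_hyperplane (der V)"
  using assms sub_der[OF sub_V] der_zero[OF assms(3)]
  by (auto simp: abelian_hyperplane_def coatoms_def sub_mem)

text \<open>
  For \<open>m\<close> outside the plane \<open>M' = [M, M]\<close>, the operators \<open>A = ad m\<close> and \<open>B = ad x\<close> on \<open>M'\<close>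
  satisfy \<open>B A - A B = A\<close> after scaling \<open>x\<close>, and \<open>A\<close> is invertible; taking the trace of
  \<open>B - A B A\<^sup>-\<^sup>1 = 1\<close> gives \<open>2 = 0\<close>.
\<close>

lemma no_invertible_commutator:
  assumes U: "sub U" "card U = q\<^sup>2"
    and A: "linear A" "A ` U \<subseteq> U" "\<And>y. y \<in> U \<Longrightarrow> A y = 0 \<Longrightarrow> y = 0"
    and B: "linear B" "B ` U \<subseteq> U" "\<And>y. y \<in> U \<Longrightarrow> B (A y) = A (B y) + A y"
    and char: "\<And>v. v \<in> V \<Longrightarrow> v + v = 0 \<Longrightarrow> v = 0"
  shows False
proof (cases "\<exists>u\<in>U. A u \<notin> adj u {0}")
  case True
  then obtain u where u: "u \<in> U" "A u \<notin> adj u {0}" by blast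
  define w where "w = A u"
  have wU: "w \<in> U" using A u by (auto simp: w_def)
  have nw: "w \<notin> adj u {0}" using u by (simp add: w_def)
  have u0: "u \<noteq> 0" using u linear_0[OF A(1)] by (auto simp: span_zero)
  have w0: "w \<noteq> 0" using nw by (auto simp: span_zero)
  have V: "u \<in> V" "w \<in> V" using U u wU sub_mem by blast+
  note basis = plane_basis[OF U u(1) u0 wU nw]
  have AwU: "A w \<in> U" using A wU by blast
  obtain \<alpha> \<gamma> where Aw: "A w = \<alpha> \<star> u + \<gamma> \<star> w" using basis[OF AwU] .
  have "B u \<in> U" using B u by blast
  then obtain a b where Xu: "B u = a \<star> u + b \<star> w" using basis by blast
  have Xw: "B w = a \<star> w + b \<star> A w + w"
    using B(3)[OF u(1)] A(1) by (simp add: w_def[symmetric] Xu linear_add linear_scale)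
  have "B (A w) = A (B w) + A w" using B(3)[OF wU] .
  moreover have "B (A w) = \<alpha> \<star> (a \<star> u + b \<star> w) + \<gamma> \<star> (a \<star> w + b \<star> A w + w)"
    using B(1) by (simp add: Aw[unfolded linear_add] linear_add linear_scale Xu Xw)
  moreover have "A (B w) = a \<star> A w + b \<star> (\<alpha> \<star> w + \<gamma> \<star> A w) + A w"
  proof -
    have "A (A w) = A (\<alpha> \<star> u + \<gamma> \<star> w)" using Aw by simp
    also have "\<dots> = \<alpha> \<star> w + \<gamma> \<star> A w" using A(1) by (simp only: linear_add linear_scale w_def)
    finally have "A (A w) = \<alpha> \<star> w + \<gamma> \<star> A w" .
    then show ?thesis unfolding Xw using A(1) by (simp only: linear_add linear_scale)
  qed
  ultimately have "\<alpha> \<star> (a \<star> u + b \<star> w) + \<gamma> \<star> (a \<star> w + b \<star> A w + w)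
      = a \<star> A w + b \<star> (\<alpha> \<star> w + \<gamma> \<star> A w) + A w + A w" by simp
  moreover have "a \<star> A w = \<alpha> \<star> a \<star> u + \<gamma> \<star> a \<star> w"
    unfolding Aw by (simp add: scale_right_distrib mult.commute)
  moreover have "b \<star> \<gamma> \<star> A w = \<gamma> \<star> b \<star> A w" "b \<star> \<alpha> \<star> w = \<alpha> \<star> b \<star> w"
    by (simp_all add: mult.commute)
  \<comment> \<open>The terms with \<open>a\<close> and \<open>b\<close> cancel between the two
    expansions of \<open>B (A w)\<close>. What is left has \<open>u\<close>-coordinate twice
    \<open>\<alpha>\<close> and \<open>w\<close>-coordinate \<open>\<gamma>\<close>; so both vanish
    and \<open>A\<close> kills \<open>w\<close>.\<close>
  ultimately have "\<gamma> \<star> w = A w + A w" by (simp add: scale_right_distrib algebra_simps)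
  then have "\<alpha> \<star> u + (\<alpha> \<star> u + \<gamma> \<star> w) = 0" unfolding Aw by (simp add: algebra_simps)
  then have e: "(\<alpha> + \<alpha>) \<star> u + \<gamma> \<star> w = 0" by (simp only: scale_left_distrib add.assoc)
  have au: "(\<alpha> + \<alpha>) \<star> u = 0" "\<gamma> \<star> w = 0" using plane_independent[OF V nw e] .
  have "A w = \<alpha> \<star> u" using Aw au by simp
  moreover have "\<alpha> \<star> u + \<alpha> \<star> u = 0" using au(1) by (simp only: scale_left_distrib)
  then have "\<alpha> \<star> u = 0" using char[of "\<alpha> \<star> u"] V by (simp add: sub_scale)
  ultimately show False using A(3)[OF wU] w0 by simp
next
  case False
  \<comment> \<open>If every vector of \<open>U\<close> is an eigenvector, all eigenvalues agree; so
    \<open>A\<close> commutes with \<open>B\<close> on \<open>u\<close>, and the commutator relation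
    leaves \<open>A u = 0\<close>.\<close>
  then have eig: "\<exists>k. A u = k \<star> u" if "u \<in> U" for u using that adj_iff[OF sub_zero] by fastforce
  have "U \<noteq> {0}" using U q_less q2 not_trivial[of U] by simp
  then obtain u where u: "u \<in> U" "u \<noteq> 0" using ex_nonzero[OF U(1)] by blast
  have XuU: "B u \<in> U" using B u by blast
  have V: "u \<in> V" "B u \<in> V" using U u XuU sub_mem by blast+
  obtain k where k: "A u = k \<star> u" using eig u by blast
  have "A (B u) = k \<star> B u"
  proof (cases "B u \<in> adj u {0}")
    case True
    then obtain c where "B u = c \<star> u" using adj_iff[OF sub_zero] by auto
    then show ?thesis using k A(1) by (simp add: linear_scale mult.commute)
  next
    case False
    obtain k' where k': "A (B u) = k' \<star> B u" using eig XuU by blast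
    have "u + B u \<in> U" using u XuU U by (simp add: sub_add)
    then obtain l where "A (u + B u) = l \<star> (u + B u)" using eig by blast
    then have "k \<star> u + k' \<star> B u = l \<star> u + l \<star> B u"
      using k k' A(1) by (simp add: linear_add scale_right_distrib)
    then have "(k - l) \<star> u + (k' - l) \<star> B u = 0" by (simp add: scale_left_diff_distrib algebra_simps)
    then have "(k - l) \<star> u = 0" "(k' - l) \<star> B u = 0" using plane_independent[OF V False] by blast+
    then have "(k - l) \<star> B u = 0" "k' \<star> B u = l \<star> B u"
      using kill[OF _ V(1) u(2) V(2), of "k - l"] by (auto simp: scale_left_diff_distrib)
    then show ?thesis using k' by (simp add: scale_left_diff_distrib)
  qed
  moreover have "B (A u) = k \<star> B u" using k B(1) by (simp add: linear_scale)
  ultimately have "A u = 0" using B(3)[OF u(1)] by simp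
  then show False using A(3) u by blast
qed

text \<open>\<open>der (der V)\<close> is a line or a plane. The plane is ruled out by
  \<open>no_invertible_commutator\<close>. A line that is an ideal of \<open>V\<close> is killed by
  \<open>der V\<close>, so \<open>der V\<close> is a Heisenberg algebra.\<close>

lemma der_3_heisenberg:
  assumes n: "card V = q ^ 4" and d: "card (der V) = q ^ 3"
    and nab: "der (der V) \<noteq> {0}" and sol: "der (der V) \<noteq> der V"
    and char: "\<And>v. v \<in> V \<Longrightarrow> v + v = 0 \<Longrightarrow> v = 0"
  shows "card (der (der V)) = q" "\<And>m y. m \<in> der V \<Longrightarrow> y \<in> der (der V) \<Longrightarrow> br m y = 0"
proof -
  let ?M = "der V" and ?U = "der (der V)"
  have sM: "sub ?M" by (simp add: sub_der)
  have MV: "?M \<subseteq> V" using sM by (simp add: sub_def)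
  have cM: "closed ?M" using ideal_closed[OF sM ideal_der[OF _ sM]] by blast
  interpret M: finite_lie scale ?M q br by (rule finite_lie_sub[OF sM cM])
  have sU: "sub ?U" by (simp add: sM sub_der)
  have UM: "?U \<subseteq> ?M" using der_mono[OF MV] .
  have Uid: "br v y \<in> ?U" if v: "v \<in> V" and y: "y \<in> ?U" for v y
  proof -
    have sv: "sub {y \<in> ?M. br v y \<in> ?U}" by (rule linear_vimage_sub[OF linear_br sM sU])
    have "?U \<subseteq> {y \<in> ?M. br v y \<in> ?U}"
    proof (rule der_least[OF sv])
      fix g h assume gh: "g \<in> ?M" "h \<in> ?M"
      have "br v g \<in> ?M" "br v h \<in> ?M" using der_gen v gh MV by blast+
      then have "br (br v g) h \<in> ?U" "br g (br v h) \<in> ?U" using der_gen gh by blast+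
      then show "br g h \<in> {y \<in> ?M. br v y \<in> ?U}"
        using br_derivation[of v g h] der_gen gh MV sU by (auto simp: sub_add)
    qed
    then show ?thesis using y by blast
  qed
  obtain j where j: "j \<le> 3" "card ?U = q ^ j" using card_pow_sub[OF sU sM UM d] .
  have "j \<noteq> 0" using j nab sub_card_1[OF sU] by auto
  have "j \<noteq> 3" using j d sol sub_card_eq[OF sM UM] by auto
  have "j \<noteq> 2"
  proof
    assume "j = 2"
    then have cU: "card ?U = q\<^sup>2" using j by simp
    have "card ?U < card ?M" using cU d q2 by (simp add: power_strict_increasing)
    then obtain m where m: "m \<in> ?M" "m \<notin> ?U" using ex_outside[OF sU sM] by blast
    have mV: "m \<in> V" using m MV by blast
    have Uab: "br g h = 0" if "g \<in> ?U" "h \<in> ?U" for g h using M.der_2_abelian[OF cU that] .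
    have Mm: "?M = adj m ?U" using adj_eqI[OF sU sM UM _ m] cU d by (simp add: eval_nat_numeral)
    have sUM: "M.sub ?U" using UM sU by (auto simp: M.sub_def sub_def)
    have "M.abelian_hyperplane ?U"
      using Uab sUM UM cU d sM by (auto simp: M.abelian_hyperplane_def M.coatoms_def eval_nat_numeral)
    \<comment> \<open>\<open>?M\<close> has the abelian hyperplane \<open>?U\<close>, so its derived
      algebra, again \<open>?U\<close>, is the image of \<open>br m\<close> on \<open>?U\<close>. A
      surjection of the finite \<open>?U\<close> is injective.\<close>
    then have im: "br m ` ?U = ?U" using M.der_abelian_hyperplane[of ?U m 2] m d by (simp add: eval_nat_numeral)
    have "card {u \<in> ?U. br m u = 0} = 1"
      using rank_nullity[OF linear_br sU, of m] im sub_card_pos[OF sU] by simp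
    moreover have "0 \<in> {u \<in> ?U. br m u = 0}" using sU by simp
    ultimately have inj: "y = 0" if "y \<in> ?U" "br m y = 0" for y
      using that by (metis (mono_tags, lifting) card_1_singletonE mem_Collect_eq singletonD)
    have "card ?M < card V" using d n q2 by (simp add: power_strict_increasing)
    then obtain x where x: "x \<in> V" "x \<notin> ?M" using ex_outside[OF sM sub_V] by blast
    have MC: "?M \<in> coatoms {0} V" using sM MV d n by (auto simp: coatoms_def eval_nat_numeral)
    have Vx: "adj x ?M = V" using coatom_adj[OF sub_V MC x] .
    have "br x m \<in> adj m ?U" using der_gen[OF x(1) mV] Mm by simp
    then obtain t s where t: "t \<in> ?U" "br x m = t + s \<star> m" by (rule adjE[OF sU])
    \<comment> \<open>Otherwise \<open>x\<close> maps \<open>?M\<close> into \<open>?U\<close>, so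
      that all brackets of \<open>V\<close>, hence \<open>?M\<close> itself, lie in
      \<open>?U\<close>.\<close>
    have "s \<star> m \<noteq> 0"
    proof
      assume "s \<star> m = 0"
      then have xm: "br x m \<in> ?U" using t by simp
      have xM: "br x y \<in> ?U" if y: "y \<in> ?M" for y
      proof -
        obtain w k where w: "w \<in> ?U" "y = w + k \<star> m" by (rule adjE[OF sU, of y m]) (use y Mm in simp)
        then show ?thesis using Uid[OF x(1) w(1)] xm sU by (simp add: br_lin sub_closed)
      qed
      have "?M \<subseteq> ?U"
      proof (rule der_least[OF sU])
        fix g h assume gh: "g \<in> V" "h \<in> V"
        obtain y k where y: "y \<in> ?M" "g = y + k \<star> x" by (rule adjE[OF sM, of g x]) (use gh Vx in simp)
        obtain y' k' where y': "y' \<in> ?M" "h = y' + k' \<star> x" by (rule adjE[OF sM, of h x]) (use gh Vx in simp)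
        have "br g h = br y y' + (k \<star> br x y' - k' \<star> br x y)"
          using y y' br_anti[of x y] by (simp add: br_lin algebra_simps)
        then show "br g h \<in> ?U" using der_gen[OF y(1) y'(1)] xM y y' sU by (simp add: sub_closed)
      qed
      then show False using m by blast
    qed
    then obtain b where b: "\<And>v. v \<in> V \<Longrightarrow> b \<star> s \<star> v = v" using inverse_ex[OF mV] by blast
    have bx: "br (b \<star> x) m = b \<star> t + m" using t b[OF mV] by (simp add: br_lin scale_right_distrib)
    have bxV: "b \<star> x \<in> V" using x by (simp add: sub_scale)
    show False
    proof (rule no_invertible_commutator[OF sU cU linear_br _ _ linear_br _ _ char])
      show "br m ` ?U \<subseteq> ?U" using im by simp
      show "br m y = 0 \<Longrightarrow> y = 0" if "y \<in> ?U" for y using inj that by blast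
      show "br (b \<star> x) ` ?U \<subseteq> ?U" using Uid bxV by blast
      fix y assume y: "y \<in> ?U"
      \<comment> \<open>After scaling, the bracket of \<open>x\<close> with \<open>m\<close> is
        \<open>m\<close> up to an element of the abelian \<open>?U\<close>; on \<open>?U\<close>
        this is the required commutator relation.\<close>
      have "br (b \<star> t) y = 0" using Uab t y sU by (simp add: br_lin)
      then show "br (b \<star> x) (br m y) = br m (br (b \<star> x) y) + br m y"
        using br_derivation[of "b \<star> x" m y] bx by (simp add: br_add_left)
    qed
  qed
  then have "j = 1" using \<open>j \<noteq> 0\<close> \<open>j \<noteq> 3\<close> j by linarith
  then show cU: "card ?U = q" using j by simp
  obtain z where z: "z \<in> ?U" "z \<noteq> 0" using ex_nonzero[OF sU nab] .
  have zV: "z \<in> V" using z sU sub_mem by blast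
  show "br m y = 0" if m: "m \<in> ?M" and y: "y \<in> ?U" for m y
  proof -
    obtain k where k: "y = k \<star> z" using lineE[OF sU cU z y] .
    have "\<exists>k. br v z = k \<star> z" if v: "v \<in> V" for v
      using lineE[OF sU cU z Uid[OF v z(1)]] by metis
    then have "br m z = 0" using der_kills_line[OF zV _ m] by blast
    then show ?thesis using k by (simp add: br_lin)
  qed
qed

text \<open>\<open>M = der V\<close> is a Heisenberg algebra with centre the line \<open>Z\<close>,
  and \<open>b\<close> counts the planes between \<open>Z\<close> and \<open>M\<close> invariant
  under some \<open>x\<close> outside \<open>M\<close>, that is, the invariant lines of
  \<open>br x\<close> on \<open>M/Z\<close>. Subobjects are sorted by their trace on
  \<open>M\<close>.\<close>

lemma counts_heisenberg:
  assumes n: "card V = q ^ 4" and d: "card (der V) = q ^ 3" and d2: "card (der (der V)) = q"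
    and cen: "\<And>m y. m \<in> der V \<Longrightarrow> y \<in> der (der V) \<Longrightarrow> br m y = 0"
  obtains b where "eig_number b" "card (subalgs 3) = 1 + b * q" "card (subalgs 2) = qn q 3 + b * q\<^sup>2"
    "card (ideals 2) = b" "card (ideals 1) = 1"
proof -
  have q0: "0 < q" using q2 by simp
  define M where "M = der V"
  define Z where "Z = der M"
  have sM: "sub M" by (simp add: M_def sub_der)
  have cM: "card M = q ^ 3" using d by (simp add: M_def)
  have MV: "M \<subseteq> V" using sM by (simp add: sub_def)
  have sZ: "sub Z" by (simp add: Z_def sM sub_der)
  have cZ: "card Z = q" using d2 by (simp add: Z_def M_def)
  have brM: "br g h \<in> M" if "g \<in> V" "h \<in> V" for g h using that by (simp add: M_def der_gen)
  have brZ: "br g h \<in> Z" if "g \<in> M" "h \<in> M" for g h using that by (simp add: Z_def der_gen)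
  have ZM: "Z \<subseteq> M" unfolding Z_def M_def using der_mono[OF MV] M_def by simp
  have Zc: "br m y = 0" "br y m = 0" if "m \<in> M" "y \<in> Z" for m y
    using cen[of m y] that br_anti[of m y] by (simp_all add: M_def Z_def)
  have Zid: "br v y \<in> Z" if v: "v \<in> V" and y: "y \<in> Z" for v y
  proof -
    have sv: "sub {y \<in> M. br v y \<in> Z}" by (rule linear_vimage_sub[OF linear_br sM sZ])
    have "Z \<subseteq> {y \<in> M. br v y \<in> Z}"
      unfolding Z_def
    proof (rule der_least[OF sv[unfolded Z_def]])
      fix g h assume gh: "g \<in> M" "h \<in> M"
      have "br (br v g) h \<in> Z" "br g (br v h) \<in> Z" using brZ brM gh v MV by blast+
      then have "br v (br g h) \<in> Z" using br_derivation[of v g h] sZ by (simp add: sub_add)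
      then show "br g h \<in> {y \<in> M. br v y \<in> der M}" using brM gh MV by (auto simp: Z_def)
    qed
    then show ?thesis using y by blast
  qed
  have "Z \<noteq> {0}" using cZ q2 not_trivial[of Z] by simp
  then obtain z where z: "z \<in> Z" "z \<noteq> 0" using ex_nonzero[OF sZ] by blast
  have zV: "z \<in> V" "z \<in> M" using z ZM MV by auto
  have ZW: "Z \<subseteq> W" if "sub W" "z \<in> W" for W using line_span[OF sZ cZ z that] .
  obtain x where x: "x \<in> V" "x \<notin> M"
  proof -
    have "card M < card V" using cM n q2 by (simp add: power_strict_increasing)
    then show ?thesis using ex_outside[OF sM sub_V] that by blast
  qed
  have MC: "M \<in> coatoms {0} V" using sM MV cM n by (auto simp: coatoms_def eval_nat_numeral)
  have Vx: "adj x M = V" using coatom_adj[OF sub_V MC x] .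
  have VE: "\<exists>w k. w \<in> M \<and> h = w + k \<star> x" if h: "h \<in> V" for h
    by (rule adjE[OF sM, of h x]) (use h Vx in auto)
  have xM: "br x y \<in> M" if "y \<in> M" for y using brM x that MV by blast
  \<comment> \<open>A scalar that is nonzero on \<open>x\<close> is invertible on \<open>V\<close>;
    the case \<open>k \<star> y = 0\<close>, which \<open>scale_mem\<close> does not cover, forces
    \<open>y = 0\<close>.\<close>
  have scale_x: "y \<in> H" if "k \<star> x \<noteq> 0" "sub H" "y \<in> V" "k \<star> y \<in> H" for k y H
  proof (cases "k \<star> y = 0")
    case True
    then have "y = 0" using kill[of k y x] x that by blast
    then show ?thesis using that by simp
  qed (use scale_mem that in blast)
  \<comment> \<open>The centre of \<open>M\<close> is no larger than \<open>Z\<close>: a further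
    central \<open>m\<close> would make \<open>M\<close> the span of a central plane and one vector,
    hence abelian.\<close>
  have not_central: "\<exists>y\<in>M. br m y \<noteq> 0" if m: "m \<in> M" "m \<notin> Z" for m
  proof (rule ccontr)
    assume "\<not> ?thesis"
    then have mc: "br m y = 0" if "y \<in> M" for y using that by blast
    have mV: "m \<in> V" using m MV by blast
    let ?P = "adj m Z"
    have P: "sub ?P" "card ?P = q\<^sup>2" using sub_adj[OF sZ mV] card_adj[OF sZ mV m(2)] cZ
      by (auto simp: power2_eq_square)
    have PM: "?P \<subseteq> M" using adj_least[OF sM ZM m(1)] .
    have Pc: "br p y = 0" if p: "p \<in> ?P" and y: "y \<in> M" for p y
    proof -
      obtain w k where "w \<in> Z" "p = w + k \<star> m" using p by (rule adjE[OF sZ])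
      then show ?thesis using Zc(2)[OF y] mc[OF y] by (simp add: br_lin)
    qed
    have "card ?P < card M" using P cM q2 by (simp add: power_strict_increasing)
    then obtain t where t: "t \<in> M" "t \<notin> ?P" using ex_outside[OF P(1) sM] by blast
    have Mt: "M = adj t ?P" using adj_eqI[OF P(1) sM PM _ t] P cM by (simp add: eval_nat_numeral)
    have "br g h = 0" if "g \<in> M" "h \<in> M" for g h
    proof (rule abelian_adj[OF P(1)])
      show "br v w = 0" if "v \<in> ?P" "w \<in> ?P" for v w using Pc that PM by blast
      show "br t v = 0" if "v \<in> ?P" for v using Pc[OF that t(1)] br_anti[of v t] by simp
    qed (use that Mt in auto)
    then have "der M \<subseteq> {0}" by (intro der_least) auto
    then show False using z by (auto simp: Z_def)
  qed
  define E where "E = eig (br x) Z M"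
  have E: "P \<in> E \<longleftrightarrow> sub P \<and> Z \<subseteq> P \<and> P \<subseteq> M \<and> card P = q\<^sup>2 \<and> br x ` P \<subseteq> P" for P
    by (auto simp: E_def eig_def atoms_def cZ power2_eq_square)
  have finE: "finite E" by (simp add: E_def eig_def)
  \<comment> \<open>If \<open>z\<close> were outside the closed plane \<open>P\<close>, then
    brackets of \<open>P\<close> would lie both in \<open>P\<close> and in \<open>Z\<close>, so
    vanish; and \<open>M\<close>, spanned by \<open>P\<close> and the central \<open>z\<close>,
    would be abelian.\<close>
  have plane_z: "Z \<subseteq> P" if P: "sub P" "P \<subseteq> M" "card P = q\<^sup>2" "closed P" for P
  proof (rule ccontr)
    assume "\<not> Z \<subseteq> P"
    then have zP: "z \<notin> P" using ZW P by blast
    have Mz: "M = adj z P" using adj_eqI[OF P(1) sM P(2) _ zV(2) zP] P cM by (simp add: eval_nat_numeral)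
    have Pab: "br g h = 0" if gh: "g \<in> P" "h \<in> P" for g h
    proof -
      have "br g h \<in> Z" "br g h \<in> P" using brZ gh P by (auto simp: closed_def)
      then obtain k where k: "br g h = k \<star> z" using lineE[OF sZ cZ z] by blast
      then show ?thesis using scale_mem[OF P(1) zV(1)] \<open>br g h \<in> P\<close> zP by metis
    qed
    have "br g h = 0" if "g \<in> M" "h \<in> M" for g h
    proof (rule abelian_adj[OF P(1) Pab])
      show "br z v = 0" if "v \<in> P" for v using Zc(2) z P that by blast
    qed (use that Mz in auto)
    then have "der M \<subseteq> {0}" by (intro der_least) auto
    then show False using z by (auto simp: Z_def)
  qed
  have closed_plane: "closed P" if "P \<subseteq> M" "Z \<subseteq> P" for P
    using brZ that by (auto simp: closed_def)
  have E_ideal: "ideal P" if P: "P \<in> E" for P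
    unfolding ideal_def
  proof (intro ballI)
    have Ps: "sub P" "Z \<subseteq> P" "P \<subseteq> M" "br x ` P \<subseteq> P" using P by (auto simp: E)
    fix h y assume h: "h \<in> V" and y: "y \<in> P"
    obtain w k where w: "w \<in> M" "h = w + k \<star> x" using VE[OF h] by blast
    have "br w y \<in> P" using brZ[OF w(1)] y Ps by blast
    moreover have "br x y \<in> P" using y Ps by blast
    moreover have "br h y = br w y + k \<star> br x y" using w by (simp add: br_lin)
    ultimately show "br h y \<in> P" using Ps by (simp add: sub_closed)
  qed

  \<comment> \<open>Subalgebras of codimension one\<close>
  have s3: "card (subalgs 3) = 1 + card E * q"
  proof -
    let ?B = "{H. sub H \<and> card H = q ^ Suc 2 \<and> \<not> H \<subseteq> M \<and> (Z \<subseteq> H \<inter> M \<and> br x ` (H \<inter> M) \<subseteq> H \<inter> M)}"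
    have "subalgs 3 = insert M ?B"
    proof (intro equalityI subsetI)
      fix H assume "H \<in> subalgs 3"
      then have H: "sub H" "closed H" "card H = q ^ Suc 2" by (auto simp: subalgs_def eval_nat_numeral)
      show "H \<in> insert M ?B"
      proof (cases "H \<subseteq> M")
        case True
        then have "H = M" using sub_card_eq[OF sM True] H cM by (simp add: eval_nat_numeral)
        then show ?thesis by simp
      next
        case False
        let ?P = "H \<inter> M"
        have HV: "H \<subseteq> V" using H by (simp add: sub_def)
        have sP: "sub ?P" using H sM sub_inter by blast
        have "card H = q * card ?P" using coatom_inter[OF sub_V MC H(1) HV False] .
        then have "q * card ?P = q * q\<^sup>2" using H by (metis power_Suc)
        then have cP: "card ?P = q\<^sup>2" by (simp only: nat_mult_eq_cancel1[OF q0])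
        have "closed ?P" using H brM MV unfolding closed_def by blast
        then have ZP: "Z \<subseteq> ?P" using plane_z[OF sP _ cP] by blast
        obtain h where h: "h \<in> H" "h \<notin> M" using False by blast
        obtain w k where w: "w \<in> M" "h = w + k \<star> x" using VE h HV by blast
        have kx: "k \<star> x \<noteq> 0" using h w by auto
        have "br x y \<in> ?P" if y: "y \<in> ?P" for y
        proof -
          have "br h y \<in> ?P" using h y H brM HV MV unfolding closed_def by blast
          moreover have "br w y \<in> ?P" using brZ w y ZP by blast
          ultimately have "br h y - br w y \<in> ?P" by (rule sub_diff[OF sP])
          then have "k \<star> br x y \<in> ?P" using w by (simp add: br_lin)
          then show ?thesis using scale_x[OF kx sP] br_V x y MV by blast
        qed
        then show ?thesis using H False ZP by blast
      qed
    next
      fix H assume "H \<in> insert M ?B"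
      then show "H \<in> subalgs 3"
      proof
        assume "H = M"
        then show ?thesis using sM cM closed_plane[OF _ ZM] by (auto simp: subalgs_def)
      next
        assume H: "H \<in> ?B"
        let ?P = "H \<inter> M"
        have sP: "sub ?P" using H sM sub_inter by blast
        have HV: "H \<subseteq> V" using H by (simp add: sub_def)
        have cH: "card H = q ^ Suc 2" using H by blast
        have cP: "card H = q * card ?P" using coatom_inter[OF sub_V MC] H HV by blast
        then have "q * card ?P = q * q\<^sup>2" using cP cH by (metis power_Suc)
        then have "card ?P = q\<^sup>2" by (simp only: nat_mult_eq_cancel1[OF q0])
        then have "?P \<in> E" using H sP by (auto simp: E)
        then have Pid: "ideal ?P" by (rule E_ideal)
        obtain h where h: "h \<in> H" "h \<notin> M" using H by blast
        have hV: "h \<in> V" using h HV by blast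
        have e: "H = adj h ?P" using adj_eqI[OF sP _ _ cP] h H by blast
        have "closed (adj h ?P)"
          using closed_adj[OF sP ideal_closed[OF sP Pid] hV] Pid hV adj_superset[of ?P h]
          by (auto simp: ideal_def)
        then show ?thesis using e H by (simp add: subalgs_def eval_nat_numeral)
      qed
    qed
    moreover have "card (insert M ?B) = Suc (card ?B)" by (rule card_insert_disjoint) auto
    moreover have "{W. sub W \<and> W \<subseteq> M \<and> card W = q\<^sup>2 \<and> (Z \<subseteq> W \<and> br x ` W \<subseteq> W)} = E"
      using E by blast
    then have "card ?B = q * card E"
      using card_over_hyperplane[OF MC, of 3 2 "\<lambda>W. Z \<subseteq> W \<and> br x ` W \<subseteq> W"] n
      by (simp add: eval_nat_numeral)
    ultimately show ?thesis by simp
  qed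

  \<comment> \<open>Subalgebras of dimension two\<close>
  define N where "N W = {h \<in> V. \<forall>w\<in>W. br h w \<in> W}" for W
  have N_adj: "N W = {h \<in> V. br h m \<in> W}" if W: "sub W" "card W = q" "m \<in> W" "m \<noteq> 0" for W m
  proof (intro equalityI subsetI)
    fix h assume h: "h \<in> {h \<in> V. br h m \<in> W}"
    have "br h w \<in> W" if w: "w \<in> W" for w
    proof -
      obtain k where "w = k \<star> m" using lineE[OF W w] .
      then show ?thesis using h W by (simp add: br_lin sub_scale)
    qed
    then show "h \<in> N W" using h by (simp add: N_def)
  qed (use W in \<open>auto simp: N_def\<close>)
  \<comment> \<open>The traces on \<open>M\<close> of the closed planes outside \<open>M\<close>
    that do not meet \<open>M\<close> in \<open>Z\<close>. Planes of \<open>E\<close> share only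
    \<open>Z\<close>, and each has \<open>q\<close> lines besides \<open>Z\<close>.\<close>
  define Ls where "Ls = (\<Union>P\<in>E. atoms {0} P - {Z})"
  have Ls: "\<exists>P m. P \<in> E \<and> sub W \<and> card W = q \<and> W \<subseteq> P \<and> m \<in> W \<and> m \<noteq> 0 \<and> m \<notin> Z \<and> P = adj m Z"
    if W: "W \<in> Ls" for W
  proof -
    obtain P where P: "P \<in> E" "W \<in> atoms {0} P" "W \<noteq> Z" using W by (auto simp: Ls_def)
    then have W: "sub W" "card W = q" "W \<subseteq> P" by (auto simp: atoms_def)
    obtain m where m: "m \<in> W" "m \<notin> {0}" using atoms_ex[OF sub_zero P(2)] by blast
    have "m \<notin> Z"
    proof
      assume "m \<in> Z"
      then have "W \<subseteq> Z" using line_span[OF W(1,2) m(1) _ sZ] m by blast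
      then show False using sub_card_eq[OF sZ] W cZ P by simp
    qed
    moreover have "P = adj m Z"
      using P(1) cZ m W(3) \<open>m \<notin> Z\<close> by (intro adj_eqI) (auto simp: E sZ power2_eq_square)
    ultimately show ?thesis using P W m by blast
  qed
  have card_Ls: "card Ls = card E * q"
  proof -
    have "card Ls = (\<Sum>P\<in>E. card (atoms {0} P - {Z}))"
      unfolding Ls_def
    proof (rule card_UN_disjoint[OF finE])
      show "\<forall>A\<in>E. \<forall>B\<in>E. A \<noteq> B \<longrightarrow> (atoms {0} A - {Z}) \<inter> (atoms {0} B - {Z}) = {}"
      proof (intro ballI impI equals0I)
        fix A B W assume AB: "A \<in> E" "B \<in> E" "A \<noteq> B" and W: "W \<in> (atoms {0} A - {Z}) \<inter> (atoms {0} B - {Z})"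
        then have "W \<in> Ls" by (auto simp: Ls_def)
        then obtain m where m: "m \<in> W" "m \<notin> Z" using Ls by blast
        have "A = adj m Z" using AB W m cZ by (intro adj_eqI) (auto simp: E sZ power2_eq_square atoms_def)
        moreover have "B = adj m Z" using AB W m cZ by (intro adj_eqI) (auto simp: E sZ power2_eq_square atoms_def)
        ultimately show False using AB by simp
      qed
    qed auto
    also have "\<dots> = (\<Sum>P\<in>E. q)"
    proof (rule sum.cong[OF refl])
      fix P assume P: "P \<in> E"
      have "card (atoms {0} P) = qn q 2" using card_atoms[of "{0}" P 2] P by (simp add: E)
      moreover have "Z \<in> atoms {0} P" using P sZ cZ by (auto simp: atoms_def E)
      ultimately show "card (atoms {0} P - {Z}) = q" by (simp add: numeral_2_eq_2)
    qed
    finally show ?thesis by simp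
  qed
  have N: "sub (N W) \<and> card (N W) = q ^ 3 \<and> sub (N W \<inter> M) \<and> card (N W \<inter> M) = q\<^sup>2 \<and> W \<subseteq> N W \<inter> M"
    if WL: "W \<in> Ls" for W
  proof -
    obtain P m where P: "P \<in> E" "sub W" "card W = q" "W \<subseteq> P" "m \<in> W" "m \<noteq> 0" "m \<notin> Z" "P = adj m Z"
      using Ls[OF WL] by blast
    have mM: "m \<in> M" using P E by blast
    have mV: "m \<in> V" using mM MV by blast
    have e: "N W = {h \<in> V. br h m \<in> W}" by (rule N_adj[OF P(2,3,5,6)])
    have e': "N W = {h \<in> V. br m h \<in> W}"
    proof -
      have "br h m \<in> W \<longleftrightarrow> br m h \<in> W" for h
        using sub_neg[OF P(2), of "br h m"] sub_neg[OF P(2), of "br m h"]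
        by (simp only: br_anti[of h m] minus_minus) blast
      then show ?thesis using e by simp
    qed
    have sN: "sub (N W)" unfolding e' by (rule linear_vimage_sub[OF linear_br sub_V P(2)])
    have WZ: "W \<inter> Z = {0}"
    proof (rule ccontr)
      assume "W \<inter> Z \<noteq> {0}"
      then obtain y where y: "y \<in> W" "y \<in> Z" "y \<noteq> 0"
        using ex_nonzero[OF sub_inter[OF P(2) sZ]] by blast
      then have "W \<subseteq> Z" using line_span[OF P(2,3) y(1,3) sZ y(2)] by simp
      then show False using P by blast
    qed
    have NM: "N W \<inter> M = {h \<in> M. br m h = 0}"
    proof (intro equalityI subsetI)
      fix h assume "h \<in> N W \<inter> M"
      then have "br m h \<in> W" "h \<in> M" "br m h \<in> Z" using e' brZ mM by auto
      then show "h \<in> {h \<in> M. br m h = 0}" using WZ by blast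
    qed (use e' MV P in auto)
    obtain t where t: "t \<in> M" "br m t \<noteq> 0" using not_central[OF mM P(7)] by blast
    have brmM: "br m ` M \<subseteq> Z" using brZ mM by blast
    have cM': "card M = q * card {h \<in> M. br m h = 0}" and im: "br m ` M = Z"
      using kernel_card[OF linear_br sM sZ cZ brmM t] by auto
    have "card M = q * q\<^sup>2" using cM by (simp add: eval_nat_numeral)
    then have "q * card (N W \<inter> M) = q * q\<^sup>2" unfolding NM cM' .
    then have cNM: "card (N W \<inter> M) = q\<^sup>2" by (simp only: nat_mult_eq_cancel1[OF q0])
    have "\<not> N W \<subseteq> M"
    proof -
      have "br x m \<in> adj m Z" using P E by blast
      then obtain y k where y: "y \<in> Z" "br x m = y + k \<star> m" by (rule adjE[OF sZ])
      \<comment> \<open>\<open>br x m\<close> is a multiple of \<open>m\<close> up to some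
        \<open>y \<in> Z\<close>, and \<open>br m\<close> maps \<open>M\<close> onto
        \<open>Z\<close>. So \<open>x\<close> can be corrected by an element of \<open>M\<close> to
        normalize the line of \<open>m\<close>; the normalizer then is not contained in
        \<open>M\<close>.\<close>
      then obtain v where v: "v \<in> M" "br m v = y" using im by blast
      have "br v m = - y" using br_anti[of m v] v(2) by (metis minus_minus)
      then have "br (x + v) m = k \<star> m" using y by (simp add: br_lin)
      then have "x + v \<in> N W" using x v MV P unfolding e by (auto simp: sub_add sub_scale)
      moreover have "x + v \<notin> M" using sub_diff[OF sM, of "x + v" v] x v by auto
      ultimately show ?thesis by blast
    qed
    then have "card (N W) = q * card (N W \<inter> M)"
      using coatom_inter[OF sub_V MC sN] sN by (simp add: sub_def)
    then have "card (N W) = q ^ 3" using cNM by (simp add: eval_nat_numeral)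
    moreover have "W \<subseteq> N W \<inter> M"
    proof
      fix w assume w: "w \<in> W"
      obtain k where "w = k \<star> m" using lineE[OF P(2,3,5,6) w] .
      then show "w \<in> N W \<inter> M" using NM mM sM by (simp add: br_lin sub_scale)
    qed
    ultimately show ?thesis using sN cNM sub_inter[OF sN sM] by blast
  qed
  have in_Ls: "H \<inter> M \<in> Ls"
    if H: "sub H" "closed H" "card H = q\<^sup>2" "\<not> H \<subseteq> M" "H \<inter> M \<noteq> Z" for H
  proof -
    let ?W = "H \<inter> M"
    have HV: "H \<subseteq> V" using H by (simp add: sub_def)
    have sW: "sub ?W" using H sM sub_inter by blast
    have "card H = q * card ?W" using coatom_inter[OF sub_V MC H(1) HV H(4)] .
    then have cW: "card ?W = q" using H q2 by (simp add: power2_eq_square)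
    have "?W \<noteq> {0}" using cW q2 not_trivial[of ?W] by simp
    then obtain m where m: "m \<in> ?W" "m \<noteq> 0" using ex_nonzero[OF sW] by blast
    have mV: "m \<in> V" using m MV by blast
    have "m \<notin> Z"
    proof
      assume "m \<in> Z"
      then have "?W \<subseteq> Z" using line_span[OF sW cW m sZ] by simp
      then show False using sub_card_eq[OF sZ] cW cZ H(5) by simp
    qed
    let ?P = "adj m Z"
    have P: "sub ?P" "card ?P = q\<^sup>2" "?P \<subseteq> M"
      using sub_adj[OF sZ mV] card_adj[OF sZ mV \<open>m \<notin> Z\<close>] adj_least[OF sM ZM] m cZ
      by (auto simp: power2_eq_square)
    obtain h where h: "h \<in> H" "h \<notin> M" using H by blast
    obtain w k where w: "w \<in> M" "h = w + k \<star> x" using VE h HV by blast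
    have kx: "k \<star> x \<noteq> 0" using h w by auto
    have "br h m \<in> ?W" using h m H(2) brM HV MV unfolding closed_def by blast
    moreover have WP: "?W \<subseteq> ?P" using line_span[OF sW cW m P(1)] by simp
    ultimately have "br h m \<in> ?P" by blast
    moreover have "br w m \<in> ?P" using brZ[OF w(1)] m adj_superset[of Z m] by blast
    ultimately have "br h m - br w m \<in> ?P" using P by (simp add: sub_diff)
    then have "k \<star> br x m \<in> ?P" using w by (simp add: br_lin)
    then have xm: "br x m \<in> ?P" using scale_x[OF kx P(1)] br_V x mV by blast
    have "br x y \<in> ?P" if y: "y \<in> ?P" for y
    proof -
      obtain v l where v: "v \<in> Z" "y = v + l \<star> m" using y by (rule adjE[OF sZ])
      have "br x v \<in> ?P" using Zid[OF x(1) v(1)] adj_superset[of Z m] by blast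
      then show ?thesis using v xm P by (simp add: br_lin sub_closed)
    qed
    then have "?P \<in> E" using P adj_superset[of Z m] by (auto simp: E)
    moreover have "?W \<in> atoms {0} ?P" using sW sub_0[OF sW] WP cW by (simp add: atoms_def)
    ultimately show ?thesis using H(5) unfolding Ls_def by blast
  qed
  have s2: "card (subalgs 2) = qn q 3 + card E * q\<^sup>2"
  proof -
    \<comment> \<open>Closed planes inside \<open>M\<close>, all of which contain \<open>Z\<close>;
      planes with trace \<open>Z\<close>, always closed because \<open>Z\<close> is an ideal; and
      planes whose trace is a line of \<open>Ls\<close>, lying in its normalizer. Their numbers are
      \<open>q + 1\<close>, \<open>q\<^sup>2\<close> and \<open>card E * q\<^sup>2\<close>.\<close>
    let ?A = "atoms Z M"
    let ?B = "{H. sub H \<and> card H = q ^ Suc 1 \<and> \<not> H \<subseteq> M \<and> H \<inter> M = Z}"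
    let ?F = "\<lambda>W. {H \<in> atoms W (N W). \<not> H \<subseteq> N W \<inter> M}"
    let ?C = "\<Union>W\<in>Ls. ?F W"
    have F_int: "H \<inter> M = W" "\<not> H \<subseteq> M" if W: "W \<in> Ls" "H \<in> ?F W" for H W
    proof -
      have NW: "sub (N W)" "sub (N W \<inter> M)" "W \<subseteq> N W \<inter> M" using N[OF W(1)] by blast+
      have "sub W" using Ls[OF W(1)] by blast
      then have "H \<inter> (N W \<inter> M) = W" using atoms_inter[of W "N W \<inter> M" H "N W"] NW W by blast
      then show "H \<inter> M = W" using W by (auto simp: atoms_def)
      show "\<not> H \<subseteq> M" using W by (auto simp: atoms_def)
    qed
    have Z_Ls: "Z \<notin> Ls" by (auto simp: Ls_def)
    have eq: "subalgs 2 = (?A \<union> ?B) \<union> ?C"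
    proof (intro equalityI subsetI)
      fix H assume "H \<in> subalgs 2"
      then have H: "sub H" "closed H" "card H = q\<^sup>2" by (auto simp: subalgs_def)
      consider "H \<subseteq> M" | "\<not> H \<subseteq> M" "H \<inter> M = Z" | "\<not> H \<subseteq> M" "H \<inter> M \<noteq> Z" by blast
      then show "H \<in> (?A \<union> ?B) \<union> ?C"
      proof cases
        case 1
        then have "H \<in> ?A" using plane_z[OF H(1) 1 H(3,2)] H cZ by (auto simp: atoms_def power2_eq_square)
        then show ?thesis by blast
      next
        case 2
        then show ?thesis using H by (auto simp: power2_eq_square)
      next
        case 3
        have W: "H \<inter> M \<in> Ls" using in_Ls[OF H 3] .
        have "H \<subseteq> N (H \<inter> M)" unfolding N_def using H(2) brM MV sub_mem[OF H(1)] unfolding closed_def by blast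
        moreover have "card (H \<inter> M) = q" using Ls[OF W] by blast
        ultimately have "H \<in> ?F (H \<inter> M)" using H 3 by (auto simp: atoms_def power2_eq_square)
        then show ?thesis using W by blast
      qed
    next
      fix H assume "H \<in> (?A \<union> ?B) \<union> ?C"
      then consider "H \<in> ?A" | "H \<in> ?B" | W where "W \<in> Ls" "H \<in> ?F W" by blast
      then show "H \<in> subalgs 2"
      proof cases
        case 1
        then show ?thesis using closed_plane cZ by (auto simp: subalgs_def atoms_def power2_eq_square)
      next
        case 2
        then obtain h where h: "h \<in> H" "h \<notin> M" by blast
        have hV: "h \<in> V" using h 2 sub_mem by blast
        have e: "H = adj h Z" using adj_eqI[OF sZ, of H h] 2 h ZM cZ by auto
        have "closed (adj h Z)"
        proof (rule closed_adj[OF sZ closed_plane hV])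
          show "br h w \<in> adj h Z" if "w \<in> Z" for w using Zid[OF hV that] adj_superset by blast
        qed (use ZM in auto)
        then show ?thesis using 2 e by (simp add: subalgs_def power2_eq_square)
      next
        case (3 W)
        obtain m where W: "sub W" "card W = q" "m \<in> W" "m \<noteq> 0" using Ls[OF 3(1)] by blast
        have Ha: "H \<in> atoms W (N W)" using 3 by blast
        obtain h where h: "h \<in> H" "h \<in> N W" "h \<notin> W" "h \<in> V" using atoms_ex[OF W(1) Ha] by blast
        have e: "H = adj h W" using atoms_adj[OF W(1) Ha h(1,3)] .
        have "closed (adj h W)"
        proof (rule closed_adj[OF W(1) _ h(4)])
          have "br g v = 0" if gv: "g \<in> W" "v \<in> W" for g v
          proof -
            obtain k where "g = k \<star> m" using lineE[OF W gv(1)] .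
            moreover obtain l where "v = l \<star> m" using lineE[OF W gv(2)] .
            ultimately show ?thesis by (simp add: br_lin)
          qed
          then show "closed W" using W by (simp add: closed_def)
          show "br h w \<in> adj h W" if "w \<in> W" for w
            using h(2) that adj_superset[of W h] by (auto simp: N_def)
        qed
        then show ?thesis using e Ha W by (simp add: subalgs_def atoms_def power2_eq_square)
      qed
    qed
    have fin: "finite ?A" "finite ?B" by simp_all
    have finL: "finite Ls" unfolding Ls_def using finE by simp
    have finC: "finite ?C" using finL by simp
    have cA: "card ?A = q + 1" using card_atoms[OF sZ sM ZM, of 2] cZ cM by (simp add: eval_nat_numeral)
    have "{W. sub W \<and> W \<subseteq> M \<and> card W = q ^ 1 \<and> W = Z} = {Z}" using sZ ZM cZ by auto
    then have cB: "card ?B = q\<^sup>2"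
      using card_over_hyperplane[OF MC, of 3 1 "\<lambda>W. W = Z"] n by (simp add: eval_nat_numeral)
    have "card ?C = (\<Sum>W\<in>Ls. card (?F W))"
    proof (rule card_UN_disjoint[OF finL])
      show "\<forall>A\<in>Ls. \<forall>B\<in>Ls. A \<noteq> B \<longrightarrow> ?F A \<inter> ?F B = {}" using F_int(1) by blast
    qed simp
    also have "\<dots> = (\<Sum>W\<in>Ls. q)"
    proof (rule sum.cong[OF refl])
      fix W assume W: "W \<in> Ls"
      have NW: "sub (N W)" "card (N W) = q ^ 3" "sub (N W \<inter> M)" "card (N W \<inter> M) = q\<^sup>2" "W \<subseteq> N W \<inter> M"
        using N[OF W] by blast+
      have Ws: "sub W" "card W = q" using Ls[OF W] by blast+
      show "card (?F W) = q"
      proof (rule card_atoms_outside[OF Ws(1) NW(3,5,1)])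
        show "card (N W) - card (N W \<inter> M) = q * ((q - 1) * card W)"
          using NW Ws by (simp add: eval_nat_numeral diff_mult_distrib diff_mult_distrib2)
      qed blast
    qed
    finally have cC: "card ?C = card E * q\<^sup>2" using card_Ls by (simp add: power2_eq_square)
    have "?A \<inter> ?B = {}" by (auto simp: atoms_def)
    moreover have "(?A \<union> ?B) \<inter> ?C = {}"
    proof (rule equals0I)
      fix H assume "H \<in> (?A \<union> ?B) \<inter> ?C"
      then obtain W where W: "W \<in> Ls" "H \<in> ?F W" and H: "H \<in> ?A \<union> ?B" by blast
      then have "H \<inter> M = Z" using F_int(2)[OF W] by (auto simp: atoms_def)
      then show False using F_int(1)[OF W] W Z_Ls by simp
    qed
    ultimately have "card ((?A \<union> ?B) \<union> ?C) = card ?A + card ?B + card ?C"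
      using card_Un_disjoint[OF fin] card_Un_disjoint[of "?A \<union> ?B" ?C] fin finC by simp
    then show ?thesis unfolding eq cA cB cC by (simp add: numeral_3_eq_3 power2_eq_square)
  qed

  \<comment> \<open>Ideals of dimension one and two\<close>
  have inside: "I \<subseteq> M" if I: "sub I" "ideal I" "card I \<le> q\<^sup>2" for I
  proof (rule ccontr)
    assume "\<not> I \<subseteq> M"
    then obtain h where h: "h \<in> I" "h \<notin> M" by blast
    have hV: "h \<in> V" using h I sub_mem by blast
    have Vh: "adj h M = V" using coatom_adj[OF sub_V MC hV h(2)] .
    let ?J = "adj z I"
    have sJ: "sub ?J" using sub_adj[OF I(1) zV(1)] .
    \<comment> \<open>\<open>V\<close> is spanned by \<open>M\<close> and \<open>h\<close>; brackets
      inside \<open>M\<close> lie in \<open>Z\<close>, and brackets with \<open>h\<close> lie in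
      \<open>I\<close>. So \<open>M\<close> lies in \<open>I + Z\<close>, whose size is at most
      \<open>q ^ 3\<close>; equality puts \<open>h\<close> into \<open>M\<close>.\<close>
    have "M \<subseteq> ?J"
      unfolding M_def
    proof (rule der_least[OF sJ])
      fix a b assume ab: "a \<in> V" "b \<in> V"
      obtain y k where y: "y \<in> M" "a = y + k \<star> h" by (rule adjE[OF sM, of a h]) (use ab Vh in simp)
      obtain y' k' where y': "y' \<in> M" "b = y' + k' \<star> h" by (rule adjE[OF sM, of b h]) (use ab Vh in simp)
      have "br a b = br y y' + (k \<star> br h y' + k' \<star> br y h)"
        using y y' by (simp add: br_lin algebra_simps)
      moreover have "br y y' \<in> ?J" using ZW[OF sJ] brZ y y' by auto
      moreover have "k \<star> br h y' + k' \<star> br y h \<in> I"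
        using ideal_rev[OF I(2,1) h(1)] I(2) h(1) y y' MV I(1) by (auto simp: ideal_def intro!: sub_closed)
      then have "k \<star> br h y' + k' \<star> br y h \<in> ?J" using adj_superset by blast
      ultimately show "br a b \<in> ?J" using sJ by (simp add: sub_add)
    qed
    then have "q ^ 3 \<le> card ?J" using sub_card_mono[OF sJ] cM by metis
    moreover have "card ?J \<le> q ^ 3"
    proof (cases "z \<in> I")
      case True
      then have "?J = I" using I(1) by (simp add: insert_absorb sub_def)
      moreover have "q\<^sup>2 \<le> q ^ 3" using q2 by (intro power_increasing) auto
      ultimately show ?thesis using I(3) by simp
    next
      case False
      then show ?thesis using card_adj[OF I(1) zV(1)] I(3) by (simp add: eval_nat_numeral)
    qed
    ultimately have "M = ?J" using \<open>M \<subseteq> ?J\<close> sub_card_eq[OF sJ] cM by simp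
    then show False using h adj_superset by blast
  qed
  have i2: "ideals 2 = E"
  proof (intro equalityI subsetI)
    fix I assume "I \<in> ideals 2"
    then have I: "sub I" "ideal I" "card I = q\<^sup>2" by (auto simp: ideals_def)
    have IM: "I \<subseteq> M" using inside[OF I(1,2)] I(3) by simp
    have "Z \<subseteq> I" using plane_z[OF I(1) IM I(3) ideal_closed[OF I(1,2)]] .
    then show "I \<in> E" using I IM x by (auto simp: E ideal_def)
  qed (use E_ideal in \<open>auto simp: ideals_def E\<close>)
  have i1: "ideals 1 = {Z}"
  proof (intro equalityI subsetI)
    fix I assume "I \<in> ideals 1"
    then have I: "sub I" "ideal I" "card I = q" by (auto simp: ideals_def)
    have IM: "I \<subseteq> M" using inside[OF I(1,2)] I(3) q_less by simp
    have "I \<noteq> {0}" using I q2 not_trivial[of I] by simp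
    then obtain m where m: "m \<in> I" "m \<noteq> 0" using ex_nonzero[OF I(1)] by blast
    have "m \<in> Z"
    proof (rule ccontr)
      assume "m \<notin> Z"
      then obtain y where y: "y \<in> M" "br m y \<noteq> 0" using not_central m IM by blast
      have "br m y \<in> I" "br m y \<in> Z" using ideal_rev[OF I(2,1) m(1)] y MV brZ m IM by blast+
      then have "I \<subseteq> Z" using line_span[OF I(1,3) _ y(2) sZ] by blast
      then show False using m \<open>m \<notin> Z\<close> by blast
    qed
    then have "I \<subseteq> Z" using line_span[OF I(1,3) m sZ] by simp
    then show "I \<in> {Z}" using sub_card_eq[OF sZ] I cZ by simp
  qed (use sZ cZ Zid in \<open>auto simp: ideals_def ideal_def\<close>)
  have "br x ` Z \<subseteq> Z" "br x ` M \<subseteq> M" using Zid x xM by blast+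
  then have "eig_number (card E)"
    unfolding E_def using card_eig_number(1)[OF linear_br sM _ sZ _ ZM, of x 2] cM cZ
    by (simp add: eval_nat_numeral)
  then show ?thesis using that s3 s2 i1 i2 by simp
qed

subsection \<open>Counts in dimension three and four\<close>

lemma counts_dim_3:
  assumes n: "card V = q ^ 3" and d: "card (der V) = q ^ d" and sol: "der V \<noteq> V"
  obtains b where "eig_number b" "card (subalgs 2) = 1 + b * q"
    "card (ideals 1) = b + (if d = 0 then q\<^sup>2 else 0)"
proof -
  have n': "card V = q ^ Suc 2" using n by (simp add: eval_nat_numeral)
  have sd: "sub (der V)" "der V \<subseteq> V" using sub_der[OF sub_V] by (auto simp: sub_def)
  have "card (der V) \<noteq> q ^ 3" using n sol sub_card_eq[OF sub_V sd(2)] by auto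
  moreover obtain j where "j \<le> 3" "card (der V) = q ^ j" using card_pow_sub[OF sd(1) sub_V sd(2) n] .
  ultimately have "d \<le> 3" "d \<noteq> 3" using d by (auto simp: q_pow_inj)
  then consider "d = 0" | "d = 1" | "d = 2" by linarith
  then obtain V0 where "abelian_hyperplane V0"
  proof cases
    case 1
    then have "der V = {0}" using d sub_card_1[OF sd(1)] by simp
    then show ?thesis using abelian_hyperplane_der_0[OF n'] that by blast
  next
    case 2
    then show ?thesis using abelian_hyperplane_der_1[of 1] n d that by (auto simp: eval_nat_numeral)
  next
    case 3
    then have "br x y = 0" if "x \<in> der V" "y \<in> der V" for x y
      using der_2_abelian that d by simp
    then have "abelian_hyperplane (der V)" using 3 d n' sd
      by (auto simp: abelian_hyperplane_def coatoms_def eval_nat_numeral)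
    then show ?thesis using that by blast
  qed
  then show ?thesis using counts_3[OF n _ d] that by blast
qed

text \<open>Of solvability only this enters: neither \<open>V\<close> nor, unless zero,
  \<open>der V\<close> is its own derived algebra. For \<open>d = 2\<close> a vanishing centre
  singles out the self-centralising case; its \<open>Suc\<close> avoids a truncated
  subtraction.\<close>

lemma counts_dim_4:
  assumes n: "card V = q ^ 4" and d: "card (der V) = q ^ d"
    and sol: "der V \<noteq> V" "der (der V) = der V \<Longrightarrow> der V = {0}"
    and char: "\<And>v. v \<in> V \<Longrightarrow> v + v = 0 \<Longrightarrow> v = 0"
  obtains b where "eig_number b" "card (subalgs 3) = 1 + b * q" "card (subalgs 2) = qn q 3 + b * q\<^sup>2"
    "if d = 2 \<and> center = {0} then card (ideals 2) = b \<and> b = Suc (card (ideals 1))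
     else if d = 3 \<and> der (der V) \<noteq> {0} then card (ideals 2) = b \<and> card (ideals 1) = 1
     else card (ideals 2) = b + (if d = 0 then qn q 3 else if d = 1 then 1 else 0) * q\<^sup>2 \<and>
       card (ideals 1) = b + (if d = 0 then q ^ 3 else 0)"
proof -
  have n': "card V = q ^ Suc 3" using n by (simp add: eval_nat_numeral)
  have sd: "sub (der V)" "der V \<subseteq> V" using sub_der[OF sub_V] by (auto simp: sub_def)
  have "card (der V) \<noteq> q ^ 4" using n sol sub_card_eq[OF sub_V sd(2)] by auto
  moreover obtain j where "j \<le> 4" "card (der V) = q ^ j" using card_pow_sub[OF sd(1) sub_V sd(2) n] .
  ultimately have "d \<le> 4" "d \<noteq> 4" using d by (auto simp: q_pow_inj)
  then consider "d = 0" | "d = 1" | "d = 2" | "d = 3" by linarith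
  then consider V0 where "abelian_hyperplane V0" "\<not> (d = 3 \<and> der (der V) \<noteq> {0})"
    | "d = 2" self_centralising | "d = 3" "der (der V) \<noteq> {0}"
  proof cases
    case 1
    then have "der V = {0}" using d sub_card_1[OF sd(1)] by simp
    then show ?thesis using abelian_hyperplane_der_0[OF n'] that(1) 1 by (metis zero_neq_numeral)
  next
    case 2
    then show ?thesis using abelian_hyperplane_der_1[of 2] n d that(1) by (auto simp: eval_nat_numeral)
  next
    case 3
    then show ?thesis using der_2_cases[OF n] d that(1,2) by (metis numeral_eq_iff semiring_norm(88) num.distinct(1) eval_nat_numeral(2) n_not_Suc_n)
  next
    case 4
    then show ?thesis using abelian_hyperplane_der_abelian[OF n'] d that(1,3) by metis
  qed
  then show ?thesis
  proof cases
    case 1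
    have "card V = q * card V0" using 1 by (auto simp: abelian_hyperplane_def coatoms_def)
    then have "q * card V0 = q * q ^ 3" by (metis n' power_Suc)
    moreover have "0 < q" using q2 by simp
    ultimately have cV0: "card V0 = q ^ 3" by (simp only: nat_mult_eq_cancel1)
    obtain x where x: "x \<in> V" "x \<notin> V0"
      using coatom_outside 1 by (metis abelian_hyperplane_def)
    have "center \<noteq> {0}" if "d = 2"
      using center_abelian_hyperplane[OF 1(1) x n'] cV0 d that q2 by (simp add: power_strict_increasing)
    then have a: "\<not> (d = 2 \<and> center = {0})" by blast
    obtain b where b: "eig_number b" "card (subalgs 3) = 1 + b * q" "card (subalgs 2) = qn q 3 + b * q\<^sup>2"
      "card (ideals 2) = b + (if d = 0 then qn q 3 else if d = 1 then 1 else 0) * q\<^sup>2"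
      "card (ideals 1) = b + (if d = 0 then q ^ 3 else 0)"
      using counts_4[OF n 1(1) d] .
    show ?thesis by (rule that[OF b(1-3)]) (simp only: a 1(2) b(4,5) if_False simp_thms)
  next
    case 2
    then have d2: "card (der V) = q\<^sup>2" using d by simp
    obtain b where b: "eig_number (Suc b)" "card (subalgs 3) = 1 + Suc b * q"
      "card (subalgs 2) = qn q 3 + Suc b * q\<^sup>2"
      "card (ideals 2) = Suc b" "card (ideals 1) = b" "center = {0}"
      using counts_self_centralising[OF n d2 2(2)] .
    show ?thesis by (rule that[OF b(1-3)]) (simp only: 2(1) b(4-6) if_True simp_thms)
  next
    case 3
    then have d3: "card (der V) = q ^ 3" using d by simp
    have "der {0} = {0}" using der_least[OF sub_zero, of "{0}"] sub_0[OF sub_der[OF sub_zero]] by auto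
    then have "der V \<noteq> {0}" using 3(2) by metis
    then have ne: "der (der V) \<noteq> der V" using sol(2) by blast
    note H = der_3_heisenberg[OF n d3 3(2) ne char]
    obtain b where b: "eig_number b" "card (subalgs 3) = 1 + b * q" "card (subalgs 2) = qn q 3 + b * q\<^sup>2"
      "card (ideals 2) = b" "card (ideals 1) = 1"
      using counts_heisenberg[OF n d3 H] by blast
    have "\<not> (d = 2 \<and> center = {0})" using 3(1) by simp
    with 3 show ?thesis by (intro that[OF b(1-3)]) (simp only: b(4,5) if_True if_False simp_thms)
  qed
qed

end

section \<open>Lie algebras on sets as submodules of a type\<close>

text \<open>
  The product of all Lie algebras with carriers in given types is a Lie algebra whose carrier is a
  whole type, so that the type class operations and the module theory over them apply. Every single
  Lie algebra is recovered as one of the factors. The extra factor of integers in the ring of scalars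
  makes sure that \<open>0 \<noteq> 1\<close>; it acts as zero.
\<close>

typedef ('f, 'g) lie_index = "{(R :: 'f ring, L :: ('f, 'g) lie_alg). lie_algebra R L}"
proof -
  \<comment> \<open>The one-element module over the one-element ring is a Lie algebra over any
    types, so the index type is inhabited.\<close>
  define R :: "'f ring" where "R = \<lparr>carrier = {undefined}, monoid.mult = \<lambda>_ _. undefined,
    monoid.one = undefined, ring.zero = undefined, ring.add = \<lambda>_ _. undefined\<rparr>"
  define L :: "('f, 'g) lie_alg" where "L = \<lparr>carrier = {undefined}, monoid.mult = \<lambda>_ _. undefined,
    monoid.one = undefined, ring.zero = undefined, ring.add = \<lambda>_ _. undefined,
    module.smult = \<lambda>_ _. undefined, bracket = \<lambda>_ _. undefined\<rparr>"
  have "cring R"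
    by (intro cringI abelian_groupI comm_monoidI) (auto simp: R_def)
  moreover have "abelian_group L"
    by (intro abelian_groupI) (auto simp: L_def)
  ultimately have "Module.module R L"
    by (intro moduleI) (auto simp: R_def L_def)
  then have "lie_algebra R L"
    by (intro lie_algebra.intro lie_algebra_axioms.intro) (auto simp: L_def)
  then show ?thesis by blast
qed

definition fring :: "('f, 'g) lie_index \<Rightarrow> 'f ring" where
  "fring i = fst (Rep_lie_index i)"

definition flie :: "('f, 'g) lie_index \<Rightarrow> ('f, 'g) lie_alg" where
  "flie i = snd (Rep_lie_index i)"

lemma flie_lie: "lie_algebra (fring i) (flie i)"
  using Rep_lie_index[of i] by (auto simp: fring_def flie_def)

lemma flie_cring: "cring (fring i)"
  and flie_ring: "ring (fring i)"
  and flie_module: "Module.module (fring i) (flie i)"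
  and flie_group: "abelian_group (flie i)"
  and flie_monoid: "abelian_monoid (flie i)"
  using flie_lie[of i] by (simp_all add: lie_algebra_def module_def cring_def abelian_group_def)

lemmas fring_closed [simp] =
  ring.ring_simprules(1,2,3,5,6)[OF flie_ring]

lemmas flie_closed [simp] =
  abelian_monoid.zero_closed[OF flie_monoid] abelian_monoid.a_closed[OF flie_monoid]
  abelian_group.a_inv_closed[OF flie_group] module.smult_closed[OF flie_module]
  lie_algebra.bracket_closed[OF flie_lie]

typedef ('f, 'g) uring = "{x :: int \<times> (('f, 'g) lie_index \<Rightarrow> 'f). \<forall>i. snd x i \<in> carrier (fring i)}"
  by (rule exI[of _ "(0, \<lambda>i. \<zero>\<^bsub>fring i\<^esub>)"]) simp

typedef ('f, 'g) umod = "{x :: ('f, 'g) lie_index \<Rightarrow> 'g. \<forall>i. x i \<in> carrier (flie i)}"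
  by (rule exI[of _ "\<lambda>i. \<zero>\<^bsub>flie i\<^esub>"]) simp

setup_lifting type_definition_uring
setup_lifting type_definition_umod

instantiation uring :: (type, type) comm_ring_1
begin

lift_definition zero_uring :: "('a, 'b) uring" is "(0, \<lambda>i. \<zero>\<^bsub>fring i\<^esub>)" by simp

lift_definition one_uring :: "('a, 'b) uring" is "(1, \<lambda>i. \<one>\<^bsub>fring i\<^esub>)" by simp

lift_definition plus_uring :: "('a, 'b) uring \<Rightarrow> ('a, 'b) uring \<Rightarrow> ('a, 'b) uring" is
  "\<lambda>x y. (fst x + fst y, \<lambda>i. snd x i \<oplus>\<^bsub>fring i\<^esub> snd y i)" by simp

lift_definition times_uring :: "('a, 'b) uring \<Rightarrow> ('a, 'b) uring \<Rightarrow> ('a, 'b) uring" is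
  "\<lambda>x y. (fst x * fst y, \<lambda>i. snd x i \<otimes>\<^bsub>fring i\<^esub> snd y i)" by simp

lift_definition uminus_uring :: "('a, 'b) uring \<Rightarrow> ('a, 'b) uring" is
  "\<lambda>x. (- fst x, \<lambda>i. \<ominus>\<^bsub>fring i\<^esub> snd x i)" by simp

definition minus_uring :: "('a, 'b) uring \<Rightarrow> ('a, 'b) uring \<Rightarrow> ('a, 'b) uring" where
  "minus_uring x y = x + - y"

instance
proof
  fix a b c :: "('a, 'b) uring"
  show "a + b + c = a + (b + c)"
    by transfer (simp add: fun_eq_iff add.assoc ring.ring_simprules(7)[OF flie_ring])
  show "a * b * c = a * (b * c)"
    by transfer (simp add: fun_eq_iff mult.assoc ring.ring_simprules(11)[OF flie_ring])
  show "(a + b) * c = a * c + b * c"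
    by transfer (simp add: fun_eq_iff distrib_right ring.ring_simprules(13)[OF flie_ring])
  show "a + b = b + a"
    by transfer (simp add: fun_eq_iff add.commute ring.ring_simprules(10)[OF flie_ring])
  show "a * b = b * a"
    by transfer (simp add: fun_eq_iff mult.commute cring.cring_simprules(14)[OF flie_cring])
  show "0 + a = a"
    by transfer (simp add: fun_eq_iff prod_eq_iff ring.ring_simprules(8)[OF flie_ring])
  show "1 * a = a"
    by transfer (simp add: fun_eq_iff prod_eq_iff ring.ring_simprules(12)[OF flie_ring])
  show "- a + a = 0"
    by transfer (simp add: fun_eq_iff ring.ring_simprules(9)[OF flie_ring])
  show "a - b = a + - b" by (simp add: minus_uring_def)
  show "(0::('a, 'b) uring) \<noteq> 1" by transfer simp
qed

end

instantiation umod :: (type, type) ab_group_add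
begin

lift_definition zero_umod :: "('a, 'b) umod" is "\<lambda>i. \<zero>\<^bsub>flie i\<^esub>" by simp

lift_definition plus_umod :: "('a, 'b) umod \<Rightarrow> ('a, 'b) umod \<Rightarrow> ('a, 'b) umod" is
  "\<lambda>x y i. x i \<oplus>\<^bsub>flie i\<^esub> y i" by simp

lift_definition uminus_umod :: "('a, 'b) umod \<Rightarrow> ('a, 'b) umod" is
  "\<lambda>x i. \<ominus>\<^bsub>flie i\<^esub> x i" by simp

definition minus_umod :: "('a, 'b) umod \<Rightarrow> ('a, 'b) umod \<Rightarrow> ('a, 'b) umod" where
  "minus_umod x y = x + - y"

instance
proof
  fix a b c :: "('a, 'b) umod"
  show "a + b + c = a + (b + c)"
    by transfer (simp add: fun_eq_iff abelian_monoid.a_assoc[OF flie_monoid])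
  show "a + b = b + a"
    by transfer (simp add: fun_eq_iff abelian_monoid.a_comm[OF flie_monoid])
  show "0 + a = a"
    by transfer (simp add: fun_eq_iff abelian_monoid.l_zero[OF flie_monoid])
  show "- a + a = 0"
    by transfer (simp add: fun_eq_iff abelian_group.l_neg[OF flie_group])
  show "a - b = a + - b" by (simp add: minus_umod_def)
qed

end

lift_definition uscale :: "('a, 'b) uring \<Rightarrow> ('a, 'b) umod \<Rightarrow> ('a, 'b) umod" is
  "\<lambda>a x i. snd a i \<odot>\<^bsub>flie i\<^esub> x i" by simp

lift_definition ubr :: "('a, 'b) umod \<Rightarrow> ('a, 'b) umod \<Rightarrow> ('a, 'b) umod" is
  "\<lambda>x y i. \<lbrakk>x i,y i\<rbrakk>\<^bsub>flie i\<^esub>" by simp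

lemma umod_module: "Modules.module (uscale :: ('a, 'b) uring \<Rightarrow> ('a, 'b) umod \<Rightarrow> ('a, 'b) umod)"
proof
  fix a b :: "('a, 'b) uring" and x y :: "('a, 'b) umod"
  show "uscale a (x + y) = uscale a x + uscale a y"
    by transfer (simp add: fun_eq_iff module.smult_r_distr[OF flie_module])
  show "uscale (a + b) x = uscale a x + uscale b x"
    by transfer (simp add: fun_eq_iff module.smult_l_distr[OF flie_module])
  show "uscale a (uscale b x) = uscale (a * b) x"
    by transfer (simp add: fun_eq_iff module.smult_assoc1[OF flie_module])
  show "uscale 1 x = x"
    by transfer (simp add: fun_eq_iff module.smult_one[OF flie_module])
qed

lemma ubr_laws:
  fixes x y z :: "('a, 'b) umod" and a :: "('a, 'b) uring"
  shows "ubr (x + y) z = ubr x z + ubr y z"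
    and "ubr x (y + z) = ubr x y + ubr x z"
    and "ubr (uscale a x) y = uscale a (ubr x y)"
    and "ubr x (uscale a y) = uscale a (ubr x y)"
    and "ubr x x = 0"
    and "ubr x (ubr y z) + ubr y (ubr z x) + ubr z (ubr x y) = 0"
       apply (transfer, simp add: fun_eq_iff lie_algebra.bracket_add_left[OF flie_lie])
      apply (transfer, simp add: fun_eq_iff lie_algebra.bracket_add_right[OF flie_lie])
     apply (transfer, simp add: fun_eq_iff lie_algebra.bracket_smult_left[OF flie_lie])
    apply (transfer, simp add: fun_eq_iff lie_algebra.bracket_smult_right[OF flie_lie])
   apply (transfer, simp add: fun_eq_iff lie_algebra.bracket_self[OF flie_lie])
  apply (transfer, simp add: fun_eq_iff lie_algebra.jacobi[OF flie_lie])
  done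

subsection \<open>The factors\<close>

lift_definition uemb :: "('f, 'g) lie_index \<Rightarrow> 'g \<Rightarrow> ('f, 'g) umod" is
  "\<lambda>j x i. if i = j \<and> x \<in> carrier (flie i) then x else \<zero>\<^bsub>flie i\<^esub>" by auto

lift_definition uscal :: "('f, 'g) lie_index \<Rightarrow> 'f \<Rightarrow> ('f, 'g) uring" is
  "\<lambda>j a. (0, \<lambda>i. if i = j \<and> a \<in> carrier (fring i) then a else \<zero>\<^bsub>fring i\<^esub>)" by auto

lift_definition ucoef :: "('f, 'g) lie_index \<Rightarrow> ('f, 'g) uring \<Rightarrow> 'f" is "\<lambda>j a. snd a j" .

lift_definition uproj :: "('f, 'g) lie_index \<Rightarrow> ('f, 'g) umod \<Rightarrow> 'g" is "\<lambda>j x. x j" .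

lemma uproj_uemb [simp]: "x \<in> carrier (flie j) \<Longrightarrow> uproj j (uemb j x) = x"
  by transfer simp

lemma ucoef_uscal [simp]: "a \<in> carrier (fring j) \<Longrightarrow> ucoef j (uscal j a) = a"
  by transfer simp

lemma ucoef_closed [simp]: "ucoef j r \<in> carrier (fring j)"
  by transfer simp

lemma uemb_inj: "inj_on (uemb j) (carrier (flie j))"
  by (rule inj_on_inverseI) (rule uproj_uemb)

lemma uemb_add:
  "x \<in> carrier (flie j) \<Longrightarrow> y \<in> carrier (flie j) \<Longrightarrow> uemb j (x \<oplus>\<^bsub>flie j\<^esub> y) = uemb j x + uemb j y"
  by transfer (auto simp: fun_eq_iff abelian_monoid.l_zero[OF flie_monoid])

lemma uemb_zero: "uemb j \<zero>\<^bsub>flie j\<^esub> = 0"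
  by transfer (auto simp: fun_eq_iff)

lemma uscale_uemb: "x \<in> carrier (flie j) \<Longrightarrow> uscale r (uemb j x) = uemb j (ucoef j r \<odot>\<^bsub>flie j\<^esub> x)"
  by transfer (auto simp: fun_eq_iff module.smult_r_null[OF flie_module])

lemma ubr_uemb:
  "x \<in> carrier (flie j) \<Longrightarrow> y \<in> carrier (flie j) \<Longrightarrow> ubr (uemb j x) (uemb j y) = uemb j \<lbrakk>x,y\<rbrakk>\<^bsub>flie j\<^esub>"
  by transfer (auto simp: fun_eq_iff lie_algebra.bracket_zero_left[OF flie_lie])

context
  fixes j :: "('f, 'g) lie_index" and F M
  defines "F \<equiv> fring j" and "M \<equiv> flie j"
begin

interpretation lie_algebra F M unfolding F_def M_def by (rule flie_lie)

lemmas facts = uproj_uemb[of _ j, folded M_def] ucoef_uscal[of _ j, folded F_def]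
  ucoef_closed[of j, folded F_def] uemb_inj[of j, folded M_def] uemb_add[of _ j, folded M_def]
  uemb_zero[of j, folded M_def] uscale_uemb[of _ j, folded M_def] ubr_uemb[of _ j, folded M_def]

private lemmas F_facts [simp] = facts(2,3)
private lemmas inj = facts(4)
private lemmas add = facts(5)
private lemmas zero = facts(6)
private lemmas scal = facts(7)
private lemmas fact_ubr = facts(8)

text \<open>A scalar of the product acts on the factor \<open>j\<close> through its component there,
  and \<open>uscal\<close> lifts every scalar of the factor; so both notions ask for closure under
  the same maps.\<close>

lemma subspace_uemb:
  assumes H: "H \<subseteq> carrier M"
  shows "Modules.module.subspace uscale (uemb j ` H) \<longleftrightarrow> LinearCombinations.submodule F H M"
proof -
  interpret U: Modules.module "uscale :: ('f, 'g) uring \<Rightarrow> ('f, 'g) umod \<Rightarrow> ('f, 'g) umod" by (rule umod_module)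
  have mem: "uemb j x \<in> uemb j ` H \<longleftrightarrow> x \<in> H" if "x \<in> carrier M" for x
    using inj_on_image_mem_iff[OF inj that H] .
  show ?thesis
  proof
    assume s: "U.subspace (uemb j ` H)"
    show "LinearCombinations.submodule F H M"
    proof (rule submodule.intro)
      show "\<zero>\<^bsub>M\<^esub> \<in> H" using U.subspace_0[OF s] mem[of "\<zero>\<^bsub>M\<^esub>"] zero by simp
      show "v \<oplus>\<^bsub>M\<^esub> w \<in> H" if "v \<in> H" "w \<in> H" for v w
        proof -
        have vw: "v \<in> carrier M" "w \<in> carrier M" using that H by auto
        have "uemb j v + uemb j w \<in> uemb j ` H" using that by (intro U.subspace_add[OF s]) auto
        then show ?thesis using mem[of "v \<oplus>\<^bsub>M\<^esub> w"] vw by (simp add: add)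
      qed
      show "a \<odot>\<^bsub>M\<^esub> v \<in> H" if "a \<in> carrier F" "v \<in> H" for a v
        proof -
        have v: "v \<in> carrier M" using that H by auto
        have "uscale (uscal j a) (uemb j v) \<in> uemb j ` H" using that by (intro U.subspace_scale[OF s]) auto
        then show ?thesis using mem[of "a \<odot>\<^bsub>M\<^esub> v"] v that by (simp add: scal)
      qed
    qed (use H module_axioms in auto)
  next
    assume "LinearCombinations.submodule F H M"
    then interpret S: LinearCombinations.submodule F H M .
    show "U.subspace (uemb j ` H)"
    proof (rule U.subspaceI)
      show "0 \<in> uemb j ` H" using S.zero_closed zero by force
      show "x + y \<in> uemb j ` H" if "x \<in> uemb j ` H" "y \<in> uemb j ` H" for x y
        using that H S.m_closed by (auto simp: add[symmetric] subset_iff)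
      show "uscale c x \<in> uemb j ` H" if "x \<in> uemb j ` H" for c x
        using that H S.smult_closed by (auto simp: scal subset_iff)
    qed
  qed
qed

text \<open>On the factor the scalars act through the field \<open>F\<close>. Cancelling nonzero
  field elements gives \<open>kill\<close>, and injectivity of multiplying a nonzero vector gives
  the size of a line.\<close>

lemma factor_finite_lie:
  assumes F: "field F" "finite (carrier F)" and M: "finite (carrier M)"
  shows "finite_lie uscale (uemb j ` carrier M) (card (carrier F)) ubr"
proof -
  interpret U: Modules.module "uscale :: ('f, 'g) uring \<Rightarrow> ('f, 'g) umod \<Rightarrow> ('f, 'g) umod" by (rule umod_module)
  interpret F: field F by (rule F)
  have cancel: "a = \<zero>\<^bsub>F\<^esub>" if a: "a \<in> carrier F" and x: "x \<in> carrier M" "x \<noteq> \<zero>\<^bsub>M\<^esub>" and ax: "a \<odot>\<^bsub>M\<^esub> x = \<zero>\<^bsub>M\<^esub>" for a x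
  proof (rule ccontr)
    assume "a \<noteq> \<zero>\<^bsub>F\<^esub>"
    then have i: "inv\<^bsub>F\<^esub> a \<in> carrier F" "inv\<^bsub>F\<^esub> a \<otimes>\<^bsub>F\<^esub> a = \<one>\<^bsub>F\<^esub>"
      using a F.field_Units by auto
    have "x = (inv\<^bsub>F\<^esub> a \<otimes>\<^bsub>F\<^esub> a) \<odot>\<^bsub>M\<^esub> x" unfolding i(2) using x by simp
    also have "\<dots> = inv\<^bsub>F\<^esub> a \<odot>\<^bsub>M\<^esub> (a \<odot>\<^bsub>M\<^esub> x)" using smult_assoc1[OF i(1) a x(1)] .
    also have "\<dots> = \<zero>\<^bsub>M\<^esub>" using i ax by simp
    finally show False using x by simp
  qed
  have nz: "uemb j x = 0 \<longleftrightarrow> x = \<zero>\<^bsub>M\<^esub>" if "x \<in> carrier M" for x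
    using inj_onD[OF inj, of x "\<zero>\<^bsub>M\<^esub>"] that zero by auto
  show ?thesis
  proof (unfold_locales)
    show "finite (uemb j ` carrier M)" using M by simp
    have "LinearCombinations.submodule F (carrier M) M"
      by (rule submodule.intro) (use module_axioms in auto)
    then show "U.subspace (uemb j ` carrier M)" by (simp add: subspace_uemb)
    have "{\<zero>\<^bsub>F\<^esub>, \<one>\<^bsub>F\<^esub>} \<subseteq> carrier F" by simp
    then have "card {\<zero>\<^bsub>F\<^esub>, \<one>\<^bsub>F\<^esub>} \<le> card (carrier F)" using F(2) by (rule card_mono[rotated])
    then show "2 \<le> card (carrier F)" using F.one_not_zero by (simp add: eq_commute)
  next
    fix a and v u :: "('f, 'g) umod" assume a: "uscale a v = 0" "v \<in> (uemb j ` carrier M)" "v \<noteq> 0" "u \<in> (uemb j ` carrier M)"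
    then obtain x y where x: "x \<in> carrier M" "v = uemb j x" and y: "y \<in> carrier M" "u = uemb j y"
      by auto
    have "ucoef j a \<odot>\<^bsub>M\<^esub> x = \<zero>\<^bsub>M\<^esub>" using a x nz[of "ucoef j a \<odot>\<^bsub>M\<^esub> x"] by (simp add: scal)
    then have "ucoef j a = \<zero>\<^bsub>F\<^esub>" using cancel[of "ucoef j a" x] a x nz by simp
    then show "uscale a u = 0" using y by (simp add: scal zero)
  next
    fix v :: "('f, 'g) umod" assume v: "v \<in> (uemb j ` carrier M)" "v \<noteq> 0"
    then obtain x where x: "x \<in> carrier M" "v = uemb j x" by (auto simp:)
    then have x0: "x \<noteq> \<zero>\<^bsub>M\<^esub>" using v nz by simp
    have "U.span {v} = uemb j ` (\<lambda>a. a \<odot>\<^bsub>M\<^esub> x) ` carrier F"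
    proof (intro equalityI subsetI)
      fix y assume "y \<in> uemb j ` (\<lambda>a. a \<odot>\<^bsub>M\<^esub> x) ` carrier F"
      then obtain a where a: "a \<in> carrier F" "y = uemb j (a \<odot>\<^bsub>M\<^esub> x)" by blast
      then have "y = uscale (uscal j a) v" using x by (simp add: scal)
      then show "y \<in> U.span {v}" by (auto simp: U.span_singleton)
    qed (use x in \<open>auto simp: U.span_singleton scal\<close>)
    moreover have "inj_on (\<lambda>a. a \<odot>\<^bsub>M\<^esub> x) (carrier F)"
    proof (rule inj_onI)
      fix a b assume ab: "a \<in> carrier F" "b \<in> carrier F" "a \<odot>\<^bsub>M\<^esub> x = b \<odot>\<^bsub>M\<^esub> x"
      have "(a \<ominus>\<^bsub>F\<^esub> b) \<odot>\<^bsub>M\<^esub> x = \<zero>\<^bsub>M\<^esub>"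
        using ab x by (simp add: a_minus_def smult_l_distr smult_l_minus M.r_neg)
      then have "a \<ominus>\<^bsub>F\<^esub> b = \<zero>\<^bsub>F\<^esub>" using cancel ab x x0 by simp
      then show "a = b" using ab by simp
    qed
    moreover have "inj_on (uemb j) ((\<lambda>a. a \<odot>\<^bsub>M\<^esub> x) ` carrier F)"
      by (rule inj_on_subset[OF inj]) (use x in auto)
    ultimately show "card (U.span {v}) = card (carrier F)" by (simp add: card_image)
  next
    show "x \<in> (uemb j ` carrier M) \<Longrightarrow> y \<in> (uemb j ` carrier M) \<Longrightarrow> ubr x y \<in> (uemb j ` carrier M)" for x y :: "('f, 'g) umod"
      by (auto simp: fact_ubr)
  qed (rule ubr_laws)+
qed

end

section \<open>Primes of a ring of integers\<close>

locale integer_ring =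
  fixes K :: "'k::field_char_0 set"
  assumes nf: "number_field K" and cr: "cring (ring_of_integers K)"
begin

abbreviation R where "R \<equiv> ring_of_integers K"

definition OK :: "'k set" where "OK = {x \<in> K. algebraic_int x}"

sublocale R: cring R by (rule cr)

lemma R_simps [simp]:
  "carrier R = OK" "\<zero>\<^bsub>R\<^esub> = 0" "\<one>\<^bsub>R\<^esub> = 1" "x \<otimes>\<^bsub>R\<^esub> y = x * y" "x \<oplus>\<^bsub>R\<^esub> y = x + y"
  by (simp_all add: ring_of_integers_def ring_of_type_algebra_def OK_def)

lemma OK_closed [simp]:
  "0 \<in> OK" "1 \<in> OK" "x \<in> OK \<Longrightarrow> y \<in> OK \<Longrightarrow> x + y \<in> OK" "x \<in> OK \<Longrightarrow> y \<in> OK \<Longrightarrow> x * y \<in> OK"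
  using R.zero_closed R.one_closed R.a_closed[of x y] R.m_closed[of x y] by simp_all

lemma R_uminus: 
  assumes "x \<in> OK"
  shows "\<ominus>\<^bsub>R\<^esub> x = - x"
proof -
  have "\<ominus>\<^bsub>R\<^esub> x + x = 0" using R.l_neg[of x] assms by simp
  then show ?thesis by (simp add: add_eq_0_iff2)
qed

lemma OK_neg [simp]: "x \<in> OK \<Longrightarrow> - x \<in> OK"
  using R.a_inv_closed[of x] by (simp add: R_uminus)

lemma OK_diff [simp]: "x \<in> OK \<Longrightarrow> y \<in> OK \<Longrightarrow> x - y \<in> OK"
  using OK_closed(3)[of x "- y"] by simp

lemma OK_sum: "(\<And>i. i \<in> S \<Longrightarrow> f i \<in> OK) \<Longrightarrow> sum f S \<in> OK"
  by (induction S rule: infinite_finite_induct) auto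

lemma OK_of_nat [simp]: "of_nat n \<in> OK"
  by (induction n) auto

lemma OK_of_int [simp]: "of_int n \<in> OK"
  by (cases n rule: int_cases) (auto simp del: of_nat_Suc)

lemma OK_poly: "x \<in> OK \<Longrightarrow> poly (map_poly of_int p) x \<in> OK"
  by (induction p) (auto simp: map_poly_pCons)

text \<open>Passes from the dimension of carrier-based algebra to a finite spanning set in the sense
  of rational scalars on a type. The equation \<open>F = \<rat>\<close> is a separate premise so
  that rule induction on \<open>dimension\<close> applies.\<close>

lemma dimension_span:
  assumes "ring.dimension (ring_of_type_algebra :: 'k ring) n F E" "F = \<rat>"
  shows "\<exists>T. finite T \<and> E \<subseteq> Modules.module.span (\<lambda>(q::rat) x. of_rat q * x) T"
proof -
  interpret A: ring "ring_of_type_algebra :: 'k ring" by (rule ring_from_type_algebra)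
  interpret Q: vector_space "\<lambda>(q::rat) (x::'k). of_rat q * x"
    by unfold_locales (auto simp: algebra_simps of_rat_add of_rat_mult)
  show ?thesis using assms
  proof (induction rule: A.dimension.induct)
    case (zero_dim F)
    then show ?case by (intro exI[of _ "{}"]) (auto simp: ring_of_type_algebra_def)
  next
    case (Suc_dim v E n F)
    then obtain T where T: "finite T" "E \<subseteq> Q.span T" by blast
    have "A.line_extension F v E \<subseteq> Q.span (insert v T)"
    proof
      fix x assume "x \<in> A.line_extension F v E"
      then obtain k y where "k \<in> F" "y \<in> E"
          "x = k \<otimes>\<^bsub>ring_of_type_algebra\<^esub> v \<oplus>\<^bsub>ring_of_type_algebra\<^esub> y"
        unfolding A.line_extension_mem_iff by blast
      then have k: "k \<in> \<rat>" "y \<in> E" "x = k * v + y"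
        using Suc_dim.prems by (simp_all add: ring_of_type_algebra_def)
      then obtain r where "k = of_rat r" by (auto simp: Rats_def)
      moreover have "y \<in> Q.span (insert v T)" using T k Q.span_mono[of T "insert v T"] by blast
      ultimately show "x \<in> Q.span (insert v T)"
        using k Q.span_add[OF Q.span_scale[OF Q.span_base[of v "insert v T"], of r]] by simp
    qed
    then show ?case using T by blast
  qed
qed

text \<open>Linear independence over the field with \<open>l\<close> elements of the images of
  \<open>S\<close> in \<open>OK\<close> modulo \<open>l\<close>, for prime \<open>l\<close>, in
  terms of integer coefficients.\<close>

definition indep_mod :: "nat \<Rightarrow> 'k set \<Rightarrow> bool" where
  "indep_mod l S \<longleftrightarrow> (\<forall>c :: 'k \<Rightarrow> int. (\<exists>z\<in>OK. (\<Sum>u\<in>S. of_int (c u) * u) = of_nat l * z) \<longrightarrow>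
     (\<forall>u\<in>S. int l dvd c u))"

text \<open>Infinite descent: a relation over the integers would be divisible by every power of \<open>l\<close>.\<close>

lemma indep_mod_relation:
  assumes l: "Factorial_Ring.prime l" and S: "finite S" "indep_mod l S"
    and rel: "(\<Sum>u\<in>S. of_int (c u) * u) = 0"
  shows "\<forall>u\<in>S. c u = 0"
  using rel
proof (induction "\<Sum>u\<in>S. nat \<bar>c u\<bar>" arbitrary: c rule: less_induct)
  case less
  have "(\<Sum>u\<in>S. of_int (c u) * u) = of_nat l * 0" using less.prems by simp
  then have "\<forall>u\<in>S. int l dvd c u"
    using S(2)[unfolded indep_mod_def, rule_format, of c] OK_closed(1) by blast
  then have "\<forall>u\<in>S. \<exists>d. c u = int l * d" by (auto simp: dvd_def)
  then obtain d where d: "\<And>u. u \<in> S \<Longrightarrow> c u = int l * d u" by metis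
  have l2: "2 \<le> l" using l prime_ge_2_nat by blast
  have "of_nat l * (\<Sum>u\<in>S. of_int (d u) * u) = (\<Sum>u\<in>S. of_int (c u) * u)"
    unfolding sum_distrib_left by (rule sum.cong) (auto simp: d mult.assoc)
  then have rel': "(\<Sum>u\<in>S. of_int (d u) * u) = 0" using less.prems l2 by auto
  show ?case
  proof (rule ccontr)
    assume "\<not> (\<forall>u\<in>S. c u = 0)"
    then obtain u where u: "u \<in> S" "c u \<noteq> 0" by blast
    have le: "nat \<bar>d v\<bar> \<le> nat \<bar>c v\<bar>" if "v \<in> S" for v
    proof -
      have "\<bar>d v\<bar> * 1 \<le> \<bar>d v\<bar> * int l" using l2 by (intro mult_left_mono) auto
      then show ?thesis using d[OF that] by (simp add: abs_mult mult.commute)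
    qed
    have "nat \<bar>d u\<bar> < nat \<bar>c u\<bar>"
    proof -
      have "d u \<noteq> 0" using u d by auto
      then have "\<bar>d u\<bar> * 1 < \<bar>d u\<bar> * int l" using l2 by (intro mult_strict_left_mono) auto
      then show ?thesis using d[OF u(1)] by (simp add: abs_mult mult.commute)
    qed
    then have "(\<Sum>u\<in>S. nat \<bar>d u\<bar>) < (\<Sum>u\<in>S. nat \<bar>c u\<bar>)"
      using S(1) u le by (intro sum_strict_mono_ex1) auto
    then have "\<forall>u\<in>S. d u = 0" using less.hyps rel' by blast
    then show False using u d by auto
  qed
qed

text \<open>Clearing denominators turns a rational relation in \<open>S\<close> into an integral
  one, which \<open>indep_mod_relation\<close> excludes. So \<open>S\<close> is rationally
  independent, and a finite spanning set of \<open>K\<close> bounds its size uniformly.\<close>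

lemma indep_mod_bound:
  "\<exists>D. \<forall>l S. Factorial_Ring.prime l \<and> finite S \<and> S \<subseteq> OK \<and> indep_mod l S \<longrightarrow> card S \<le> D"
proof -
  interpret A: ring "ring_of_type_algebra :: 'k ring" by (rule ring_from_type_algebra)
  interpret Q: vector_space "\<lambda>(q::rat) (x::'k). of_rat q * x"
    by unfold_locales (auto simp: algebra_simps of_rat_add of_rat_mult)
  obtain n where "A.dimension n \<rat> K" using nf by (auto simp: number_field_def A.finite_dimension_def)
  then obtain T where T: "finite T" "K \<subseteq> Q.span T" using dimension_span by blast
  have "card S \<le> card T" if l: "Factorial_Ring.prime l" and S: "finite S" "S \<subseteq> OK" "indep_mod l S" for l S
  proof -
    have "Q.independent S"
    proof
      assume "Q.dependent S"
      then obtain c v where c: "v \<in> S" "c v \<noteq> 0" "(\<Sum>u\<in>S. of_rat (c u) * u) = 0"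
        using Q.dependent_finite[OF S(1)] by auto
      define N where "N = (\<Prod>u\<in>S. snd (quotient_of (c u)))"
      have "snd (quotient_of (c u)) \<noteq> 0" for u using quotient_of_denom_pos'[of "c u"] by simp
      then have N0: "N \<noteq> 0" unfolding N_def using S(1) by simp
      have "\<exists>d :: int. of_int N * c u = of_int d" if u: "u \<in> S" for u
      proof -
        obtain a b where ab: "quotient_of (c u) = (a, b)" by (cases "quotient_of (c u)")
        then have "b > 0" "c u = of_int a / of_int b" using quotient_of_denom_pos quotient_of_div by auto
        moreover have "b dvd N" unfolding N_def using S(1) u ab by (metis dvd_prodI snd_conv)
        then obtain e where "N = b * e" by (auto simp: dvd_def)
        ultimately have "of_int N * c u = of_int (a * e)" by (simp add: field_simps)
        then show ?thesis by blast
      qed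
      then obtain d where d: "\<And>u. u \<in> S \<Longrightarrow> of_int N * c u = (of_int (d u) :: rat)" by metis
      have "of_int (d u) = of_int N * (of_rat (c u) :: 'k)" if "u \<in> S" for u
        using d[OF that] by (metis of_rat_mult of_rat_of_int_eq)
      then have "(\<Sum>u\<in>S. of_int (d u) * u) = (\<Sum>u\<in>S. of_int N * (of_rat (c u) * u))"
        by (intro sum.cong) auto
      also have "\<dots> = 0" using c by (simp add: sum_distrib_left[symmetric])
      finally have "d v = 0" using indep_mod_relation[OF l S(1,3)] c by blast
      then show False using d[OF c(1)] c N0 by auto
    qed
    moreover have "S \<subseteq> Q.span T" using S T by (auto simp: OK_def)
    ultimately show ?thesis using Q.independent_span_bound[OF T(1)] by blast
  qed
  then show ?thesis by blast
qed

text \<open>A largest set \<open>S\<close> independent modulo \<open>l\<close>, which exists by the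
  uniform bound, generates \<open>OK\<close> modulo \<open>l\<close>. Its combinations with
  coefficients from 0 to \<open>l - 1\<close> represent all residues.\<close>

lemma finite_residues:
  assumes l: "Factorial_Ring.prime l"
  shows "\<exists>T. finite T \<and> T \<subseteq> OK \<and> (\<forall>y\<in>OK. \<exists>t\<in>T. \<exists>z\<in>OK. y = t + of_nat l * z)"
proof -
  obtain D where D: "\<forall>S. finite S \<and> S \<subseteq> OK \<and> indep_mod l S \<longrightarrow> card S \<le> D"
    using indep_mod_bound l by blast
  let ?P = "\<lambda>S. finite S \<and> S \<subseteq> OK \<and> indep_mod l S"
  have "?P {}" by (simp add: indep_mod_def)
  then have "\<exists>S. ?P S \<and> (\<forall>S'. ?P S' \<longrightarrow> card S' \<le> card S)"
    by (rule ex_has_greatest_nat[where b = "Suc D"]) (use D in \<open>auto simp: less_Suc_eq_le\<close>)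
  then obtain S where S: "finite S" "S \<subseteq> OK" "indep_mod l S"
    and max: "\<And>S'. finite S' \<Longrightarrow> S' \<subseteq> OK \<Longrightarrow> indep_mod l S' \<Longrightarrow> card S' \<le> card S" by blast
  define T where "T = (\<lambda>c. \<Sum>u\<in>S. of_int (c u) * u) ` (S \<rightarrow>\<^sub>E {0..<int l})"
  have l0: "0 < l" using l prime_gt_0_nat by blast
  have comb: "\<exists>t\<in>T. \<exists>z\<in>OK. y = t + of_nat l * z"
    if y: "y = (\<Sum>u\<in>S. of_int (e u) * u) + of_nat l * z" "z \<in> OK" for y e z
  proof -
    let ?c = "restrict (\<lambda>u. e u mod int l) S"
    let ?z = "(\<Sum>u\<in>S. of_int (e u div int l) * u) + z"
    have "(\<Sum>u\<in>S. of_int (e u) * u) = (\<Sum>u\<in>S. of_int (?c u) * u + of_nat l * (of_int (e u div int l) * u))"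
    proof (rule sum.cong[OF refl])
      fix u assume "u \<in> S"
      have "(of_int (e u) :: 'k) = of_int (e u mod int l + int l * (e u div int l))" by simp
      also have "\<dots> = of_int (e u mod int l) + of_nat l * of_int (e u div int l)"
        by (simp only: of_int_add of_int_mult of_int_of_nat_eq)
      finally show "of_int (e u) * u = of_int (?c u) * u + of_nat l * (of_int (e u div int l) * u)"
        using \<open>u \<in> S\<close> by (simp add: algebra_simps)
    qed
    then have "y = (\<Sum>u\<in>S. of_int (?c u) * u) + of_nat l * ?z"
      using y by (simp add: sum.distrib sum_distrib_left algebra_simps)
    moreover have "(\<Sum>u\<in>S. of_int (?c u) * u) \<in> T" unfolding T_def using l0 by (intro imageI) auto
    moreover have "?z \<in> OK" using S y by (auto intro!: OK_sum OK_closed(3))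
    ultimately show ?thesis by blast
  qed
  have "\<exists>t\<in>T. \<exists>z\<in>OK. y = t + of_nat l * z" if y: "y \<in> OK" for y
  proof (cases "y \<in> S")
    case True
    have "(\<Sum>u\<in>S. of_int (if u = y then 1 else 0) * u) = (\<Sum>u\<in>S. if u = y then u else 0)"
      by (intro sum.cong) auto
    also have "\<dots> = y" using S(1) True by simp
    finally have "y = (\<Sum>u\<in>S. of_int (if u = y then 1 else 0) * u) + of_nat l * 0" by simp
    then show ?thesis using comb[of y "\<lambda>u. if u = y then 1 else 0" 0] by simp
  next
    case False
    have "\<not> indep_mod l (insert y S)"
    proof
      assume "indep_mod l (insert y S)"
      then have "card (insert y S) \<le> card S" using max[of "insert y S"] S y by simp
      then show False using False S by simp
    qed
    then obtain c z where c: "z \<in> OK" "(\<Sum>u\<in>insert y S. of_int (c u) * u) = of_nat l * z"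
        and nd: "\<not> (\<forall>u\<in>insert y S. int l dvd c u)"
      unfolding indep_mod_def by blast
    have e: "of_int (c y) * y + (\<Sum>u\<in>S. of_int (c u) * u) = of_nat l * z" using c False S by simp
    \<comment> \<open>Otherwise the relation would be one of \<open>S\<close> alone modulo
      \<open>l\<close>.\<close>
    have "\<not> int l dvd c y"
    proof
      assume d: "int l dvd c y"
      then obtain f where f: "c y = int l * f" by (auto simp: dvd_def)
      then have "(\<Sum>u\<in>S. of_int (c u) * u) = of_nat l * (z - of_int f * y)"
        using e by (simp add: algebra_simps)
      moreover have "z - of_int f * y \<in> OK" using c y by simp
      ultimately have "\<forall>u\<in>S. int l dvd c u" using S(3) unfolding indep_mod_def by blast
      then show False using nd d by blast
    qed
    then have "coprime (c y) (int l)" using l by (metis coprime_commute prime_imp_coprime prime_int_nat_transfer prime_nat_int_transfer)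
    \<comment> \<open>Bezout inverts the coefficient of \<open>y\<close> modulo \<open>l\<close>,
      which expresses \<open>y\<close> by \<open>S\<close>.\<close>
    then obtain a b where ab: "a * c y + b * int l = 1" using bezout_int[of "c y" "int l"] by (auto simp: coprime_iff_gcd_eq_1)
    have "y = of_int (a * c y + b * int l) * y" using ab by simp
    also have "\<dots> = of_int a * (of_int (c y) * y) + of_nat l * (of_int b * y)"
      by (simp add: algebra_simps)
    also have "of_int (c y) * y = of_nat l * z - (\<Sum>u\<in>S. of_int (c u) * u)" using e by (simp add: algebra_simps)
    also have "of_int a * \<dots> + of_nat l * (of_int b * y)
        = (\<Sum>u\<in>S. of_int (- a * c u) * u) + of_nat l * (of_int a * z + of_int b * y)"
      by (simp add: algebra_simps sum_distrib_left sum_negf)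
    finally have "y = (\<Sum>u\<in>S. of_int (- a * c u) * u) + of_nat l * (of_int a * z + of_int b * y)" .
    then show ?thesis by (rule comb) (use c y in simp)
  qed
  moreover have "finite T" unfolding T_def using S(1) by (intro finite_imageI finite_PiE) auto
  moreover have "T \<subseteq> OK" using S by (auto simp: T_def intro!: OK_sum OK_closed(4))
  ultimately show ?thesis by blast
qed

lemma ideal_closed:
  assumes "Ideal.ideal p R"
  shows "p \<subseteq> OK" "0 \<in> p" "x \<in> p \<Longrightarrow> y \<in> p \<Longrightarrow> x + y \<in> p" "x \<in> p \<Longrightarrow> y \<in> OK \<Longrightarrow> x * y \<in> p"
    "x \<in> p \<Longrightarrow> y \<in> OK \<Longrightarrow> y * x \<in> p" "x \<in> p \<Longrightarrow> - x \<in> p" "x \<in> p \<Longrightarrow> y \<in> p \<Longrightarrow> x - y \<in> p"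
proof -
  interpret p: Ideal.ideal p R by fact
  show 1: "p \<subseteq> OK" "0 \<in> p" "x \<in> p \<Longrightarrow> y \<in> p \<Longrightarrow> x + y \<in> p" for x y
    using p.a_subset p.zero_closed p.a_closed[of x y] by simp_all
  show 2: "x \<in> p \<Longrightarrow> y \<in> OK \<Longrightarrow> x * y \<in> p" "x \<in> p \<Longrightarrow> y \<in> OK \<Longrightarrow> y * x \<in> p" for x y
    using p.I_r_closed[of x y] p.I_l_closed[of x y] by simp_all
  show 3: "x \<in> p \<Longrightarrow> - x \<in> p" for x using 2(1)[of x "- 1"] by simp
  show "x \<in> p \<Longrightarrow> y \<in> p \<Longrightarrow> x - y \<in> p" using 1(3)[of x "- y"] 3[of y] by simp
qed

lemma ideal_sum: "Ideal.ideal p R \<Longrightarrow> (\<And>i. i \<in> S \<Longrightarrow> f i \<in> p) \<Longrightarrow> sum f S \<in> p"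
  by (induction S rule: infinite_finite_induct) (auto simp: ideal_closed)

text \<open>An ideal that contains \<open>l\<close> is a union of residue classes modulo
  \<open>l\<close>, so it is determined by which of the finitely many representatives it
  contains.\<close>

lemma finite_ideals_prime:
  assumes l: "Factorial_Ring.prime l"
  shows "finite {p. Ideal.ideal p R \<and> of_nat l \<in> p}"
proof -
  obtain T where T: "finite T" "T \<subseteq> OK" "\<forall>y\<in>OK. \<exists>t\<in>T. \<exists>z\<in>OK. y = t + of_nat l * z"
    using finite_residues[OF l] by blast
  have sub: "p \<subseteq> p'" if p: "Ideal.ideal p R" "of_nat l \<in> p" and p': "Ideal.ideal p' R" "of_nat l \<in> p'"
    and e: "p \<inter> T = p' \<inter> T" for p p'
  proof
    fix y assume y: "y \<in> p"
    then have "y \<in> OK" using ideal_closed(1)[OF p(1)] by blast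
    then obtain t z where t: "t \<in> T" "z \<in> OK" "y = t + of_nat l * z" using T(3) by blast
    have "t = y - of_nat l * z" using t by simp
    then have "t \<in> p"
      using ideal_closed(7)[OF p(1) y, of "of_nat l * z"] ideal_closed(4)[OF p(1,2) t(2)] by simp
    then have "t \<in> p'" using e t by blast
    then show "y \<in> p'" using t ideal_closed(3,4)[OF p'(1)] p'(2) by simp
  qed
  have "inj_on (\<lambda>p. p \<inter> T) {p. Ideal.ideal p R \<and> of_nat l \<in> p}"
    by (rule inj_onI) (use sub in blast)
  moreover have "(\<lambda>p. p \<inter> T) ` {p. Ideal.ideal p R \<and> of_nat l \<in> p} \<subseteq> Pow T" by blast
  ultimately show ?thesis using T(1) by (meson finite_Pow_iff inj_on_finite)
qed

lemma finite_quotient_prime: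
  assumes l: "Factorial_Ring.prime l" and p: "Ideal.ideal p R" "of_nat l \<in> p"
  shows "finite (carrier (R Quot p))"
proof -
  interpret p: Ideal.ideal p R by fact
  obtain T where T: "finite T" "T \<subseteq> OK" "\<forall>y\<in>OK. \<exists>t\<in>T. \<exists>z\<in>OK. y = t + of_nat l * z"
    using finite_residues[OF l] by blast
  have "carrier (R Quot p) \<subseteq> (\<lambda>t. p +>\<^bsub>R\<^esub> t) ` T"
  proof
    fix A assume "A \<in> carrier (R Quot p)"
    then obtain y where y: "y \<in> OK" "A = p +>\<^bsub>R\<^esub> y" by (auto simp: FactRing_def A_RCOSETS_def')
    obtain t z where t: "t \<in> T" "z \<in> OK" "y = t + of_nat l * z" using T(3) y by blast
    have "y \<in> p +>\<^bsub>R\<^esub> t"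
    proof -
      have "y \<ominus>\<^bsub>R\<^esub> t \<in> p" using t T(2) ideal_closed(4)[OF p(1)] p(2) R_uminus[of t]
        by (auto simp: a_minus_def)
      then show ?thesis using p.a_rcos_module[of t y] t T y by (auto simp: a_minus_def)
    qed
    then have "A = p +>\<^bsub>R\<^esub> t" using y t T p.a_repr_independence'[of y t] by auto
    then show "A \<in> (\<lambda>t. p +>\<^bsub>R\<^esub> t) ` T" using t by blast
  qed
  then show ?thesis using T(1) finite_surj by blast
qed

text \<open>Cancelling powers of the nonzero \<open>x\<close> in an annihilating polynomial makes
  its constant term nonzero, and \<open>x\<close> divides that term.\<close>

lemma divides_integer:
  assumes x: "x \<in> OK" "x \<noteq> 0"
  obtains N :: nat and y where "N \<noteq> 0" "y \<in> OK" "of_nat N = x * y"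
proof -
  have *: "\<exists>N y. N \<noteq> 0 \<and> y \<in> OK \<and> of_int N = x * y" if "q \<noteq> 0" "poly (map_poly of_int q) x = 0" for q :: "int poly"
    using that
  proof (induction q)
    case (pCons a q)
    show ?case
    proof (cases "a = 0")
      case True
      then have "q \<noteq> 0" "poly (map_poly of_int q) x = 0" using pCons.prems x by (auto simp: map_poly_pCons)
      then show ?thesis by (rule pCons.IH)
    next
      case False
      have "of_int (- a) = x * poly (map_poly of_int q) x"
        using pCons.prems by (simp add: map_poly_pCons add_eq_0_iff)
      then show ?thesis using False OK_poly[OF x(1)] by (metis neg_equal_0_iff_equal)
    qed
  qed simp
  obtain q :: "int poly" where q: "poly (map_poly of_int q) x = 0" "lead_coeff q = 1"
    using x by (auto simp: OK_def algebraic_int_altdef_ipoly)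
  then have "q \<noteq> 0" by auto
  then obtain N y where N: "N \<noteq> 0" "y \<in> OK" "of_int N = x * y" using * q by blast
  show ?thesis
  proof (cases "N \<ge> 0")
    case True
    then show ?thesis using that[of "nat N" y] N by (simp add: of_nat_nat)
  next
    case False
    then show ?thesis using that[of "nat (- N)" "- y"] N by (simp add: of_nat_nat)
  qed
qed

definition PP :: "'k set set" where
  "PP = {p. primeideal p R \<and> p \<noteq> {\<zero>\<^bsub>R\<^esub>}}"

lemma PP_ideal: "p \<in> PP \<Longrightarrow> Ideal.ideal p R"
  by (auto simp: PP_def primeideal_def)

lemma PP_not_one: "p \<in> PP \<Longrightarrow> 1 \<notin> p"
  using Ideal.ideal.I_l_closed[of p R 1] primeideal.I_notcarr[of p R] PP_ideal[of p] ideal_closed(1)[of p]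
  by (force simp: PP_def)

lemma PP_prime: "p \<in> PP \<Longrightarrow> x \<in> OK \<Longrightarrow> y \<in> OK \<Longrightarrow> x * y \<in> p \<Longrightarrow> x \<in> p \<or> y \<in> p"
  using primeideal.I_prime[of p R x y] by (auto simp: PP_def)

lemma PP_prime_number:
  assumes p: "p \<in> PP" and N: "of_nat N \<in> p" "N \<noteq> 0"
  shows "\<exists>l. Factorial_Ring.prime l \<and> l dvd N \<and> of_nat l \<in> p"
  using N
proof (induction N rule: less_induct)
  case (less N)
  have "N \<noteq> 1" using less.prems PP_not_one[OF p] by auto
  then obtain l where l: "Factorial_Ring.prime l" "l dvd N" using prime_factor_nat by blast
  then obtain m where m: "N = l * m" by (auto simp: dvd_def)
  have "(of_nat l :: 'k) * of_nat m \<in> p" using less.prems m by simp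
  then have "of_nat l \<in> p \<or> of_nat m \<in> p" by (intro PP_prime[OF p]) simp_all
  then consider "of_nat l \<in> p" | "of_nat m \<in> p" by blast
  then show ?case
  proof cases
    case 2
    have "m < N" "m \<noteq> 0" using m less.prems prime_gt_1_nat[OF l(1)] by auto
    then obtain l' where "Factorial_Ring.prime l'" "l' dvd m" "of_nat l' \<in> p" using less.IH 2 by blast
    then show ?thesis using m by auto
  qed (use l in blast)
qed

text \<open>\<open>x\<close> divides a nonzero integer \<open>N\<close>; a prime ideal containing
  \<open>x\<close> then contains a rational prime divisor of \<open>N\<close>, and only finitely
  many ideals contain a given rational prime. All statements about almost all primes go back to
  this.\<close>

lemma finite_primes_containing:
  assumes x: "x \<in> OK" "x \<noteq> 0"
  shows "finite {p \<in> PP. x \<in> p}"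
proof -
  obtain N y where N: "N \<noteq> 0" "y \<in> OK" "of_nat N = x * y" using divides_integer[OF x] .
  have "{p \<in> PP. x \<in> p} \<subseteq> (\<Union>l\<in>{l. Factorial_Ring.prime l \<and> l dvd N}. {p. Ideal.ideal p R \<and> of_nat l \<in> p})"
  proof
    fix p assume p: "p \<in> {p \<in> PP. x \<in> p}"
    then have "of_nat N \<in> p" using ideal_closed(4)[OF PP_ideal, of p x y] N by simp
    then show "p \<in> (\<Union>l\<in>{l. Factorial_Ring.prime l \<and> l dvd N}. {p. Ideal.ideal p R \<and> of_nat l \<in> p})"
      using PP_prime_number[of p N] N p PP_ideal by auto
  qed
  moreover have "finite {l. Factorial_Ring.prime l \<and> l dvd N}"
    using N by (intro finite_subset[OF _ finite_divisors_nat[of N]]) auto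
  then have "finite (\<Union>l\<in>{l. Factorial_Ring.prime l \<and> l dvd N}. {p. Ideal.ideal p R \<and> of_nat l \<in> p})"
    using finite_ideals_prime by (intro finite_UN_I) auto
  ultimately show ?thesis by (rule finite_subset)
qed

lemma finite_quotient:
  assumes p: "p \<in> PP"
  shows "finite (carrier (R Quot p))"
proof -
  obtain x where x: "x \<in> p" "x \<noteq> 0" using p ideal_closed(2)[OF PP_ideal[OF p]] by (auto simp: PP_def)
  then have "x \<in> OK" using ideal_closed(1)[OF PP_ideal[OF p]] by blast
  then obtain N y where N: "N \<noteq> 0" "y \<in> OK" "of_nat N = x * y" using divides_integer x by blast
  then have "of_nat N \<in> p" using ideal_closed(4)[OF PP_ideal[OF p], of x y] x by simp
  then obtain l where "Factorial_Ring.prime l" "of_nat l \<in> p" using PP_prime_number[OF p] N by blast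
  then show ?thesis using finite_quotient_prime PP_ideal[OF p] by blast
qed

lemma quotient_field:
  assumes p: "p \<in> PP"
  shows "field (R Quot p)"
proof -
  have "primeideal p R" using p by (simp add: PP_def)
  then interpret Q: domain "R Quot p" by (rule primeideal.quotient_is_domain)
  show ?thesis
  proof (rule Q.cring_fieldI)
    show "Units (R Quot p) = carrier (R Quot p) - {\<zero>\<^bsub>R Quot p\<^esub>}"
    proof (intro equalityI subsetI)
      fix a assume a: "a \<in> Units (R Quot p)"
      then have "a \<noteq> \<zero>\<^bsub>R Quot p\<^esub>" using Q.Units_r_inv[OF a] Q.one_not_zero Q.l_null[OF Q.Units_inv_closed[OF a]]
        by metis
      then show "a \<in> carrier (R Quot p) - {\<zero>\<^bsub>R Quot p\<^esub>}" using a Q.Units_closed by simp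
    next
      fix a assume a: "a \<in> carrier (R Quot p) - {\<zero>\<^bsub>R Quot p\<^esub>}"
      have "inj_on (\<lambda>x. a \<otimes>\<^bsub>R Quot p\<^esub> x) (carrier (R Quot p))"
        using a by (intro inj_onI) (simp add: Q.m_lcancel)
      then have "(\<lambda>x. a \<otimes>\<^bsub>R Quot p\<^esub> x) ` carrier (R Quot p) = carrier (R Quot p)"
        using finite_quotient[OF p] a by (intro endo_inj_surj) auto
      then have "\<one>\<^bsub>R Quot p\<^esub> \<in> (\<lambda>x. a \<otimes>\<^bsub>R Quot p\<^esub> x) ` carrier (R Quot p)" using Q.one_closed by simp
      then obtain b where b: "b \<in> carrier (R Quot p)" "a \<otimes>\<^bsub>R Quot p\<^esub> b = \<one>\<^bsub>R Quot p\<^esub>" by force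
      then have "b \<otimes>\<^bsub>R Quot p\<^esub> a = \<one>\<^bsub>R Quot p\<^esub>" using a Q.m_comm[of a b] by simp
      then show "a \<in> Units (R Quot p)" using a b unfolding Group.Units_def by blast
    qed
  qed
qed

text \<open>By the pigeonhole principle, a prime of norm \<open>q\<close> contains a positive integer up to \<open>q\<close>.\<close>

lemma finite_primes_norm: "finite {p \<in> PP. card (carrier (R Quot p)) = q}"
proof -
  have "{p \<in> PP. card (carrier (R Quot p)) = q} \<subseteq> (\<Union>m\<in>{1..q}. {p \<in> PP. of_nat m \<in> p})"
  proof
    fix p assume p: "p \<in> {p \<in> PP. card (carrier (R Quot p)) = q}"
    then interpret p: Ideal.ideal p R using PP_ideal by blast
    let ?f = "\<lambda>n :: nat. p +>\<^bsub>R\<^esub> of_nat n"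
    have "?f n \<in> carrier (R Quot p)" for n
      using OK_of_nat[of n] by (auto simp: FactRing_def A_RCOSETS_def')
    then have "?f ` {0..q} \<subseteq> carrier (R Quot p)" by blast
    then have "card (?f ` {0..q}) \<le> q" using p finite_quotient card_mono by fastforce
    then have "\<not> inj_on ?f {0..q}" using card_image[of ?f "{0..q}"] by force
    then obtain i j where "i \<in> {0..q}" "j \<in> {0..q}" "i \<noteq> j" "?f i = ?f j" by (auto simp: inj_on_def)
    then obtain i j where ij: "i < j" "j \<le> q" "?f i = ?f j" by (metis atLeastAtMost_iff linorder_neqE_nat)
    have "of_nat j \<in> p +>\<^bsub>R\<^esub> of_nat i" using ij(3) p.a_rcos_self[of "of_nat j"] by simp
    then have "of_nat j \<ominus>\<^bsub>R\<^esub> of_nat i \<in> p" using p.a_rcos_module[of "of_nat i" "of_nat j"] by (simp add: a_minus_def)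
    then have "of_nat (j - i) \<in> p" using ij by (simp add: a_minus_def R_uminus of_nat_diff)
    then show "p \<in> (\<Union>m\<in>{1..q}. {p \<in> PP. of_nat m \<in> p})" using ij p by (intro UN_I[of "j - i"]) auto
  qed
  moreover have "finite (\<Union>m\<in>{1..q}. {p \<in> PP. of_nat m \<in> p})"
    by (intro finite_UN_I finite_primes_containing) auto
  ultimately show ?thesis by (rule finite_subset)
qed

subsection \<open>Linear systems modulo primes\<close>

text \<open>The homogeneous linear system with unknowns \<open>J\<close> and rows \<open>rs\<close>
  has only the zero solution over the residue field of \<open>p\<close>; residues are represented by
  elements of \<open>OK\<close>.\<close>

definition trivial_mod :: "'k set \<Rightarrow> 'j set \<Rightarrow> ('j \<Rightarrow> 'k) set \<Rightarrow> bool" where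
  "trivial_mod p J rs \<longleftrightarrow> (\<forall>x. (\<forall>j\<in>J. x j \<in> OK) \<longrightarrow> (\<forall>r\<in>rs. (\<Sum>j\<in>J. x j * r j) \<in> p) \<longrightarrow> (\<forall>j\<in>J. x j \<in> p))"

text \<open>The pivot \<open>r k\<close> is invertible modulo \<open>p\<close>. Cross-multiplied
  rows lose the unknown \<open>k\<close> without any division, so that the entries stay in
  \<open>OK\<close> and are the same for all primes.\<close>

lemma trivial_mod_elim:
  assumes p: "p \<in> PP" and J: "finite J" "k \<notin> J" and rs: "\<And>s j. s \<in> rs \<Longrightarrow> j \<in> insert k J \<Longrightarrow> s j \<in> OK"
    and r: "r \<in> rs" "r k \<notin> p"
  shows "trivial_mod p (insert k J) rs \<longleftrightarrow> trivial_mod p J ((\<lambda>s j. r k * s j - s k * r j) ` rs)"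
proof
  have pI: "Ideal.ideal p R" using p by (rule PP_ideal)
  have rk: "r k \<in> OK" using rs r by blast
  assume t: "trivial_mod p J ((\<lambda>s j. r k * s j - s k * r j) ` rs)"
  show "trivial_mod p (insert k J) rs" unfolding trivial_mod_def
  proof (intro allI impI)
    fix x assume x: "\<forall>j\<in>insert k J. x j \<in> OK" "\<forall>s\<in>rs. (\<Sum>j\<in>insert k J. x j * s j) \<in> p"
    have "(\<Sum>j\<in>J. x j * (r k * s j - s k * r j)) \<in> p" if s: "s \<in> rs" for s
    proof -
      have "(\<Sum>j\<in>J. x j * (r k * s j - s k * r j))
          = r k * (\<Sum>j\<in>insert k J. x j * s j) - s k * (\<Sum>j\<in>insert k J. x j * r j)"
        using J by (simp add: sum_distrib_left sum_subtractf algebra_simps)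
      then show ?thesis using x s r rs rk ideal_closed(5,7)[OF pI] by simp
    qed
    then have xJ: "\<forall>j\<in>J. x j \<in> p" using t x unfolding trivial_mod_def by simp
    have "x k * r k = (\<Sum>j\<in>insert k J. x j * r j) - (\<Sum>j\<in>J. x j * r j)" using J by simp
    moreover have "(\<Sum>j\<in>J. x j * r j) \<in> p" using xJ rs r by (intro ideal_sum[OF pI] ideal_closed(4)[OF pI]) auto
    ultimately have "x k * r k \<in> p" using x r ideal_closed(7)[OF pI] by simp
    then have "x k \<in> p" using PP_prime[OF p] x rk r by blast
    then show "\<forall>j\<in>insert k J. x j \<in> p" using xJ by simp
  qed
next
  have pI: "Ideal.ideal p R" using p by (rule PP_ideal)
  have rk: "r k \<in> OK" using rs r by blast
  assume t: "trivial_mod p (insert k J) rs"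
  show "trivial_mod p J ((\<lambda>s j. r k * s j - s k * r j) ` rs)" unfolding trivial_mod_def
  proof (intro allI impI)
    fix x assume x: "\<forall>j\<in>J. x j \<in> OK" "\<forall>s\<in>(\<lambda>s j. r k * s j - s k * r j) ` rs. (\<Sum>j\<in>J. x j * s j) \<in> p"
    \<comment> \<open>Back substitution cleared of denominators: scaling the other unknowns by the
      pivot makes the value that row \<open>r\<close> forces on the unknown \<open>k\<close>
      integral.\<close>
    define y where "y j = (if j = k then - (\<Sum>j\<in>J. x j * r j) else r k * x j)" for j
    have "(\<Sum>j\<in>J. x j * r j) \<in> OK" by (intro OK_sum OK_closed(4)) (use x rs r in auto)
    then have yO: "\<forall>j\<in>insert k J. y j \<in> OK" using x rk by (auto simp: y_def)
    have "(\<Sum>j\<in>insert k J. y j * s j) \<in> p" if s: "s \<in> rs" for s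
    proof -
      have "(\<Sum>j\<in>insert k J. y j * s j) = y k * s k + (\<Sum>j\<in>J. r k * x j * s j)"
        using J by (simp add: y_def) (intro sum.cong, auto)
      also have "\<dots> = (\<Sum>j\<in>J. x j * (r k * s j - s k * r j))"
        by (simp add: y_def sum_distrib_left sum_distrib_right sum_subtractf algebra_simps)
      finally show ?thesis using x s by auto
    qed
    then have "\<forall>j\<in>insert k J. y j \<in> p" using t yO unfolding trivial_mod_def by blast
    moreover have "y j = r k * x j" if "j \<in> J" for j using that J by (auto simp: y_def)
    ultimately have "\<forall>j\<in>J. r k * x j \<in> p" by (metis insertI2)
    then show "\<forall>j\<in>J. x j \<in> p" using PP_prime[OF p rk] x r by blast
  qed
qed

text \<open>Gaussian elimination over the integers, which is valid modulo almost all primes.\<close>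

lemma trivial_mod_dichotomy:
  assumes "finite J" "\<And>r j. r \<in> rs \<Longrightarrow> j \<in> J \<Longrightarrow> r j \<in> OK"
  shows "\<exists>b. finite {p \<in> PP. trivial_mod p J rs \<noteq> b}"
  using assms
proof (induction J arbitrary: rs rule: finite_induct)
  case empty
  then show ?case by (intro exI[of _ True]) (simp add: trivial_mod_def)
next
  case (insert k J)
  show ?case
  proof (cases "\<exists>r\<in>rs. r k \<noteq> 0")
    case True
    then obtain r where r: "r \<in> rs" "r k \<noteq> 0" by blast
    let ?rs = "(\<lambda>s j. r k * s j - s k * r j) ` rs"
    have "\<exists>b. finite {p \<in> PP. trivial_mod p J ?rs \<noteq> b}"
      using insert.prems r by (intro insert.IH) auto
    then obtain b where b: "finite {p \<in> PP. trivial_mod p J ?rs \<noteq> b}" by blast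
    have "{p \<in> PP. trivial_mod p (insert k J) rs \<noteq> b} \<subseteq> {p \<in> PP. trivial_mod p J ?rs \<noteq> b} \<union> {p \<in> PP. r k \<in> p}"
    proof -
      have "trivial_mod p (insert k J) rs \<longleftrightarrow> trivial_mod p J ?rs" if "p \<in> PP" "r k \<notin> p" for p
        by (rule trivial_mod_elim[OF that(1) insert.hyps _ r(1) that(2)]) (rule insert.prems)
      then show ?thesis by blast
    qed
    moreover have "finite {p \<in> PP. r k \<in> p}" using insert.prems r by (intro finite_primes_containing) auto
    ultimately show ?thesis using b by (meson finite_Un finite_subset)
  next
    case False
    \<comment> \<open>No row involves the unknown \<open>k\<close>, so its unit vector is a nonzero
      solution modulo every prime.\<close>
    have "\<not> trivial_mod p (insert k J) rs" if p: "p \<in> PP" for p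
    proof
      assume t: "trivial_mod p (insert k J) rs"
      let ?x = "\<lambda>j. if j = k then 1 else (0::'k)"
      have "(\<Sum>j\<in>insert k J. ?x j * s j) = 0" if "s \<in> rs" for s
        using False that by (intro sum.neutral) auto
      then have "\<forall>j\<in>insert k J. ?x j \<in> p"
        using t[unfolded trivial_mod_def, rule_format, of ?x] ideal_closed(2)[OF PP_ideal[OF p]] by auto
      then show False using PP_not_one[OF p] by simp
    qed
    then have "{p \<in> PP. trivial_mod p (insert k J) rs \<noteq> False} = {}" by blast
    then have "finite {p \<in> PP. trivial_mod p (insert k J) rs \<noteq> False}" by (simp only: finite.emptyI)
    then show ?thesis by (rule exI)
  qed
qed

end

section \<open>Zeta functions of finite Lie algebras\<close>

context finite_space
begin

text \<open>The ring of scalars acts through a field, but not faithfully; a coefficient counts as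
  zero if it acts as zero on \<open>V\<close>.\<close>

definition indep_family :: "('j \<Rightarrow> 'v) \<Rightarrow> 'j set \<Rightarrow> bool" where
  "indep_family w J \<longleftrightarrow> (\<forall>a. (\<Sum>i\<in>J. a i \<star> w i) = 0 \<longrightarrow> (\<forall>i\<in>J. \<forall>v\<in>V. a i \<star> v = 0))"

lemma span_family:
  assumes "finite J" "x \<in> span (w ` J)"
  shows "\<exists>a. x = (\<Sum>i\<in>J. a i \<star> w i)"
  using assms
proof (induction J arbitrary: x rule: finite_induct)
  case (insert i J)
  then obtain k where "x - k \<star> w i \<in> span (w ` J)" using span_breakdown_eq[of x "w i" "w ` J"] by auto
  then obtain a where a: "x - k \<star> w i = (\<Sum>i\<in>J. a i \<star> w i)" using insert.IH by blast
  have "(\<Sum>j\<in>J. (a(i := k)) j \<star> w j) = (\<Sum>j\<in>J. a j \<star> w j)"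
    using insert.hyps by (intro sum.cong) auto
  then have "x = (\<Sum>j\<in>insert i J. (a(i := k)) j \<star> w j)"
    using insert.hyps a by (simp add: algebra_simps)
  then show ?case by blast
qed simp

lemma indep_family_insert:
  assumes J: "finite J" "i \<notin> J" "indep_family w J" "w ` J \<subseteq> V" and i: "w i \<in> V" "w i \<notin> span (w ` J)"
  shows "indep_family w (insert i J)"
  unfolding indep_family_def
proof (intro allI impI)
  fix a assume "(\<Sum>j\<in>insert i J. a j \<star> w j) = 0"
  then have e: "a i \<star> w i + (\<Sum>j\<in>J. a j \<star> w j) = 0" using J by simp
  have s: "sub (span (w ` J))" using J(4) by (rule sub_span)
  have "(\<Sum>j\<in>J. a j \<star> w j) \<in> span (w ` J)" by (intro span_sum span_scale span_base) auto
  then have "- (\<Sum>j\<in>J. a j \<star> w j) \<in> span (w ` J)" by (rule span_neg)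
  moreover have "a i \<star> w i = - (\<Sum>j\<in>J. a j \<star> w j)" using e by (simp only: eq_neg_iff_add_eq_0)
  ultimately have "a i \<star> w i \<in> span (w ` J)" by simp
  then have ai: "a i \<star> w i = 0" using scale_mem[OF s i(1)] i(2) by blast
  moreover have "w i \<noteq> 0" using i(2) by (auto simp: span_zero)
  ultimately have "\<forall>v\<in>V. a i \<star> v = 0" using kill[OF _ i(1)] by blast
  moreover have "\<forall>j\<in>J. \<forall>v\<in>V. a j \<star> v = 0" using J(3) e ai unfolding indep_family_def by simp
  ultimately show "\<forall>j\<in>insert i J. \<forall>v\<in>V. a j \<star> v = 0" by blast
qed

lemma indep_family_mono:
  assumes "indep_family w J" "J' \<subseteq> J" "finite J"
  shows "indep_family w J'"
  unfolding indep_family_def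
proof (intro allI impI)
  fix a assume 0: "(\<Sum>i\<in>J'. a i \<star> w i) = 0"
  let ?a = "\<lambda>i. if i \<in> J' then a i else 0"
  have "(\<Sum>i\<in>J. ?a i \<star> w i) = (\<Sum>i\<in>J'. ?a i \<star> w i)"
    using assms by (intro sum.mono_neutral_right) auto
  also have "\<dots> = 0" using 0 by simp
  finally have "\<forall>i\<in>J. \<forall>v\<in>V. ?a i \<star> v = 0"
    by (rule assms(1)[unfolded indep_family_def, THEN spec[of _ ?a], THEN mp])
  then show "\<forall>i\<in>J'. \<forall>v\<in>V. a i \<star> v = 0" using assms(2) by force
qed

text \<open>Independence puts each new vector outside the span of the others, which multiplies the
  size by \<open>q\<close>. In a zero space every scalar acts as zero and every family is
  independent, hence \<open>V \<noteq> {0}\<close>.\<close>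

lemma card_span_indep:
  assumes "finite J" "w ` J \<subseteq> V" "indep_family w J" "V \<noteq> {0}"
  shows "card (span (w ` J)) = q ^ card J"
  using assms
proof (induction J rule: finite_induct)
  case (insert i J)
  have s: "sub (span (w ` J))" using insert.prems by (intro sub_span) auto
  have iV: "w i \<in> V" using insert.prems by auto
  have "w i \<notin> span (w ` J)"
  proof
    assume "w i \<in> span (w ` J)"
    then obtain a where a: "w i = (\<Sum>j\<in>J. a j \<star> w j)" using span_family[OF insert.hyps(1)] by blast
    let ?a = "a(i := - 1)"
    have "(\<Sum>j\<in>J. ?a j \<star> w j) = (\<Sum>j\<in>J. a j \<star> w j)" using insert.hyps by (intro sum.cong) auto
    then have "(\<Sum>j\<in>insert i J. ?a j \<star> w j) = 0"
      using insert.hyps a by (simp add: scale_minus_left)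
    then have "\<forall>v\<in>V. (- 1) \<star> v = 0" using insert.prems(2) unfolding indep_family_def by force
    then have "V \<subseteq> {0}" by (auto simp: scale_minus_left)
    then show False using insert.prems(3) sub_0[OF sub_V] by blast
  qed
  then have "card (adj (w i) (span (w ` J))) = q * card (span (w ` J))" by (rule card_adj[OF s iV])
  moreover have "adj (w i) (span (w ` J)) = span (w ` insert i J)"
    by (simp add: Set.set_eq_iff span_breakdown_eq span_span)
  moreover have "card (span (w ` J)) = q ^ card J"
    using insert indep_family_mono[of w "insert i J" J] by auto
  ultimately show ?case using insert.hyps by simp
qed simp

text \<open>A largest independent subfamily spans. Written as a maximum over index sets, the rank
  depends only on which subfamilies are independent, that is, on finitely many linear systems that
  behave alike modulo almost all primes.\<close>

lemma card_span_family:
  assumes I: "finite I" "w ` I \<subseteq> V" and V: "V \<noteq> {0}"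
  shows "card (span (w ` I)) = q ^ Max (card ` {J. J \<subseteq> I \<and> indep_family w J})"
proof -
  let ?P = "{J. J \<subseteq> I \<and> indep_family w J}"
  have fin: "finite (card ` ?P)" using I by simp
  have "{} \<in> ?P" by (simp add: indep_family_def)
  then have "card ` ?P \<noteq> {}" by blast
  then have "Max (card ` ?P) \<in> card ` ?P" using fin by (rule Max_in[rotated])
  then obtain J where J: "J \<subseteq> I" "indep_family w J" and m: "card J = Max (card ` ?P)" by auto
  have finJ: "finite J" using J I finite_subset by blast
  have JV: "w ` J \<subseteq> V" using J I by blast
  have "w i \<in> span (w ` J)" if i: "i \<in> I" for i
  proof (rule ccontr)
    assume n: "w i \<notin> span (w ` J)"
    then have "i \<notin> J" by (auto intro: span_base)
    moreover have "w i \<in> V" using I i by blast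
    ultimately have "insert i J \<in> ?P" using indep_family_insert[OF finJ _ J(2) JV _ n] J i by simp
    then have "card (insert i J) \<le> card J" unfolding m using fin by (intro Max_ge) auto
    then show False using \<open>i \<notin> J\<close> finJ by simp
  qed
  then have "span (w ` I) \<subseteq> span (w ` J)" by (intro span_minimal) auto
  moreover have "span (w ` J) \<subseteq> span (w ` I)" using J by (intro span_mono) auto
  ultimately have "span (w ` I) = span (w ` J)" by blast
  then show ?thesis using card_span_indep[OF finJ JV J(2) V] m by simp
qed

end

context finite_lie
begin

lemma generated_subset: "V = span S \<Longrightarrow> sub U \<Longrightarrow> S \<subseteq> U \<Longrightarrow> V \<subseteq> U"
  by (metis span_minimal sub_def)

lemma der_span:
  assumes S: "V = span S"
  shows "der V = span ((\<lambda>(a, b). br a b) ` (S \<times> S))" (is "_ = ?W")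
proof
  have SV: "S \<subseteq> V" using S by (auto intro: span_base)
  have "br a b \<in> V" if "a \<in> S" "b \<in> S" for a b using that SV by (intro br_V) auto
  then have W: "sub ?W" by (intro sub_span) auto
  have 1: "br a y \<in> ?W" if a: "a \<in> S" and y: "y \<in> V" for a y
  proof -
    have "sub {y \<in> V. br a y \<in> ?W}" by (rule linear_vimage_sub[OF linear_br sub_V W])
    moreover have "S \<subseteq> {y \<in> V. br a y \<in> ?W}" using a SV by (auto intro!: span_base)
    ultimately have "V \<subseteq> {y \<in> V. br a y \<in> ?W}" by (intro generated_subset[OF S])
    then show ?thesis using y by blast
  qed
  show "der V \<subseteq> ?W"
  proof (rule der_least[OF W])
    fix x y assume x: "x \<in> V" and y: "y \<in> V"
    have "sub {x \<in> V. br y x \<in> ?W}" by (rule linear_vimage_sub[OF linear_br sub_V W])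
    moreover have "S \<subseteq> {x \<in> V. br y x \<in> ?W}"
    proof
      fix a assume a: "a \<in> S"
      have "br y a = - br a y" by (rule br_anti)
      then show "a \<in> {x \<in> V. br y x \<in> ?W}" using 1[OF a y] a SV W by (auto simp: sub_neg)
    qed
    ultimately have "V \<subseteq> {x \<in> V. br y x \<in> ?W}" by (intro generated_subset[OF S])
    then have "br y x \<in> ?W" using x by blast
    then show "br x y \<in> ?W" using br_anti[of x y] W by (simp add: sub_neg)
  qed
  show "?W \<subseteq> der V" unfolding der_def using SV by (intro span_mono) auto
qed

lemma center_span:
  assumes S: "V = span S"
  shows "center = {z \<in> V. \<forall>b\<in>S. br b z = 0}"
proof (intro equalityI subsetI)
  fix z assume z: "z \<in> {z \<in> V. \<forall>b\<in>S. br b z = 0}"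
  have "sub {v \<in> V. br z v \<in> {0}}" by (rule linear_vimage_sub[OF linear_br sub_V sub_zero])
  moreover have "S \<subseteq> {v \<in> V. br z v \<in> {0}}"
  proof
    fix b assume b: "b \<in> S"
    have "br z b = - br b z" by (rule br_anti)
    then show "b \<in> {v \<in> V. br z v \<in> {0}}" using z b S by (auto intro: span_base)
  qed
  ultimately have "V \<subseteq> {v \<in> V. br z v \<in> {0}}" by (intro generated_subset[OF S])
  then have "br v z = 0" if "v \<in> V" for v using that br_anti[of v z] by auto
  then show "z \<in> center" using z by (auto simp: center_def)
next
  fix z assume "z \<in> center"
  moreover have "S \<subseteq> V" using S span_superset by blast
  ultimately show "z \<in> {z \<in> V. \<forall>b\<in>S. br b z = 0}" by (auto simp: center_def)
qed

end

lemma card_vectorspace: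
  assumes v: "vectorspace F W" and F: "finite (carrier F)" and W: "finite (carrier W)"
  shows "card (carrier W) = card (carrier F) ^ vectorspace.dim F W"
proof -
  interpret vectorspace F W by (rule v)
  have "span (carrier W) = carrier W"
    using span_is_subset2[of "carrier W"] in_own_span[of "carrier W"] by auto
  then have "fin_dim" unfolding fin_dim_def using W by blast
  then obtain \<beta> where \<beta>: "finite \<beta>" "basis \<beta>" using finite_basis_exists by blast
  have \<beta>W: "\<beta> \<subseteq> carrier W" using \<beta> by (simp add: basis_def)
  have crit: "\<forall>v. v \<in> carrier W \<longrightarrow> (\<exists>!a. a \<in> \<beta> \<rightarrow>\<^sub>E carrier F \<and> lincomb a \<beta> = v)"
    using basis_criterion[OF \<beta>(1) \<beta>W] \<beta>(2) by blast
  have "bij_betw (\<lambda>a. lincomb a \<beta>) (\<beta> \<rightarrow>\<^sub>E carrier F) (carrier W)"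
  proof (rule bij_betwI')
    fix a b assume ab: "a \<in> \<beta> \<rightarrow>\<^sub>E carrier F" "b \<in> \<beta> \<rightarrow>\<^sub>E carrier F"
    have "lincomb a \<beta> \<in> carrier W" using ab \<beta>W by (intro lincomb_closed) auto
    then show "(lincomb a \<beta> = lincomb b \<beta>) = (a = b)" using crit ab by metis
  next
    show "lincomb a \<beta> \<in> carrier W" if "a \<in> \<beta> \<rightarrow>\<^sub>E carrier F" for a
      using that \<beta>W by (intro lincomb_closed) auto
    show "\<exists>a\<in>\<beta> \<rightarrow>\<^sub>E carrier F. v = lincomb a \<beta>" if "v \<in> carrier W" for v
      using crit that by metis
  qed
  then have "card (carrier W) = card (\<beta> \<rightarrow>\<^sub>E carrier F)" by (rule bij_betw_same_card[symmetric])
  then show ?thesis using card_PiE[OF \<beta>(1), of "\<lambda>_. carrier F"] dim_basis[OF \<beta>] by simp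
qed

abbreviation fV :: "('f, 'g) lie_index \<Rightarrow> ('f, 'g) umod set" where
  "fV j \<equiv> uemb j ` carrier (flie j)"

abbreviation fq :: "('f, 'g) lie_index \<Rightarrow> nat" where
  "fq j \<equiv> card (carrier (fring j))"

definition subobjects :: "subobject \<Rightarrow> ('f, 'g) lie_index \<Rightarrow> nat \<Rightarrow> ('f, 'g) umod set set" where
  "subobjects t j k = (case t of Subalgebras \<Rightarrow> finite_lie.subalgs uscale (fV j) (fq j) ubr k
    | Ideals \<Rightarrow> finite_lie.ideals uscale (fV j) (fq j) ubr k)"

lemma count_codim_eq:
  assumes F: "field (fring j)" "finite (carrier (fring j))" and M: "finite (carrier (flie j))"
    and n: "card (carrier (flie j)) = fq j ^ n"
  shows "count_codim t (fring j) (flie j) i = (if i \<le> n then card (subobjects t j (n - i)) else 0)"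
proof -
  interpret L: lie_algebra "fring j" "flie j" by (rule flie_lie)
  interpret F: field "fring j" by (rule F)
  interpret finite_lie uscale "fV j" "fq j" ubr by (rule factor_finite_lie[OF F M])
  have vs: "vectorspace (fring j) (flie j)" by (intro vectorspace.intro L.module_axioms F)
  have dim: "card H = fq j ^ vectorspace.dim (fring j) (flie j\<lparr>carrier := H\<rparr>)"
    if H: "LinearCombinations.submodule (fring j) H (flie j)" for H
  proof -
    have "VectorSpace.subspace (fring j) H (flie j)" using vs H by (simp add: VectorSpace.subspace_def)
    then have v: "vectorspace (fring j) (flie j\<lparr>carrier := H\<rparr>)" by (rule vectorspace.subspace_is_vs[OF vs])
    have "H \<subseteq> carrier (flie j)" using H by (rule LinearCombinations.submodule.subset)
    then have "finite H" using M finite_subset by blast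
    then show ?thesis using card_vectorspace[OF v F(2)] by simp
  qed
  have "fq j ^ n = fq j ^ vectorspace.dim (fring j) (flie j)" using card_vectorspace[OF vs F(2) M] n by simp
  then have dimM: "vectorspace.dim (fring j) (flie j) = n" using q_pow_inj by simp
  have sm: "LinearCombinations.submodule (fring j) H (flie j)" if "is_subobject t (fring j) (flie j) H" for H
    using that by (cases t) (auto simp: lie_subalgebra_def lie_ideal_def)
  have iff: "is_subobject t (fring j) (flie j) H \<longleftrightarrow>
      sub (uemb j ` H) \<and> (case t of Subalgebras \<Rightarrow> closed (uemb j ` H) | Ideals \<Rightarrow> ideal (uemb j ` H))"
    if H: "H \<subseteq> carrier (flie j)" for H
  proof -
    have s: "sub (uemb j ` H) \<longleftrightarrow> LinearCombinations.submodule (fring j) H (flie j)"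
      using subspace_uemb[OF H] H by (auto simp: sub_def)
    have mem: "uemb j x \<in> uemb j ` H \<longleftrightarrow> x \<in> H" if "x \<in> carrier (flie j)" for x
      using inj_on_image_mem_iff[OF uemb_inj that H] .
    have c: "closed (uemb j ` H) \<longleftrightarrow> (\<forall>x\<in>H. \<forall>y\<in>H. \<lbrakk>x,y\<rbrakk>\<^bsub>flie j\<^esub> \<in> H)"
      using H mem by (auto simp: closed_def ubr_uemb subset_iff)
    have i: "ideal (uemb j ` H) \<longleftrightarrow> (\<forall>x\<in>carrier (flie j). \<forall>y\<in>H. \<lbrakk>x,y\<rbrakk>\<^bsub>flie j\<^esub> \<in> H)"
      using H mem by (auto simp: ideal_def ubr_uemb subset_iff)
    show ?thesis using s c i by (cases t) (auto simp: lie_subalgebra_def lie_ideal_def)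
  qed
  let ?S = "{H. is_subobject t (fring j) (flie j) H \<and>
      vectorspace.dim (fring j) (flie j) = vectorspace.dim (fring j) (flie j\<lparr>carrier := H\<rparr>) + i}"
  show ?thesis
  proof (cases "i \<le> n")
    case False
    then have "?S = {}" using dimM by auto
    then have "count_codim t (fring j) (flie j) i = 0" unfolding count_codim_def by (simp only: card.empty)
    then show ?thesis using False by simp
  next
    case True
    have so: "A \<in> subobjects t j (n - i) \<longleftrightarrow> sub A \<and> (case t of Subalgebras \<Rightarrow> closed A | Ideals \<Rightarrow> ideal A) \<and>
        card A = fq j ^ (n - i)" for A
      by (cases t) (auto simp: subobjects_def subalgs_def ideals_def)
    have "bij_betw (\<lambda>H. uemb j ` H) ?S (subobjects t j (n - i))"
    proof (rule bij_betwI')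
      fix H H' assume H: "H \<in> ?S" "H' \<in> ?S"
      then have "H \<subseteq> carrier (flie j)" "H' \<subseteq> carrier (flie j)"
        using sm LinearCombinations.submodule.subset by blast+
      then show "(uemb j ` H = uemb j ` H') = (H = H')" using inj_on_image_eq_iff[OF uemb_inj] by blast
    next
      fix H assume H: "H \<in> ?S"
      then have s: "LinearCombinations.submodule (fring j) H (flie j)" using sm by blast
      then have Hc: "H \<subseteq> carrier (flie j)" by (rule LinearCombinations.submodule.subset)
      have "vectorspace.dim (fring j) (flie j\<lparr>carrier := H\<rparr>) = n - i" using H dimM by auto
      then have "card H = fq j ^ (n - i)" using dim[OF s] by simp
      moreover have "card (uemb j ` H) = card H" using inj_on_subset[OF uemb_inj Hc] by (rule card_image)
      ultimately show "uemb j ` H \<in> subobjects t j (n - i)" using so iff[OF Hc] H by auto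
    next
      fix A assume A: "A \<in> subobjects t j (n - i)"
      then have "A \<subseteq> fV j" using so by (auto simp: sub_def)
      then obtain H where H: "H \<subseteq> carrier (flie j)" "A = uemb j ` H" by (meson subset_imageE)
      have o: "is_subobject t (fring j) (flie j) H" using iff[OF H(1)] so A H(2) by auto
      have "card A = card H" unfolding H(2) using inj_on_subset[OF uemb_inj H(1)] by (rule card_image)
      then have "fq j ^ (n - i) = fq j ^ vectorspace.dim (fring j) (flie j\<lparr>carrier := H\<rparr>)"
        using dim[OF sm[OF o]] so A by simp
      then have "vectorspace.dim (fring j) (flie j\<lparr>carrier := H\<rparr>) = n - i" using q_pow_inj by simp
      then have "H \<in> ?S" using o dimM True by simp
      then show "\<exists>H\<in>?S. A = uemb j ` H" using H(2) by blast
    qed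
    then have "card ?S = card (subobjects t j (n - i))" by (rule bij_betw_same_card)
    then show ?thesis using True unfolding count_codim_def by simp
  qed
qed

lemma lie_zeta_eq:
  assumes F: "field (fring j)" "finite (carrier (fring j))" and M: "finite (carrier (flie j))"
    and n: "card (carrier (flie j)) = fq j ^ n"
  shows "lie_zeta t (fring j) (flie j) s
    = (\<Sum>i\<le>n. of_nat (card (subobjects t j (n - i))) * (of_nat (fq j) powr (- s)) ^ i)"
proof -
  interpret finite_lie uscale "fV j" "fq j" ubr by (rule factor_finite_lie[OF F M])
  have q0: "of_nat (fq j) \<noteq> (0 :: complex)" using q2 by simp
  have pw: "of_nat (fq j) powr (- (of_nat i * s)) = (of_nat (fq j) powr (- s)) ^ i" for i
    using q0 by (simp add: powr_def exp_of_nat_mult[symmetric] algebra_simps)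
  have "lie_zeta t (fring j) (flie j) s
      = (\<Sum>i\<le>n. of_nat (count_codim t (fring j) (flie j) i) * of_nat (fq j) powr (- (of_nat i * s)))"
    unfolding lie_zeta_def by (rule suminf_finite) (auto simp: count_codim_eq[OF assms])
  then show ?thesis using pw by (simp add: count_codim_eq[OF assms])
qed

subsection \<open>The polynomials\<close>

definition ev :: "rat poly \<Rightarrow> complex \<Rightarrow> complex" where
  "ev c x = poly (map_poly of_rat c) x"

lemma ev_simps [simp]:
  "ev 0 x = 0" "ev 1 x = 1" "ev (pCons a c) x = of_rat a + x * ev c x"
  by (simp_all add: ev_def map_poly_pCons)

lemma ev_add [simp]: "ev (c + d) x = ev c x + ev d x"
proof -
  have "map_poly of_rat (c + d) = (map_poly of_rat c + map_poly of_rat d :: complex poly)"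
    by (intro poly_eqI) (simp add: coeff_map_poly of_rat_add)
  then show ?thesis by (simp add: ev_def)
qed

lemma ev_diff [simp]: "ev (c - d) x = ev c x - ev d x"
  using ev_add[of "c - d" d x] by simp

lemma eval_XY_simps [simp]:
  "eval_XY 0 x y = 0" "eval_XY (pCons c P) x y = ev c x + y * eval_XY P x y"
  by (simp_all add: eval_XY_def ev_def map_poly_pCons)

text \<open>For fixed \<open>q\<close> the values q^(-s) exhaust the nonzero complex numbers, so the
  coefficients in \<open>Y\<close> agree at \<open>X = q\<close>. Each coefficient is a polynomial
  in \<open>X\<close> and is determined by infinitely many \<open>q\<close>.\<close>

lemma eval_XY_eq_imp_eq:
  assumes "infinite Q" "\<And>q. q \<in> Q \<Longrightarrow> 2 \<le> q"
    and eq: "\<And>q s. q \<in> Q \<Longrightarrow> eval_XY P (of_nat q) (of_nat q powr (- s)) = eval_XY P' (of_nat q) (of_nat q powr (- s))"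
  shows "P = P'"
proof (rule poly_eqI)
  fix i
  have co: "ev (coeff P i) (of_nat q) = ev (coeff P' i) (of_nat q)" if q: "q \<in> Q" for q
  proof -
    let ?f = "\<lambda>P. map_poly (\<lambda>c. ev c (of_nat q)) P"
    have q0: "of_nat q \<noteq> (0::complex)" "ln (of_nat q) \<noteq> (0::complex)"
      using assms(2)[OF q] by (auto simp: Ln_of_nat)
    have "poly (?f P - ?f P') y = 0" if "y \<noteq> 0" for y
    proof -
      \<comment> \<open>Solves q^(-s) = y; for \<open>q \<ge> 2\<close> the logarithm of
        \<open>q\<close> does not vanish.\<close>
      let ?s = "- (ln y / ln (of_nat q))"
      have "of_nat q powr (- ?s) = y" using q0 that by (simp add: powr_def)
      then show ?thesis using eq[OF q, of ?s] by (simp add: eval_XY_def ev_def)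
    qed
    then have "UNIV - {0} \<subseteq> {y. poly (?f P - ?f P') y = 0}" by blast
    moreover have "infinite (UNIV - {0::complex})" by (simp add: infinite_UNIV_char_0)
    ultimately have "?f P - ?f P' = 0" using poly_roots_finite finite_subset by blast
    then have "coeff (?f P) i = coeff (?f P') i" by simp
    then show ?thesis by (simp add: coeff_map_poly)
  qed
  let ?g = "map_poly of_rat (coeff P i) - map_poly of_rat (coeff P' i) :: complex poly"
  have "of_nat ` Q \<subseteq> {x. poly ?g x = 0}" using co by (auto simp: ev_def)
  moreover have "infinite ((of_nat :: nat \<Rightarrow> complex) ` Q)"
    using assms(1) by (subst finite_image_iff) (auto simp: inj_on_def)
  ultimately have "?g = 0" using poly_roots_finite finite_subset by blast
  then have "coeff (map_poly of_rat (coeff P i) :: complex poly) k = coeff (map_poly of_rat (coeff P' i)) k" for k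
    by simp
  then show "coeff P i = coeff P' i" by (intro poly_eqI) (simp add: coeff_map_poly)
qed

fun Qn :: "nat \<Rightarrow> rat poly" where
  "Qn 0 = 0"
| "Qn (Suc k) = pCons 1 (Qn k)"

lemma ev_Qn [simp]: "ev (Qn k) (of_nat q) = of_nat (qn q k)"
  by (induction k) simp_all

fun beta :: "nat \<times> nat \<times> nat \<Rightarrow> rat poly" where
  "beta (c0, c1, c2) = [:of_nat c0, of_nat c1, of_nat c2:]"

definition types :: "(nat \<times> nat \<times> nat) set" where
  "types = {0..4} \<times> {0..4} \<times> {0..4}"

lemma beta_inj: "beta \<tau> = beta \<tau>' \<longleftrightarrow> \<tau> = \<tau>'"
  by (cases \<tau>; cases \<tau>') simp

lemma ev_beta: "ev (beta (c0, c1, c2)) (of_nat q) = of_nat (c0 + c1 * q + c2 * q\<^sup>2)"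
  by (simp add: algebra_simps power2_eq_square)

lemma eig_number_type:
  assumes "finite_lie uscale (fV j) (fq j) ubr" "finite_lie.eig_number (fq j) b"
  shows "\<exists>\<tau>\<in>types. ev (beta \<tau>) (of_nat (fq j)) = of_nat b"
proof -
  obtain c0 c1 c2 where "c0 \<le> 4" "c1 \<le> 4" "c2 \<le> 4" "b = c0 + c1 * fq j + c2 * (fq j)\<^sup>2"
    using assms(2) unfolding finite_lie.eig_number_def[OF assms(1)] by blast
  then show ?thesis by (intro bexI[of _ "(c0, c1, c2)"]) (auto simp: types_def ev_beta simp del: beta.simps)
qed

text \<open>The coefficient of \<open>Y^i\<close> counts codimension \<open>i\<close>, from
  \<open>V\<close> itself down to zero, and \<open>pCons 0\<close> multiplies by \<open>X\<close>.
  All lines are subalgebras, whence \<open>Qn n\<close> in codimension \<open>n - 1\<close>.\<close>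

definition sub_poly :: "nat \<Rightarrow> nat \<times> nat \<times> nat \<Rightarrow> rat poly poly" where
  "sub_poly n \<tau> =
     (if n = 4 then [:1, pCons 1 (beta \<tau>), Qn 3 + pCons 0 (pCons 0 (beta \<tau>)), Qn 4, 1:]
      else if n = 3 then [:1, pCons 1 (beta \<tau>), Qn 3, 1:]
      else if n = 2 then [:1, Qn 2, 1:] else if n = 1 then [:1, 1:] else [:1:])"

text \<open>\<open>d\<close> is the dimension of the derived algebra, \<open>z\<close> says that the
  centre is zero, and \<open>a\<close> that the second derived algebra is not. In codimension one
  the ideals are the hyperplanes above the derived algebra. In the first branch \<open>beta\<close>
  counts the plane ideals, one more than the line ideals.\<close>

definition ideal_poly :: "nat \<Rightarrow> nat \<Rightarrow> bool \<Rightarrow> bool \<Rightarrow> nat \<times> nat \<times> nat \<Rightarrow> rat poly poly" where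
  "ideal_poly n d z a \<tau> =
     (if n = 4 then
        (if d = 2 \<and> z then [:1, Qn 2, beta \<tau>, beta \<tau> - 1, 1:]
         else if d = 3 \<and> a then [:1, Qn 1, beta \<tau>, 1, 1:]
         else [:1, Qn (4 - d),
           beta \<tau> + pCons 0 (pCons 0 (if d = 0 then Qn 3 else if d = 1 then 1 else 0)),
           beta \<tau> + pCons 0 (pCons 0 (pCons 0 (if d = 0 then 1 else 0))), 1:])
      else if n = 3 then
        [:1, Qn (3 - d), beta \<tau> + pCons 0 (pCons 0 (if d = 0 then 1 else 0)), 1:]
      else if n = 2 then [:1, Qn (2 - d), 1:] else if n = 1 then [:1, 1:] else [:1:])"

text \<open>The triple can be read off from the coefficient of \<open>Y\<close> for subalgebras and
  from that of \<open>Y^2\<close> for ideals, whichever branch applies.\<close>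

lemma poly_inj:
  assumes "n = 3 \<or> n = 4"
  shows "inj_on (sub_poly n) types" "inj_on (ideal_poly n d z a) types"
  using assms by (auto simp: inj_on_def sub_poly_def ideal_poly_def beta_inj split: if_splits)

text \<open>Below dimension 3 the polynomials do not depend on the triple, so a single one is kept
  to preserve injectivity.\<close>

definition trivial_types :: "nat \<Rightarrow> (nat \<times> nat \<times> nat) set" where
  "trivial_types n = (if n = 3 \<or> n = 4 then types else {(0, 0, 0)})"

lemma trivial_types_inj:
  "inj_on (sub_poly n) (trivial_types n)" "inj_on (ideal_poly n d z a) (trivial_types n)"
  using poly_inj by (auto simp: trivial_types_def)

text \<open>One triple serves both kinds of subobjects: the existential stands outside the
  conjunction, and this is what makes the two periods comparable.\<close>

lemma zeta_local:
  assumes F: "field (fring j)" "finite (carrier (fring j))" and M: "finite (carrier (flie j))"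
    and n: "card (carrier (flie j)) = fq j ^ n" "n \<le> 4"
    and d: "card (finite_lie.der uscale ubr (fV j)) = fq j ^ d"
    and sol: "\<And>U. U = fV j \<or> U = finite_lie.der uscale ubr (fV j) \<Longrightarrow>
      finite_lie.der uscale ubr U = U \<Longrightarrow> U = {0}"
    and char: "\<And>v. v \<in> fV j \<Longrightarrow> v + v = 0 \<Longrightarrow> v = 0"
    and z: "z \<longleftrightarrow> finite_lie.center (fV j) ubr = {0}"
    and a: "a \<longleftrightarrow> finite_lie.der uscale ubr (finite_lie.der uscale ubr (fV j)) \<noteq> {0}"
  shows "\<exists>\<tau>\<in>trivial_types n. \<forall>s. let q = of_nat (fq j) in
    lie_zeta Subalgebras (fring j) (flie j) s = eval_XY (sub_poly n \<tau>) q (q powr (- s)) \<and>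
    lie_zeta Ideals (fring j) (flie j) s = eval_XY (ideal_poly n d z a \<tau>) q (q powr (- s))"
proof -
  interpret finite_lie uscale "fV j" "fq j" ubr by (rule factor_finite_lie[OF F M])
  note fl = factor_finite_lie[OF F M]
  have cV: "card (fV j) = fq j ^ n" using card_image[OF uemb_inj] n by metis
  let ?s = "\<lambda>k. card (subalgs k)" and ?i = "\<lambda>k. card (ideals k)"
  have Z: "lie_zeta Subalgebras (fring j) (flie j) s = (\<Sum>i\<le>n. of_nat (?s (n - i)) * (of_nat (fq j) powr (- s)) ^ i)"
    "lie_zeta Ideals (fring j) (flie j) s = (\<Sum>i\<le>n. of_nat (?i (n - i)) * (of_nat (fq j) powr (- s)) ^ i)" for s
    using lie_zeta_eq[OF F M n(1)] by (simp_all add: subobjects_def)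
  note basic = subalgs_0 ideals_0 subalgs_top[OF cV] ideals_top[OF cV]
  have s1: "?s 1 = qn (fq j) n" by (rule subalgs_1[OF cV])
  have co: "?i m = qn (fq j) (Suc m - d)" if "n = Suc m" for m
    using ideals_coatoms[OF cV[unfolded that] d] .
  have solV: "der (fV j) \<noteq> fV j" if "n \<noteq> 0"
  proof
    assume "der (fV j) = fV j"
    then have "fV j = {0}" using sol by blast
    then have "fq j ^ n = fq j ^ 0" using cV by simp
    then show False using that by (simp only: q_pow_inj)
  qed
  consider "n = 0" | "n = 1" | "n = 2" | "n = 3" | "n = 4" using n(2) by linarith
  then show ?thesis
  proof cases
    case 1
    then show ?thesis
      by (intro bexI[of _ "(0, 0, 0)"])
        (simp_all add: Z basic sub_poly_def ideal_poly_def trivial_types_def)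
  next
    case 2
    then show ?thesis using basic
      by (intro bexI[of _ "(0, 0, 0)"])
        (simp_all add: Z sub_poly_def ideal_poly_def trivial_types_def)
  next
    case 3
    then show ?thesis using basic s1 co[of 1]
      by (intro bexI[of _ "(0, 0, 0)"])
        (simp_all add: Z sub_poly_def ideal_poly_def trivial_types_def numeral_2_eq_2 algebra_simps)
  next
    case 4
    then have cV3: "card (fV j) = fq j ^ 3" using cV by simp
    obtain b where b: "eig_number b" "?s 2 = 1 + b * fq j" "?i 1 = b + (if d = 0 then (fq j)\<^sup>2 else 0)"
      using counts_dim_3[OF cV3 d] solV 4 by auto
    obtain \<tau> where \<tau>: "\<tau> \<in> types" "ev (beta \<tau>) (of_nat (fq j)) = of_nat b" using eig_number_type[OF fl b(1)] by blast
    have i2: "?i 2 = qn (fq j) (3 - d)" using co[of 2] 4 by (simp add: eval_nat_numeral)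
    show ?thesis
      using \<tau> basic s1 i2 b 4
      by (intro bexI[of _ \<tau>])
        (auto simp add: Z sub_poly_def ideal_poly_def trivial_types_def numeral_3_eq_3 numeral_2_eq_2
          algebra_simps simp del: Qn.simps)
  next
    case 5
    then have cV4: "card (fV j) = fq j ^ 4" using cV by simp
    have sV: "der (fV j) \<noteq> fV j" using solV 5 by simp
    have sol2: "der (der (fV j)) = der (fV j) \<Longrightarrow> der (fV j) = {0}" using sol by blast
    obtain b where b: "eig_number b" "?s 3 = 1 + b * fq j" "?s 2 = qn (fq j) 3 + b * (fq j)\<^sup>2"
      and i: "if d = 2 \<and> center = {0} then ?i 2 = b \<and> b = Suc (?i 1)
       else if d = 3 \<and> der (der (fV j)) \<noteq> {0} then ?i 2 = b \<and> ?i 1 = 1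
       else ?i 2 = b + (if d = 0 then qn (fq j) 3 else if d = 1 then 1 else 0) * (fq j)\<^sup>2 \<and>
         ?i 1 = b + (if d = 0 then fq j ^ 3 else 0)"
      by (rule counts_dim_4[OF cV4 d sV sol2 char])
    obtain \<tau> where \<tau>: "\<tau> \<in> types" "ev (beta \<tau>) (of_nat (fq j)) = of_nat b" using eig_number_type[OF fl b(1)] by blast
    have i3: "?i 3 = qn (fq j) (4 - d)" using co[of 3] 5 by (simp add: eval_nat_numeral)
    have sum4: "(\<Sum>i\<le>4. f i) = f 0 + f 1 + f 2 + f 3 + f (4::nat)" for f :: "nat \<Rightarrow> complex"
      by (simp add: eval_nat_numeral)
    let ?q = "of_nat (fq j) :: complex"
    have S: "lie_zeta Subalgebras (fring j) (flie j) s = eval_XY (sub_poly 4 \<tau>) ?q (?q powr (- s))" for s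
      unfolding Z(1) 5 sum4 using basic s1 b 5 \<tau>(2)
      by (simp add: sub_poly_def algebra_simps power2_eq_square eval_nat_numeral del: Qn.simps qn_simps)
    have I: "lie_zeta Ideals (fring j) (flie j) s = eval_XY (ideal_poly 4 d z a \<tau>) ?q (?q powr (- s))" for s
    proof -
      define y where "y = ?q powr (- s)"
      consider "d = 2 \<and> z" | "\<not> (d = 2 \<and> z)" "d = 3 \<and> a" | "\<not> (d = 2 \<and> z)" "\<not> (d = 3 \<and> a)" by blast
      then show ?thesis
      proof cases
        case 1
        then have "?i 2 = b" "b = Suc (?i 1)" using i z by auto
        then show ?thesis
          unfolding Z(2) 5 sum4 y_def[symmetric] using basic i3 1 5 \<tau>(2)
          by (simp add: ideal_poly_def algebra_simps power2_eq_square eval_nat_numeral del: Qn.simps qn_simps)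
      next
        case 2
        then have "?i 2 = b" "?i 1 = 1" using i a z by auto
        then show ?thesis
          unfolding Z(2) 5 sum4 y_def[symmetric] using basic i3 2 5 \<tau>(2)
          by (simp add: ideal_poly_def algebra_simps power2_eq_square eval_nat_numeral)
      next
        case 3
        then have "?i 2 = b + (if d = 0 then qn (fq j) 3 else if d = 1 then 1 else 0) * (fq j)\<^sup>2"
          "?i 1 = b + (if d = 0 then fq j ^ 3 else 0)"
          using i[folded z a] by (simp_all only: if_False simp_thms)
        then show ?thesis
          unfolding Z(2) 5 sum4 y_def[symmetric] using basic i3 3 5 \<tau>(2)
          by (auto simp add: ideal_poly_def algebra_simps power2_eq_square eval_nat_numeral simp del: Qn.simps qn_simps)
      qed
    qed
    show ?thesis using S I \<tau> 5 by (intro bexI[of _ \<tau>]) (auto simp: trivial_types_def Let_def)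
  qed
qed

section \<open>Periods\<close>

lemma (in integer_ring) norm_ge_2: "p \<in> PP \<Longrightarrow> 2 \<le> card (carrier (R Quot p))"
proof -
  assume p: "p \<in> PP"
  interpret F: field "R Quot p" by (rule quotient_field[OF p])
  have "{\<zero>\<^bsub>R Quot p\<^esub>, \<one>\<^bsub>R Quot p\<^esub>} \<subseteq> carrier (R Quot p)" by simp
  then have "card {\<zero>\<^bsub>R Quot p\<^esub>, \<one>\<^bsub>R Quot p\<^esub>} \<le> card (carrier (R Quot p))"
    using finite_quotient[OF p] by (rule card_mono[rotated])
  then show ?thesis using F.one_not_zero by (simp add: eq_commute)
qed

text \<open>
  If almost all zeta functions are given by finitely many pairwise distinct polynomials, then the
  period is the number of those polynomials that occur infinitely often, since a polynomial is
  determined by its values at infinitely many norms.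
\<close>

lemma (in integer_ring) period_le_iff:
  fixes t :: subobject and L :: "('k, 'l) lie_alg" and \<tau> :: "'k set \<Rightarrow> 'b"
  assumes T: "finite T" "inj_on F T" and bad: "finite {p \<in> PP. \<not> good p}"
    and good: "\<And>p. p \<in> PP \<Longrightarrow> good p \<Longrightarrow> \<tau> p \<in> T"
      "\<And>p s. p \<in> PP \<Longrightarrow> good p \<Longrightarrow> lie_zeta t (R Quot p) (reduction R L p) s =
        eval_XY (F (\<tau> p)) (of_nat (card (carrier (R Quot p)))) (of_nat (card (carrier (R Quot p))) powr (- s))"
  shows "period_le t R L k \<longleftrightarrow> card {\<beta> \<in> T. infinite {p \<in> PP. good p \<and> \<tau> p = \<beta>}} \<le> k"
proof -
  let ?T = "{\<beta> \<in> T. infinite {p \<in> PP. good p \<and> \<tau> p = \<beta>}}"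
  let ?q = "\<lambda>p. of_nat (card (carrier (R Quot p))) :: complex"
  let ?ok = "\<lambda>P p. \<forall>s. lie_zeta t (R Quot p) (reduction R L p) s = eval_XY P (?q p) (?q p powr (- s))"
  have finT: "finite ?T" using T by simp
  have def: "period_le t R L k \<longleftrightarrow> (\<exists>P. finite {p \<in> PP. \<not> (\<exists>i\<in>{1..k}. ?ok (P i) p)})"
    by (simp add: period_le_def PP_def Let_def conj_assoc del: R_simps)
  show ?thesis
  proof
    assume "period_le t R L k"
    then obtain P where P: "finite {p \<in> PP. \<not> (\<exists>i\<in>{1..k}. ?ok (P i) p)}" using def by blast
    have "\<exists>i\<in>{1..k}. P i = F \<beta>" if \<beta>: "\<beta> \<in> ?T" for \<beta>
    proof -
      let ?S = "\<lambda>i. {p \<in> PP. good p \<and> \<tau> p = \<beta> \<and> ?ok (P i) p}"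
      \<comment> \<open>Pigeonhole: up to finitely many exceptions the primes of type
        \<open>\<beta>\<close> are distributed over \<open>k\<close> polynomials, so one polynomial
        serves infinitely many of them.\<close>
      have "{p \<in> PP. good p \<and> \<tau> p = \<beta>} \<subseteq> {p \<in> PP. \<not> (\<exists>i\<in>{1..k}. ?ok (P i) p)} \<union> (\<Union>i\<in>{1..k}. ?S i)"
        by blast
      moreover have "infinite {p \<in> PP. good p \<and> \<tau> p = \<beta>}" using \<beta> by simp
      ultimately have "infinite (\<Union>i\<in>{1..k}. ?S i)" using P by (meson finite_Un finite_subset)
      then obtain i where i: "i \<in> {1..k}" "infinite (?S i)" by (meson finite_UN_I finite_atLeastAtMost)
      let ?Q = "(\<lambda>p. card (carrier (R Quot p))) ` ?S i"
      \<comment> \<open>A given norm occurs only finitely often, so infinitely many primes have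
        infinitely many norms.\<close>
      have "infinite ?Q"
      proof
        assume "finite ?Q"
        then have "finite (\<Union>q\<in>?Q. {p \<in> PP. card (carrier (R Quot p)) = q})"
          using finite_primes_norm by blast
        moreover have "?S i \<subseteq> (\<Union>q\<in>?Q. {p \<in> PP. card (carrier (R Quot p)) = q})" by blast
        ultimately show False using i(2) finite_subset by blast
      qed
      then have "P i = F \<beta>"
      proof (rule eval_XY_eq_imp_eq)
        show "2 \<le> q" if "q \<in> ?Q" for q using that norm_ge_2 by blast
        fix q s assume "q \<in> ?Q"
        then obtain p where p: "p \<in> PP" "good p" "\<tau> p = \<beta>" "?ok (P i) p" "q = card (carrier (R Quot p))"
          by blast
        show "eval_XY (P i) (of_nat q) (of_nat q powr (- s)) = eval_XY (F \<beta>) (of_nat q) (of_nat q powr (- s))"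
          unfolding p(5) using good(2)[OF p(1,2), of s] p(3) p(4)[rule_format, of s] by simp
      qed
      then show ?thesis using i by blast
    qed
    then have "F ` ?T \<subseteq> P ` {1..k}" by force
    then have "card (F ` ?T) \<le> card (P ` {1..k})" by (intro card_mono) auto
    also have "\<dots> \<le> k" using card_image_le[of "{1..k}" P] by simp
    finally show "card ?T \<le> k"
      using card_image[OF inj_on_subset[OF T(2)], of ?T] by simp
  next
    assume le: "card ?T \<le> k"
    \<comment> \<open>Numbers the types that occur infinitely often. The other types account for
      finitely many primes only.\<close>
    obtain h where h: "bij_betw h {1..card ?T} ?T" using ex_bij_betw_nat_finite_1[OF finT] by blast
    have "{p \<in> PP. \<not> (\<exists>i\<in>{1..k}. ?ok (F (h i)) p)}
        \<subseteq> {p \<in> PP. \<not> good p} \<union> (\<Union>\<beta>\<in>T - ?T. {p \<in> PP. good p \<and> \<tau> p = \<beta>})"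
    proof
      fix p assume p: "p \<in> {p \<in> PP. \<not> (\<exists>i\<in>{1..k}. ?ok (F (h i)) p)}"
      show "p \<in> {p \<in> PP. \<not> good p} \<union> (\<Union>\<beta>\<in>T - ?T. {p \<in> PP. good p \<and> \<tau> p = \<beta>})"
      proof (cases "good p \<and> \<tau> p \<in> ?T")
        case True
        then have "\<tau> p \<in> h ` {1..card ?T}" using bij_betw_imp_surj_on[OF h] by simp
        then obtain i where i: "i \<in> {1..card ?T}" "h i = \<tau> p" by fastforce
        then have "i \<in> {1..k}" using le by simp
        moreover have "p \<in> PP" using p by simp
        then have "?ok (F (h i)) p" unfolding i(2) using good(2)[of p] True by blast
        ultimately have "\<exists>i\<in>{1..k}. ?ok (F (h i)) p" by (rule bexI[rotated])
        moreover have "\<not> (\<exists>i\<in>{1..k}. ?ok (F (h i)) p)" using p by simp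
        ultimately show ?thesis by (rule notE[rotated])
      qed (use p good(1) in blast)
    qed
    moreover have "finite (\<Union>\<beta>\<in>T - ?T. {p \<in> PP. good p \<and> \<tau> p = \<beta>})" using T by blast
    ultimately have "finite {p \<in> PP. \<not> (\<exists>i\<in>{1..k}. ?ok (F (h i)) p)}"
      using bad by (meson finite_Un finite_subset)
    then show "period_le t R L k" unfolding def by (intro exI[of _ "\<lambda>i. F (h i)"])
  qed
qed

section \<open>Reduction modulo primes\<close>

locale integral_lie = integer_ring K for K :: "'k::field_char_0 set" +
  fixes L :: "('k, 'l) lie_alg" and B :: "'l set"
  assumes lie: "lie_algebra (ring_of_integers K) L"
    and B: "finite B" "B \<subseteq> carrier L" "module.lin_indpt (ring_of_integers K) L B"
      "module.span (ring_of_integers K) L B = carrier L"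
begin

sublocale L: lie_algebra R L by (rule lie)

lemma lincomb_unique:
  assumes a: "a \<in> B \<rightarrow> OK" and c: "c \<in> B \<rightarrow> OK" and e: "L.lincomb a B = L.lincomb c B" and b: "b \<in> B"
  shows "a b = c b"
proof (rule ccontr)
  assume "a b \<noteq> c b"
  have ac: "a \<in> B \<rightarrow> carrier R" "c \<in> B \<rightarrow> carrier R" using a c by simp_all
  have m: "a v \<ominus>\<^bsub>R\<^esub> c v = a v - c v" if "v \<in> B" for v
    using R_uminus[of "c v"] c that by (auto simp: a_minus_def)
  have "L.lincomb (\<lambda>v. a v \<ominus>\<^bsub>R\<^esub> c v) B = \<zero>\<^bsub>L\<^esub>"
    using L.lincomb_diff[OF B(1,2) ac] e L.lincomb_closed[OF B(2) ac(2)] by (simp add: a_minus_def L.M.r_neg)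
  moreover have "a b \<ominus>\<^bsub>R\<^esub> c b \<noteq> \<zero>\<^bsub>R\<^esub>" using m[OF b] \<open>a b \<noteq> c b\<close> by simp
  moreover have "(\<lambda>v. a v \<ominus>\<^bsub>R\<^esub> c v) \<in> B \<rightarrow> carrier R" using ac by blast
  ultimately have "L.lin_dep B" using L.lin_dep_crit[OF B(1) subset_refl _ b] by blast
  then show False using B(3) by blast
qed

definition coo :: "'l \<Rightarrow> 'l \<Rightarrow> 'k" where
  "coo x = (SOME a. a \<in> B \<rightarrow> OK \<and> L.lincomb a B = x)"

lemma coo: "x \<in> carrier L \<Longrightarrow> coo x \<in> B \<rightarrow> OK \<and> L.lincomb (coo x) B = x"
proof -
  assume "x \<in> carrier L"
  then have "\<exists>a. a \<in> B \<rightarrow> OK \<and> L.lincomb a B = x"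
    using L.finite_in_span[OF B(1,2)] B(4) by simp
  then show ?thesis unfolding coo_def by (rule someI_ex)
qed

lemma coo_closed: "x \<in> carrier L \<Longrightarrow> b \<in> B \<Longrightarrow> coo x b \<in> OK"
  using coo by blast

abbreviation idx :: "'k set \<Rightarrow> ('k set, 'l set) lie_index" where
  "idx p \<equiv> Abs_lie_index (R Quot p, reduction R L p)"

context
  fixes p assumes p: "p \<in> PP"
begin

interpretation I: lie_algebra_ideal R L p
  by (intro lie_algebra_ideal.intro lie PP_ideal p)

lemma idx_simps: "fring (idx p) = R Quot p" "flie (idx p) = reduction R L p"
  using I.reduction_lie_algebra by (simp_all add: fring_def flie_def Abs_lie_index_inverse)

text \<open>Reduction modulo \<open>p\<close>, with values in the factor of the product that is the
  Lie algebra \<open>L/pL\<close>.\<close>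

definition \<phi> :: "'l \<Rightarrow> ('k set, 'l set) umod" where
  "\<phi> x = uemb (idx p) (I.cls x)"

definition act :: "'k \<Rightarrow> ('k set, 'l set) umod \<Rightarrow> ('k set, 'l set) umod" where
  "act a v = uscale (uscal (idx p) (p +>\<^bsub>R\<^esub> a)) v"

lemma fV_eq: "fV (idx p) = \<phi> ` carrier L"
proof -
  have "carrier (reduction R L p) = I.cls ` carrier L"
    using I.reduction_cls I.reduction_cases by blast
  then show ?thesis by (auto simp: idx_simps \<phi>_def)
qed

lemma cls_in: "x \<in> carrier L \<Longrightarrow> I.cls x \<in> carrier (flie (idx p))"
  using I.reduction_cls by (simp add: idx_simps)

lemma coset_in: "a \<in> OK \<Longrightarrow> p +>\<^bsub>R\<^esub> a \<in> carrier (fring (idx p))"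
  unfolding idx_simps by (auto simp: FactRing_def A_RCOSETS_def')

lemma \<phi>_add: "x \<in> carrier L \<Longrightarrow> y \<in> carrier L \<Longrightarrow> \<phi> (x \<oplus>\<^bsub>L\<^esub> y) = \<phi> x + \<phi> y"
  using uemb_add[OF cls_in cls_in, of x y] I.reduction_add[of x y] by (simp add: \<phi>_def idx_simps)

lemma \<phi>_smult: "a \<in> OK \<Longrightarrow> x \<in> carrier L \<Longrightarrow> \<phi> (a \<odot>\<^bsub>L\<^esub> x) = act a (\<phi> x)"
  using uscale_uemb[OF cls_in, of x] ucoef_uscal[OF coset_in, of a] I.reduction_smult[of a x]
  by (simp add: \<phi>_def act_def idx_simps)

lemma \<phi>_bracket: "x \<in> carrier L \<Longrightarrow> y \<in> carrier L \<Longrightarrow> \<phi> \<lbrakk>x,y\<rbrakk>\<^bsub>L\<^esub> = ubr (\<phi> x) (\<phi> y)"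
  using ubr_uemb[OF cls_in cls_in, of x y] I.reduction_bracket[of x y] by (simp add: \<phi>_def idx_simps)

lemma \<phi>_zero: "\<phi> \<zero>\<^bsub>L\<^esub> = 0"
  using uemb_zero[of "idx p"] I.reduction_zero by (simp add: \<phi>_def idx_simps)

text \<open>Combinations with coefficients in \<open>p\<close> are closed under all operations that
  generate \<open>pL\<close>, and coordinates with respect to \<open>B\<close> are unique since
  \<open>L\<close> is free.\<close>

lemma lincomb_N:
  assumes a: "a \<in> B \<rightarrow> OK"
  shows "L.lincomb a B \<in> I.N \<longleftrightarrow> (\<forall>b\<in>B. a b \<in> p)"
proof
  assume "L.lincomb a B \<in> I.N"
  then have "\<exists>c. (\<forall>b\<in>B. c b \<in> p) \<and> L.lincomb c B = L.lincomb a B"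
  proof (rule I.N_induct)
    show "\<exists>c. (\<forall>b\<in>B. c b \<in> p) \<and> L.lincomb c B = \<zero>\<^bsub>L\<^esub>"
    proof (intro exI conjI)
      show "\<forall>b\<in>B. \<zero>\<^bsub>R\<^esub> \<in> p" using ideal_closed(2)[OF PP_ideal[OF p]] by simp
      show "L.lincomb (\<lambda>_. \<zero>\<^bsub>R\<^esub>) B = \<zero>\<^bsub>L\<^esub>"
        unfolding L.lincomb_def using B(2) L.smult_l_null by (intro L.M.add.finprod_one_eqI) auto
    qed
  next
    fix y z assume "\<exists>c. (\<forall>b\<in>B. c b \<in> p) \<and> L.lincomb c B = y" "\<exists>c. (\<forall>b\<in>B. c b \<in> p) \<and> L.lincomb c B = z"
    then obtain c d where c: "\<forall>b\<in>B. c b \<in> p" "L.lincomb c B = y" and d: "\<forall>b\<in>B. d b \<in> p" "L.lincomb d B = z"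
      by blast
    have cd: "c \<in> B \<rightarrow> carrier R" "d \<in> B \<rightarrow> carrier R" using c d ideal_closed(1)[OF PP_ideal[OF p]] by auto
    have "L.lincomb (\<lambda>v. c v \<oplus>\<^bsub>R\<^esub> d v) B = y \<oplus>\<^bsub>L\<^esub> z" using L.lincomb_sum[OF B(1,2) cd] c d by simp
    moreover have "\<forall>b\<in>B. c b \<oplus>\<^bsub>R\<^esub> d b \<in> p" using c d ideal_closed(3)[OF PP_ideal[OF p]] by simp
    ultimately show "\<exists>c. (\<forall>b\<in>B. c b \<in> p) \<and> L.lincomb c B = y \<oplus>\<^bsub>L\<^esub> z"
      by (intro exI[of _ "\<lambda>v. c v \<oplus>\<^bsub>R\<^esub> d v"] conjI)
  next
    fix r y assume r: "r \<in> carrier R" and "\<exists>c. (\<forall>b\<in>B. c b \<in> p) \<and> L.lincomb c B = y"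
    then obtain c where c: "\<forall>b\<in>B. c b \<in> p" "L.lincomb c B = y" by blast
    have cR: "c \<in> B \<rightarrow> carrier R" using c ideal_closed(1)[OF PP_ideal[OF p]] by auto
    have "L.lincomb (\<lambda>v. r \<otimes>\<^bsub>R\<^esub> c v) B = r \<odot>\<^bsub>L\<^esub> y" using L.lincomb_smult[OF B(2) cR r] c by simp
    moreover have "\<forall>b\<in>B. r \<otimes>\<^bsub>R\<^esub> c b \<in> p" using c r ideal_closed(5)[OF PP_ideal[OF p]] by simp
    ultimately show "\<exists>c. (\<forall>b\<in>B. c b \<in> p) \<and> L.lincomb c B = r \<odot>\<^bsub>L\<^esub> y"
      by (intro exI[of _ "\<lambda>v. r \<otimes>\<^bsub>R\<^esub> c v"] conjI)
  next
    fix r y assume r: "r \<in> p" and y: "y \<in> carrier L"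
    have rR: "r \<in> carrier R" using r ideal_closed(1)[OF PP_ideal[OF p]] by auto
    have c: "coo y \<in> B \<rightarrow> carrier R" "L.lincomb (coo y) B = y" using coo[OF y] by simp_all
    have "L.lincomb (\<lambda>v. r \<otimes>\<^bsub>R\<^esub> coo y v) B = r \<odot>\<^bsub>L\<^esub> y" using L.lincomb_smult[OF B(2) c(1) rR] c by simp
    moreover have "\<forall>b\<in>B. r \<otimes>\<^bsub>R\<^esub> coo y b \<in> p" using coo_closed[OF y] r ideal_closed(4)[OF PP_ideal[OF p]] by simp
    ultimately show "\<exists>c. (\<forall>b\<in>B. c b \<in> p) \<and> L.lincomb c B = r \<odot>\<^bsub>L\<^esub> y"
      by (intro exI[of _ "\<lambda>v. r \<otimes>\<^bsub>R\<^esub> coo y v"] conjI)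
  qed
  then obtain c where c: "\<forall>b\<in>B. c b \<in> p" "L.lincomb c B = L.lincomb a B" by blast
  have "c \<in> B \<rightarrow> OK" using c ideal_closed(1)[OF PP_ideal[OF p]] by auto
  then show "\<forall>b\<in>B. a b \<in> p" using lincomb_unique[OF a, of c] c by metis
next
  assume ap: "\<forall>b\<in>B. a b \<in> p"
  have "L.lincomb a C \<in> I.N" if "C \<subseteq> B" for C
    using finite_subset[OF that B(1)] that
  proof (induction C rule: finite_induct)
    case empty
    then show ?case using I.N_zero by (simp add: L.lincomb_def)
  next
    case (insert b C)
    have "L.lincomb a (C \<union> {b}) = a b \<odot>\<^bsub>L\<^esub> b \<oplus>\<^bsub>L\<^esub> L.lincomb a C"
      using insert a B(2) by (intro L.lincomb_insert) auto
    then show ?case using insert ap B(2) by (auto intro!: I.N_add I.N_gen)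
  qed
  then show "L.lincomb a B \<in> I.N" by blast
qed

lemma \<phi>_eq_0: "x \<in> carrier L \<Longrightarrow> \<phi> x = 0 \<longleftrightarrow> x \<in> I.N"
proof -
  assume x: "x \<in> carrier L"
  have z: "\<ominus>\<^bsub>L\<^esub> \<zero>\<^bsub>L\<^esub> = \<zero>\<^bsub>L\<^esub>"
    using L.M.r_neg[OF L.M.zero_closed] L.M.l_zero[OF L.M.a_inv_closed[OF L.M.zero_closed]] by metis
  have "\<phi> x = 0 \<longleftrightarrow> I.cls x = I.cls \<zero>\<^bsub>L\<^esub>"
    using inj_on_eq_iff[OF uemb_inj cls_in[OF x] cls_in[OF L.M.zero_closed]] \<phi>_zero by (simp add: \<phi>_def)
  also have "\<dots> \<longleftrightarrow> x \<in> I.N" using I.cls_eq[OF x L.M.zero_closed] x by (simp add: a_minus_def z)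
  finally show ?thesis .
qed

lemma finite_reduction: "finite (carrier (flie (idx p)))"
proof -
  have "\<exists>r. \<forall>A\<in>carrier (R Quot p). r A \<in> OK \<and> A = p +>\<^bsub>R\<^esub> r A"
    by (intro bchoice) (auto simp: FactRing_def A_RCOSETS_def')
  then obtain r where r: "\<And>A. A \<in> carrier (R Quot p) \<Longrightarrow> r A \<in> OK \<and> A = p +>\<^bsub>R\<^esub> r A" by blast
  define T where "T = r ` carrier (R Quot p)"
  have finT: "finite T" using finite_quotient[OF p] by (simp add: T_def)
  have TO: "T \<subseteq> OK" using r by (auto simp: T_def)
  have "carrier (flie (idx p)) \<subseteq> (\<lambda>a. I.cls (L.lincomb a B)) ` (B \<rightarrow>\<^sub>E T)"
  proof
    fix U assume "U \<in> carrier (flie (idx p))"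
    then obtain x where x: "x \<in> carrier L" "U = I.cls x" by (auto simp: idx_simps elim: I.reduction_cases)
    define a where "a = restrict (\<lambda>b. r (p +>\<^bsub>R\<^esub> coo x b)) B"
    have c: "coo x \<in> B \<rightarrow> carrier R" "L.lincomb (coo x) B = x" using coo[OF x(1)] by simp_all
    have cs: "p +>\<^bsub>R\<^esub> coo x b \<in> carrier (R Quot p)" if "b \<in> B" for b
      using coset_in[of "coo x b"] coo_closed[OF x(1) that] by (simp add: idx_simps)
    have a: "a \<in> B \<rightarrow>\<^sub>E T" using cs by (auto simp: a_def T_def)
    then have aR: "a \<in> B \<rightarrow> carrier R" using TO by auto
    have "coo x b \<ominus>\<^bsub>R\<^esub> a b \<in> p" if b: "b \<in> B" for b
    proof -
      have "a b \<in> OK" "p +>\<^bsub>R\<^esub> coo x b = p +>\<^bsub>R\<^esub> a b" using r[OF cs[OF b]] b by (simp_all add: a_def)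
      then have "coo x b \<in> p +>\<^bsub>R\<^esub> a b" using I.a_rcos_self[of "coo x b"] coo_closed[OF x(1) b] by simp
      then show ?thesis using I.a_rcos_module[of "a b" "coo x b"] \<open>a b \<in> OK\<close> coo_closed[OF x(1) b]
        by (simp add: a_minus_def)
    qed
    then have "L.lincomb (\<lambda>b. coo x b \<ominus>\<^bsub>R\<^esub> a b) B \<in> I.N"
      proof (subst lincomb_N)
      show "(\<lambda>b. coo x b \<ominus>\<^bsub>R\<^esub> a b) \<in> B \<rightarrow> OK"
      proof
        fix b assume b: "b \<in> B"
        then have "coo x b \<in> carrier R" "a b \<in> carrier R" using c(1) aR by auto
        then show "coo x b \<ominus>\<^bsub>R\<^esub> a b \<in> OK" using R.minus_closed by simp
      qed
    qed simp
    then have "x \<ominus>\<^bsub>L\<^esub> L.lincomb a B \<in> I.N" using L.lincomb_diff[OF B(1,2) c(1) aR] c(2) by simp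
    then have "U = I.cls (L.lincomb a B)" using I.cls_eq[OF x(1) L.lincomb_closed[OF B(2) aR]] x by simp
    then show "U \<in> (\<lambda>a. I.cls (L.lincomb a B)) ` (B \<rightarrow>\<^sub>E T)" using a by blast
  qed
  moreover have "finite (B \<rightarrow>\<^sub>E T)" using B(1) finT by (intro finite_PiE) auto
  ultimately show ?thesis by (meson finite_imageI finite_subset)
qed

lemma V_finite_lie: "finite_lie uscale (fV (idx p)) (fq (idx p)) ubr"
  using factor_finite_lie[of "idx p"] quotient_field[OF p] finite_quotient[OF p] finite_reduction
  by (simp add: idx_simps)

interpretation V: finite_lie uscale "fV (idx p)" "fq (idx p)" ubr
  by (rule V_finite_lie)

lemma \<phi>_V [simp]: "x \<in> carrier L \<Longrightarrow> \<phi> x \<in> fV (idx p)"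
  by (simp add: fV_eq)

lemma B_L: "b \<in> B \<Longrightarrow> b \<in> carrier L"
  using B(2) by blast

lemma act_add: "a \<in> OK \<Longrightarrow> c \<in> OK \<Longrightarrow> v \<in> fV (idx p) \<Longrightarrow> act (a + c) v = act a v + act c v"
proof -
  assume a: "a \<in> OK" "c \<in> OK" and v: "v \<in> fV (idx p)"
  obtain x where x: "x \<in> carrier L" "v = \<phi> x" using v fV_eq by blast
  have "\<phi> ((a \<oplus>\<^bsub>R\<^esub> c) \<odot>\<^bsub>L\<^esub> x) = \<phi> (a \<odot>\<^bsub>L\<^esub> x) + \<phi> (c \<odot>\<^bsub>L\<^esub> x)"
    using a x by (subst L.smult_l_distr) (auto simp: \<phi>_add simp del: R_simps(5))
  then show ?thesis using a x by (simp add: \<phi>_smult)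
qed

lemma act_mult: "a \<in> OK \<Longrightarrow> c \<in> OK \<Longrightarrow> v \<in> fV (idx p) \<Longrightarrow> act (a * c) v = act a (act c v)"
proof -
  assume a: "a \<in> OK" "c \<in> OK" and v: "v \<in> fV (idx p)"
  obtain x where x: "x \<in> carrier L" "v = \<phi> x" using v fV_eq by blast
  have "\<phi> ((a \<otimes>\<^bsub>R\<^esub> c) \<odot>\<^bsub>L\<^esub> x) = \<phi> (a \<odot>\<^bsub>L\<^esub> (c \<odot>\<^bsub>L\<^esub> x))"
    using a x by (subst L.smult_assoc1) auto
  then show ?thesis using a x by (simp add: \<phi>_smult)
qed

lemma act_one: "v \<in> fV (idx p) \<Longrightarrow> act 1 v = v"
proof -
  assume v: "v \<in> fV (idx p)"
  obtain x where x: "x \<in> carrier L" "v = \<phi> x" using v fV_eq by blast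
  have "\<phi> (\<one>\<^bsub>R\<^esub> \<odot>\<^bsub>L\<^esub> x) = \<phi> x" using x by (subst L.smult_one) auto
  then show ?thesis using \<phi>_smult[of 1 x] x by simp
qed

lemma act_prime: "a \<in> p \<Longrightarrow> v \<in> fV (idx p) \<Longrightarrow> act a v = 0"
proof -
  assume a: "a \<in> p" and v: "v \<in> fV (idx p)"
  obtain x where x: "x \<in> carrier L" "v = \<phi> x" using v fV_eq by blast
  have "a \<in> OK" using a ideal_closed(1)[OF PP_ideal[OF p]] by blast
  moreover have "\<phi> (a \<odot>\<^bsub>L\<^esub> x) = 0" using \<phi>_eq_0[of "a \<odot>\<^bsub>L\<^esub> x"] I.N_gen[OF a x(1)] by (simp add: x)
  ultimately show ?thesis using x by (simp add: \<phi>_smult)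
qed

lemma act_0: "v \<in> fV (idx p) \<Longrightarrow> act 0 v = 0"
  using act_prime ideal_closed(2)[OF PP_ideal[OF p]] by blast

lemma act_sum_right: "act a (\<Sum>i\<in>S. f i) = (\<Sum>i\<in>S. act a (f i))"
  unfolding act_def by (rule V.scale_sum_right)

lemma act_sum_left:
  "(\<And>i. i \<in> S \<Longrightarrow> f i \<in> OK) \<Longrightarrow> v \<in> fV (idx p) \<Longrightarrow> act (\<Sum>i\<in>S. f i) v = (\<Sum>i\<in>S. act (f i) v)"
  by (induction S rule: infinite_finite_induct) (auto simp: act_0 act_add OK_sum)

lemma act_eq_0:
  assumes a: "a \<in> OK" and v: "v \<in> fV (idx p)" "v \<noteq> 0" and 0: "act a v = 0"
  shows "a \<in> p"
proof (rule ccontr)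
  assume n: "a \<notin> p"
  interpret Q: field "R Quot p" by (rule quotient_field[OF p])
  have c: "p +>\<^bsub>R\<^esub> a \<in> carrier (R Quot p)" using coset_in[OF a] by (simp add: idx_simps)
  have "p +>\<^bsub>R\<^esub> a \<noteq> \<zero>\<^bsub>R Quot p\<^esub>"
    using n I.a_rcos_self[of a] a by (auto simp: FactRing_def)
  then obtain A where A: "A \<in> carrier (R Quot p)" "A \<otimes>\<^bsub>R Quot p\<^esub> (p +>\<^bsub>R\<^esub> a) = \<one>\<^bsub>R Quot p\<^esub>"
    using c Q.field_Units Q.Units_l_inv_ex[of "p +>\<^bsub>R\<^esub> a"] by force
  then obtain d where d: "d \<in> OK" "A = p +>\<^bsub>R\<^esub> d" by (auto elim: I.Q_cases)
  have "p +>\<^bsub>R\<^esub> (d * a) = p +>\<^bsub>R\<^esub> 1" using A d a I.Q_mult[of d a] I.Q_one by simp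
  then have "d * a \<in> p +>\<^bsub>R\<^esub> 1" using I.a_rcos_self[of "d * a"] d a by simp
  then have "d * a \<ominus>\<^bsub>R\<^esub> 1 \<in> p" using I.a_rcos_module[of 1 "d * a"] d a by (simp add: a_minus_def)
  then have "d * a - 1 \<in> p" using R_uminus[of 1] by (simp add: a_minus_def)
  then have "act (d * a - 1) v = 0" using act_prime v by blast
  moreover have "act (d * a) v = act (d * a - 1) v + act 1 v" using act_add[of "d * a - 1" 1 v] d a v by simp
  moreover have "act (d * a) v = 0" using act_mult[OF d(1) a v(1)] unfolding 0 by (simp add: act_def)
  ultimately show False using act_one v by simp
qed

text \<open>Only one component of a scalar of the product acts on this factor, a coset of
  \<open>p\<close>, and any representative acts alike. So all coefficients can be taken in
  \<open>OK\<close>.\<close>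

lemma scalar_act:
  obtains a where "a \<in> OK" "\<And>v. v \<in> fV (idx p) \<Longrightarrow> uscale r v = act a v"
proof -
  have "ucoef (idx p) r \<in> carrier (R Quot p)" using ucoef_closed[of "idx p" r] by (simp add: idx_simps)
  then obtain a where a: "a \<in> OK" "ucoef (idx p) r = p +>\<^bsub>R\<^esub> a" by (auto elim: I.Q_cases)
  have "uscale r v = act a v" if v: "v \<in> fV (idx p)" for v
  proof -
    obtain U where U: "U \<in> carrier (flie (idx p))" "v = uemb (idx p) U" using v by blast
    show ?thesis unfolding act_def U(2) using uscale_uemb[OF U(1)] a ucoef_uscal[OF coset_in[OF a(1)]] by simp
  qed
  then show ?thesis using that a by blast
qed

lemma \<phi>_lincomb:
  assumes a: "a \<in> B \<rightarrow> OK"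
  shows "\<phi> (L.lincomb a B) = (\<Sum>b\<in>B. act (a b) (\<phi> b))"
proof -
  have "\<phi> (L.lincomb a C) = (\<Sum>b\<in>C. act (a b) (\<phi> b))" if "C \<subseteq> B" for C
    using finite_subset[OF that B(1)] that
  proof (induction C rule: finite_induct)
    case empty
    then show ?case by (simp add: L.lincomb_def \<phi>_zero)
  next
    case (insert b C)
    have "L.lincomb a (C \<union> {b}) = a b \<odot>\<^bsub>L\<^esub> b \<oplus>\<^bsub>L\<^esub> L.lincomb a C"
      using insert a B(2) by (intro L.lincomb_insert) auto
    moreover have "L.lincomb a C \<in> carrier L" using insert a B(2) by (intro L.lincomb_closed) auto
    moreover have "b \<in> carrier L" "a b \<in> OK" using insert a B(2) by auto
    ultimately show ?case using insert by (simp add: \<phi>_add \<phi>_smult)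
  qed
  then show ?thesis by blast
qed

lemma \<phi>_coo: "x \<in> carrier L \<Longrightarrow> \<phi> x = (\<Sum>b\<in>B. act (coo x b) (\<phi> b))"
  using \<phi>_lincomb[of "coo x"] coo[of x] by simp

lemma combination_eq_0:
  assumes a: "a \<in> B \<rightarrow> OK"
  shows "(\<Sum>b\<in>B. act (a b) (\<phi> b)) = 0 \<longleftrightarrow> (\<forall>b\<in>B. a b \<in> p)"
  using \<phi>_eq_0[of "L.lincomb a B"] \<phi>_lincomb[OF a] lincomb_N[OF a] L.lincomb_closed[OF B(2), of a] a by simp

lemma \<phi>_zero_iff: "x \<in> carrier L \<Longrightarrow> \<phi> x = 0 \<longleftrightarrow> (\<forall>b\<in>B. coo x b \<in> p)"
  using \<phi>_coo[of x] combination_eq_0[of "coo x"] coo[of x] by simp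

text \<open>Expanding in the basis turns a relation between reduced vectors into congruences modulo
  \<open>p\<close>, one for each coordinate.\<close>

lemma family_eq_0:
  assumes a: "\<And>j. j \<in> J \<Longrightarrow> a j \<in> OK" and x: "\<And>j. j \<in> J \<Longrightarrow> x j \<in> carrier L"
  shows "(\<Sum>j\<in>J. act (a j) (\<phi> (x j))) = 0 \<longleftrightarrow> (\<forall>b\<in>B. (\<Sum>j\<in>J. a j * coo (x j) b) \<in> p)"
proof -
  have c: "(\<lambda>b. \<Sum>j\<in>J. a j * coo (x j) b) \<in> B \<rightarrow> OK"
    using a x coo_closed by (intro Pi_I OK_sum OK_closed(4)) auto
  have "(\<Sum>j\<in>J. act (a j) (\<phi> (x j))) = (\<Sum>j\<in>J. \<Sum>b\<in>B. act (a j * coo (x j) b) (\<phi> b))"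
  proof (rule sum.cong[OF refl])
    fix j assume j: "j \<in> J"
    have "act (a j) (\<phi> (x j)) = (\<Sum>b\<in>B. act (a j) (act (coo (x j) b) (\<phi> b)))"
      using \<phi>_coo[OF x[OF j]] act_sum_right by simp
    also have "\<dots> = (\<Sum>b\<in>B. act (a j * coo (x j) b) (\<phi> b))"
      using a[OF j] coo_closed[OF x[OF j]] B_L by (intro sum.cong) (auto simp: act_mult)
    finally show "act (a j) (\<phi> (x j)) = (\<Sum>b\<in>B. act (a j * coo (x j) b) (\<phi> b))" .
  qed
  also have "\<dots> = (\<Sum>b\<in>B. \<Sum>j\<in>J. act (a j * coo (x j) b) (\<phi> b))" by (rule sum.swap)
  also have "\<dots> = (\<Sum>b\<in>B. act (\<Sum>j\<in>J. a j * coo (x j) b) (\<phi> b))"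
    using a x coo_closed B_L by (intro sum.cong) (auto simp: act_sum_left)
  finally show ?thesis
    using combination_eq_0[of "\<lambda>b. \<Sum>j\<in>J. a j * coo (x j) b"] c by simp
qed

lemma V_span: "fV (idx p) = V.span (\<phi> ` B)"
proof
  show "fV (idx p) \<subseteq> V.span (\<phi> ` B)"
  proof
    fix v assume "v \<in> fV (idx p)"
    then obtain x where "x \<in> carrier L" "v = \<phi> x" using fV_eq by blast
    then have "v = (\<Sum>b\<in>B. act (coo x b) (\<phi> b))" using \<phi>_coo by blast
    also have "\<dots> \<in> V.span (\<phi> ` B)" unfolding act_def by (intro V.span_sum V.span_scale V.span_base) auto
    finally show "v \<in> V.span (\<phi> ` B)" .
  qed
  have "\<phi> ` B \<subseteq> fV (idx p)" using B_L by auto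
  then show "V.span (\<phi> ` B) \<subseteq> fV (idx p)" using V.sub_span by (auto simp: V.sub_def)
qed

lemma \<phi>_basis_nonzero: "b \<in> B \<Longrightarrow> \<phi> b \<noteq> 0"
proof
  assume b: "b \<in> B" and 0: "\<phi> b = 0"
  let ?a = "\<lambda>c. if c = b then 1 else (0::'k)"
  have "(\<Sum>c\<in>B. act (?a c) (\<phi> c)) = (\<Sum>c\<in>B. 0)"
    using 0 B_L by (intro sum.cong) (auto simp: act_0 act_one)
  then have "\<forall>c\<in>B. ?a c \<in> p" using combination_eq_0[of ?a] by simp
  then have "?a b \<in> p" using b by (rule bspec)
  then show False using PP_not_one[OF p] by simp
qed

lemma V_nonzero: "B \<noteq> {} \<Longrightarrow> fV (idx p) \<noteq> {0}"
proof
  assume "B \<noteq> {}" and V0: "fV (idx p) = {0}"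
  then obtain b where b: "b \<in> B" by blast
  have "\<phi> b \<in> {0}" using \<phi>_V[OF B_L[OF b]] unfolding V0 .
  then show False using \<phi>_basis_nonzero[OF b] by simp
qed

lemma \<phi>_B_V: "\<phi> ` B \<subseteq> fV (idx p)"
  by (intro image_subsetI \<phi>_V B_L)

text \<open>Coefficients are replaced by elements of \<open>OK\<close> with the same action. Whether
  one lies in \<open>p\<close> is read off from its action on a nonzero \<open>\<phi> b0\<close>,
  hence the condition on \<open>B\<close>.\<close>

lemma indep_iff:
  assumes J: "finite J" and x: "\<And>j. j \<in> J \<Longrightarrow> x j \<in> carrier L" and ne: "B \<noteq> {}"
  shows "V.indep_family (\<lambda>j. \<phi> (x j)) J \<longleftrightarrow> trivial_mod p J ((\<lambda>b j. coo (x j) b) ` B)"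
proof
  obtain b0 where b0: "b0 \<in> B" using ne by blast
  assume i: "V.indep_family (\<lambda>j. \<phi> (x j)) J"
  show "trivial_mod p J ((\<lambda>b j. coo (x j) b) ` B)"
    unfolding trivial_mod_def
  proof (intro allI impI ballI)
    fix a j assume a: "\<forall>j\<in>J. a j \<in> OK" "\<forall>r\<in>(\<lambda>b j. coo (x j) b) ` B. (\<Sum>j\<in>J. a j * r j) \<in> p" and j: "j \<in> J"
    then have "(\<Sum>j\<in>J. act (a j) (\<phi> (x j))) = 0" using family_eq_0[of J a x] x by simp
    then have "\<forall>v\<in>fV (idx p). act (a j) v = 0"
      using i j unfolding V.indep_family_def act_def
      by (elim allE[where x = "\<lambda>j. uscal (idx p) (p +>\<^bsub>R\<^esub> a j)"]) blast
    then have "act (a j) (\<phi> b0) = 0" using \<phi>_V[OF B_L[OF b0]] by (rule bspec)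
    then show "a j \<in> p"
      using act_eq_0[OF _ \<phi>_V[OF B_L[OF b0]] \<phi>_basis_nonzero[OF b0], of "a j"] a(1) j by blast
  qed
next
  assume t: "trivial_mod p J ((\<lambda>b j. coo (x j) b) ` B)"
  show "V.indep_family (\<lambda>j. \<phi> (x j)) J"
    unfolding V.indep_family_def
  proof (intro allI impI)
    fix r assume r: "(\<Sum>i\<in>J. uscale (r i) (\<phi> (x i))) = 0"
    have "\<forall>i. \<exists>a. a \<in> OK \<and> (\<forall>v\<in>fV (idx p). uscale (r i) v = act a v)" using scalar_act by metis
    then obtain a where a: "\<And>i. a i \<in> OK" "\<And>i v. v \<in> fV (idx p) \<Longrightarrow> uscale (r i) v = act (a i) v" by metis
    have "(\<Sum>i\<in>J. act (a i) (\<phi> (x i))) = (\<Sum>i\<in>J. uscale (r i) (\<phi> (x i)))"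
      using a x by (intro sum.cong) auto
    then have "\<forall>b\<in>B. (\<Sum>j\<in>J. a j * coo (x j) b) \<in> p" using family_eq_0[of J a x] a x r by simp
    then have "\<forall>j\<in>J. a j \<in> p" using t a unfolding trivial_mod_def by blast
    then show "\<forall>i\<in>J. \<forall>v\<in>fV (idx p). uscale (r i) v = 0" using a act_prime by simp
  qed
qed

lemma V_card: "card (fV (idx p)) = fq (idx p) ^ card B"
proof (cases "B = {}")
  case True
  then have "fV (idx p) = {0}" using V_span by simp
  then show ?thesis using True by simp
next
  case False
  have "V.indep_family (\<lambda>j. \<phi> j) B"
    unfolding V.indep_family_def
  proof (intro allI impI)
    fix r assume r: "(\<Sum>i\<in>B. uscale (r i) (\<phi> i)) = 0"
    have "\<forall>i. \<exists>a. a \<in> OK \<and> (\<forall>v\<in>fV (idx p). uscale (r i) v = act a v)" using scalar_act by metis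
    then obtain a where a: "\<And>i. a i \<in> OK" "\<And>i v. v \<in> fV (idx p) \<Longrightarrow> uscale (r i) v = act (a i) v" by metis
    have "(\<Sum>i\<in>B. act (a i) (\<phi> i)) = (\<Sum>i\<in>B. uscale (r i) (\<phi> i))"
      using a B_L by (intro sum.cong) auto
    then have "\<forall>b\<in>B. a b \<in> p" using combination_eq_0[of a] a r by simp
    then show "\<forall>i\<in>B. \<forall>v\<in>fV (idx p). uscale (r i) v = 0" using a act_prime by simp
  qed
  from V.card_span_indep[OF B(1) \<phi>_B_V this V_nonzero[OF False]] show ?thesis
    unfolding V_span[symmetric] .
qed

lemma der_V:
  "V.der (fV (idx p)) = V.span ((\<lambda>(b, c). \<phi> \<lbrakk>b,c\<rbrakk>\<^bsub>L\<^esub>) ` (B \<times> B))"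
proof -
  have "(\<lambda>(a, b). ubr a b) ` (\<phi> ` B \<times> \<phi> ` B) = (\<lambda>(b, c). \<phi> \<lbrakk>b,c\<rbrakk>\<^bsub>L\<^esub>) ` (B \<times> B)"
    unfolding image_paired_Times[symmetric] image_image
    using B_L by (intro image_cong refl) (auto simp: \<phi>_bracket)
  then show ?thesis using V.der_span[OF V_span] by (simp only:)
qed

text \<open>\<open>f\<close> stands for the answers that the linear systems have modulo almost all
  primes; the exponent then is the same for all of these.\<close>

lemma der_card:
  assumes J: "\<And>J. J \<subseteq> B \<times> B \<Longrightarrow> trivial_mod p J ((\<lambda>b (c, c'). coo \<lbrakk>c,c'\<rbrakk>\<^bsub>L\<^esub> b) ` B) \<longleftrightarrow> f J"
  shows "card (V.der (fV (idx p))) = fq (idx p) ^ Max (card ` {J. J \<subseteq> B \<times> B \<and> f J})"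
proof (cases "B = {}")
  case True
  have "f {}" using J[of "{}"] by (simp add: trivial_mod_def)
  then have "{J. J \<subseteq> B \<times> B \<and> f J} = {{}}" using True by auto
  then show ?thesis using der_V True by simp
next
  case False
  let ?x = "\<lambda>(c, c'). \<lbrakk>c,c'\<rbrakk>\<^bsub>L\<^esub>"
  let ?w = "\<lambda>j. \<phi> (?x j)"
  have ne: "fV (idx p) \<noteq> {0}" using False by (rule V_nonzero)
  have w: "?w ` (B \<times> B) \<subseteq> fV (idx p)"
  proof (rule image_subsetI)
    fix j assume "j \<in> B \<times> B"
    then have "?x j \<in> carrier L" using B_L by auto
    then show "?w j \<in> fV (idx p)" by (rule \<phi>_V)
  qed
  have "V.indep_family ?w J \<longleftrightarrow> f J" if "J \<subseteq> B \<times> B" for J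
  proof -
    have "finite J" using that B(1) finite_subset by blast
    moreover have "?x j \<in> carrier L" if "j \<in> J" for j using that \<open>J \<subseteq> B \<times> B\<close> B_L by auto
    ultimately have "V.indep_family ?w J \<longleftrightarrow> trivial_mod p J ((\<lambda>b j. coo (?x j) b) ` B)"
      using indep_iff[of J ?x] False by blast
    moreover have "(\<lambda>b j. coo (?x j) b) = (\<lambda>b (c, c'). coo \<lbrakk>c,c'\<rbrakk>\<^bsub>L\<^esub> b)" by (auto simp: fun_eq_iff)
    ultimately show ?thesis using J[OF that] by (simp only:)
  qed
  then have "{J. J \<subseteq> B \<times> B \<and> V.indep_family ?w J} = {J. J \<subseteq> B \<times> B \<and> f J}" by blast
  moreover have "?w = (\<lambda>(b, c). \<phi> \<lbrakk>b,c\<rbrakk>\<^bsub>L\<^esub>)" by (auto simp: fun_eq_iff)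
  ultimately show ?thesis using V.card_span_family[OF finite_cartesian_product[OF B(1) B(1)] w ne] der_V by (simp only:)
qed

text \<open>The unknowns are the coordinates of a vector, and the row \<open>(c, c')\<close> says
  that the coordinate at \<open>c'\<close> of its bracket with \<open>c\<close> vanishes.\<close>

lemma center_iff:
  "V.center = {0} \<longleftrightarrow> trivial_mod p B ((\<lambda>(c, c') b. coo \<lbrakk>c,b\<rbrakk>\<^bsub>L\<^esub> c') ` (B \<times> B))"
proof -
  have key: "(\<Sum>b\<in>B. act (a b) (\<phi> b)) \<in> V.center \<longleftrightarrow> (\<forall>c\<in>B. \<forall>c'\<in>B. (\<Sum>b\<in>B. a b * coo \<lbrakk>c,b\<rbrakk>\<^bsub>L\<^esub> c') \<in> p)"
    if a: "a \<in> B \<rightarrow> OK" for a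
  proof -
    let ?z = "\<Sum>b\<in>B. act (a b) (\<phi> b)"
    have zV: "?z \<in> fV (idx p)" using \<phi>_V[of "L.lincomb a B"] L.lincomb_closed[OF B(2), of a] a \<phi>_lincomb[OF a] by simp
    have "ubr (\<phi> c) ?z = (\<Sum>b\<in>B. act (a b) (\<phi> \<lbrakk>c,b\<rbrakk>\<^bsub>L\<^esub>))" if c: "c \<in> B" for c
    proof -
      have "ubr (\<phi> c) ?z = (\<Sum>b\<in>B. ubr (\<phi> c) (act (a b) (\<phi> b)))"
        by (rule module_hom.sum[OF V.linear_br])
      also have "\<dots> = (\<Sum>b\<in>B. act (a b) (\<phi> \<lbrakk>c,b\<rbrakk>\<^bsub>L\<^esub>))"
        using B_L c by (intro sum.cong) (auto simp: act_def V.br_scale_right \<phi>_bracket)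
      finally show ?thesis .
    qed
    then have "?z \<in> V.center \<longleftrightarrow> (\<forall>c\<in>B. (\<Sum>b\<in>B. act (a b) (\<phi> \<lbrakk>c,b\<rbrakk>\<^bsub>L\<^esub>)) = 0)"
      using V.center_span[OF V_span] zV by auto
    also have "\<dots> \<longleftrightarrow> (\<forall>c\<in>B. \<forall>c'\<in>B. (\<Sum>b\<in>B. a b * coo \<lbrakk>c,b\<rbrakk>\<^bsub>L\<^esub> c') \<in> p)"
      using family_eq_0[of B a] a B_L by (intro ball_cong refl) (auto simp: Pi_iff)
    finally show ?thesis .
  qed
  have rows: "(\<forall>r\<in>(\<lambda>(c, c') b. coo \<lbrakk>c,b\<rbrakk>\<^bsub>L\<^esub> c') ` (B \<times> B). (\<Sum>b\<in>B. a b * r b) \<in> p)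
      \<longleftrightarrow> (\<forall>c\<in>B. \<forall>c'\<in>B. (\<Sum>b\<in>B. a b * coo \<lbrakk>c,b\<rbrakk>\<^bsub>L\<^esub> c') \<in> p)" for a
    by (simp only: ball_simps split_paired_Ball_Sigma prod.case)
  show ?thesis
  proof
    assume c: "V.center = {0}"
    show "trivial_mod p B ((\<lambda>(c, c') b. coo \<lbrakk>c,b\<rbrakk>\<^bsub>L\<^esub> c') ` (B \<times> B))"
      unfolding trivial_mod_def
    proof (intro allI impI)
      fix a assume a: "\<forall>j\<in>B. a j \<in> OK"
        "\<forall>r\<in>(\<lambda>(c, c') b. coo \<lbrakk>c,b\<rbrakk>\<^bsub>L\<^esub> c') ` (B \<times> B). (\<Sum>b\<in>B. a b * r b) \<in> p"
      then have aB: "a \<in> B \<rightarrow> OK" by auto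
      have "(\<Sum>b\<in>B. act (a b) (\<phi> b)) \<in> V.center" unfolding key[OF aB] rows[symmetric] by (rule a(2))
      then have "(\<Sum>b\<in>B. act (a b) (\<phi> b)) = 0" unfolding c by (rule singletonD)
      then show "\<forall>j\<in>B. a j \<in> p" using combination_eq_0[OF aB] by blast
    qed
  next
    assume t: "trivial_mod p B ((\<lambda>(c, c') b. coo \<lbrakk>c,b\<rbrakk>\<^bsub>L\<^esub> c') ` (B \<times> B))"
    show "V.center = {0}"
    proof (intro equalityI subsetI)
      fix z assume z: "z \<in> V.center"
      then have "z \<in> fV (idx p)" by (simp add: V.center_def)
      then obtain x where x: "x \<in> carrier L" "z = \<phi> x" using fV_eq by blast
      have c: "coo x \<in> B \<rightarrow> OK" using coo[OF x(1)] by blast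
      have e: "z = (\<Sum>b\<in>B. act (coo x b) (\<phi> b))" using \<phi>_coo x by blast
      have cz: "\<forall>r\<in>(\<lambda>(c, c') b. coo \<lbrakk>c,b\<rbrakk>\<^bsub>L\<^esub> c') ` (B \<times> B). (\<Sum>b\<in>B. coo x b * r b) \<in> p"
        unfolding rows key[OF c, symmetric] e[symmetric] by (rule z)
      have "\<forall>b\<in>B. coo x b \<in> OK" using c by blast
      from t[unfolded trivial_mod_def, THEN spec, THEN mp, THEN mp, OF this cz]
      have "\<forall>b\<in>B. coo x b \<in> p" .
      then show "z \<in> {0}" using e combination_eq_0[OF c] by simp
    qed (simp add: V.center_def)
  qed
qed

text \<open>Finitely many elements of \<open>OK\<close> decide the matter, and for almost all
  \<open>p\<close> such an element lies in \<open>p\<close> only if it is 0.\<close>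

lemma der_der_iff:
  "V.der (V.der (fV (idx p))) = {0} \<longleftrightarrow>
    (\<forall>(b, c, d, e, f) \<in> B \<times> B \<times> B \<times> B \<times> B. coo \<lbrakk>\<lbrakk>b,c\<rbrakk>\<^bsub>L\<^esub>,\<lbrakk>d,e\<rbrakk>\<^bsub>L\<^esub>\<rbrakk>\<^bsub>L\<^esub> f \<in> p)"
proof -
  let ?S = "(\<lambda>(b, c). \<phi> \<lbrakk>b,c\<rbrakk>\<^bsub>L\<^esub>) ` (B \<times> B)"
  have s: "V.sub (V.der (fV (idx p)))" by (simp add: V.sub_der)
  have cl: "V.closed (V.der (fV (idx p)))" using V.ideal_closed[OF s V.ideal_der[OF _ s]] by blast
  have "V.der (V.der (fV (idx p))) = V.span ((\<lambda>(a, b). ubr a b) ` (?S \<times> ?S))"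
    using finite_lie.der_span[OF V.finite_lie_sub[OF s cl] der_V] .
  moreover have "V.span T = {0} \<longleftrightarrow> T \<subseteq> {0}" for T
  proof
    assume "V.span T = {0}"
    then show "T \<subseteq> {0}" using V.span_superset[of T] by simp
  next
    assume "T \<subseteq> {0}"
    then have "V.span T \<subseteq> {0}" by (rule V.span_minimal) (simp add: V.subspace_def)
    then show "V.span T = {0}" using V.span_zero[of T] by (intro equalityI) simp_all
  qed
  moreover have "(\<lambda>(a, b). ubr a b) ` (?S \<times> ?S) \<subseteq> {0} \<longleftrightarrow> (\<forall>g\<in>?S. \<forall>h\<in>?S. ubr g h = 0)"
    by (simp only: image_subset_iff split_paired_Ball_Sigma prod.case singleton_iff)
  ultimately have "V.der (V.der (fV (idx p))) = {0} \<longleftrightarrow> (\<forall>g\<in>?S. \<forall>h\<in>?S. ubr g h = 0)" by (simp only:)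
  also have "\<dots> \<longleftrightarrow> (\<forall>b\<in>B. \<forall>c\<in>B. \<forall>d\<in>B. \<forall>e\<in>B. \<phi> \<lbrakk>\<lbrakk>b,c\<rbrakk>\<^bsub>L\<^esub>,\<lbrakk>d,e\<rbrakk>\<^bsub>L\<^esub>\<rbrakk>\<^bsub>L\<^esub> = 0)"
    using B_L by (auto simp: \<phi>_bracket)
  also have "\<dots> \<longleftrightarrow> (\<forall>b\<in>B. \<forall>c\<in>B. \<forall>d\<in>B. \<forall>e\<in>B. \<forall>f\<in>B. coo \<lbrakk>\<lbrakk>b,c\<rbrakk>\<^bsub>L\<^esub>,\<lbrakk>d,e\<rbrakk>\<^bsub>L\<^esub>\<rbrakk>\<^bsub>L\<^esub> f \<in> p)"
    using B_L by (intro ball_cong refl \<phi>_zero_iff) auto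
  finally show ?thesis by auto
qed

text \<open>If \<open>U\<close> comes from one term of the derived series, its brackets come from
  the next term; and these brackets span \<open>U\<close> again. For solvable \<open>L\<close> this
  leaves only \<open>U = {0}\<close>.\<close>

lemma derived_series_image:
  assumes U: "U \<subseteq> fV (idx p)" "V.der U = U"
  shows "U \<subseteq> \<phi> ` derived_series R L n"
proof (induction n)
  case 0
  then show ?case using U fV_eq by simp
next
  case (Suc n)
  let ?D = "derived_series R L n"
  let ?G = "{\<lbrakk>x,y\<rbrakk>\<^bsub>L\<^esub> | x y. x \<in> ?D \<and> y \<in> ?D}"
  have D: "derived_series R L n \<subseteq> carrier L" for n
  proof (induction n)
    case (Suc n)
    then have "{\<lbrakk>x,y\<rbrakk>\<^bsub>L\<^esub> | x y. x \<in> derived_series R L n \<and> y \<in> derived_series R L n} \<subseteq> carrier L" by auto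
    from L.span_is_submodule[OF this] show ?case
      using LinearCombinations.submodule.subset by simp
  qed simp
  have Gc: "?G \<subseteq> carrier L" using D by auto
  then interpret S: LinearCombinations.submodule R "L.span ?G" L by (rule L.span_is_submodule)
  have Sc: "L.span ?G \<subseteq> carrier L" by (rule S.subset)
  have "V.subspace (\<phi> ` L.span ?G)"
  proof (rule V.subspaceI)
    show "0 \<in> \<phi> ` L.span ?G" using S.zero_closed \<phi>_zero by force
    fix u v assume "u \<in> \<phi> ` L.span ?G" "v \<in> \<phi> ` L.span ?G"
    then obtain x y where xy: "x \<in> L.span ?G" "y \<in> L.span ?G" "u = \<phi> x" "v = \<phi> y" by blast
    then have "x \<in> carrier L" "y \<in> carrier L" using Sc by blast+
    then have "u + v = \<phi> (x \<oplus>\<^bsub>L\<^esub> y)" by (simp add: \<phi>_add xy)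
    moreover have "x \<oplus>\<^bsub>L\<^esub> y \<in> L.span ?G" using xy(1,2) by (rule S.m_closed)
    ultimately show "u + v \<in> \<phi> ` L.span ?G" by blast
  next
    fix r v assume "v \<in> \<phi> ` L.span ?G"
    then obtain x where x: "x \<in> L.span ?G" "v = \<phi> x" by blast
    then have xL: "x \<in> carrier L" using Sc by blast
    obtain a where a: "a \<in> OK" "\<And>v. v \<in> fV (idx p) \<Longrightarrow> uscale r v = act a v" using scalar_act[of r] by blast
    have "uscale r v = \<phi> (a \<odot>\<^bsub>L\<^esub> x)" using a(1) a(2)[OF \<phi>_V[OF xL]] xL by (simp add: \<phi>_smult x(2))
    moreover have "a \<odot>\<^bsub>L\<^esub> x \<in> L.span ?G" using S.smult_closed a x by simp
    ultimately show "uscale r v \<in> \<phi> ` L.span ?G" by blast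
  qed
  moreover have "ubr u v \<in> \<phi> ` L.span ?G" if uv: "u \<in> U" "v \<in> U" for u v
  proof -
    obtain x y where xy: "x \<in> ?D" "y \<in> ?D" "u = \<phi> x" "v = \<phi> y" using uv Suc.IH by blast
    have "\<lbrakk>x,y\<rbrakk>\<^bsub>L\<^esub> \<in> L.span ?G" using L.in_own_span[OF Gc] xy by blast
    moreover have "ubr u v = \<phi> \<lbrakk>x,y\<rbrakk>\<^bsub>L\<^esub>" unfolding xy(3,4) using xy(1,2) D[of n] by (intro \<phi>_bracket[symmetric]) blast+
    ultimately show ?thesis by blast
  qed
  then have "{ubr u v | u v. u \<in> U \<and> v \<in> U} \<subseteq> \<phi> ` L.span ?G" by blast
  ultimately have "V.der U \<subseteq> \<phi> ` L.span ?G" unfolding V.der_def by (intro V.span_minimal)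
  then show ?case using U(2) by simp
qed

lemma solvable_reduction:
  assumes "solvable_lie R L" "U \<subseteq> fV (idx p)" "V.der U = U"
  shows "U = {0}"
proof -
  obtain n where "derived_series R L n = {\<zero>\<^bsub>L\<^esub>}" using assms(1) by (auto simp: solvable_lie_def)
  then have "U \<subseteq> {0}" using derived_series_image[OF assms(2,3), of n] \<phi>_zero by simp
  moreover have "0 \<in> U" using assms(3) V.span_zero unfolding V.der_def by blast
  ultimately show ?thesis by blast
qed

lemma char_reduction:
  assumes "2 \<notin> p" "v \<in> fV (idx p)" "v + v = 0"
  shows "v = 0"
proof (rule ccontr)
  assume "v \<noteq> 0"
  have "act (1 + 1) v = v + v" using act_add[of 1 1 v] act_one assms by simp
  then have "act (1 + 1) v = 0" using assms(3) by simp
  moreover have "1 + 1 \<in> OK" by (intro OK_closed)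
  ultimately have "1 + 1 \<in> p" using act_eq_0[OF _ assms(2) \<open>v \<noteq> 0\<close>] by blast
  then show False using assms by simp
qed

lemma zeta_reduction:
  assumes n: "card B \<le> 4" and sol: "solvable_lie R L" and 2: "2 \<notin> p"
    and d: "\<And>J. J \<subseteq> B \<times> B \<Longrightarrow> trivial_mod p J ((\<lambda>b (c, c'). coo \<lbrakk>c,c'\<rbrakk>\<^bsub>L\<^esub> b) ` B) \<longleftrightarrow> f J"
    and z: "z \<longleftrightarrow> trivial_mod p B ((\<lambda>(c, c') b. coo \<lbrakk>c,b\<rbrakk>\<^bsub>L\<^esub> c') ` (B \<times> B))"
    and a: "\<And>b c d e f. b \<in> B \<Longrightarrow> c \<in> B \<Longrightarrow> d \<in> B \<Longrightarrow> e \<in> B \<Longrightarrow> f \<in> B \<Longrightarrow>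
      coo \<lbrakk>\<lbrakk>b,c\<rbrakk>\<^bsub>L\<^esub>,\<lbrakk>d,e\<rbrakk>\<^bsub>L\<^esub>\<rbrakk>\<^bsub>L\<^esub> f \<in> p \<longleftrightarrow> coo \<lbrakk>\<lbrakk>b,c\<rbrakk>\<^bsub>L\<^esub>,\<lbrakk>d,e\<rbrakk>\<^bsub>L\<^esub>\<rbrakk>\<^bsub>L\<^esub> f = 0"
  shows "\<exists>\<tau>\<in>trivial_types (card B). \<forall>s. let q = of_nat (card (carrier (R Quot p))) in
    lie_zeta Subalgebras (R Quot p) (reduction R L p) s = eval_XY (sub_poly (card B) \<tau>) q (q powr (- s)) \<and>
    lie_zeta Ideals (R Quot p) (reduction R L p) s =
      eval_XY (ideal_poly (card B) (Max (card ` {J. J \<subseteq> B \<times> B \<and> f J})) z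
        (\<not> (\<forall>(b, c, d, e, f) \<in> B \<times> B \<times> B \<times> B \<times> B. coo \<lbrakk>\<lbrakk>b,c\<rbrakk>\<^bsub>L\<^esub>,\<lbrakk>d,e\<rbrakk>\<^bsub>L\<^esub>\<rbrakk>\<^bsub>L\<^esub> f = 0)) \<tau>) q (q powr (- s))"
proof -
  have 1: "field (fring (idx p))" "finite (carrier (fring (idx p)))"
    using quotient_field[OF p] finite_quotient[OF p] by (simp_all add: idx_simps)
  have c: "card (carrier (flie (idx p))) = fq (idx p) ^ card B"
    using V_card card_image[OF uemb_inj, of "idx p"] by simp
  have s: "U = {0}" if "U = fV (idx p) \<or> U = V.der (fV (idx p))" "V.der U = U" for U
    using solvable_reduction[OF sol] that V.sub_der[OF V.sub_V] by (auto simp: V.sub_def)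
  have dd: "(\<not> (\<forall>(b, c, d, e, f) \<in> B \<times> B \<times> B \<times> B \<times> B. coo \<lbrakk>\<lbrakk>b,c\<rbrakk>\<^bsub>L\<^esub>,\<lbrakk>d,e\<rbrakk>\<^bsub>L\<^esub>\<rbrakk>\<^bsub>L\<^esub> f = 0))
      \<longleftrightarrow> V.der (V.der (fV (idx p))) \<noteq> {0}"
    unfolding der_der_iff using a by auto
  have zz: "z \<longleftrightarrow> V.center = {0}" using z center_iff by simp
  show ?thesis
    using zeta_local[OF 1 finite_reduction c n der_card[OF d] s char_reduction[OF 2] zz dd]
    unfolding idx_simps .
qed

end

theorem same_period:
  assumes n: "card B \<le> 4" and sol: "solvable_lie R L"
  shows "Fq_period Subalgebras R L = Fq_period Ideals R L"
proof -
  let ?rd = "(\<lambda>b (c, c'). coo \<lbrakk>c,c'\<rbrakk>\<^bsub>L\<^esub> b) ` B" and ?rz = "(\<lambda>(c, c') b. coo \<lbrakk>c,b\<rbrakk>\<^bsub>L\<^esub> c') ` (B \<times> B)"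
  let ?m = "\<lambda>(b, c, d, e, f). coo \<lbrakk>\<lbrakk>b,c\<rbrakk>\<^bsub>L\<^esub>,\<lbrakk>d,e\<rbrakk>\<^bsub>L\<^esub>\<rbrakk>\<^bsub>L\<^esub> f"
  let ?I = "B \<times> B \<times> B \<times> B \<times> B"
  have BL: "b \<in> carrier L" if "b \<in> B" for b using that B(2) by blast
  have "\<exists>f. \<forall>J\<in>Pow (B \<times> B). finite {p \<in> PP. trivial_mod p J ?rd \<noteq> f J}"
  proof (rule bchoice, rule ballI)
    fix J assume J: "J \<in> Pow (B \<times> B)"
    then have "finite J" using B(1) by (auto intro: finite_subset)
    moreover have "r j \<in> OK" if "r \<in> ?rd" "j \<in> J" for r j using that J BL by (auto intro!: coo_closed)
    ultimately show "\<exists>b. finite {p \<in> PP. trivial_mod p J ?rd \<noteq> b}" using trivial_mod_dichotomy by blast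
  qed
  then obtain f where f: "\<And>J. J \<subseteq> B \<times> B \<Longrightarrow> finite {p \<in> PP. trivial_mod p J ?rd \<noteq> f J}" by blast
  have "\<exists>z. finite {p \<in> PP. trivial_mod p B ?rz \<noteq> z}"
    using BL B(1) by (intro trivial_mod_dichotomy) (auto intro!: coo_closed)
  then obtain z where z: "finite {p \<in> PP. trivial_mod p B ?rz \<noteq> z}" by blast
  \<comment> \<open>Makes \<open>q\<close> odd and gives \<open>d\<close> and the vanishing of the
    centre and of the second derived algebra their generic values. Each condition fails for finitely
    many primes only.\<close>
  define good where "good p \<longleftrightarrow> 2 \<notin> p \<and> (\<forall>J\<in>Pow (B \<times> B). trivial_mod p J ?rd = f J) \<and>
    trivial_mod p B ?rz = z \<and> (\<forall>i\<in>?I. ?m i \<in> p \<longleftrightarrow> ?m i = 0)" for p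
  have m: "?m i \<in> OK" if "i \<in> ?I" for i using that BL by (auto intro!: coo_closed)
  have fm: "finite {p \<in> PP. (?m i \<in> p) \<noteq> (?m i = 0)}" if i: "i \<in> ?I" for i
  proof (cases "?m i = 0")
    case True
    then have "{p \<in> PP. (?m i \<in> p) \<noteq> (?m i = 0)} = {}" using ideal_closed(2)[OF PP_ideal] by auto
    then show ?thesis by (simp only: finite.emptyI)
  next
    case False
    then show ?thesis using finite_primes_containing[OF m[OF i] False] by simp
  qed
  have two: "(2::'k) \<in> OK" using OK_of_nat[of 2] by simp
  have "{p \<in> PP. \<not> good p} \<subseteq> {p \<in> PP. 2 \<in> p} \<union> (\<Union>J\<in>Pow (B \<times> B). {p \<in> PP. trivial_mod p J ?rd \<noteq> f J})
      \<union> {p \<in> PP. trivial_mod p B ?rz \<noteq> z} \<union> (\<Union>i\<in>?I. {p \<in> PP. (?m i \<in> p) \<noteq> (?m i = 0)})"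
  proof
    fix p assume "p \<in> {p \<in> PP. \<not> good p}"
    then have "p \<in> PP" "2 \<in> p \<or> (\<exists>J\<in>Pow (B \<times> B). trivial_mod p J ?rd \<noteq> f J) \<or>
        trivial_mod p B ?rz \<noteq> z \<or> (\<exists>i\<in>?I. (?m i \<in> p) \<noteq> (?m i = 0))"
      unfolding good_def by simp_all
    then show "p \<in> {p \<in> PP. 2 \<in> p} \<union> (\<Union>J\<in>Pow (B \<times> B). {p \<in> PP. trivial_mod p J ?rd \<noteq> f J})
        \<union> {p \<in> PP. trivial_mod p B ?rz \<noteq> z} \<union> (\<Union>i\<in>?I. {p \<in> PP. (?m i \<in> p) \<noteq> (?m i = 0)})"
      by (elim disjE bexE) (simp_all only: Un_iff UN_iff mem_Collect_eq, blast+)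
  qed
  moreover have "finite (\<Union>J\<in>Pow (B \<times> B). {p \<in> PP. trivial_mod p J ?rd \<noteq> f J})"
    using f B(1) by (intro finite_UN_I) auto
  moreover have "finite (\<Union>i\<in>?I. {p \<in> PP. (?m i \<in> p) \<noteq> (?m i = 0)})"
    using B(1) by (intro finite_UN_I fm) auto
  moreover have "finite {p \<in> PP. 2 \<in> p}" using two by (intro finite_primes_containing) auto
  ultimately have bad: "finite {p \<in> PP. \<not> good p}" using z by (meson finite_Un finite_subset)
  define S where "S = sub_poly (card B)"
  define I where "I = ideal_poly (card B) (Max (card ` {J. J \<subseteq> B \<times> B \<and> f J})) z
    (\<not> (\<forall>(b, c, d, e, f) \<in> ?I. coo \<lbrakk>\<lbrakk>b,c\<rbrakk>\<^bsub>L\<^esub>,\<lbrakk>d,e\<rbrakk>\<^bsub>L\<^esub>\<rbrakk>\<^bsub>L\<^esub> f = 0))"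
  define ok where "ok p \<tau> \<longleftrightarrow> \<tau> \<in> trivial_types (card B) \<and> (\<forall>s. let q = of_nat (card (carrier (R Quot p))) in
    lie_zeta Subalgebras (R Quot p) (reduction R L p) s = eval_XY (S \<tau>) q (q powr (- s)) \<and>
    lie_zeta Ideals (R Quot p) (reduction R L p) s = eval_XY (I \<tau>) q (q powr (- s)))" for p \<tau>
  have "\<exists>\<tau>. ok p \<tau>" if p: "p \<in> PP" "good p" for p
  proof -
    have g: "2 \<notin> p" "\<And>J. J \<subseteq> B \<times> B \<Longrightarrow> trivial_mod p J ?rd \<longleftrightarrow> f J" "z \<longleftrightarrow> trivial_mod p B ?rz"
      using p(2) unfolding good_def by blast+
    have g4: "coo \<lbrakk>\<lbrakk>b,c\<rbrakk>\<^bsub>L\<^esub>,\<lbrakk>d,e\<rbrakk>\<^bsub>L\<^esub>\<rbrakk>\<^bsub>L\<^esub> h \<in> p \<longleftrightarrow> coo \<lbrakk>\<lbrakk>b,c\<rbrakk>\<^bsub>L\<^esub>,\<lbrakk>d,e\<rbrakk>\<^bsub>L\<^esub>\<rbrakk>\<^bsub>L\<^esub> h = 0"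
      if "b \<in> B" "c \<in> B" "d \<in> B" "e \<in> B" "h \<in> B" for b c d e h
      using p(2) that unfolding good_def by auto
    have "\<exists>\<tau>\<in>trivial_types (card B). \<forall>s. let q = of_nat (card (carrier (R Quot p))) in
      lie_zeta Subalgebras (R Quot p) (reduction R L p) s = eval_XY (S \<tau>) q (q powr (- s)) \<and>
      lie_zeta Ideals (R Quot p) (reduction R L p) s = eval_XY (I \<tau>) q (q powr (- s))"
      unfolding S_def I_def by (rule zeta_reduction[OF p(1) n sol g(1)]) (fact g g4)+
    then show ?thesis unfolding ok_def by blast
  qed
  \<comment> \<open>For small norms several triples may fit; one is fixed per prime and used for
    both zeta functions.\<close>
  then obtain \<tau> where \<tau>: "\<And>p. p \<in> PP \<Longrightarrow> good p \<Longrightarrow> ok p (\<tau> p)" by metis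
  have finT: "finite (trivial_types (card B))" by (simp add: trivial_types_def types_def)
  have "period_le Subalgebras R L k \<longleftrightarrow> period_le Ideals R L k" for k
  proof -
    have inj: "inj_on S (trivial_types (card B))" "inj_on I (trivial_types (card B))"
      unfolding S_def I_def by (rule trivial_types_inj)+
    have t: "\<And>p. p \<in> PP \<Longrightarrow> good p \<Longrightarrow> \<tau> p \<in> trivial_types (card B)" using \<tau> by (simp add: ok_def)
    have "period_le Subalgebras R L k \<longleftrightarrow> card {\<beta> \<in> trivial_types (card B). infinite {p \<in> PP. good p \<and> \<tau> p = \<beta>}} \<le> k"
      by (rule period_le_iff[OF finT inj(1) bad t]) (use \<tau> in \<open>auto simp: ok_def Let_def\<close>)
    moreover have "period_le Ideals R L k \<longleftrightarrow> card {\<beta> \<in> trivial_types (card B). infinite {p \<in> PP. good p \<and> \<tau> p = \<beta>}} \<le> k"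
      by (rule period_le_iff[OF finT inj(2) bad t]) (use \<tau> in \<open>auto simp: ok_def Let_def\<close>)
    ultimately show ?thesis by simp
  qed
  then show ?thesis by (simp add: Fq_period_def)
qed

end

theorem corollary1p13:
  fixes K :: "'k::field_char_0 set" and L :: "('k, 'l) lie_alg"
  assumes "number_field K"
    and "lie_algebra (ring_of_integers K) L"
    and "\<exists>n\<le>4. free_of_rank (ring_of_integers K) L n"
    and "solvable_lie (ring_of_integers K) L"
  shows "Fq_period Subalgebras (ring_of_integers K) L = Fq_period Ideals (ring_of_integers K) L"
proof -
  obtain B where B: "B \<subseteq> carrier L" "finite B" "card B \<le> 4" "module.lin_indpt (ring_of_integers K) L B"
    "module.span (ring_of_integers K) L B = carrier L"
    using assms(3) by (auto simp: free_of_rank_def)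
  \<comment> \<open>That the algebraic integers of \<open>K\<close> form a ring is contained in the
    assumption that \<open>L\<close> is a module over them.\<close>
  have "cring (ring_of_integers K)" using assms(2) by (simp add: lie_algebra_def module_def)
  then interpret integral_lie K L B
    using assms(1,2) B by (intro integral_lie.intro integer_ring.intro integral_lie_axioms.intro)
  show ?thesis using same_period[OF \<open>card B \<le> 4\<close> assms(4)] .
qed

end
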